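(* Fix $p,q\in(0,\infty]$. Consider i.i.d. observations $(X_1,Y_1),\dots,(X_n,Y_n)$ from $Y=f^*(X)+\xi$. Suppose that $P_X$, the law of $X$, has a density that is bounded below by a constant $C_{P_X}>0$ on $[0,1]^d$; that, with $\beta>d/p$, $f^*\in\mathcal{B}_{p,q}^{\beta'}$ for every $\beta'\in(0,\beta]$; and that the preprocessed output $\hat Y:[0,1]^d\to\mathbb{R}$ (a random map) is continuous, satisfies $\mathbb{E}[\|\hat Y\|_{L^\infty}^2]\le V^2$ for some $V>0$, and satisfies $\mathbb{E}[\|\hat Y-f^*\|_{L^\infty}^2]\le\zeta_n^2$ for all $n$, with a non-negative sequence $\zeta_n\to0$ such that $\zeta_n^2=O(n^{-2\beta/(2\beta+d)}\log^{\beta^*}n)$ for some $\beta^*>0$. Let $$\hat f\in\operatorname*{argmin}_{f\in\overline{\mathcal{F}}(L,W,S,\bar B)}\frac1n\sum_{i=1}^n\sup_{x'\in\Delta_h^s(X_i)}(\hat Y(x')-f(x'))^2 ,$$ where the parameters are set as $L\ge C_{d,p,\beta,B}\log n$ with a positive finite constant $C_{d,p,\beta,B}$ depending on $d,p,\beta,B$, $S\asymp W\asymp n^{d/(2\beta+d)}$, and $\bar B=O(n^a)$ with some $a>0$. Then, as $n\to\infty$, $$\mathbb{E}\big[\|\hat f-f^*\|_{L^\infty}^2\big]=O\big(n^{-2\beta/(2\beta+d)}\log^{3\vee\beta^*}n\big).$$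
   Context: $d\in\mathbb{N}$, $X$ takes values in $[0,1]^d$; the noise $\xi$ has zero mean and finite variance and is independent of $X$. $\|g\|_{L^\infty}=\sup_{x\in[0,1]^d}|g(x)|$; $a\vee a'=\max\{a,a'\}$; $a_n\asymp b_n$ means $a_n/b_n$ converges to some $c\in(0,\infty)$; $\lambda$ is Lebesgue measure. $\hat Y$ depends on $n$ and may be constructed from the same data as used for $\hat f$. Neighbourhood: $\Delta_h^s(x)=\{x'\in[0,1]^d:\|x-x'\|_s\le h\}$, where the order $s\ge1$ ($s=\infty$ allowed) and $h\in(\underline h,1)$ (with some $\underline h>0$) are given. Besov ball (radius $B\ge1$): for $r\in\mathbb{N}$ and $v\in\mathbb{R}^d$ let $D_v^r[f](x)=\mathbf{1}\{x+rv\in[0,1]^d\}\sum_{j=0}^r\binom rj(-1)^{r-j}f(x+jv)$, and $\omega_{r,p}(f,u)=\sup_{\|v\|_2\le u}\|D_v^r[f]\|_{L^p(\lambda)}$ for $u>0$. For $r>\beta$ put $$\|f\|_{\mathcal{B}_{p,q}^\beta}=\Big(\int_0^\infty(u^{-\beta}\omega_{r,p}(f,u))^q\,u^{-1}du\Big)^{1/q}\ (q<\infty),\qquad \|f\|_{\mathcal{B}_{p,\infty}^\beta}=\sup_{u>0}u^{-\beta}\omega_{r,p}(f,u),$$ and $\mathcal{B}_{p,q}^\beta=\{f:[0,1]^d\to\mathbb{R}:\ \|f\|_{L^p(\lambda)}+\|f\|_{\mathcal{B}_{p,q}^\beta}\le B\}$. Neural networks: for $L\in\mathbb{N}$ and widths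 $\mathcal{W}=(W_1,\dots,W_{L+1})$ with $W_1=d$, $W_{L+1}=1$, a network is $f_\theta=g_L\circ\cdots\circ g_1$ with $g_\ell(z)=\sigma(A_\ell z+b_\ell)$ for $\ell\le L-1$, $g_L(z)=A_Lz+b_L$, where $\sigma$ is the componentwise ReLU $\sigma(z)_i=\max\{z_i,0\}$, $A_\ell\in\mathbb{R}^{W_{\ell+1}\times W_\ell}$, $b_\ell\in\mathbb{R}^{W_{\ell+1}}$. $\mathcal{F}(L,W)$ is the set of all such functions on $[0,1]^d$ with $\max_\ell W_\ell\le W$ and $\|f_\theta\|_{L^\infty}\le B$, where $B\ge1$. $\overline{\mathcal{F}}(L,W,S,\bar B)$ is the set of those networks in $\mathcal{F}(L,W)$ such that there are $S\in\mathbb{N}$ non-zero parameters and each parameter value lies in $[-\bar B,\bar B]$, $\bar B\ge1$.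
   Formalization: Two assumptions are added: |f*| ≤ B on the cube (Besov membership alone does not give it, and networks are bounded by B), and L ≤ κS for large n with some κ < 1 (if L > S every network in the class is constant and the claim fails for non-constant f* ). *)

theory Defs
  imports "HOL-Probability.Probability"
begin

section \<open>The cube, norms and neighbourhoods\<close>

abbreviation unit_cube :: "(real^'d) set" where
  "unit_cube \<equiv> cbox 0 1"

text \<open>The values of \<open>sup_norm\<close> are extended non-negative reals, so an unbounded function
  has norm \<open>\<infinity>\<close>. It is a true supremum, not an essential one.\<close>

definition sup_norm :: "(real^'d \<Rightarrow> real) \<Rightarrow> ennreal" where
  "sup_norm g = (SUP x\<in>unit_cube. ennreal \<bar>g x\<bar>)"

definition lnorm :: "ennreal \<Rightarrow> real^'d \<Rightarrow> real" where
  "lnorm s x = (if s = \<infinity> then infnorm x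
     else (\<Sum>i\<in>UNIV. \<bar>x $ i\<bar> powr enn2real s) powr (1 / enn2real s))"

definition neighbourhood :: "ennreal \<Rightarrow> real \<Rightarrow> real^'d \<Rightarrow> (real^'d) set" where
  "neighbourhood s h x = {x'\<in>unit_cube. lnorm s (x - x') \<le> h}"

section \<open>Besov balls\<close>

text \<open>Only used with exponents \<open>a > 0\<close>.\<close>

definition epowr :: "ennreal \<Rightarrow> real \<Rightarrow> ennreal" where
  "epowr x a = (if x = \<infinity> then \<infinity> else ennreal (enn2real x powr a))"

definition Lp_norm :: "ennreal \<Rightarrow> (real^'d \<Rightarrow> real) \<Rightarrow> ennreal" where
  "Lp_norm p f =
     (if p = \<infinity> then esssup (lebesgue_on unit_cube) (\<lambda>x. ennreal \<bar>f x\<bar>)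
      else epowr (\<integral>\<^sup>+ x. ennreal (\<bar>f x\<bar> powr enn2real p) \<partial>lebesgue_on unit_cube)
             (1 / enn2real p))"

text \<open>For \<open>x\<close> in the cube the indicator ensures, by convexity, that all the points
  \<open>x + j v\<close> lie in the cube, so values of \<open>f\<close> outside the cube play no role.\<close>

definition fin_diff :: "nat \<Rightarrow> real^'d \<Rightarrow> (real^'d \<Rightarrow> real) \<Rightarrow> real^'d \<Rightarrow> real" where
  "fin_diff r v f x = indicator unit_cube (x + real r *\<^sub>R v) *
     (\<Sum>j=0..r. real (r choose j) * (- 1) ^ (r - j) * f (x + real j *\<^sub>R v))"

definition modulus :: "nat \<Rightarrow> ennreal \<Rightarrow> (real^'d \<Rightarrow> real) \<Rightarrow> real \<Rightarrow> ennreal" where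
  "modulus r p f u = (SUP v\<in>{v. norm v \<le> u}. Lp_norm p (fin_diff r v f))"

definition besov_seminorm ::
  "nat \<Rightarrow> ennreal \<Rightarrow> ennreal \<Rightarrow> real \<Rightarrow> (real^'d \<Rightarrow> real) \<Rightarrow> ennreal" where
  "besov_seminorm r p q \<beta> f =
     (if q = \<infinity> then (SUP u\<in>{0<..}. ennreal (u powr (- \<beta>)) * modulus r p f u)
      else epowr (\<integral>\<^sup>+ u\<in>{0<..}. epowr (ennreal (u powr (- \<beta>)) * modulus r p f u) (enn2real q)
                     * ennreal (1 / u) \<partial>lborel)
             (1 / enn2real q))"

definition besov_ball ::
  "nat \<Rightarrow> ennreal \<Rightarrow> ennreal \<Rightarrow> real \<Rightarrow> real \<Rightarrow> (real^'d \<Rightarrow> real) set" where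
  "besov_ball r p q \<beta> B =
     {f \<in> borel_measurable (lebesgue_on unit_cube).
        Lp_norm p f + besov_seminorm r p q \<beta> f \<le> ennreal B}"

section \<open>Sparse ReLU networks\<close>

text \<open>Layers are numbered from 1: the map of layer \<open>l\<close> has weight matrix \<open>A l\<close> of size
  \<open>w (Suc l) \<times> w l\<close> and bias \<open>b l\<close> of length \<open>w (Suc l)\<close>. Vectors are functions on \<open>nat\<close>,
  of which only the entries below the relevant width are used.\<close>

definition affine_map :: "nat \<Rightarrow> (nat \<Rightarrow> nat \<Rightarrow> real) \<Rightarrow> (nat \<Rightarrow> real) \<Rightarrow> (nat \<Rightarrow> real) \<Rightarrow> nat \<Rightarrow> real"
  where "affine_map m A b z = (\<lambda>i. (\<Sum>j<m. A i j * z j) + b i)"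

primrec hidden_layers :: "(nat \<Rightarrow> nat) \<Rightarrow> (nat \<Rightarrow> nat \<Rightarrow> nat \<Rightarrow> real) \<Rightarrow> (nat \<Rightarrow> nat \<Rightarrow> real) \<Rightarrow>
    nat \<Rightarrow> (nat \<Rightarrow> real) \<Rightarrow> nat \<Rightarrow> real" where
  "hidden_layers w A b 0 z = z"
| "hidden_layers w A b (Suc l) z =
     (\<lambda>i. max (affine_map (w (Suc l)) (A (Suc l)) (b (Suc l)) (hidden_layers w A b l z) i) 0)"

text \<open>The coordinates of the input are enumerated by \<open>from_nat_into UNIV\<close>, a bijection from
  \<open>{..<CARD('d)}\<close> to \<open>'d\<close>. Another enumeration only permutes the columns of \<open>A 1\<close>.\<close>

definition relu_net :: "nat \<Rightarrow> (nat \<Rightarrow> nat) \<Rightarrow> (nat \<Rightarrow> nat \<Rightarrow> nat \<Rightarrow> real) \<Rightarrow> (nat \<Rightarrow> nat \<Rightarrow> real) \<Rightarrow>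
    real^'d \<Rightarrow> real" where
  "relu_net L w A b x =
     affine_map (w L) (A L) (b L)
       (hidden_layers w A b (L - 1) (\<lambda>i. x $ from_nat_into UNIV i)) 0"

definition weight_idx :: "nat \<Rightarrow> (nat \<Rightarrow> nat) \<Rightarrow> (nat \<times> nat \<times> nat) set" where
  "weight_idx L w = {(l, i, j). 1 \<le> l \<and> l \<le> L \<and> i < w (Suc l) \<and> j < w l}"

definition bias_idx :: "nat \<Rightarrow> (nat \<Rightarrow> nat) \<Rightarrow> (nat \<times> nat) set" where
  "bias_idx L w = {(l, i). 1 \<le> l \<and> l \<le> L \<and> i < w (Suc l)}"

definition num_nonzero :: "nat \<Rightarrow> (nat \<Rightarrow> nat) \<Rightarrow> (nat \<Rightarrow> nat \<Rightarrow> nat \<Rightarrow> real) \<Rightarrow>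
    (nat \<Rightarrow> nat \<Rightarrow> real) \<Rightarrow> nat" where
  "num_nonzero L w A b =
     card {(l, i, j) \<in> weight_idx L w. A l i j \<noteq> 0} + card {(l, i) \<in> bias_idx L w. b l i \<noteq> 0}"

text \<open>A function belongs to the class when it coincides on the cube with a network; its values
  outside the cube are irrelevant.\<close>

definition sparse_nets :: "nat \<Rightarrow> nat \<Rightarrow> nat \<Rightarrow> real \<Rightarrow> real \<Rightarrow> (real^'d \<Rightarrow> real) set" where
  "sparse_nets L W S Bpar B =
     {f. sup_norm f \<le> ennreal B \<and>
       (\<exists>w A b. w 1 = CARD('d) \<and> w (Suc L) = 1 \<and> (\<forall>l\<in>{1..Suc L}. 1 \<le> w l \<and> w l \<le> W) \<and>
          num_nonzero L w A b = S \<and>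
          (\<forall>(l, i, j)\<in>weight_idx L w. \<bar>A l i j\<bar> \<le> Bpar) \<and>
          (\<forall>(l, i)\<in>bias_idx L w. \<bar>b l i\<bar> \<le> Bpar) \<and>
          (\<forall>x\<in>unit_cube. f x = relu_net L w A b x))}"

section \<open>Regression data and empirical risk\<close>

definition (in prob_space) iid_regression ::
  "(real^'d \<Rightarrow> real) \<Rightarrow> (nat \<Rightarrow> 'a \<Rightarrow> real^'d) \<Rightarrow> (nat \<Rightarrow> 'a \<Rightarrow> real) \<Rightarrow> (nat \<Rightarrow> 'a \<Rightarrow> real) \<Rightarrow> bool" where
  "iid_regression fstar X \<xi> Y \<longleftrightarrow>
     indep_vars (\<lambda>_. borel) (\<lambda>i \<omega>. (X i \<omega>, Y i \<omega>)) UNIV \<and>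
     (\<forall>i. distr M borel (\<lambda>\<omega>. (X i \<omega>, Y i \<omega>)) = distr M borel (\<lambda>\<omega>. (X 0 \<omega>, Y 0 \<omega>))) \<and>
     (\<forall>i. \<forall>\<omega>\<in>space M. X i \<omega> \<in> unit_cube \<and> Y i \<omega> = fstar (X i \<omega>) + \<xi> i \<omega>) \<and>
     (\<forall>i. indep_set {X i -` A \<inter> space M |A. A \<in> sets borel} {\<xi> i -` A \<inter> space M |A. A \<in> sets borel} \<and>
        integrable M (\<xi> i) \<and> expectation (\<xi> i) = 0 \<and> integrable M (\<lambda>\<omega>. (\<xi> i \<omega>)\<^sup>2))"

text \<open>The suprema are over non-empty sets whenever the sample points lie in the cube and \<open>h \<ge> 0\<close>,
  and they are finite for continuous \<open>yhat\<close> and \<open>f\<close>.\<close>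

definition adv_risk ::
  "ennreal \<Rightarrow> real \<Rightarrow> nat \<Rightarrow> (nat \<Rightarrow> real^'d) \<Rightarrow> (real^'d \<Rightarrow> real) \<Rightarrow> (real^'d \<Rightarrow> real) \<Rightarrow> real" where
  "adv_risk s h n x yhat f =
     (1 / real n) * (\<Sum>i<n. SUP x'\<in>neighbourhood s h (x i). (yhat x' - f x')\<^sup>2)"

definition same_order :: "(nat \<Rightarrow> real) \<Rightarrow> (nat \<Rightarrow> real) \<Rightarrow> bool" where
  "same_order a b \<longleftrightarrow> (\<exists>c>0. (\<lambda>n. a n / b n) \<longlonglongrightarrow> c)"

end

theory Submission
  imports Defs "HOL-Computational_Algebra.Polynomial" "HOL-Real_Asymp.Real_Asymp"
begin

text \<open>Outside an event of probability \<open>O(1 / n)\<close>, every cell of a fixed dyadic grid of mesh below \<open>h\<close> contains a positive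
  fraction of the sample. The neighbourhoods of these sample points contain the whole cell, so the empirical
  adversarial risk dominates a multiple of the squared supremum norm of \<open>Y\<close>-hat minus \<open>f\<close>. Hence \<open>f\<close>-hat is as
  close to the preprocessed output as the best network, up to a constant factor, and it remains to approximate \<open>f\<close>
  in supremum norm with error \<open>n powr (- \<beta> / (2 \<beta> + d))\<close>.

  Here \<open>f\<close> is continuous, being a uniform limit of realisations of the preprocessed outputs, and membership in the
  Besov ball bounds the measure of the set of large \<open>r\<close>-th differences. If the differences along a shifted lattice
  and all its dyadic refinements are small on a cube, then comparing interpolants of consecutive steps shows that the
  Lagrange interpolant on the lattice is close to \<open>f\<close> there. Averaging over the shifts bounds the number of
  dyadic cubes on which every shift fails, and because \<open>\<beta> > d / p\<close> this gives a cover by about \<open>2 ^ (J d)\<close> good cubes of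
  levels \<open>J\<close> to \<open>c (J + 1)\<close> with error \<open>2 powr (- \<beta> J)\<close>.

  The local polynomials are blended by a partition of unity that runs through classes of disjoint bumps.
  Collecting the blended coefficients of each monomial leaves a bounded number of products, and a bounded number of
  layers computes each of them to the required accuracy by the self-similarity of the parabola, with
  \<open>2 ^ J\<close> pieces per layer. So the depth is constant; weights polynomial in \<open>2 ^ J\<close> are scaled below 1 and
  compensated by layers that add up many copies.\<close>

section \<open>Local polynomial interpolation\<close>

text \<open>For p < \<infinity> a uniform mesh of side 2^(-J) in general gives only the sup-norm
  error 2^(-(\<beta> - d/p) J), as the Lp modulus tolerates a few cubes with large differences.
  Refining those cubes restores the exponent \<beta>, and \<beta> p > d keeps this shallow: at
  tolerance 2^(-\<beta> J) about 2^(\<beta> p J - (\<beta> p - d) j) cubes of level j can be bad,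
  which is 2^(J d) at j = J, decays geometrically in j and drops below 1 at a level linear in J. The
  budget S of order 2^(J d) shapes the network. A product accurate to a power of 2^(-J) at bounded
  depth takes about 2^J units, so one product per cube is too expensive. Hence the local polynomials
  are expanded in global monomials: their blended coefficients are linear in the partition of unity
  and leave boundedly many products. The price is coefficients of polynomial size in 2^J, while the
  bound on the parameters may be as small as 1. Depth left over up to L is spent on identity layers
  at one parameter each, which fit into S because \<kappa> < 1.\<close>

definition lagrange :: "nat \<Rightarrow> nat \<Rightarrow> real \<Rightarrow> real" where
  "lagrange r a y = (\<Prod>b\<in>{..<r} - {a}. (y - real b) / (real a - real b))"

definition lagrange_poly :: "nat \<Rightarrow> nat \<Rightarrow> real poly" where
  "lagrange_poly r a = (\<Prod>b\<in>{..<r} - {a}. smult (1 / (real a - real b)) [:- real b, 1:])"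

lemma poly_lagrange_poly: "poly (lagrange_poly r a) y = lagrange r a y"
  unfolding lagrange_poly_def lagrange_def poly_prod by (intro prod.cong) (auto simp: divide_simps)

lemma degree_lagrange_poly: "a < r \<Longrightarrow> degree (lagrange_poly r a) < r"
proof -
  assume a: "a < r"
  have "degree (lagrange_poly r a) \<le> (\<Sum>b\<in>{..<r} - {a}. degree (smult (1 / (real a - real b)) [:- real b, 1:]))"
    unfolding lagrange_poly_def by (rule degree_prod_sum_le[unfolded comp_def]) simp
  also have "\<dots> \<le> (\<Sum>b\<in>{..<r} - {a}. 1)"
    by (intro sum_mono) (rule order_trans[OF degree_smult_le], simp)
  also have "\<dots> < r" using a by simp
  finally show ?thesis .
qed

lemma lagrange_node: "a < r \<Longrightarrow> b < r \<Longrightarrow> lagrange r a (real b) = (if a = b then 1 else 0)"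
  unfolding lagrange_def by auto

lemma lagrange_abs_le:
  assumes "a < r" "\<bar>y\<bar> \<le> Y"
  shows "\<bar>lagrange r a y\<bar> \<le> (Y + real r) ^ r"
proof -
  have Y: "0 \<le> Y" using assms by linarith
  have "\<bar>lagrange r a y\<bar> = (\<Prod>b\<in>{..<r} - {a}. \<bar>(y - real b) / (real a - real b)\<bar>)"
    by (simp add: lagrange_def abs_prod)
  also have "\<dots> \<le> (\<Prod>b\<in>{..<r} - {a}. (Y + real r))"
  proof (rule prod_mono)
    fix b assume b: "b \<in> {..<r} - {a}"
    have 1: "1 \<le> \<bar>real a - real b\<bar>" using b by (cases a b rule: linorder_cases) auto
    have 2: "\<bar>y - real b\<bar> \<le> Y + real r" using b assms by auto
    have "\<bar>(y - real b) / (real a - real b)\<bar> \<le> \<bar>y - real b\<bar> / 1"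
      unfolding abs_divide using 1 by (intro divide_left_mono) auto
    with 2 show "0 \<le> \<bar>(y - real b) / (real a - real b)\<bar> \<and> \<bar>(y - real b) / (real a - real b)\<bar> \<le> Y + real r" by simp
  qed
  also have "\<dots> = (Y + real r) ^ (r - 1)" using assms by simp
  also have "\<dots> \<le> (Y + real r) ^ r" using assms Y by (intro power_increasing) auto
  finally show ?thesis .
qed

text \<open>The difference of the two sides has degree below r and vanishes at the r nodes.\<close>

lemma poly_eq_sum_lagrange:
  assumes "degree q < r"
  shows "(\<Sum>a<r. poly q (real a) * lagrange r a y) = poly q y"
proof -
  define p where "p = (\<Sum>a<r. smult (poly q (real a)) (lagrange_poly r a)) - q"
  have dp: "degree p < r" unfolding p_def
    by (intro degree_diff_less degree_sum_less assms order.strict_trans1[OF degree_smult_le degree_lagrange_poly])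
       (use assms in auto)
  have "poly p (real b) = 0" if "b < r" for b
    using that by (simp add: p_def poly_sum poly_lagrange_poly lagrange_node if_distrib sum.delta cong: if_cong)
  hence "real ` {..<r} \<subseteq> {x. poly p x = 0}" by auto
  have "p = 0"
  proof (rule ccontr)
    assume "p \<noteq> 0"
    hence "card (real ` {..<r}) \<le> card {x. poly p x = 0}"
      by (intro card_mono poly_roots_finite) (use \<open>_ \<subseteq> {x. poly p x = 0}\<close> in auto)
    also have "\<dots> \<le> degree p" using \<open>p \<noteq> 0\<close> by (rule card_poly_roots_bound)
    finally show False using dp by (simp add: card_image)
  qed
  hence "poly p y = 0" by simp
  thus ?thesis by (simp add: p_def poly_sum poly_lagrange_poly)
qed

lemma poly_eq_sum_lagrange_affine:
  assumes "degree q < r" "h \<noteq> 0"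
  shows "(\<Sum>a<r. poly q (s + h * real a) * lagrange r a ((y - s) / h)) = poly q y"
proof -
  have "degree (pcompose q [:s, h:]) < r" using assms by (simp add: degree_pcompose)
  from poly_eq_sum_lagrange[OF this, of "(y - s) / h"] show ?thesis
    using assms by (simp add: poly_pcompose mult.commute)
qed

text \<open>Pascal's rule: a difference of order r + 1 is the difference of order r of the forward
  difference. It drives the induction in \<open>fin_diff_poly\<close>.\<close>

lemma sum_binomial_alternating_Suc:
  fixes g :: "nat \<Rightarrow> real"
  shows "(\<Sum>j=0..Suc r. real (Suc r choose j) * (-1) ^ (Suc r - j) * g j) =
    (\<Sum>j=0..r. real (r choose j) * (-1) ^ (r - j) * (g (Suc j) - g j))"
proof -
  have "(\<Sum>j=0..Suc r. real (Suc r choose j) * (-1) ^ (Suc r - j) * g j) =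
    (-1) ^ Suc r * g 0 + (\<Sum>j=0..r. real (Suc r choose Suc j) * (-1) ^ (r - j) * g (Suc j))"
    by (subst sum.atLeast0_atMost_Suc_shift) simp
  also have "(\<Sum>j=0..r. real (Suc r choose Suc j) * (-1) ^ (r - j) * g (Suc j)) =
     (\<Sum>j=0..r. real (r choose j) * (-1) ^ (r - j) * g (Suc j)) +
     (\<Sum>j=0..r. real (r choose Suc j) * (-1) ^ (r - j) * g (Suc j))"
    by (simp add: sum.distrib algebra_simps)
  moreover have "(\<Sum>j=0..r. real (r choose Suc j) * (-1) ^ (r - j) * g (Suc j)) + (-1) ^ Suc r * g 0
     = - (\<Sum>j=0..r. real (r choose j) * (-1) ^ (r - j) * g j)"
  proof -
    have "(\<Sum>j=0..r. real (r choose Suc j) * (-1) ^ (r - j) * g (Suc j)) + (-1) ^ Suc r * g 0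
      = (\<Sum>j=0..Suc r. real (r choose j) * (-1) ^ (Suc r - j) * g j)"
      by (subst sum.atLeast0_atMost_Suc_shift) simp
    also have "\<dots> = (\<Sum>j=0..r. real (r choose j) * (-1) ^ (Suc r - j) * g j)"
      by simp
    also have "\<dots> = (\<Sum>j=0..r. - (real (r choose j) * (-1) ^ (r - j) * g j))"
      by (intro sum.cong) (auto simp: Suc_diff_le)
    finally show ?thesis by (simp add: sum_negf)
  qed
  ultimately show ?thesis by (simp add: sum_subtractf algebra_simps)
qed

text \<open>The leading coefficients cancel. The case \<open>r = 0\<close> is excluded because the
  zero polynomial has degree 0 by convention.\<close>

lemma degree_shift_diff_less:
  fixes q :: "real poly"
  assumes "degree q < Suc r" "0 < r"
  shows "degree (pcompose q [:h, 1:] - q) < r"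
proof (cases "degree q = 0")
  case True
  then obtain c where "q = [:c:]" by (rule degree_eq_zeroE)
  thus ?thesis using assms by simp
next
  case False
  have "coeff (pcompose q [:h, 1:] - q) (degree q) = 0"
    using lead_coeff_comp[of "[:h, 1:]" q] by (simp add: degree_pcompose)
  moreover have "degree (pcompose q [:h, 1:] - q) \<le> degree q"
    by (intro degree_diff_le) (auto simp: degree_pcompose)
  ultimately have "degree (pcompose q [:h, 1:] - q) < degree q"
    using False eq_zero_or_degree_less by fastforce
  thus ?thesis using assms by simp
qed

lemma fin_diff_poly:
  fixes q :: "real poly"
  assumes "degree q < r"
  shows "(\<Sum>j=0..r. real (r choose j) * (-1) ^ (r - j) * poly q (x + real j * h)) = 0"
  using assms
proof (induction r arbitrary: q)
  case 0 thus ?case by simp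
next
  case (Suc r)
  have eq: "(\<Sum>j=0..Suc r. real (Suc r choose j) * (-1) ^ (Suc r - j) * poly q (x + real j * h))
     = (\<Sum>j=0..r. real (r choose j) * (-1) ^ (r - j) * poly (pcompose q [:h, 1:] - q) (x + real j * h))"
    by (subst sum_binomial_alternating_Suc) (simp add: poly_pcompose algebra_simps)
  show ?case
  proof (cases "r = 0")
    case True
    then obtain c where "q = [:c:]" using Suc.prems by (auto elim: degree_eq_zeroE)
    thus ?thesis using True by simp
  next
    case False
    show ?thesis unfolding eq
      by (rule Suc.IH) (use degree_shift_diff_less[of q r h] Suc.prems False in auto)
  qed
qed

text \<open>A discrete Whitney estimate. \<open>q\<close> interpolates the first r values, so the
  error vanishes there. In the r-th difference ending at k the error at k has coefficient 1, so it
  is bounded by \<open>lam\<close> plus at most 2^r times the largest bound on the preceding errors.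
  Each further node thus costs a factor \<open>2 ^ r + 1\<close>.\<close>

lemma lattice_poly_approx:
  fixes \<phi> :: "nat \<Rightarrow> real"
  assumes r: "0 < r" and lam: "0 \<le> lam"
    and D: "\<And>k. k + r \<le> m \<Longrightarrow> \<bar>\<Sum>j=0..r. real (r choose j) * (-1) ^ (r - j) * \<phi> (k + j)\<bar> \<le> lam"
  obtains q where "degree q < r" "\<And>k. k \<le> m \<Longrightarrow> \<bar>\<phi> k - poly q (real k)\<bar> \<le> (2 ^ r + 1) ^ m * lam"
proof -
  define q where "q = (\<Sum>a<r. smult (\<phi> a) (lagrange_poly r a))"
  have dq: "degree q < r" unfolding q_def
    by (intro degree_sum_less order.strict_trans1[OF degree_smult_le degree_lagrange_poly]) (use r in auto)
  define \<psi> where "\<psi> k = \<phi> k - poly q (real k)" for k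
  have \<psi>0: "\<psi> k = 0" if "k < r" for k
    using that by (simp add: \<psi>_def q_def poly_sum poly_lagrange_poly lagrange_node if_distrib sum.delta cong: if_cong)
  have D\<psi>: "\<bar>\<Sum>j=0..r. real (r choose j) * (-1) ^ (r - j) * \<psi> (k + j)\<bar> \<le> lam" if "k + r \<le> m" for k
  proof -
    have "(\<Sum>j=0..r. real (r choose j) * (-1) ^ (r - j) * \<psi> (k + j)) =
       (\<Sum>j=0..r. real (r choose j) * (-1) ^ (r - j) * \<phi> (k + j)) -
       (\<Sum>j=0..r. real (r choose j) * (-1) ^ (r - j) * poly q (real k + real j * 1))"
      by (simp add: \<psi>_def algebra_simps sum_subtractf)
    thus ?thesis using fin_diff_poly[OF dq, of "real k" 1] D[OF that] by simp
  qed
  have bnd: "k \<le> m \<longrightarrow> \<bar>\<psi> k\<bar> \<le> (2 ^ r + 1) ^ k * lam" for k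
  proof (induction k rule: less_induct)
    case (less k)
    show ?case
    proof (intro impI)
      assume km: "k \<le> m"
      show "\<bar>\<psi> k\<bar> \<le> (2 ^ r + 1) ^ k * lam"
      proof (cases "k < r")
        case True thus ?thesis using \<psi>0[of k] lam by simp
      next
        case False
        then obtain i where i: "k = i + r" using le_Suc_ex[of r k] by (auto simp: add.commute)
        let ?s = "\<Sum>j<r. real (r choose j) * (-1) ^ (r - j) * \<psi> (i + j)"
        have "(\<Sum>j=0..r. real (r choose j) * (-1) ^ (r - j) * \<psi> (i + j)) = ?s + \<psi> k"
          by (simp add: i atLeast0AtMost lessThan_Suc_atMost[symmetric])
        hence "\<bar>\<psi> k\<bar> \<le> lam + \<bar>?s\<bar>" using D\<psi>[of i] km i by auto
        also have "\<bar>?s\<bar> \<le> (\<Sum>j<r. real (r choose j) * ((2 ^ r + 1) ^ (k - 1) * lam))"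
        proof (rule order_trans[OF sum_abs], rule sum_mono)
          fix j assume j: "j \<in> {..<r}"
          have "\<bar>\<psi> (i + j)\<bar> \<le> (2 ^ r + 1) ^ (i + j) * lam" using less.IH[of "i + j"] j i km by auto
          also have "\<dots> \<le> (2 ^ r + 1) ^ (k - 1) * lam"
            using j i lam by (intro mult_right_mono power_increasing) auto
          finally show "\<bar>real (r choose j) * (-1) ^ (r - j) * \<psi> (i + j)\<bar> \<le> real (r choose j) * ((2 ^ r + 1) ^ (k - 1) * lam)"
            by (auto simp: abs_mult power_abs intro!: mult_left_mono)
        qed
        also have "\<dots> = (\<Sum>j<r. real (r choose j)) * ((2 ^ r + 1) ^ (k - 1) * lam)"
          by (simp add: sum_distrib_right)
        also have "\<dots> \<le> 2 ^ r * ((2 ^ r + 1) ^ (k - 1) * lam)"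
        proof (rule mult_right_mono)
          have "(\<Sum>j<r. r choose j) \<le> (\<Sum>j\<le>r. r choose j)" by (intro sum_mono2) auto
          thus "(\<Sum>j<r. real (r choose j)) \<le> 2 ^ r"
            unfolding choose_row_sum by (metis of_nat_le_iff of_nat_numeral of_nat_power of_nat_sum)
        qed (use lam in auto)
        also have "lam + \<dots> \<le> (2 ^ r + 1) ^ (k - 1) * lam + 2 ^ r * ((2 ^ r + 1) ^ (k - 1) * lam)"
        proof -
          have "1 \<le> (2 ^ r + 1 :: real) ^ (k - 1)" by (rule one_le_power) simp
          from mult_right_mono[OF this lam] show ?thesis by simp
        qed
        also have "\<dots> = (2 ^ r + 1) ^ Suc (k - 1) * lam" by (simp add: algebra_simps)
        also have "Suc (k - 1) = k" using False r by simp
        finally show ?thesis by simp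
      qed
    qed
  qed
  show thesis
  proof (rule that[OF dq])
    fix k assume k: "k \<le> m"
    have "\<bar>\<psi> k\<bar> \<le> (2 ^ r + 1) ^ k * lam" using bnd k by blast
    also have "\<dots> \<le> (2 ^ r + 1) ^ m * lam" using k lam by (intro mult_right_mono power_increasing) auto
    finally show "\<bar>\<phi> k - poly q (real k)\<bar> \<le> (2 ^ r + 1) ^ m * lam" by (simp add: \<psi>_def)
  qed
qed

text \<open>Both interpolation functionals, with step 1 and step 2, reproduce polynomials of degree below \<open>r\<close>,
  so they differ by no more than the distance of \<open>\<phi>\<close> to such polynomials.\<close>
lemma stencil_compare:
  assumes r: "0 < r" and Y: "0 \<le> Y"
  shows "\<exists>C\<ge>0. \<forall>\<phi> lam s1 s2 y. 0 \<le> lam \<longrightarrow>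
    (\<forall>k. k + r \<le> m \<longrightarrow> \<bar>\<Sum>j=0..r. real (r choose j) * (-1) ^ (r - j) * \<phi> (k + j)\<bar> \<le> lam) \<longrightarrow>
    s1 + (r - 1) \<le> m \<longrightarrow> s2 + 2 * (r - 1) \<le> m \<longrightarrow> \<bar>y - real s1\<bar> \<le> Y \<longrightarrow> \<bar>y - real s2\<bar> \<le> Y \<longrightarrow>
    \<bar>(\<Sum>a<r. \<phi> (s1 + a) * lagrange r a (y - real s1)) - (\<Sum>a<r. \<phi> (s2 + 2 * a) * lagrange r a ((y - real s2) / 2))\<bar> \<le> C * lam"
proof -
  \<comment> \<open>Number of nodes, times the distance of the lattice values from a polynomial,
    times the bound on the Lagrange basis at distance Y.\<close>
  define E where "E = real r * ((2 ^ r + 1) ^ m * (Y + real r) ^ r)"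
  have E0: "0 \<le> E" using Y by (simp add: E_def)
  show ?thesis
  proof (intro exI[of _ "E + E"] conjI allI impI)
    fix \<phi> :: "nat \<Rightarrow> real" and lam :: real and s1 s2 and y :: real
    assume lam: "0 \<le> lam"
      and D: "\<forall>k. k + r \<le> m \<longrightarrow> \<bar>\<Sum>j=0..r. real (r choose j) * (-1) ^ (r - j) * \<phi> (k + j)\<bar> \<le> lam"
      and s: "s1 + (r - 1) \<le> m" "s2 + 2 * (r - 1) \<le> m" and y: "\<bar>y - real s1\<bar> \<le> Y" "\<bar>y - real s2\<bar> \<le> Y"
    obtain q where q: "degree q < r" "\<And>k. k \<le> m \<Longrightarrow> \<bar>\<phi> k - poly q (real k)\<bar> \<le> (2 ^ r + 1) ^ m * lam"
      using lattice_poly_approx[OF r lam, of m \<phi>] D by blast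
    have gen: "\<bar>(\<Sum>a<r. \<phi> (s + h * a) * lagrange r a ((y - real s) / real h)) - poly q y\<bar> \<le> E * lam"
      if h: "0 < h" and sm: "s + h * (r - 1) \<le> m" and ys: "\<bar>(y - real s) / real h\<bar> \<le> Y" for s h :: nat
    proof -
      have "poly q y = (\<Sum>a<r. poly q (real s + real h * real a) * lagrange r a ((y - real s) / real h))"
        using poly_eq_sum_lagrange_affine[OF q(1), of "real h" "real s" y] h by simp
      hence "\<bar>(\<Sum>a<r. \<phi> (s + h * a) * lagrange r a ((y - real s) / real h)) - poly q y\<bar> =
        \<bar>\<Sum>a<r. (\<phi> (s + h * a) - poly q (real (s + h * a))) * lagrange r a ((y - real s) / real h)\<bar>"
        by (simp add: algebra_simps sum_subtractf)
      also have "\<dots> \<le> (\<Sum>a<r. ((2 ^ r + 1) ^ m * lam) * (Y + real r) ^ r)"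
      proof (rule order_trans[OF sum_abs], rule sum_mono)
        fix a assume a: "a \<in> {..<r}"
        have "h * a \<le> h * (r - 1)" using a by (intro mult_left_mono) auto
        hence "s + h * a \<le> m" using sm by linarith
        thus "\<bar>(\<phi> (s + h * a) - poly q (real (s + h * a))) * lagrange r a ((y - real s) / real h)\<bar>
           \<le> ((2 ^ r + 1) ^ m * lam) * (Y + real r) ^ r"
          unfolding abs_mult using q(2)[OF \<open>s + h * a \<le> m\<close>] lagrange_abs_le[OF _ ys, of a r] a lam
          by (intro mult_mono) auto
      qed
      also have "\<dots> = E * lam" by (simp add: E_def algebra_simps)
      finally show ?thesis .
    qed
    have "\<bar>(y - real s2) / real 2\<bar> \<le> Y" using y by simp
    with gen[of 1 s1] gen[of 2 s2] s y
    have "\<bar>(\<Sum>a<r. \<phi> (s1 + a) * lagrange r a (y - real s1)) - poly q y\<bar> \<le> E * lam"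
      "\<bar>(\<Sum>a<r. \<phi> (s2 + 2 * a) * lagrange r a ((y - real s2) / 2)) - poly q y\<bar> \<le> E * lam" by auto
    thus "\<bar>(\<Sum>a<r. \<phi> (s1 + a) * lagrange r a (y - real s1)) - (\<Sum>a<r. \<phi> (s2 + 2 * a) * lagrange r a ((y - real s2) / 2))\<bar> \<le> (E + E) * lam"
      by (simp add: algebra_simps)
  qed (use E0 in auto)
qed

section \<open>Tensor products of one-dimensional functionals\<close>

definition prod_functional :: "nat \<Rightarrow> ('d::finite \<Rightarrow> nat \<Rightarrow> real) \<Rightarrow> ('d \<Rightarrow> nat \<Rightarrow> real) \<Rightarrow> (real^'d \<Rightarrow> real) \<Rightarrow> real" where
  "prod_functional r Z w f = (\<Sum>\<alpha>\<in>PiE UNIV (\<lambda>_. {..<r}). f (\<chi> e. Z e (\<alpha> e)) * (\<Prod>e\<in>UNIV. w e (\<alpha> e)))"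

definition vec_upd :: "real^'d::finite \<Rightarrow> 'd \<Rightarrow> real \<Rightarrow> real^'d" where
  "vec_upd x e t = (\<chi> e'. if e' = e then t else x $ e')"

lemma vec_upd_nth: "vec_upd x e t $ e' = (if e' = e then t else x $ e')"
  by (simp add: vec_upd_def)

lemma sum_PiE_single_out:
  fixes G :: "('d::finite \<Rightarrow> nat) \<Rightarrow> real"
  shows "(\<Sum>\<alpha>\<in>PiE UNIV (\<lambda>_. {..<r}). G \<alpha>) = (\<Sum>\<alpha>\<in>PiE (UNIV - {e}) (\<lambda>_. {..<r}). \<Sum>a<r. G (\<alpha>(e := a)))"
proof -
  have "PiE (UNIV :: 'd set) (\<lambda>_. {..<r}) = (\<lambda>(a, \<alpha>). \<alpha>(e := a)) ` ({..<r} \<times> PiE (UNIV - {e}) (\<lambda>_. {..<r}))"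
    using PiE_insert_eq[of e "UNIV - {e}" "\<lambda>_. {..<r}"] by (simp add: insert_UNIV)
  moreover have "inj_on (\<lambda>(a, \<alpha>). \<alpha>(e := a)) ({..<r} \<times> PiE (UNIV - {e}) (\<lambda>_. {..<r}))"
  proof (rule inj_onI, clarify)
    fix a b and \<alpha> \<beta> :: "'d \<Rightarrow> nat"
    assume *: "\<alpha> \<in> PiE (UNIV - {e}) (\<lambda>_. {..<r})" "\<beta> \<in> PiE (UNIV - {e}) (\<lambda>_. {..<r})"
      and eq: "\<alpha>(e := a) = \<beta>(e := b)"
    have "a = b" using fun_cong[OF eq, of e] by simp
    moreover have "\<alpha> x = \<beta> x" for x
      using fun_cong[OF eq, of x] * by (cases "x = e") (auto simp: PiE_def extensional_def)
    ultimately show "a = b \<and> \<alpha> = \<beta>" by auto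
  qed
  ultimately have "(\<Sum>\<alpha>\<in>PiE UNIV (\<lambda>_. {..<r}). G \<alpha>) =
     (\<Sum>(a, \<alpha>)\<in>{..<r} \<times> PiE (UNIV - {e}) (\<lambda>_. {..<r}). G (\<alpha>(e := a)))"
    by (simp add: sum.reindex case_prod_unfold)
  also have "\<dots> = (\<Sum>a<r. \<Sum>\<alpha>\<in>PiE (UNIV - {e}) (\<lambda>_. {..<r}). G (\<alpha>(e := a)))"
    by (simp add: sum.cartesian_product)
  also have "\<dots> = (\<Sum>\<alpha>\<in>PiE (UNIV - {e}) (\<lambda>_. {..<r}). \<Sum>a<r. G (\<alpha>(e := a)))"
    by (rule sum.swap)
  finally show ?thesis .
qed

text \<open>Fixing the indices of all other coordinates leaves a one-dimensional difference on a
  line, which \<open>diff\<close> bounds by \<open>D\<close>. There are r^(d - 1) such lines, each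
  with weight at most \<Lambda>^(d - 1).\<close>

lemma prod_functional_step:
  fixes Z Z' w w' :: "'d::finite \<Rightarrow> nat \<Rightarrow> real"
  assumes same: "\<And>e'. e' \<noteq> e \<Longrightarrow> Z' e' = Z e' \<and> w' e' = w e'"
    and w: "\<And>e' a. a < r \<Longrightarrow> \<bar>w e' a\<bar> \<le> \<Lambda>" and "0 \<le> D"
    and diff: "\<And>x. (\<And>e'. e' \<noteq> e \<Longrightarrow> x $ e' \<in> Z e' ` {..<r}) \<Longrightarrow>
       \<bar>(\<Sum>a<r. f (vec_upd x e (Z e a)) * w e a) - (\<Sum>a<r. f (vec_upd x e (Z' e a)) * w' e a)\<bar> \<le> D"
  shows "\<bar>prod_functional r Z w f - prod_functional r Z' w' f\<bar> \<le> (real r * \<Lambda>) ^ (CARD('d) - 1) * D"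
proof -
  let ?P = "PiE (UNIV - {e}) (\<lambda>_. {..<r})"
  define x :: "('d \<Rightarrow> nat) \<Rightarrow> real^'d" where "x \<alpha> = (\<chi> e'. Z e' (\<alpha> e'))" for \<alpha>
  define p where "p \<alpha> = (\<Prod>e'\<in>UNIV - {e}. w e' (\<alpha> e'))" for \<alpha> :: "'d \<Rightarrow> nat"
  have pr: "(\<Prod>e'\<in>UNIV. v e' ((\<alpha>(e := a)) e')) = v e a * p \<alpha>" if "\<And>e'. e' \<noteq> e \<Longrightarrow> v e' = w e'"
    for v \<alpha> a
  proof -
    have "(\<Prod>e'\<in>UNIV. v e' ((\<alpha>(e := a)) e')) = v e a * (\<Prod>e'\<in>UNIV - {e}. v e' ((\<alpha>(e := a)) e'))"
      by (subst prod.remove[of _ e]) auto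
    also have "(\<Prod>e'\<in>UNIV - {e}. v e' ((\<alpha>(e := a)) e')) = p \<alpha>"
      unfolding p_def using that by (intro prod.cong) auto
    finally show ?thesis .
  qed
  have xs: "(\<chi> e'. Y e' ((\<alpha>(e := a)) e')) = vec_upd (x \<alpha>) e (Y e a)" if "\<And>e'. e' \<noteq> e \<Longrightarrow> Y e' = Z e'"
    for Y \<alpha> a
    using that by (auto simp: vec_eq_iff vec_upd_def x_def)
  have "prod_functional r Z w f = (\<Sum>\<alpha>\<in>?P. \<Sum>a<r. f (vec_upd (x \<alpha>) e (Z e a)) * (w e a * p \<alpha>))"
    unfolding prod_functional_def by (subst sum_PiE_single_out[of _ _ e]) (simp only: pr xs)
  moreover have "prod_functional r Z' w' f = (\<Sum>\<alpha>\<in>?P. \<Sum>a<r. f (vec_upd (x \<alpha>) e (Z' e a)) * (w' e a * p \<alpha>))"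
  proof -
    have "(\<Prod>e'\<in>UNIV. w' e' ((\<alpha>(e := a)) e')) = w' e a * p \<alpha>" for \<alpha> a
      by (rule pr) (use same in blast)
    moreover have "(\<chi> e'. Z' e' ((\<alpha>(e := a)) e')) = vec_upd (x \<alpha>) e (Z' e a)" for \<alpha> a
      by (rule xs) (use same in blast)
    ultimately show ?thesis
      unfolding prod_functional_def by (subst sum_PiE_single_out[of _ _ e]) (simp only:)
  qed
  ultimately have "prod_functional r Z w f - prod_functional r Z' w' f =
     (\<Sum>\<alpha>\<in>?P. p \<alpha> * ((\<Sum>a<r. f (vec_upd (x \<alpha>) e (Z e a)) * w e a) - (\<Sum>a<r. f (vec_upd (x \<alpha>) e (Z' e a)) * w' e a)))"
    by (simp add: sum_distrib_left right_diff_distrib sum_subtractf mult_ac)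
  also have "\<bar>\<dots>\<bar> \<le> (\<Sum>\<alpha>\<in>?P. \<Lambda> ^ (CARD('d) - 1) * D)"
  proof (rule order_trans[OF sum_abs], rule sum_mono)
    fix \<alpha> assume \<alpha>: "\<alpha> \<in> ?P"
    have "\<bar>p \<alpha>\<bar> \<le> (\<Prod>e'\<in>UNIV - {e}. \<Lambda>)" unfolding p_def abs_prod
      using \<alpha> w by (intro prod_mono) (auto simp: PiE_def)
    hence "\<bar>p \<alpha>\<bar> \<le> \<Lambda> ^ (CARD('d) - 1)" by (simp add: card_Diff_singleton)
    moreover have "\<bar>(\<Sum>a<r. f (vec_upd (x \<alpha>) e (Z e a)) * w e a) - (\<Sum>a<r. f (vec_upd (x \<alpha>) e (Z' e a)) * w' e a)\<bar> \<le> D"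
      by (rule diff) (use \<alpha> in \<open>auto simp: x_def PiE_def Pi_def\<close>)
    ultimately show "\<bar>p \<alpha> * ((\<Sum>a<r. f (vec_upd (x \<alpha>) e (Z e a)) * w e a) - (\<Sum>a<r. f (vec_upd (x \<alpha>) e (Z' e a)) * w' e a))\<bar>
       \<le> \<Lambda> ^ (CARD('d) - 1) * D"
      unfolding abs_mult by (intro mult_mono) auto
  qed
  also have "\<dots> = (real r * \<Lambda>) ^ (CARD('d) - 1) * D"
    by (simp add: card_PiE power_mult_distrib card_Diff_singleton)
  finally show ?thesis .
qed

text \<open>A hybrid argument: the functionals are exchanged one coordinate at a time. In the
  intermediate functionals some coordinates already carry the new nodes, hence the union of the two
  node sets in the hypothesis.\<close>

lemma prod_functional_diff:
  fixes Z Z' w w' :: "'d::finite \<Rightarrow> nat \<Rightarrow> real"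
  assumes w: "\<And>e a. a < r \<Longrightarrow> \<bar>w e a\<bar> \<le> \<Lambda>" "\<And>e a. a < r \<Longrightarrow> \<bar>w' e a\<bar> \<le> \<Lambda>" and "0 \<le> D"
    and diff: "\<And>e x. (\<And>e'. e' \<noteq> e \<Longrightarrow> x $ e' \<in> Z e' ` {..<r} \<union> Z' e' ` {..<r}) \<Longrightarrow>
       \<bar>(\<Sum>a<r. f (vec_upd x e (Z e a)) * w e a) - (\<Sum>a<r. f (vec_upd x e (Z' e a)) * w' e a)\<bar> \<le> D"
  shows "\<bar>prod_functional r Z w f - prod_functional r Z' w' f\<bar> \<le> real CARD('d) * ((real r * \<Lambda>) ^ (CARD('d) - 1) * D)"
proof -
  define H where "H E = prod_functional r (\<lambda>e. if e \<in> E then Z' e else Z e) (\<lambda>e. if e \<in> E then w' e else w e) f" for E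
  have "\<bar>H {} - H E\<bar> \<le> real (card E) * ((real r * \<Lambda>) ^ (CARD('d) - 1) * D)" if "finite E" for E
    using that
  proof induction
    case empty show ?case by simp
  next
    case (insert e E)
    have "\<bar>H E - H (insert e E)\<bar> \<le> (real r * \<Lambda>) ^ (CARD('d) - 1) * D"
      unfolding H_def
    proof (rule prod_functional_step[of e])
      fix x :: "real^'d" assume x: "\<And>e'. e' \<noteq> e \<Longrightarrow> x $ e' \<in> (if e' \<in> E then Z' e' else Z e') ` {..<r}"
      have "x $ e' \<in> Z e' ` {..<r} \<union> Z' e' ` {..<r}" if "e' \<noteq> e" for e'
        using x[OF that] by (auto split: if_splits)
      from diff[OF this] insert(2)
      show "\<bar>(\<Sum>a<r. f (vec_upd x e ((if e \<in> E then Z' e else Z e) a)) * (if e \<in> E then w' e else w e) a) -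
         (\<Sum>a<r. f (vec_upd x e ((if e \<in> insert e E then Z' e else Z e) a)) * (if e \<in> insert e E then w' e else w e) a)\<bar> \<le> D"
        by simp
    qed (use assms in auto)
    hence "\<bar>H {} - H (insert e E)\<bar> \<le> real (card E) * ((real r * \<Lambda>) ^ (CARD('d) - 1) * D) + (real r * \<Lambda>) ^ (CARD('d) - 1) * D"
      using insert(3) by linarith
    thus ?case using insert(1,2) by (simp add: distrib_right)
  qed
  from this[of UNIV] show ?thesis by (simp add: H_def)
qed

definition grid_interp :: "nat \<Rightarrow> real^'d::finite \<Rightarrow> real \<Rightarrow> (real^'d \<Rightarrow> real) \<Rightarrow> real^'d \<Rightarrow> real" where
  "grid_interp r s h f x = prod_functional r (\<lambda>e a. s $ e + h * real a) (\<lambda>e a. lagrange r a ((x $ e - s $ e) / h)) f"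

text \<open>The Lagrange weights sum to 1, so the constant c can be subtracted under the sum. The
  factor bounds the Lebesgue constant of the tensor interpolation.\<close>

lemma grid_interp_close:
  fixes f :: "real^'d::finite \<Rightarrow> real"
  assumes r: "0 < r" and h: "0 < h" and xs: "\<And>e. \<bar>(x $ e - s $ e) / h\<bar> \<le> Y"
    and f: "\<And>z. (\<And>e. \<exists>a<r. z $ e = s $ e + h * real a) \<Longrightarrow> \<bar>f z - c\<bar> \<le> \<eta>"
  shows "\<bar>grid_interp r s h f x - c\<bar> \<le> (real r * (Y + real r) ^ r) ^ CARD('d) * \<eta>"
proof -
  let ?P = "PiE (UNIV :: 'd set) (\<lambda>_. {..<r})"
  let ?w = "\<lambda>e a. lagrange r a ((x $ e - s $ e) / h)"
  have one: "(\<Sum>a<r. ?w e a) = 1" for e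
    using poly_eq_sum_lagrange[of "[:1:]" r "(x $ e - s $ e) / h"] r by simp
  have "(\<Sum>\<alpha>\<in>?P. \<Prod>e\<in>UNIV. ?w e (\<alpha> e)) = (\<Prod>e\<in>UNIV. \<Sum>a<r. ?w e a)"
    by (rule prod_sum_PiE[symmetric]) auto
  hence S1: "(\<Sum>\<alpha>\<in>?P. \<Prod>e\<in>UNIV. ?w e (\<alpha> e)) = 1" by (simp add: one)
  have "grid_interp r s h f x - c = (\<Sum>\<alpha>\<in>?P. f (\<chi> e. s $ e + h * real (\<alpha> e)) * (\<Prod>e\<in>UNIV. ?w e (\<alpha> e))) - c * (\<Sum>\<alpha>\<in>?P. \<Prod>e\<in>UNIV. ?w e (\<alpha> e))"
    unfolding S1 grid_interp_def prod_functional_def by simp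
  also have "\<dots> = (\<Sum>\<alpha>\<in>?P. (f (\<chi> e. s $ e + h * real (\<alpha> e)) - c) * (\<Prod>e\<in>UNIV. ?w e (\<alpha> e)))"
    by (simp add: sum_distrib_left algebra_simps sum_subtractf)
  also have "\<bar>\<dots>\<bar> \<le> (\<Sum>\<alpha>\<in>?P. \<eta> * ((Y + real r) ^ r) ^ CARD('d))"
  proof (rule order_trans[OF sum_abs], rule sum_mono)
    fix \<alpha> assume \<alpha>: "\<alpha> \<in> ?P"
    have "\<bar>f (\<chi> e. s $ e + h * real (\<alpha> e)) - c\<bar> \<le> \<eta>"
      by (rule f) (use \<alpha> in auto)
    moreover have "(\<Prod>e\<in>UNIV. \<bar>?w e (\<alpha> e)\<bar>) \<le> (\<Prod>e\<in>(UNIV::'d set). (Y + real r) ^ r)"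
      by (rule prod_mono) (use \<alpha> lagrange_abs_le[OF _ xs] in auto)
    ultimately show "\<bar>(f (\<chi> e. s $ e + h * real (\<alpha> e)) - c) * (\<Prod>e\<in>UNIV. ?w e (\<alpha> e))\<bar> \<le> \<eta> * ((Y + real r) ^ r) ^ CARD('d)"
      unfolding abs_mult abs_prod by (intro mult_mono) (auto intro!: prod_nonneg)
  qed
  also have "\<dots> = (real r * (Y + real r) ^ r) ^ CARD('d) * \<eta>"
    by (simp add: card_PiE power_mult_distrib)
  finally show ?thesis .
qed

section \<open>Comparing the interpolants of consecutive steps on a cube\<close>

definition cube :: "real^'d::finite \<Rightarrow> real \<Rightarrow> (real^'d) set" where
  "cube a \<rho> = {z. \<forall>e. a $ e \<le> z $ e \<and> z $ e \<le> a $ e + \<rho>}"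

text \<open>\<open>fin_diff\<close> in the direction \<open>h *\<^sub>R axis e 1\<close> without its
  indicator. That the segment stays in the cube is stated separately wherever this form is
  used.\<close>

definition axis_diff :: "nat \<Rightarrow> real \<Rightarrow> 'd::finite \<Rightarrow> (real^'d \<Rightarrow> real) \<Rightarrow> real^'d \<Rightarrow> real" where
  "axis_diff r h e f z = (\<Sum>j=0..r. real (r choose j) * (-1) ^ (r - j) * f (z + real j *\<^sub>R (h *\<^sub>R axis e 1)))"

definition lattice :: "real^'d::finite \<Rightarrow> real \<Rightarrow> (real^'d) set" where
  "lattice t h = {z. \<forall>e. \<exists>k::int. z $ e = t $ e + h * real_of_int k}"

text \<open>The lattice point just above \<open>x\<close>, moved down where the stencil would leave \<open>cube a \<rho>\<close>.\<close>
definition stencil_start :: "nat \<Rightarrow> real^'d::finite \<Rightarrow> real \<Rightarrow> real^'d \<Rightarrow> real \<Rightarrow> real^'d \<Rightarrow> real^'d" where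
  "stencil_start r a \<rho> t h x = (\<chi> e. t $ e + h * real_of_int \<lceil>(min (x $ e) (a $ e + \<rho> - real (r + 1) * h) - t $ e) / h\<rceil>)"

text \<open>The clamp leaves \<open>r + 1\<close> steps below the upper face, and rounding up to the
  lattice uses at most one of them; the remaining r steps hold the stencil.\<close>

lemma stencil_start_props:
  assumes h: "0 < h" "real (r + 1) * h \<le> \<rho>" and x: "x \<in> cube a \<rho>"
  shows "a $ e \<le> stencil_start r a \<rho> t h x $ e"
    and "stencil_start r a \<rho> t h x $ e + real r * h \<le> a $ e + \<rho>"
    and "\<bar>x $ e - stencil_start r a \<rho> t h x $ e\<bar> \<le> real (r + 1) * h"
    and "\<exists>k::int. stencil_start r a \<rho> t h x $ e = t $ e + h * real_of_int k"
proof -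
  define u where "u = min (x $ e) (a $ e + \<rho> - real (r + 1) * h)"
  define s where "s = stencil_start r a \<rho> t h x $ e"
  have s: "s = t $ e + h * real_of_int \<lceil>(u - t $ e) / h\<rceil>"
    by (simp add: s_def stencil_start_def u_def)
  define c where "c = (u - t $ e) / h"
  have hc: "h * c = u - t $ e" using h by (simp add: c_def)
  have "h * c \<le> h * real_of_int \<lceil>c\<rceil>"
    using h by (intro mult_left_mono) auto
  moreover have "h * real_of_int \<lceil>c\<rceil> \<le> h * (c + 1)"
    using h by (intro mult_left_mono of_int_ceiling_le_add_one) auto
  moreover have "h * (c + 1) = h * c + h" by (simp add: distrib_left)
  moreover have "s = t $ e + h * real_of_int \<lceil>c\<rceil>" using s by (simp only: c_def)
  ultimately have us: "u \<le> s" "s \<le> u + h" using hc by linarith+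
  have x': "a $ e \<le> x $ e" "x $ e \<le> a $ e + \<rho>" using x by (auto simp: cube_def)
  have u: "a $ e \<le> u" "u \<le> a $ e + \<rho> - real (r + 1) * h" "u \<le> x $ e" "x $ e \<le> u + real (r + 1) * h"
    using x' h by (auto simp: u_def min_def)
  have rh: "real (r + 1) * h = real r * h + h" "0 \<le> real r * h" using h by (auto simp: algebra_simps)
  show "a $ e \<le> s" "s + real r * h \<le> a $ e + \<rho>" "\<bar>x $ e - s\<bar> \<le> real (r + 1) * h"
    using us u rh h by linarith+
  show "\<exists>k::int. s = t $ e + h * real_of_int k" using s by blast
qed

lemma axis_shift: "z + real j *\<^sub>R (h *\<^sub>R axis e 1) = vec_upd z e (z $ e + real j * h)"
  by (auto simp: vec_eq_iff vec_upd_def axis_def)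

text \<open>The nodes of both stencils lie in the lattice of step h. After exchanging one coordinate
  at a time, both interpolants are functionals of the same lattice values on a line, and
  \<open>stencil_compare\<close> applies. The clamping in \<open>stencil_start\<close> keeps these
  lines in the cube, where the differences are controlled.\<close>

lemma interp_level_diff:
  assumes r: "0 < r"
  shows "\<exists>C\<ge>0. \<forall>(f :: real^'d::finite \<Rightarrow> real) a \<rho> t h lam x. 0 < h \<longrightarrow> real (r + 1) * (2 * h) \<le> \<rho> \<longrightarrow> 0 \<le> lam \<longrightarrow> x \<in> cube a \<rho> \<longrightarrow>
     (\<forall>e. \<forall>z\<in>lattice t h. z \<in> cube a \<rho> \<longrightarrow> z + real r *\<^sub>R (h *\<^sub>R axis e 1) \<in> cube a \<rho> \<longrightarrow> \<bar>axis_diff r h e f z\<bar> \<le> lam) \<longrightarrow>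
     \<bar>grid_interp r (stencil_start r a \<rho> t (2 * h) x) (2 * h) f x - grid_interp r (stencil_start r a \<rho> t h x) h f x\<bar> \<le> C * lam"
proof -
  define Y where "Y = 2 * real (r + 1)"
  have Y0: "0 \<le> Y" by (simp add: Y_def)
  define Q where "Q m C \<longleftrightarrow> 0 \<le> C \<and> (\<forall>\<phi> lam s1 s2 y. 0 \<le> lam \<longrightarrow>
    (\<forall>k. k + r \<le> m \<longrightarrow> \<bar>\<Sum>j=0..r. real (r choose j) * (-1) ^ (r - j) * \<phi> (k + j)\<bar> \<le> lam) \<longrightarrow>
    s1 + (r - 1) \<le> m \<longrightarrow> s2 + 2 * (r - 1) \<le> m \<longrightarrow> \<bar>y - real s1\<bar> \<le> Y \<longrightarrow> \<bar>y - real s2\<bar> \<le> Y \<longrightarrow>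
    \<bar>(\<Sum>a<r. \<phi> (s1 + a) * lagrange r a (y - real s1)) - (\<Sum>a<r. \<phi> (s2 + 2 * a) * lagrange r a ((y - real s2) / 2))\<bar> \<le> C * lam)" for m C
  have "\<forall>m. \<exists>C. Q m C" unfolding Q_def by (intro allI stencil_compare[OF r Y0])
  then obtain c where cQ: "\<forall>m. Q m (c m)" using choice[of Q] by blast
  have c: "0 \<le> c m" for m using cQ[rule_format, of m] unfolding Q_def by (rule conjunct1)
  have cs: "\<bar>(\<Sum>a<r. \<phi> (s1 + a) * lagrange r a (y - real s1)) - (\<Sum>a<r. \<phi> (s2 + 2 * a) * lagrange r a ((y - real s2) / 2))\<bar> \<le> c m * lam"
    if "0 \<le> lam" "\<And>k. k + r \<le> m \<Longrightarrow> \<bar>\<Sum>j=0..r. real (r choose j) * (-1) ^ (r - j) * \<phi> (k + j)\<bar> \<le> lam"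
      "s1 + (r - 1) \<le> m" "s2 + 2 * (r - 1) \<le> m" "\<bar>y - real s1\<bar> \<le> Y" "\<bar>y - real s2\<bar> \<le> Y"
    for m \<phi> lam s1 s2 y
    using cQ[rule_format, of m, unfolded Q_def, THEN conjunct2] that by blast
  \<comment> \<open>The constant of \<open>stencil_compare\<close> depends on the length m of the
    window. One stencil starts at index 0, the other at most 3 (r + 1) later, and the longer one
    spans 2 (r - 1) steps, so \<open>6 * r + 8\<close> is a generous bound; the sum serves as a
    maximum over all windows.\<close>
  define c' where "c' = (\<Sum>m\<le>6 * r + 8. c m)"
  have cc: "c m \<le> c'" if "m \<le> 6 * r + 8" for m
    unfolding c'_def using that c by (intro member_le_sum) auto
  have c'0: "0 \<le> c'" unfolding c'_def using c by (intro sum_nonneg) auto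
  define \<Lambda> where "\<Lambda> = (Y + real r) ^ r"
  define C where "C = real CARD('d) * ((real r * \<Lambda>) ^ (CARD('d) - 1) * c')"
  have \<Lambda>0: "0 \<le> \<Lambda>" by (simp add: \<Lambda>_def Y_def)
  have C0: "0 \<le> C" using c'0 \<Lambda>0 by (simp add: C_def)
  show ?thesis
  proof (intro exI[of _ C] conjI C0 allI impI)
    fix f :: "real^'d \<Rightarrow> real" and a \<rho> t h lam x
    assume h: "0 < h" "real (r + 1) * (2 * h) \<le> \<rho>" and lam: "0 \<le> lam" and x: "x \<in> cube a \<rho>"
      and D: "\<forall>e. \<forall>z\<in>lattice t h. z \<in> cube a \<rho> \<longrightarrow> z + real r *\<^sub>R (h *\<^sub>R axis e 1) \<in> cube a \<rho> \<longrightarrow> \<bar>axis_diff r h e f z\<bar> \<le> lam"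
    define sf where "sf = stencil_start r a \<rho> t h x"
    define sc where "sc = stencil_start r a \<rho> t (2 * h) x"
    have h2: "real (r + 1) * h \<le> \<rho>" "0 < 2 * h"
    proof -
      have "real (r + 1) * h \<le> real (r + 1) * (2 * h)" using h by (intro mult_left_mono) auto
      thus "real (r + 1) * h \<le> \<rho>" using h by linarith
    qed (use h in simp)
    note pf = stencil_start_props[OF h(1) h2(1) x, where t=t, folded sf_def]
    note pc = stencil_start_props[OF h2(2) h(2) x, where t=t, folded sc_def]
    have rbnd: "0 \<le> b * h \<and> b * h \<le> real r * h" if "0 \<le> b" "b \<le> real r" for b :: real
      using that h by (auto intro: mult_right_mono)
    have nodef: "a $ e \<le> sf $ e + h * real b \<and> sf $ e + h * real b \<le> a $ e + \<rho> \<and> (\<exists>k::int. sf $ e + h * real b = t $ e + h * real_of_int k)"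
      if "b < r" for e b
    proof -
      obtain k :: int where "sf $ e = t $ e + h * real_of_int k" using pf(4) by blast
      hence "sf $ e + h * real b = t $ e + h * real_of_int (k + int b)" by (simp add: algebra_simps)
      hence "\<exists>k::int. sf $ e + h * real b = t $ e + h * real_of_int k" by (rule exI)
      moreover have "0 \<le> h * real b" "h * real b \<le> real r * h"
        using rbnd[of "real b"] that by (simp_all add: mult.commute)
      ultimately show ?thesis using pf(1,2)[of e] by (intro conjI) linarith+
    qed
    have nodec: "a $ e \<le> sc $ e + 2 * h * real b \<and> sc $ e + 2 * h * real b \<le> a $ e + \<rho> \<and> (\<exists>k::int. sc $ e + 2 * h * real b = t $ e + h * real_of_int k)"
      if "b < r" for e b
    proof -
      obtain k :: int where "sc $ e = t $ e + 2 * h * real_of_int k" using pc(4) by blast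
      hence "sc $ e + 2 * h * real b = t $ e + h * real_of_int (2 * k + 2 * int b)" by (simp add: algebra_simps)
      hence "\<exists>k::int. sc $ e + 2 * h * real b = t $ e + h * real_of_int k" by (rule exI)
      moreover have "0 \<le> h * real b" "h * real b \<le> real r * h"
        using rbnd[of "real b"] that by (simp_all add: mult.commute)
      moreover have "2 * h * real b = h * real b + h * real b" "real r * (2 * h) = real r * h + real r * h" by simp_all
      ultimately show ?thesis using pc(1,2)[of e] by (intro conjI) linarith+
    qed
    have "\<bar>grid_interp r sc (2 * h) f x - grid_interp r sf h f x\<bar> \<le> real CARD('d) * ((real r * \<Lambda>) ^ (CARD('d) - 1) * (c' * lam))"
      unfolding grid_interp_def
    proof (rule prod_functional_diff)
      fix e and b :: nat assume b: "b < r"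
      have "\<bar>(x $ e - sc $ e) / (2 * h)\<bar> \<le> Y" "\<bar>(x $ e - sf $ e) / h\<bar> \<le> Y"
        using pc(3)[of e] pf(3)[of e] h by (auto simp: Y_def field_simps abs_divide)
      thus "\<bar>lagrange r b ((x $ e - sc $ e) / (2 * h))\<bar> \<le> \<Lambda>" "\<bar>lagrange r b ((x $ e - sf $ e) / h)\<bar> \<le> \<Lambda>"
        unfolding \<Lambda>_def using lagrange_abs_le b by auto
    next
      fix e and z :: "real^'d"
      assume z: "\<And>e'. e' \<noteq> e \<Longrightarrow> z $ e' \<in> (\<lambda>a. sc $ e' + 2 * h * real a) ` {..<r} \<union> (\<lambda>a. sf $ e' + h * real a) ` {..<r}"
      have zc: "a $ e' \<le> z $ e' \<and> z $ e' \<le> a $ e' + \<rho> \<and> (\<exists>k::int. z $ e' = t $ e' + h * real_of_int k)" if "e' \<noteq> e" for e'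
        using z[OF that] nodef nodec by force
      obtain kf :: int where kf: "sf $ e = t $ e + h * real_of_int kf" using pf(4) by blast
      obtain kc0 :: int where "sc $ e = t $ e + 2 * h * real_of_int kc0" using pc(4) by blast
      then obtain kc :: int where kc: "sc $ e = t $ e + h * real_of_int kc"
        by (intro that[of "2 * kc0"]) (simp add: algebra_simps)
      \<comment> \<open>The lower of the two starting points becomes index 0 on the line. Then s1 or
        s2 is 0, and the closeness of both stencils to y bounds the other.\<close>
      define kl where "kl = min kf kc"
      define s1 s2 where "s1 = nat (kf - kl)" and "s2 = nat (kc - kl)"
      have s1: "real s1 = real_of_int kf - real_of_int kl" and s2: "real s2 = real_of_int kc - real_of_int kl"
        by (auto simp: s1_def s2_def kl_def)
      define lo where "lo = t $ e + h * real_of_int kl"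
      have lo: "lo + h * real s1 = sf $ e" "lo + h * real s2 = sc $ e"
        by (simp_all add: lo_def s1 s2 kf kc algebra_simps)
      have loa: "a $ e \<le> lo" using pf(1)[of e] pc(1)[of e] kf kc by (auto simp: lo_def kl_def min_def)
      define \<phi> where "\<phi> k = f (vec_upd z e (lo + h * real k))" for k
      define y where "y = (x $ e - lo) / h"
      define m where "m = max (s1 + (r - 1)) (s2 + 2 * (r - 1))"
      have ys: "y - real s1 = (x $ e - sf $ e) / h" "(y - real s2) / 2 = (x $ e - sc $ e) / (2 * h)"
        using h by (simp_all add: y_def lo[symmetric] field_simps)
      have ys2: "y - real s2 = (x $ e - sc $ e) / h" using h by (simp add: y_def lo[symmetric] field_simps)
      have yb: "\<bar>y - real s1\<bar> \<le> real (r + 1)" "\<bar>y - real s2\<bar> \<le> Y"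
        unfolding ys ys2 using pc(3)[of e] pf(3)[of e] h by (auto simp: Y_def field_simps abs_divide)
      have "s1 = 0 \<or> s2 = 0" by (auto simp: s1_def s2_def kl_def)
      hence "real s1 \<le> 3 * real (r + 1)" "real s2 \<le> 3 * real (r + 1)"
        using yb by (auto simp: Y_def)
      hence "s1 \<le> 3 * (r + 1)" "s2 \<le> 3 * (r + 1)" by linarith+
      hence m: "m \<le> 6 * r + 8" by (auto simp: m_def)
      have top: "lo + h * real m \<le> a $ e + \<rho>"
      proof (cases "s1 + (r - 1) \<le> s2 + 2 * (r - 1)")
        case True
        have "m = s2 + 2 * (r - 1)" using True by (simp add: m_def)
        hence "real m = real s2 + 2 * real (r - 1)" by (simp only: of_nat_add of_nat_mult of_nat_numeral)
        hence "lo + h * real m = sc $ e + 2 * h * real (r - 1)"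
          by (simp only: lo[symmetric]) (simp only: algebra_simps)
        thus ?thesis using nodec[of "r - 1" e] r by auto
      next
        case False
        have "m = s1 + (r - 1)" using False by (simp add: m_def)
        hence "real m = real s1 + real (r - 1)" by (simp only: of_nat_add)
        hence "lo + h * real m = sf $ e + h * real (r - 1)"
          by (simp only: lo[symmetric]) (simp only: algebra_simps)
        thus ?thesis using nodef[of "r - 1" e] r by auto
      qed
      have "\<bar>\<Sum>j=0..r. real (r choose j) * (-1) ^ (r - j) * \<phi> (k + j)\<bar> \<le> lam" if k: "k + r \<le> m" for k
      proof -
        define w where "w = vec_upd z e (lo + h * real k)"
        have kr: "h * real k + real r * h \<le> h * real m"
        proof -
          have "h * real (k + r) \<le> h * real m" using k h by (intro mult_left_mono) auto
          thus ?thesis by (simp add: algebra_simps)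
        qed
        have hr: "0 \<le> h * real k" "0 \<le> real r * h" using h by auto
        have "w \<in> cube a \<rho>" using zc kr hr top loa by (auto simp: cube_def w_def vec_upd_nth)
        moreover have "w + real r *\<^sub>R (h *\<^sub>R axis e 1) \<in> cube a \<rho>"
          unfolding axis_shift using zc kr hr top loa by (auto simp: cube_def w_def vec_upd_nth)
        moreover have "w \<in> lattice t h"
        proof -
          have "lo + h * real k = t $ e + h * real_of_int (kl + int k)" by (simp add: lo_def algebra_simps)
          hence "\<exists>k'::int. lo + h * real k = t $ e + h * real_of_int k'" by blast
          thus ?thesis using zc by (auto simp: lattice_def w_def vec_upd_nth)
        qed
        ultimately have "\<bar>axis_diff r h e f w\<bar> \<le> lam" using D by blast
        also have "axis_diff r h e f w = (\<Sum>j=0..r. real (r choose j) * (-1) ^ (r - j) * \<phi> (k + j))"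
          unfolding axis_diff_def axis_shift \<phi>_def
          by (intro sum.cong refl arg_cong2[where f="(*)"] arg_cong[where f=f])
             (auto simp: w_def vec_upd_def vec_eq_iff algebra_simps)
        finally show ?thesis .
      qed
      from cs[OF lam this, of m s1 s2 y] yb
      have "\<bar>(\<Sum>a<r. \<phi> (s1 + a) * lagrange r a (y - real s1)) - (\<Sum>a<r. \<phi> (s2 + 2 * a) * lagrange r a ((y - real s2) / 2))\<bar> \<le> c m * lam"
        by (auto simp: m_def Y_def)
      also have "c m * lam \<le> c' * lam" using cc[OF m] lam by (rule mult_right_mono)
      also have "(\<Sum>a<r. \<phi> (s1 + a) * lagrange r a (y - real s1)) = (\<Sum>a<r. f (vec_upd z e (sf $ e + h * real a)) * lagrange r a ((x $ e - sf $ e) / h))"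
        unfolding \<phi>_def ys(1) lo(1)[symmetric] by (simp add: algebra_simps)
      also have "(\<Sum>a<r. \<phi> (s2 + 2 * a) * lagrange r a ((y - real s2) / 2)) = (\<Sum>a<r. f (vec_upd z e (sc $ e + 2 * h * real a)) * lagrange r a ((x $ e - sc $ e) / (2 * h)))"
        unfolding \<phi>_def ys(2) lo(2)[symmetric] by (simp add: algebra_simps)
      finally show "\<bar>(\<Sum>a<r. f (vec_upd z e (sc $ e + 2 * h * real a)) * lagrange r a ((x $ e - sc $ e) / (2 * h))) -
          (\<Sum>a<r. f (vec_upd z e (sf $ e + h * real a)) * lagrange r a ((x $ e - sf $ e) / h))\<bar> \<le> c' * lam"
        by (simp add: abs_minus_commute)
    qed (use c'0 lam in auto)
    thus "\<bar>grid_interp r (stencil_start r a \<rho> t (2 * h) x) (2 * h) f x - grid_interp r (stencil_start r a \<rho> t h x) h f x\<bar> \<le> C * lam"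
      by (simp add: C_def sf_def sc_def algebra_simps)
  qed
qed

lemma cube_eq_cbox: "cube a \<rho> = cbox a (\<chi> e. a $ e + \<rho>)"
  by (auto simp: cube_def mem_box_cart)

lemma norm_le_CARD:
  fixes z :: "real^'d::finite"
  assumes "\<And>e. \<bar>z $ e\<bar> \<le> b"
  shows "norm z \<le> real CARD('d) * b"
proof -
  have "norm z \<le> (\<Sum>e\<in>UNIV. \<bar>z $ e\<bar>)" by (rule norm_le_l1_cart)
  also have "\<dots> \<le> (\<Sum>e\<in>(UNIV::'d set). b)" by (intro sum_mono assms)
  finally show ?thesis by simp
qed

text \<open>The stencil of step h stays in the cube and within (2 r + 1) h of x in every coordinate,
  so continuity on the closed cube is enough even for x on its boundary.\<close>

lemma interp_tendsto:
  fixes f :: "real^'d::finite \<Rightarrow> real"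
  assumes r: "0 < r" and \<rho>: "0 < \<rho>" and f: "continuous_on (cube a \<rho>) f" and x: "x \<in> cube a \<rho>"
    and h: "h = (\<lambda>i::nat. \<rho> / real (r + 1) / 2 ^ i)"
  shows "(\<lambda>i. grid_interp r (stencil_start r a \<rho> t (h i) x) (h i) f x) \<longlonglongrightarrow> f x"
proof (rule LIMSEQ_I)
  fix \<eta> :: real assume \<eta>: "0 < \<eta>"
  define K where "K = (real r * (real (r + 1) + real r) ^ r) ^ CARD('d)"
  have K0: "0 < K" using r by (simp add: K_def)
  obtain \<delta> where \<delta>: "0 < \<delta>" "\<And>z. z \<in> cube a \<rho> \<Longrightarrow> dist z x < \<delta> \<Longrightarrow> dist (f z) (f x) < \<eta> / (2 * K)"
    using f x K0 \<eta> unfolding continuous_on_iff by (metis divide_pos_pos mult_pos_pos zero_less_numeral)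
  have hpos: "0 < h i" for i using \<rho> by (simp add: h)
  have hle: "real (r + 1) * h i \<le> \<rho>" for i
    using \<rho> by (simp add: h divide_le_eq mult_le_cancel_left1)
  have "(\<lambda>i. real CARD('d) * (real (2 * r + 1) * h i)) \<longlonglongrightarrow> 0"
  proof -
    have "h \<longlonglongrightarrow> 0" unfolding h by (rule LIMSEQ_divide_realpow_zero) simp
    from tendsto_mult_right_zero[OF tendsto_mult_right_zero[OF this]] show ?thesis .
  qed
  from order_tendstoD(2)[OF this \<delta>(1)] obtain N where N: "\<And>i. N \<le> i \<Longrightarrow> real CARD('d) * (real (2 * r + 1) * h i) < \<delta>"
    by (auto simp: eventually_sequentially)
  show "\<exists>N. \<forall>i\<ge>N. norm (grid_interp r (stencil_start r a \<rho> t (h i) x) (h i) f x - f x) < \<eta>"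
  proof (intro exI[of _ N] allI impI)
    fix i assume i: "N \<le> i"
    define s where "s = stencil_start r a \<rho> t (h i) x"
    note p = stencil_start_props[OF hpos[of i] hle[of i] x, where t=t, folded s_def]
    have "\<bar>grid_interp r s (h i) f x - f x\<bar> \<le> K * (\<eta> / (2 * K))"
      unfolding K_def
    proof (rule grid_interp_close[OF r hpos])
      show "\<bar>(x $ e - s $ e) / h i\<bar> \<le> real (r + 1)" for e
        using p(3)[of e] hpos[of i] by (simp add: abs_divide divide_le_eq)
      fix z assume z: "\<And>e. \<exists>b<r. z $ e = s $ e + h i * real b"
      have zz: "a $ e \<le> z $ e \<and> z $ e \<le> a $ e + \<rho> \<and> \<bar>z $ e - x $ e\<bar> \<le> real (2 * r + 1) * h i" for e
      proof -
        obtain b where b: "b < r" "z $ e = s $ e + h i * real b" using z by blast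
        have "0 \<le> h i * real b" "h i * real b \<le> h i * real r" using b hpos[of i] by auto
        moreover have "real (2 * r + 1) * h i = real (r + 1) * h i + h i * real r" by (simp add: algebra_simps)
        ultimately show ?thesis using b p(1,2,3)[of e] by (auto simp: mult.commute)
      qed
      have "norm (z - x) \<le> real CARD('d) * (real (2 * r + 1) * h i)"
        by (rule norm_le_CARD) (use zz in auto)
      hence "dist z x < \<delta>" using N[OF i] by (simp add: dist_norm)
      moreover have "z \<in> cube a \<rho>" using zz by (auto simp: cube_def)
      ultimately show "\<bar>f z - f x\<bar> \<le> \<eta> / (2 * (real r * (real (r + 1) + real r) ^ r) ^ CARD('d))"
        using \<delta>(2)[of z] by (simp add: dist_real_def K_def)
    qed
    also have "\<dots> < \<eta>" using K0 \<eta> by simp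
    finally show "norm (grid_interp r (stencil_start r a \<rho> t (h i) x) (h i) f x - f x) < \<eta>" by (simp add: s_def)
  qed
qed

text \<open>The increments from step \<rho>/(r + 1) down to 0 telescope, and
  \<open>interp_tendsto\<close> identifies the limit as f x. The coarsest interpolant is the same
  polynomial for all x, which turns a pointwise estimate into an approximation on the whole
  cube.\<close>

lemma local_approx:
  assumes r: "0 < r"
  shows "\<exists>C\<ge>0. \<forall>(f :: real^'d::finite \<Rightarrow> real) a \<rho> \<tau> lam \<Lambda>. 0 < \<rho> \<longrightarrow> continuous_on (cube a \<rho>) f \<longrightarrow>
    (\<forall>e. 0 \<le> \<tau> $ e \<and> \<tau> $ e < \<rho> / real (r + 1)) \<longrightarrow> (\<forall>i. 0 \<le> lam i) \<longrightarrow> (\<forall>n. (\<Sum>i<n. lam i) \<le> \<Lambda>) \<longrightarrow>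
    (\<forall>i e. \<forall>z\<in>lattice (a + \<tau>) (\<rho> / real (r + 1) / 2 ^ Suc i). z \<in> cube a \<rho> \<longrightarrow>
        z + real r *\<^sub>R ((\<rho> / real (r + 1) / 2 ^ Suc i) *\<^sub>R axis e 1) \<in> cube a \<rho> \<longrightarrow>
        \<bar>axis_diff r (\<rho> / real (r + 1) / 2 ^ Suc i) e f z\<bar> \<le> lam i) \<longrightarrow>
    (\<forall>x\<in>cube a \<rho>. \<bar>f x - grid_interp r (a + \<tau>) (\<rho> / real (r + 1)) f x\<bar> \<le> C * \<Lambda>)"
proof -
  obtain C where C0: "0 \<le> C" and C: "\<And>(f :: real^'d \<Rightarrow> real) a \<rho> t h lam x. 0 < h \<Longrightarrow> real (r + 1) * (2 * h) \<le> \<rho> \<Longrightarrow> 0 \<le> lam \<Longrightarrow> x \<in> cube a \<rho> \<Longrightarrow>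
     (\<forall>e. \<forall>z\<in>lattice t h. z \<in> cube a \<rho> \<longrightarrow> z + real r *\<^sub>R (h *\<^sub>R axis e 1) \<in> cube a \<rho> \<longrightarrow> \<bar>axis_diff r h e f z\<bar> \<le> lam) \<Longrightarrow>
     \<bar>grid_interp r (stencil_start r a \<rho> t (2 * h) x) (2 * h) f x - grid_interp r (stencil_start r a \<rho> t h x) h f x\<bar> \<le> C * lam"
    using interp_level_diff[OF r, where 'd='d] by blast
  show ?thesis
  proof (intro exI[of _ C] conjI C0 allI impI ballI)
    fix f :: "real^'d \<Rightarrow> real" and a \<rho> \<tau> lam \<Lambda> x
    assume \<rho>: "0 < \<rho>" and f: "continuous_on (cube a \<rho>) f" and \<tau>: "\<forall>e. 0 \<le> \<tau> $ e \<and> \<tau> $ e < \<rho> / real (r + 1)"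
      and lam: "\<forall>i. 0 \<le> lam i" and \<Lambda>: "\<forall>n. (\<Sum>i<n. lam i) \<le> \<Lambda>"
      and D: "\<forall>i e. \<forall>z\<in>lattice (a + \<tau>) (\<rho> / real (r + 1) / 2 ^ Suc i). z \<in> cube a \<rho> \<longrightarrow>
        z + real r *\<^sub>R ((\<rho> / real (r + 1) / 2 ^ Suc i) *\<^sub>R axis e 1) \<in> cube a \<rho> \<longrightarrow>
        \<bar>axis_diff r (\<rho> / real (r + 1) / 2 ^ Suc i) e f z\<bar> \<le> lam i"
      and x: "x \<in> cube a \<rho>"
    define h where "h = (\<lambda>i::nat. \<rho> / real (r + 1) / 2 ^ i)"
    define P where "P i = grid_interp r (stencil_start r a \<rho> (a + \<tau>) (h i) x) (h i) f x" for i
    have hS: "2 * h (Suc i) = h i" for i by (simp add: h_def)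
    have hpos: "0 < h i" for i using \<rho> by (simp add: h_def)
    have hle: "real (r + 1) * h i \<le> \<rho>" for i
      using \<rho> by (simp add: h_def divide_le_eq mult_le_cancel_left1)
    have st: "\<bar>P i - P (Suc i)\<bar> \<le> C * lam i" for i
      unfolding P_def hS[symmetric, of i]
    proof (rule C)
      show "real (r + 1) * (2 * h (Suc i)) \<le> \<rho>" unfolding hS by (rule hle)
      show "\<forall>e. \<forall>z\<in>lattice (a + \<tau>) (h (Suc i)). z \<in> cube a \<rho> \<longrightarrow>
        z + real r *\<^sub>R (h (Suc i) *\<^sub>R axis e 1) \<in> cube a \<rho> \<longrightarrow>
        \<bar>axis_diff r (h (Suc i)) e f z\<bar> \<le> lam i"
        using D unfolding h_def by blast
    qed (use hpos x lam in auto)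
    have tele: "\<bar>P 0 - P n\<bar> \<le> C * (\<Sum>i<n. lam i)" for n
    proof (induction n)
      case (Suc n)
      have "\<bar>P 0 - P (Suc n)\<bar> \<le> \<bar>P 0 - P n\<bar> + \<bar>P n - P (Suc n)\<bar>" by linarith
      thus ?case using Suc st[of n] by (simp add: distrib_left)
    qed simp
    have "\<bar>P 0 - P n\<bar> \<le> C * \<Lambda>" for n
      using tele[of n] mult_left_mono[OF _ C0, of "\<Sum>i<n. lam i" \<Lambda>] \<Lambda> by (meson order_trans)
    moreover have "P \<longlonglongrightarrow> f x" unfolding P_def using interp_tendsto[OF r \<rho> f x h_def] .
    hence "(\<lambda>n. \<bar>P 0 - P n\<bar>) \<longlonglongrightarrow> \<bar>P 0 - f x\<bar>" by (intro tendsto_intros)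
    ultimately have "\<bar>P 0 - f x\<bar> \<le> C * \<Lambda>" by (intro Lim_bounded[of "\<lambda>n. \<bar>P 0 - P n\<bar>"]) auto
    \<comment> \<open>With step \<rho>/(r + 1) the clamp returns the lower corner whatever x is, and
      rounding it up to the lattice through a + \<tau> gives a + \<tau> itself, since -\<tau>
      divided by the step lies in (-1, 0].\<close>
    moreover have "stencil_start r a \<rho> (a + \<tau>) (h 0) x = a + \<tau>"
    proof -
      have "\<lceil>(min (x $ e) (a $ e + \<rho> - real (r + 1) * h 0) - (a + \<tau>) $ e) / h 0\<rceil> = 0" for e
      proof -
        have "real (r + 1) * h 0 = \<rho>" by (simp add: h_def)
        hence "min (x $ e) (a $ e + \<rho> - real (r + 1) * h 0) = a $ e" using x by (auto simp: cube_def)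
        moreover have "- 1 < - \<tau> $ e / h 0" "- \<tau> $ e / h 0 \<le> 0"
          using \<tau> hpos[of 0] by (auto simp: h_def less_divide_eq divide_le_0_iff)
        ultimately show ?thesis by (simp add: ceiling_eq_iff)
      qed
      thus ?thesis by (simp add: stencil_start_def vec_eq_iff)
    qed
    ultimately show "\<bar>f x - grid_interp r (a + \<tau>) (\<rho> / real (r + 1)) f x\<bar> \<le> C * \<Lambda>"
      by (simp add: P_def h_def abs_minus_commute)
  qed
qed

section \<open>Averaging over the shifts of the lattice\<close>

lemma emeasure_lborel_image_diff:
  fixes A :: "(real^'d::finite) set"
  assumes "A \<in> sets borel"
  shows "(\<lambda>z. z - c) ` A \<in> sets borel" "emeasure lborel ((\<lambda>z. z - c) ` A) = emeasure lborel A"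
proof -
  have eq: "(\<lambda>z. z - c) ` A = (+) c -` A" by (auto simp: image_iff) (metis add_diff_cancel_left')
  show m: "(\<lambda>z. z - c) ` A \<in> sets borel"
    unfolding eq using measurable_sets[OF borel_measurable_add[OF borel_measurable_const measurable_ident_sets[OF refl]] assms, of c]
    by simp
  have "emeasure lborel A = emeasure (distr lborel borel ((+) c)) A"
    by (simp add: lborel_distr_plus)
  also have "\<dots> = emeasure lborel ((+) c -` A \<inter> space lborel)"
    by (rule emeasure_distr) (use assms in auto)
  finally show "emeasure lborel ((\<lambda>z. z - c) ` A) = emeasure lborel A" by (simp add: eq)
qed

definition large_diff :: "nat \<Rightarrow> real \<Rightarrow> 'd::finite \<Rightarrow> (real^'d \<Rightarrow> real) \<Rightarrow> real \<Rightarrow> (real^'d) set \<Rightarrow> (real^'d) set" where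
  "large_diff r h e f lam R = {z \<in> R. z + real r *\<^sub>R (h *\<^sub>R axis e 1) \<in> R \<and> lam < \<bar>axis_diff r h e f z\<bar>}"

lemma cube_segment:
  assumes "z \<in> cube a \<rho>" "z + real r *\<^sub>R (h *\<^sub>R axis e 1) \<in> cube a \<rho>" "j \<le> r"
  shows "z + real j *\<^sub>R (h *\<^sub>R axis e 1) \<in> cube a \<rho>"
proof -
  have *: "a $ e' \<le> z $ e' \<and> z $ e' \<le> a $ e' + \<rho>" for e' using assms(1) by (auto simp: cube_def)
  have r: "a $ e \<le> z $ e + real r * h \<and> z $ e + real r * h \<le> a $ e + \<rho>"
    using assms(2) unfolding axis_shift by (auto simp: cube_def vec_upd_nth dest: spec[of _ e])
  have "a $ e \<le> z $ e + real j * h \<and> z $ e + real j * h \<le> a $ e + \<rho>"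
  proof (cases "0 \<le> h")
    case True
    hence "0 \<le> real j * h" "real j * h \<le> real r * h" using assms(3) by (auto intro: mult_right_mono)
    thus ?thesis using *[of e] r by linarith
  next
    case False
    hence "real j * h \<le> 0" "real r * h \<le> real j * h" using assms(3) by (auto intro: mult_right_mono_neg simp: mult_le_0_iff)
    thus ?thesis using *[of e] r by linarith
  qed
  thus ?thesis unfolding axis_shift using * by (auto simp: cube_def vec_upd_nth)
qed

text \<open>Relatively open in the closed set of those z for which both end points lie in the cube;
  by convexity the differences there use only values of f where it is continuous.\<close>

lemma large_diff_borel:
  assumes f: "continuous_on (cube a \<rho>) f"
  shows "large_diff r h e f lam (cube a \<rho>) \<in> sets borel"
proof -
  define V where "V = cube a \<rho> \<inter> (\<lambda>z. z + real r *\<^sub>R (h *\<^sub>R axis e 1)) -` cube a \<rho>"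
  have cl: "closed (cube a \<rho>)" by (simp add: cube_eq_cbox closed_cbox)
  have "closed V" unfolding V_def
    by (intro closed_Int cl closed_vimage continuous_intros)
  have "continuous_on V (\<lambda>z. \<bar>axis_diff r h e f z\<bar>)"
    unfolding axis_diff_def
  proof (intro continuous_intros continuous_on_compose2[OF f])
    fix j assume "j \<in> {0..r}"
    thus "(\<lambda>z. z + real j *\<^sub>R (h *\<^sub>R axis e 1)) ` V \<subseteq> cube a \<rho>"
      using cube_segment[of _ a \<rho> r h e j] by (auto simp: V_def)
  qed
  hence "openin (top_of_set V) (V \<inter> (\<lambda>z. \<bar>axis_diff r h e f z\<bar>) -` {lam<..})"
    by (intro continuous_openin_preimage_gen) auto
  then obtain U where U: "open U" "V \<inter> (\<lambda>z. \<bar>axis_diff r h e f z\<bar>) -` {lam<..} = V \<inter> U"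
    by (auto simp: openin_open)
  have "large_diff r h e f lam (cube a \<rho>) = V \<inter> (\<lambda>z. \<bar>axis_diff r h e f z\<bar>) -` {lam<..}"
    by (auto simp: large_diff_def V_def)
  also have "\<dots> \<in> sets borel" unfolding U(2) using \<open>closed V\<close> U(1) by (intro sets.Int borel_closed borel_open)
  finally show ?thesis .
qed

text \<open>Contraposition of \<open>local_approx\<close>: if the shift \<tau> fails, some point a +
  \<tau> + h k of a refined lattice lies in a set of large differences. So the box of all shifts is
  covered by translates of these sets. The factor in the sum counts the lattice vectors k that can
  occur at refinement i.\<close>

lemma bad_cube_measure:
  assumes r: "0 < r"
  shows "\<exists>C>0. \<forall>(f :: real^'d::finite \<Rightarrow> real) a \<rho> lam \<Lambda>. 0 < \<rho> \<longrightarrow> continuous_on (cube a \<rho>) f \<longrightarrow>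
    (\<forall>i. 0 \<le> lam i) \<longrightarrow> (\<forall>n. (\<Sum>i<n. lam i) \<le> \<Lambda>) \<longrightarrow>
    (\<forall>\<tau>. (\<forall>e. 0 \<le> \<tau> $ e \<and> \<tau> $ e < \<rho> / real (r + 1)) \<longrightarrow> (\<exists>x\<in>cube a \<rho>. C * \<Lambda> < \<bar>f x - grid_interp r (a + \<tau>) (\<rho> / real (r + 1)) f x\<bar>)) \<longrightarrow>
    ennreal ((\<rho> / real (r + 1)) ^ CARD('d)) \<le> (\<Sum>i. \<Sum>e\<in>UNIV. ennreal ((real (r + 3) * 2 ^ Suc i) ^ CARD('d)) *
       emeasure lborel (large_diff r (\<rho> / real (r + 1) / 2 ^ Suc i) e f (lam i) (cube a \<rho>)))"
proof -
  obtain C where C0: "0 \<le> C" and C: "\<And>(f :: real^'d \<Rightarrow> real) a \<rho> \<tau> lam \<Lambda>. 0 < \<rho> \<Longrightarrow> continuous_on (cube a \<rho>) f \<Longrightarrow>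
    (\<forall>e. 0 \<le> \<tau> $ e \<and> \<tau> $ e < \<rho> / real (r + 1)) \<Longrightarrow> (\<forall>i. 0 \<le> lam i) \<Longrightarrow> (\<forall>n. (\<Sum>i<n. lam i) \<le> \<Lambda>) \<Longrightarrow>
    (\<forall>i e. \<forall>z\<in>lattice (a + \<tau>) (\<rho> / real (r + 1) / 2 ^ Suc i). z \<in> cube a \<rho> \<longrightarrow>
        z + real r *\<^sub>R ((\<rho> / real (r + 1) / 2 ^ Suc i) *\<^sub>R axis e 1) \<in> cube a \<rho> \<longrightarrow>
        \<bar>axis_diff r (\<rho> / real (r + 1) / 2 ^ Suc i) e f z\<bar> \<le> lam i) \<Longrightarrow>
    (\<forall>x\<in>cube a \<rho>. \<bar>f x - grid_interp r (a + \<tau>) (\<rho> / real (r + 1)) f x\<bar> \<le> C * \<Lambda>)"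
    using local_approx[OF r, where 'd='d] by blast
  show ?thesis
  proof (intro exI[of _ "C + 1"] conjI allI impI)
    fix f :: "real^'d \<Rightarrow> real" and a \<rho> and lam :: "nat \<Rightarrow> real" and \<Lambda> :: real
    assume \<rho>: "0 < \<rho>" and f: "continuous_on (cube a \<rho>) f" and lam: "\<forall>i. 0 \<le> lam i" and \<Lambda>: "\<forall>n. (\<Sum>i<n. lam i) \<le> \<Lambda>"
      and bad: "\<forall>\<tau>. (\<forall>e. 0 \<le> \<tau> $ e \<and> \<tau> $ e < \<rho> / real (r + 1)) \<longrightarrow> (\<exists>x\<in>cube a \<rho>. (C + 1) * \<Lambda> < \<bar>f x - grid_interp r (a + \<tau>) (\<rho> / real (r + 1)) f x\<bar>)"
    define h where "h = (\<lambda>i::nat. \<rho> / real (r + 1) / 2 ^ i)"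
    have hpos: "0 < h i" for i using \<rho> by (simp add: h_def)
    have \<Lambda>0: "0 \<le> \<Lambda>" using \<Lambda>[rule_format, of 0] by simp
    define A where "A i e = large_diff r (h (Suc i)) e f (lam i) (cube a \<rho>)" for i e
    have Ab: "A i e \<in> sets borel" for i e unfolding A_def by (rule large_diff_borel[OF f])
    \<comment> \<open>A lattice point z in the cube satisfies -\<rho>/(r + 1) < z - a - \<tau> \<le>
      \<rho> in each coordinate; in units of the refined step this is the range given.\<close>
    define K where "K i = PiE (UNIV::'d set) (\<lambda>_. {- (2 ^ Suc i) .. int (r + 1) * 2 ^ Suc i})" for i :: nat
    define T where "T i k = a + (\<chi> e. h (Suc i) * real_of_int (k e))" for i :: nat and k :: "'d \<Rightarrow> int"
    have cK: "real (card (K i)) \<le> (real (r + 3) * 2 ^ Suc i) ^ CARD('d)" for i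
    proof -
      define w :: nat where "w = 2 ^ Suc i"
      have w: "1 \<le> w" "real w = 2 ^ Suc i" "int w = 2 ^ Suc i" by (auto simp: w_def)
      have "card {- int w .. int (r + 1) * int w} = (r + 1) * w + w + 1"
        by (simp add: nat_add_distrib nat_mult_distrib)
      hence "card (K i) = ((r + 1) * w + w + 1) ^ CARD('d)"
        unfolding K_def w(3)[symmetric] by (subst card_PiE) auto
      also have "\<dots> \<le> ((r + 3) * w) ^ CARD('d)"
        by (rule power_mono) (use w(1) in \<open>auto simp: algebra_simps\<close>)
      finally have "real (card (K i)) \<le> real (((r + 3) * w) ^ CARD('d))" by (simp only: of_nat_le_iff)
      also have "\<dots> = (real (r + 3) * 2 ^ Suc i) ^ CARD('d)"
        unfolding of_nat_power of_nat_mult w(2) ..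
      finally show ?thesis .
    qed
    have cover: "box 0 (\<chi> e. h 0) \<subseteq> (\<Union>i. \<Union>e\<in>UNIV. \<Union>k\<in>K i. (\<lambda>z. z - T i k) ` A i e)"
    proof
      fix \<tau> :: "real^'d" assume "\<tau> \<in> box 0 (\<chi> e. h 0)"
      hence \<tau>: "\<forall>e. 0 \<le> \<tau> $ e \<and> \<tau> $ e < \<rho> / real (r + 1)"
        by (auto simp: mem_box_cart h_def less_imp_le)
      obtain x where x: "x \<in> cube a \<rho>" "(C + 1) * \<Lambda> < \<bar>f x - grid_interp r (a + \<tau>) (\<rho> / real (r + 1)) f x\<bar>"
        using bad \<tau> by blast
      have "C * \<Lambda> \<le> (C + 1) * \<Lambda>" using \<Lambda>0 by (simp add: distrib_right)
      hence "\<not> (\<forall>x\<in>cube a \<rho>. \<bar>f x - grid_interp r (a + \<tau>) (\<rho> / real (r + 1)) f x\<bar> \<le> C * \<Lambda>)"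
        using x by force
      from contrapos_nn[OF this C[OF \<rho> f \<tau> lam \<Lambda>]]
      have "\<exists>i e. \<exists>z\<in>lattice (a + \<tau>) (h (Suc i)). z \<in> A i e"
        unfolding h_def A_def large_diff_def mem_Collect_eq not_le[symmetric] by blast
      then obtain i e z where z: "z \<in> lattice (a + \<tau>) (h (Suc i))" "z \<in> A i e" by blast
      have "\<forall>e. \<exists>k::int. z $ e = (a + \<tau>) $ e + h (Suc i) * real_of_int k"
        using z(1) unfolding lattice_def by blast
      from choice[OF this] obtain k :: "'d \<Rightarrow> int" where k: "\<And>e. z $ e = (a + \<tau>) $ e + h (Suc i) * real_of_int (k e)"
        by blast
      have zc: "a $ e' \<le> z $ e' \<and> z $ e' \<le> a $ e' + \<rho>" for e'
        using z(2) by (auto simp: A_def large_diff_def cube_def)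
      have "k \<in> K i" unfolding K_def
      proof (rule PiE_I)
        fix e'
        have h2: "h (Suc i) * 2 ^ Suc i = \<rho> / real (r + 1)" by (simp add: h_def)
        have 1: "h (Suc i) * real_of_int (k e') \<ge> h (Suc i) * (- (2 ^ Suc i))"
          using k[of e'] zc[of e'] \<tau>[rule_format, of e'] h2 by simp
        have "h (Suc i) * (real (r + 1) * 2 ^ Suc i) = real (r + 1) * (h (Suc i) * 2 ^ Suc i)"
          by (simp only: mult_ac)
        hence "h (Suc i) * (real (r + 1) * 2 ^ Suc i) = \<rho>" unfolding h2 by simp
        hence 2: "h (Suc i) * real_of_int (k e') \<le> h (Suc i) * (real (r + 1) * 2 ^ Suc i)"
          using k[of e'] zc[of e'] \<tau>[rule_format, of e'] by simp
        have "- (2 ^ Suc i) \<le> real_of_int (k e')" using 1 hpos[of "Suc i"] mult_le_cancel_left_pos by blast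
        moreover have "real_of_int (k e') \<le> real (r + 1) * 2 ^ Suc i" using 2 hpos[of "Suc i"] mult_le_cancel_left_pos by blast
        ultimately have "real_of_int (- (2 ^ Suc i)) \<le> real_of_int (k e')" "real_of_int (k e') \<le> real_of_int (int (r + 1) * 2 ^ Suc i)"
          by auto
        thus "k e' \<in> {- (2 ^ Suc i)..int (r + 1) * 2 ^ Suc i}" by (simp only: of_int_le_iff atLeastAtMost_iff)
      qed simp
      moreover have "\<tau> = z - T i k" using k by (simp add: T_def vec_eq_iff)
      ultimately show "\<tau> \<in> (\<Union>i. \<Union>e\<in>UNIV. \<Union>k\<in>K i. (\<lambda>z. z - T i k) ` A i e)"
        using z(2) by blast
    qed
    have fK: "finite (K i)" for i unfolding K_def by (rule finite_PiE[OF finite finite_atLeastAtMost_int])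
    have "emeasure lborel (box 0 (\<chi> e::'d. h 0)) = ennreal (h 0 ^ CARD('d))"
    proof -
      have "emeasure lborel (box 0 (\<chi> e::'d. h 0)) = emeasure lborel (cbox 0 (\<chi> e::'d. h 0))"
        unfolding emeasure_lborel_box_eq emeasure_lborel_cbox_eq ..
      also have "\<dots> = ennreal (measure lborel (cbox 0 (\<chi> e::'d. h 0)))"
        by (rule emeasure_eq_ennreal_measure) (use emeasure_bounded_finite[OF bounded_cbox, of 0 "\<chi> e::'d. h 0"] in simp)
      also have "measure lborel (cbox 0 (\<chi> e::'d. h 0)) = h 0 ^ CARD('d)"
        using hpos[of 0] by (subst content_cbox_cart) (auto simp: interval_ne_empty_cart less_imp_le)
      finally show ?thesis .
    qed
    moreover have m0: "(\<Union>k\<in>K i. (\<lambda>z. z - T i k) ` A i e) \<in> sets lborel" for i e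
      unfolding sets_lborel by (intro sets.finite_UN fK emeasure_lborel_image_diff(1)[OF Ab])
    have m1: "(\<Union>e\<in>UNIV. \<Union>k\<in>K i. (\<lambda>z. z - T i k) ` A i e) \<in> sets lborel" for i
      by (intro sets.finite_UN m0 finite)
    have "(\<Union>i. \<Union>e\<in>UNIV. \<Union>k\<in>K i. (\<lambda>z. z - T i k) ` A i e) \<in> sets lborel"
      by (intro sets.countable_UN) (use m1 in blast)
    from emeasure_mono[OF cover this]
    have "emeasure lborel (box 0 (\<chi> e::'d. h 0)) \<le> emeasure lborel (\<Union>i. \<Union>e\<in>UNIV. \<Union>k\<in>K i. (\<lambda>z. z - T i k) ` A i e)" .
    ultimately have "ennreal (h 0 ^ CARD('d)) \<le> emeasure lborel (\<Union>i. \<Union>e\<in>UNIV. \<Union>k\<in>K i. (\<lambda>z. z - T i k) ` A i e)"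
      by simp
    also have "\<dots> \<le> (\<Sum>i. emeasure lborel (\<Union>e\<in>UNIV. \<Union>k\<in>K i. (\<lambda>z. z - T i k) ` A i e))"
      by (rule emeasure_subadditive_countably) (use m1 in blast)
    also have "\<dots> \<le> (\<Sum>i. \<Sum>e\<in>UNIV. ennreal ((real (r + 3) * 2 ^ Suc i) ^ CARD('d)) * emeasure lborel (A i e))"
    proof (rule suminf_le)
      fix i
      have "emeasure lborel (\<Union>e\<in>UNIV. \<Union>k\<in>K i. (\<lambda>z. z - T i k) ` A i e) \<le>
        (\<Sum>e\<in>UNIV. emeasure lborel (\<Union>k\<in>K i. (\<lambda>z. z - T i k) ` A i e))"
        by (intro emeasure_subadditive_finite finite) (use m0 in blast)
      also have "\<dots> \<le> (\<Sum>e\<in>UNIV. \<Sum>k\<in>K i. emeasure lborel ((\<lambda>z. z - T i k) ` A i e))"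
        by (intro sum_mono emeasure_subadditive_finite fK)
          (use emeasure_lborel_image_diff(1)[OF Ab] in \<open>auto simp only: sets_lborel\<close>)
      also have "\<dots> = (\<Sum>e\<in>UNIV. ennreal (real (card (K i))) * emeasure lborel (A i e))"
        using emeasure_lborel_image_diff(2)[OF Ab] by (simp add: ennreal_of_nat_eq_real_of_nat)
      also have "\<dots> \<le> (\<Sum>e\<in>UNIV. ennreal ((real (r + 3) * 2 ^ Suc i) ^ CARD('d)) * emeasure lborel (A i e))"
        by (intro sum_mono mult_right_mono ennreal_leI cK) auto
      finally show "emeasure lborel (\<Union>e\<in>UNIV. \<Union>k\<in>K i. (\<lambda>z. z - T i k) ` A i e) \<le>
         (\<Sum>e\<in>UNIV. ennreal ((real (r + 3) * 2 ^ Suc i) ^ CARD('d)) * emeasure lborel (A i e))" .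
    qed auto
    finally show "ennreal ((\<rho> / real (r + 1)) ^ CARD('d)) \<le> (\<Sum>i. \<Sum>e\<in>UNIV. ennreal ((real (r + 3) * 2 ^ Suc i) ^ CARD('d)) *
       emeasure lborel (large_diff r (\<rho> / real (r + 1) / 2 ^ Suc i) e f (lam i) (cube a \<rho>)))"
      by (simp add: A_def h_def)
  qed (use C0 in auto)
qed

section \<open>Covering by good dyadic cubes\<close>

definition dyadic_idx :: "nat \<Rightarrow> ('d::finite \<Rightarrow> nat) set" where
  "dyadic_idx j = PiE UNIV (\<lambda>_. {..<2 ^ j})"

definition dyadic_cell :: "nat \<Rightarrow> ('d::finite \<Rightarrow> nat) \<Rightarrow> (real^'d) set" where
  "dyadic_cell j k = {x. \<forall>e. real (k e) \<le> 2 ^ j * x $ e \<and> 2 ^ j * x $ e \<le> real (k e) + 1}"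

text \<open>Clamped so that the cube of twice the side length of the cell stays inside the unit cube.\<close>
definition big_corner :: "nat \<Rightarrow> ('d::finite \<Rightarrow> nat) \<Rightarrow> real^'d" where
  "big_corner j k = (\<chi> e. max 0 (min (real (k e) - 1/2) (2 ^ j - 2)) / 2 ^ j)"

definition big_cube :: "nat \<Rightarrow> ('d::finite \<Rightarrow> nat) \<Rightarrow> (real^'d) set" where
  "big_cube j k = cube (big_corner j k) (2 / 2 ^ j)"

lemma finite_dyadic_idx: "finite (dyadic_idx j)"
  unfolding dyadic_idx_def by (rule finite_PiE[OF finite finite_lessThan])

lemma card_dyadic_idx: "card (dyadic_idx j :: ('d::finite \<Rightarrow> nat) set) = (2 ^ j) ^ CARD('d)"
  by (simp add: dyadic_idx_def card_PiE)

lemma big_cube_iff: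
  "x \<in> big_cube j k \<longleftrightarrow> (\<forall>e. max 0 (min (real (k e) - 1/2) (2 ^ j - 2)) \<le> 2 ^ j * x $ e \<and>
      2 ^ j * x $ e \<le> max 0 (min (real (k e) - 1/2) (2 ^ j - 2)) + 2)"
proof -
  have "x \<in> big_cube j k \<longleftrightarrow> (\<forall>e. max 0 (min (real (k e) - 1/2) (2 ^ j - 2)) / 2 ^ j \<le> x $ e \<and>
      x $ e \<le> max 0 (min (real (k e) - 1/2) (2 ^ j - 2)) / 2 ^ j + 2 / 2 ^ j)"
    unfolding big_cube_def cube_def big_corner_def by simp
  also have "\<dots> \<longleftrightarrow> (\<forall>e. max 0 (min (real (k e) - 1/2) (2 ^ j - 2)) / 2 ^ j \<le> x $ e \<and>
      x $ e \<le> (max 0 (min (real (k e) - 1/2) (2 ^ j - 2)) + 2) / 2 ^ j)"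
    by (simp only: add_divide_distrib)
  finally show ?thesis by (simp add: pos_divide_le_eq pos_le_divide_eq mult.commute)
qed

lemma big_cube_subset:
  assumes "1 \<le> j" shows "big_cube j k \<subseteq> cube 0 1"
proof
  fix x assume x: "x \<in> big_cube j k"
  have j2: "(2::real) \<le> 2 ^ j" using power_increasing[OF assms, of "2::real"] by simp
  have "0 \<le> x $ e \<and> x $ e \<le> 1" for e
  proof -
    define m where "m = max 0 (min (real (k e) - 1/2) (2 ^ j - 2))"
    have "0 \<le> m" "m + 2 \<le> 2 ^ j" using j2 by (auto simp: m_def)
    moreover have "m \<le> 2 ^ j * x $ e" "2 ^ j * x $ e \<le> m + 2"
      using x unfolding big_cube_iff m_def by blast+
    ultimately have "0 \<le> 2 ^ j * x $ e" "2 ^ j * x $ e \<le> 2 ^ j * 1" by linarith+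
    thus ?thesis using mult_le_cancel_left_pos[of "2 ^ j" 0 "x $ e"] mult_le_cancel_left_pos[of "2 ^ j" "x $ e" 1] by simp
  qed
  thus "x \<in> cube 0 1" by (auto simp: cube_def)
qed

text \<open>The bump of a cell will be supported within a quarter of a side around it. The big cube,
  even when clamped, has to contain this part of the unit cube, so that the local polynomial is
  valid wherever its bump is non-zero.\<close>

lemma big_cube_contains:
  assumes "k \<in> dyadic_idx j" "x \<in> cube 0 1"
    and "\<And>e. real (k e) - 1/4 \<le> 2 ^ j * x $ e \<and> 2 ^ j * x $ e \<le> real (k e) + 5/4"
  shows "x \<in> big_cube j k"
proof -
  have "max 0 (min (real (k e) - 1/2) (2 ^ j - 2)) \<le> 2 ^ j * x $ e \<and>
      2 ^ j * x $ e \<le> max 0 (min (real (k e) - 1/2) (2 ^ j - 2)) + 2" for e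
  proof -
    have "k e < 2 ^ j" using assms(1) by (auto simp: dyadic_idx_def)
    hence "real (k e + 1) \<le> real (2 ^ j)" by (subst of_nat_le_iff) auto
    hence k: "real (k e) + 1 \<le> 2 ^ j" by simp
    have x: "0 \<le> x $ e" "x $ e \<le> 1" using assms(2) by (auto simp: cube_def)
    hence x2: "0 \<le> 2 ^ j * x $ e" "2 ^ j * x $ e \<le> 2 ^ j" by (auto intro: mult_left_le)
    have "real (k e) = 0 \<or> 1 \<le> real (k e)" by (cases "k e") auto
    thus ?thesis using k x2 assms(3)[of e] by (auto simp: max_def min_def)
  qed
  thus ?thesis unfolding big_cube_iff by blast
qed

lemma big_cube_overlap:
  fixes x :: "real^'d::finite"
  assumes "K \<subseteq> dyadic_idx j"
  shows "finite {k\<in>K. x \<in> big_cube j k} \<and> card {k\<in>K. x \<in> big_cube j k} \<le> 4 ^ CARD('d)"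
proof -
  define m where "m e = nat \<lceil>2 ^ j * x $ e - 2\<rceil>" for e
  have sub: "{k\<in>K. x \<in> big_cube j k} \<subseteq> PiE UNIV (\<lambda>e. {m e..<m e + 4})"
  proof
    fix k assume k: "k \<in> {k\<in>K. x \<in> big_cube j k}"
    show "k \<in> PiE UNIV (\<lambda>e. {m e..<m e + 4})"
    proof (rule PiE_I)
      fix e
      have "k e < 2 ^ j" using k assms by (auto simp: dyadic_idx_def)
      hence "real (k e + 1) \<le> real (2 ^ j)" by (subst of_nat_le_iff) auto
      hence k1: "real (k e) + 1 \<le> 2 ^ j" by simp
      have "real (k e) = 0 \<or> 1 \<le> real (k e)" by (cases "k e") auto
      hence "real (k e) - 1 \<le> max 0 (min (real (k e) - 1/2) (2 ^ j - 2))" "max 0 (min (real (k e) - 1/2) (2 ^ j - 2)) \<le> real (k e)"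
        using k1 by (auto simp: max_def min_def)
      moreover have "max 0 (min (real (k e) - 1/2) (2 ^ j - 2)) \<le> 2 ^ j * x $ e"
        "2 ^ j * x $ e \<le> max 0 (min (real (k e) - 1/2) (2 ^ j - 2)) + 2"
        using k unfolding big_cube_iff mem_Collect_eq by blast+
      ultimately have "real (k e) - 1 \<le> 2 ^ j * x $ e" "2 ^ j * x $ e \<le> real (k e) + 2" by linarith+
      hence "m e \<le> k e" "k e < m e + 4" unfolding m_def by linarith+
      thus "k e \<in> {m e..<m e + 4}" by simp
    qed simp
  qed
  have fin: "finite (PiE UNIV (\<lambda>e. {m e..<m e + 4}))" by (rule finite_PiE[OF finite finite_atLeastLessThan])
  have "card {k\<in>K. x \<in> big_cube j k} \<le> card (PiE UNIV (\<lambda>e. {m e..<m e + 4}))"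
    by (rule card_mono[OF fin sub])
  thus ?thesis using finite_subset[OF sub fin] by (simp add: card_PiE)
qed

text \<open>Bounded overlap: at most four indices per coordinate are possible, so a set is charged
  at most 4^d times when the cells of one level are counted together.\<close>

lemma sum_emeasure_overlap:
  fixes A :: "(real^'d::finite) set"
  assumes "A \<in> sets borel" "K \<subseteq> dyadic_idx j"
  shows "(\<Sum>k\<in>K. emeasure lborel (A \<inter> big_cube j k)) \<le> ennreal (4 ^ CARD('d)) * emeasure lborel A"
proof -
  have fK: "finite K" using assms(2) finite_dyadic_idx finite_subset by blast
  have bb: "big_cube j k \<in> sets borel" for k :: "'d \<Rightarrow> nat"
    unfolding big_cube_def cube_eq_cbox by (rule borel_closed) (rule closed_cbox)
  have "(\<Sum>k\<in>K. emeasure lborel (A \<inter> big_cube j k)) = (\<Sum>k\<in>K. \<integral>\<^sup>+x. indicator (A \<inter> big_cube j k) x \<partial>lborel)"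
    using assms(1) bb by (intro sum.cong refl nn_integral_indicator[symmetric]) auto
  also have "\<dots> = (\<integral>\<^sup>+x. (\<Sum>k\<in>K. indicator (A \<inter> big_cube j k) x) \<partial>lborel)"
    using assms(1) bb by (intro nn_integral_sum[symmetric] borel_measurable_indicator) auto
  also have "\<dots> \<le> (\<integral>\<^sup>+x. ennreal (4 ^ CARD('d)) * indicator A x \<partial>lborel)"
  proof (rule nn_integral_mono)
    fix x :: "real^'d"
    have "(\<Sum>k\<in>K. indicator (A \<inter> big_cube j k) x) = (\<Sum>k\<in>K. if x \<in> big_cube j k then indicator A x else (0::ennreal))"
      by (intro sum.cong) (auto simp: indicator_def)
    also have "\<dots> = (\<Sum>k\<in>{k\<in>K. x \<in> big_cube j k}. indicator A x)"
      by (rule sum.inter_filter[OF fK, symmetric])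
    also have "\<dots> = of_nat (card {k\<in>K. x \<in> big_cube j k}) * indicator A x" by simp
    also have "\<dots> \<le> of_nat (4 ^ CARD('d)) * indicator A x"
      using big_cube_overlap[OF assms(2), of x] by (intro mult_right_mono) (auto simp only: of_nat_le_iff, simp)
    also have "of_nat (4 ^ CARD('d)) = ennreal (4 ^ CARD('d))" by (simp add: ennreal_of_nat_eq_real_of_nat)
    finally show "(\<Sum>k\<in>K. indicator (A \<inter> big_cube j k) x) \<le> ennreal (4 ^ CARD('d)) * indicator A x" .
  qed
  also have "\<dots> = ennreal (4 ^ CARD('d)) * emeasure lborel A"
    using assms(1) by (subst nn_integral_cmult_indicator) auto
  finally show ?thesis .
qed

text \<open>The condition on s keeps all interpolation nodes in the unit cube, where |f| \<le> B
  later bounds the coefficients of the local polynomial. The tolerance is not tied to the level j: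
  it stays fixed while cells are refined.\<close>

definition good_cell :: "nat \<Rightarrow> (real^'d::finite \<Rightarrow> real) \<Rightarrow> real \<Rightarrow> nat \<Rightarrow> ('d \<Rightarrow> nat) \<Rightarrow> bool" where
  "good_cell r f \<epsilon> j k \<longleftrightarrow> (\<exists>s. (\<forall>e. 0 \<le> s $ e \<and> s $ e + real r * (2 / 2 ^ j / real (r + 1)) \<le> 1) \<and>
     (\<forall>x\<in>big_cube j k. \<bar>f x - grid_interp r s (2 / 2 ^ j / real (r + 1)) f x\<bar> \<le> \<epsilon>))"

lemma large_diff_subset: "R \<subseteq> R' \<Longrightarrow> large_diff r h e f lam R \<subseteq> large_diff r h e f lam R' \<inter> R"
  by (auto simp: large_diff_def)

text \<open>By \<open>bad_cube_measure\<close> and bounded overlap, the number of bad cells times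
  h^d is at most, up to constants, the sum over i of 2^(i d) times the measure of the large
  differences at step h/2^(i + 1). The measure bound contributes 2^(-\<beta> p i), and the resulting
  gain 2^(-\<sigma> i) pays for thresholds that decrease with i.\<close>

lemma count_bad_cells:
  fixes f :: "real^'d::finite \<Rightarrow> real"
  assumes r: "0 < r" and p: "0 < p" and bp: "real CARD('d) < \<beta> * p" and f: "continuous_on (cube 0 1) f"
    and K: "0 \<le> K" "\<And>h e lam. 0 < h \<Longrightarrow> 0 < lam \<Longrightarrow>
       emeasure lborel (large_diff r h e f lam (cube 0 1)) \<le> ennreal (K * h powr (\<beta> * p) * lam powr (- p))"
  shows "\<exists>C\<ge>0. \<forall>j \<epsilon>. 1 \<le> j \<longrightarrow> 0 < \<epsilon> \<longrightarrow>
     real (card {k\<in>dyadic_idx j. \<not> good_cell r f \<epsilon> j k}) \<le> C * 2 powr (- (\<beta> * p - real CARD('d)) * real j) * \<epsilon> powr (- p)"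
proof -
  let ?d = "CARD('d)"
  obtain C0 where C0: "0 < C0" and bad: "\<And>(f :: real^'d \<Rightarrow> real) a \<rho> lam \<Lambda>. 0 < \<rho> \<Longrightarrow> continuous_on (cube a \<rho>) f \<Longrightarrow>
    (\<forall>i. 0 \<le> lam i) \<Longrightarrow> (\<forall>n. (\<Sum>i<n. lam i) \<le> \<Lambda>) \<Longrightarrow>
    (\<forall>\<tau>. (\<forall>e. 0 \<le> \<tau> $ e \<and> \<tau> $ e < \<rho> / real (r + 1)) \<longrightarrow> (\<exists>x\<in>cube a \<rho>. C0 * \<Lambda> < \<bar>f x - grid_interp r (a + \<tau>) (\<rho> / real (r + 1)) f x\<bar>)) \<Longrightarrow>
    ennreal ((\<rho> / real (r + 1)) ^ CARD('d)) \<le> (\<Sum>i. \<Sum>e\<in>UNIV. ennreal ((real (r + 3) * 2 ^ Suc i) ^ CARD('d)) *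
       emeasure lborel (large_diff r (\<rho> / real (r + 1) / 2 ^ Suc i) e f (lam i) (cube a \<rho>)))"
    using bad_cube_measure[OF r, where 'd='d] by blast
  define \<sigma> where "\<sigma> = \<beta> * p - real ?d"
  have \<sigma>: "0 < \<sigma>" using bp by (simp add: \<sigma>_def)
  \<comment> \<open>Since \<open>q powr (- p)\<close> is 2 powr (\<sigma>/2), lowering the threshold
    by the factor q per refinement uses up half of the gain; what remains is the ratio
    \<open>g\<close> of a convergent geometric series.\<close>
  define q where "q = 2 powr (- \<sigma> / (2 * p))"
  have q: "0 < q" "q < 1" using \<sigma> p by (auto simp: q_def powr_less_one divide_neg_pos)
  define g where "g = 2 powr (- \<sigma> / 2)"
  have g: "0 < g" "g < 1" using \<sigma> by (auto simp: g_def powr_less_one)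
  define E where "E = real ?d * (real (r + 3) * 4) ^ ?d * K * ((1 - q) / C0) powr (- p) / (1 - g)"
  have E0: "0 \<le> E" using K g by (simp add: E_def)
  define C where "C = E * (2 / real (r + 1)) powr \<sigma>"
  have C0': "0 \<le> C" using E0 by (simp add: C_def)
  show ?thesis
  proof (intro exI[of _ C] conjI C0' allI impI)
    fix j :: nat and \<epsilon> :: real assume j: "1 \<le> j" and \<epsilon>: "0 < \<epsilon>"
    define h where "h = 2 / 2 ^ j / real (r + 1)"
    have h: "0 < h" by (simp add: h_def)
    \<comment> \<open>Chosen so that the bound \<Lambda> on the sum of all thresholds satisfies C0 *
      \<Lambda> = \<epsilon>.\<close>
    define l0 where "l0 = \<epsilon> * (1 - q) / C0"
    have l0: "0 < l0" using \<epsilon> q C0 by (simp add: l0_def)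
    define lam where "lam i = l0 * q ^ i" for i
    have lam: "0 < lam i" for i using l0 q by (simp add: lam_def)
    define \<Lambda> where "\<Lambda> = l0 / (1 - q)"
    have lsum: "(\<Sum>i<n. lam i) \<le> \<Lambda>" for n
    proof -
      have "(\<Sum>i<n. q ^ i) = (1 - q ^ n) / (1 - q)" using q by (subst sum_gp_strict) auto
      also have "\<dots> \<le> 1 / (1 - q)" using q by (intro divide_right_mono) auto
      finally have "l0 * (\<Sum>i<n. q ^ i) \<le> l0 * (1 / (1 - q))" using l0 by (intro mult_left_mono) auto
      thus ?thesis by (simp add: lam_def \<Lambda>_def sum_distrib_left)
    qed
    have C0\<Lambda>: "C0 * \<Lambda> = \<epsilon>" using q C0 by (simp add: \<Lambda>_def l0_def)
    define B where "B = {k\<in>dyadic_idx j. \<not> good_cell r f \<epsilon> j k}"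
    have B: "B \<subseteq> dyadic_idx j" by (auto simp: B_def)
    have fB: "finite B" using B finite_dyadic_idx finite_subset by blast
    define A where "A i e = large_diff r (h / 2 ^ Suc i) e f (lam i) (cube 0 1)" for i e
    have Ab: "A i e \<in> sets borel" for i e unfolding A_def by (rule large_diff_borel[OF f])
    define w where "w i = ennreal ((real (r + 3) * 2 ^ Suc i) ^ ?d)" for i :: nat
    have each: "ennreal (h ^ ?d) \<le> (\<Sum>i. \<Sum>e\<in>UNIV. w i * emeasure lborel (A i e \<inter> big_cube j k))"
      if k: "k \<in> B" for k
    proof -
      have sub: "big_cube j k \<subseteq> cube 0 1" by (rule big_cube_subset[OF j])
      have nb: "\<not> (\<forall>x\<in>big_cube j k. \<bar>f x - grid_interp r (big_corner j k + \<tau>) h f x\<bar> \<le> \<epsilon>)"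
        if \<tau>: "\<forall>e. 0 \<le> \<tau> $ e \<and> \<tau> $ e < 2 / 2 ^ j / real (r + 1)" for \<tau>
      proof
        assume *: "\<forall>x\<in>big_cube j k. \<bar>f x - grid_interp r (big_corner j k + \<tau>) h f x\<bar> \<le> \<epsilon>"
        have rh: "real (r + 1) * h = 2 / 2 ^ j" unfolding h_def by (rule nonzero_mult_div_cancel_left[of "real (r + 1)" "2 / 2 ^ j", unfolded times_divide_eq_right[symmetric]]) simp
        have "big_corner j k + (\<chi> e. 2 / 2 ^ j) \<in> big_cube j k" "big_corner j k \<in> big_cube j k"
          by (auto simp: big_cube_def cube_def)
        hence "big_corner j k + (\<chi> e. 2 / 2 ^ j) \<in> cube 0 1" "big_corner j k \<in> cube 0 1"
          using sub by auto
        hence b: "0 \<le> big_corner j k $ e \<and> big_corner j k $ e + 2 / 2 ^ j \<le> 1" for e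
          by (auto simp: cube_def)
        have "real (r + 1) * h = real r * h + h" by (simp add: algebra_simps)
        hence "\<forall>e. 0 \<le> (big_corner j k + \<tau>) $ e \<and> (big_corner j k + \<tau>) $ e + real r * h \<le> 1"
          using b \<tau>[folded h_def] rh by (smt (verit) vector_add_component)
        with * have "good_cell r f \<epsilon> j k" unfolding good_cell_def h_def by blast
        with k show False by (simp add: B_def)
      qed
      have "ennreal ((2 / 2 ^ j / real (r + 1)) ^ CARD('d)) \<le> (\<Sum>i. \<Sum>e\<in>UNIV. ennreal ((real (r + 3) * 2 ^ Suc i) ^ CARD('d)) *
       emeasure lborel (large_diff r (2 / 2 ^ j / real (r + 1) / 2 ^ Suc i) e f (lam i) (cube (big_corner j k) (2 / 2 ^ j))))"
      proof (rule bad[where \<Lambda>=\<Lambda>])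
        show "continuous_on (cube (big_corner j k) (2 / 2 ^ j)) f"
          using continuous_on_subset[OF f sub] by (simp add: big_cube_def)
        show "\<forall>\<tau>. (\<forall>e. 0 \<le> \<tau> $ e \<and> \<tau> $ e < 2 / 2 ^ j / real (r + 1)) \<longrightarrow>
          (\<exists>x\<in>cube (big_corner j k) (2 / 2 ^ j). C0 * \<Lambda> < \<bar>f x - grid_interp r (big_corner j k + \<tau>) (2 / 2 ^ j / real (r + 1)) f x\<bar>)"
          unfolding C0\<Lambda> using nb unfolding big_cube_def h_def not_le[symmetric] by blast
      qed (use lam lsum less_imp_le in auto)
      also have "\<dots> \<le> (\<Sum>i. \<Sum>e\<in>UNIV. w i * emeasure lborel (A i e \<inter> big_cube j k))"
      proof (rule suminf_le)
        fix i
        show "(\<Sum>e\<in>UNIV. ennreal ((real (r + 3) * 2 ^ Suc i) ^ CARD('d)) *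
          emeasure lborel (large_diff r (2 / 2 ^ j / real (r + 1) / 2 ^ Suc i) e f (lam i) (cube (big_corner j k) (2 / 2 ^ j))))
          \<le> (\<Sum>e\<in>UNIV. w i * emeasure lborel (A i e \<inter> big_cube j k))"
          unfolding w_def
        proof (intro sum_mono mult_left_mono emeasure_mono)
          fix e
          show "large_diff r (2 / 2 ^ j / real (r + 1) / 2 ^ Suc i) e f (lam i) (cube (big_corner j k) (2 / 2 ^ j)) \<subseteq> A i e \<inter> big_cube j k"
            using large_diff_subset[OF sub] by (simp add: A_def h_def big_cube_def)
          show "A i e \<inter> big_cube j k \<in> sets lborel"
            using Ab[of i e] by (auto simp: big_cube_def cube_eq_cbox)
        qed auto
      qed auto
      finally show ?thesis by (simp add: h_def)
    qed
    have termb: "(\<Sum>e\<in>UNIV. w i * (ennreal (4 ^ ?d) * emeasure lborel (A i e))) \<le> ennreal (E * (1 - g) * h powr (\<beta> * p) * \<epsilon> powr (- p) * g ^ i)" for i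
    proof -
      have "(\<Sum>e\<in>UNIV. w i * (ennreal (4 ^ ?d) * emeasure lborel (A i e))) \<le>
         (\<Sum>e\<in>(UNIV::'d set). w i * (ennreal (4 ^ ?d) * ennreal (K * (h / 2 ^ Suc i) powr (\<beta> * p) * lam i powr (- p))))"
        unfolding A_def by (intro sum_mono mult_left_mono K(2) lam) (use h in auto)
      also have "\<dots> = ennreal (real ?d * ((real (r + 3) * 2 ^ Suc i) ^ ?d * (4 ^ ?d * (K * (h / 2 ^ Suc i) powr (\<beta> * p) * lam i powr (- p)))))"
        using K(1) by (simp add: w_def ennreal_mult[symmetric] ennreal_of_nat_eq_real_of_nat)
      also have "real ?d * ((real (r + 3) * 2 ^ Suc i) ^ ?d * (4 ^ ?d * (K * (h / 2 ^ Suc i) powr (\<beta> * p) * lam i powr (- p))))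
         = real ?d * (real (r + 3) * 4) ^ ?d * K * h powr (\<beta> * p) * l0 powr (- p) * ((2 ^ Suc i) ^ ?d * (2 ^ Suc i) powr (- (\<beta> * p)) * (q ^ i) powr (- p))"
      proof -
        have "(h / 2 ^ Suc i) powr (\<beta> * p) = h powr (\<beta> * p) * (2 ^ Suc i) powr (- (\<beta> * p))"
          using h by (subst powr_divide) (auto simp: powr_minus divide_inverse)
        moreover have "lam i powr (- p) = l0 powr (- p) * (q ^ i) powr (- p)"
          unfolding lam_def using l0 q by (subst powr_mult) auto
        ultimately show ?thesis by (simp only: power_mult_distrib mult_ac)
      qed
      also have "(2 ^ Suc i) ^ ?d * (2 ^ Suc i) powr (- (\<beta> * p)) * (q ^ i) powr (- p) = 2 powr (- \<sigma> * real (Suc i) + \<sigma> / 2 * real i)"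
      proof -
        have "((2::real) ^ Suc i) ^ ?d = 2 powr (real (Suc i) * real ?d)"
          by (subst powr_realpow[symmetric], simp, subst powr_realpow[symmetric], simp, simp only: powr_powr)
        moreover have "((2::real) ^ Suc i) powr (- (\<beta> * p)) = 2 powr (real (Suc i) * - (\<beta> * p))"
          by (subst powr_realpow[symmetric], simp, simp only: powr_powr)
        moreover have "(q ^ i) powr (- p) = 2 powr (\<sigma> / 2 * real i)"
        proof -
          have "q ^ i = q powr real i" using q by (simp add: powr_realpow)
          hence "(q ^ i) powr (- p) = 2 powr ((- \<sigma> / (2 * p)) * (real i * - p))" by (simp only: q_def powr_powr mult.assoc)
          also have "(- \<sigma> / (2 * p)) * (real i * - p) = \<sigma> / 2 * real i" using p by simp
          finally show ?thesis .
        qed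
        ultimately show ?thesis by (simp only: powr_add[symmetric]) (simp add: \<sigma>_def algebra_simps)
      qed
      also have "2 powr (- \<sigma> * real (Suc i) + \<sigma> / 2 * real i) \<le> g ^ i"
      proof -
        have "g ^ i = 2 powr (- \<sigma> / 2 * real i)" unfolding g_def by (subst powr_realpow[symmetric]) (simp_all only: powr_powr, simp)
        moreover have "- \<sigma> * real (Suc i) + \<sigma> / 2 * real i \<le> - \<sigma> / 2 * real i" using \<sigma> by (simp add: algebra_simps)
        ultimately show ?thesis by (simp only:) (rule powr_mono, auto)
      qed
      also have "l0 powr (- p) = \<epsilon> powr (- p) * ((1 - q) / C0) powr (- p)"
      proof -
        have "l0 = \<epsilon> * ((1 - q) / C0)" by (simp add: l0_def)
        thus ?thesis using \<epsilon> q C0 by (simp only:) (subst powr_mult, auto)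
      qed
      finally have "(\<Sum>e\<in>UNIV. w i * (ennreal (4 ^ ?d) * emeasure lborel (A i e))) \<le>
        ennreal (real ?d * (real (r + 3) * 4) ^ ?d * K * h powr (\<beta> * p) * (\<epsilon> powr (- p) * ((1 - q) / C0) powr (- p)) * g ^ i)"
        using K(1) by (simp add: ennreal_leI mult_left_mono)
      moreover have "E * (1 - g) = real ?d * (real (r + 3) * 4) ^ ?d * K * ((1 - q) / C0) powr (- p)" using g by (simp add: E_def)
      ultimately show ?thesis by (simp only: mult_ac)
    qed
    have "ennreal (real (card B) * h ^ ?d) = (\<Sum>k\<in>B. ennreal (h ^ ?d))"
      using h by (simp add: ennreal_mult ennreal_of_nat_eq_real_of_nat)
    also have "\<dots> \<le> (\<Sum>k\<in>B. \<Sum>i. \<Sum>e\<in>UNIV. w i * emeasure lborel (A i e \<inter> big_cube j k))"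
      by (intro sum_mono each)
    also have "\<dots> = (\<Sum>i. \<Sum>k\<in>B. \<Sum>e\<in>UNIV. w i * emeasure lborel (A i e \<inter> big_cube j k))"
      by (rule suminf_sum[symmetric]) auto
    also have "\<dots> = (\<Sum>i. \<Sum>e\<in>UNIV. w i * (\<Sum>k\<in>B. emeasure lborel (A i e \<inter> big_cube j k)))"
      by (subst sum.swap) (simp add: sum_distrib_left)
    also have "\<dots> \<le> (\<Sum>i. \<Sum>e\<in>UNIV. w i * (ennreal (4 ^ ?d) * emeasure lborel (A i e)))"
      by (intro suminf_le sum_mono mult_left_mono sum_emeasure_overlap Ab B) auto
    also have "\<dots> \<le> (\<Sum>i. ennreal (E * (1 - g) * h powr (\<beta> * p) * \<epsilon> powr (- p) * g ^ i))"
      by (intro suminf_le termb) auto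
    also have "\<dots> = ennreal (E * h powr (\<beta> * p) * \<epsilon> powr (- p))"
    proof -
      have "(\<lambda>i. E * (1 - g) * h powr (\<beta> * p) * \<epsilon> powr (- p) * g ^ i) sums (E * (1 - g) * h powr (\<beta> * p) * \<epsilon> powr (- p) * (1 / (1 - g)))"
        using g by (intro sums_mult geometric_sums) auto
      also have "E * (1 - g) * h powr (\<beta> * p) * \<epsilon> powr (- p) * (1 / (1 - g)) = E * h powr (\<beta> * p) * \<epsilon> powr (- p)"
        using g by simp
      finally have s: "(\<lambda>i. E * (1 - g) * h powr (\<beta> * p) * \<epsilon> powr (- p) * g ^ i) sums (E * h powr (\<beta> * p) * \<epsilon> powr (- p))" .
      have "0 \<le> E * (1 - g) * h powr (\<beta> * p) * \<epsilon> powr (- p) * g ^ i" for i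
        using E0 g by (intro mult_nonneg_nonneg) auto
      from suminf_ennreal2[OF this sums_summable[OF s]] show ?thesis
        unfolding sums_unique[OF s, symmetric] .
    qed
    finally have "real (card B) * h ^ ?d \<le> E * h powr (\<beta> * p) * \<epsilon> powr (- p)"
      using E0 by (subst (asm) ennreal_le_iff) auto
    hence "real (card B) \<le> E * h powr (\<beta> * p) * \<epsilon> powr (- p) / h ^ ?d"
      using h by (simp add: le_divide_eq)
    also have "\<dots> = E * h powr \<sigma> * \<epsilon> powr (- p)"
      using h by (simp add: \<sigma>_def powr_diff powr_realpow)
    also have "h powr \<sigma> = (2 / real (r + 1)) powr \<sigma> * 2 powr (- \<sigma> * real j)"
    proof -
      have "h = 2 / real (r + 1) * 2 powr (- real j)" by (simp add: h_def powr_minus powr_realpow divide_inverse)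
      thus ?thesis by (simp only:) (subst powr_mult, auto simp: powr_powr mult.commute)
    qed
    finally show "real (card {k\<in>dyadic_idx j. \<not> good_cell r f \<epsilon> j k}) \<le> C * 2 powr (- (\<beta> * p - real CARD('d)) * real j) * \<epsilon> powr (- p)"
      by (simp add: B_def C_def \<sigma>_def mult_ac)
  qed
qed

text \<open>The minimum with \<open>2 ^ j - 1\<close> puts the points with x $ e = 1 into the last
  cells. Every point of the cube then has one cell per level, and these cells are nested.\<close>

definition cell_idx :: "nat \<Rightarrow> real^'d::finite \<Rightarrow> 'd \<Rightarrow> nat" where
  "cell_idx j x = (\<lambda>e. min (nat \<lfloor>2 ^ j * x $ e\<rfloor>) (2 ^ j - 1))"

lemma cell_idx_props:
  assumes "x \<in> cube 0 1"
  shows "cell_idx j x \<in> dyadic_idx j" "x \<in> dyadic_cell j (cell_idx j x)"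
    "\<exists>b\<in>PiE UNIV (\<lambda>_. {0, 1}). cell_idx (Suc j) x = (\<lambda>e. 2 * cell_idx j x e + b e)"
proof -
  show "cell_idx j x \<in> dyadic_idx j"
    by (simp add: dyadic_idx_def cell_idx_def PiE_def Pi_def min.strict_coboundedI2)
  have x: "0 \<le> x $ e" "x $ e \<le> 1" for e using assms by (auto simp: cube_def)
  have fl: "real (nat \<lfloor>2 ^ j * x $ e\<rfloor>) \<le> 2 ^ j * x $ e" "2 ^ j * x $ e < real (nat \<lfloor>2 ^ j * x $ e\<rfloor>) + 1"
    "2 ^ j * x $ e \<le> 2 ^ j" for e j
    using x[of e] by (auto intro: mult_left_le simp: of_nat_nat)
  have "real (cell_idx j x e) \<le> 2 ^ j * x $ e \<and> 2 ^ j * x $ e \<le> real (cell_idx j x e) + 1" for e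
  proof (cases "nat \<lfloor>2 ^ j * x $ e\<rfloor> \<le> 2 ^ j - 1")
    case True
    thus ?thesis using fl[of j e] by (simp add: cell_idx_def)
  next
    case False
    hence "cell_idx j x e = 2 ^ j - 1" by (simp add: cell_idx_def)
    moreover have "real (2 ^ j - 1 :: nat) = 2 ^ j - 1" by (simp add: of_nat_diff)
    moreover have "2 ^ j \<le> nat \<lfloor>2 ^ j * x $ e\<rfloor>" using False by linarith
    hence "real (2 ^ j) \<le> real (nat \<lfloor>2 ^ j * x $ e\<rfloor>)" by (simp only: of_nat_le_iff)
    hence "2 ^ j \<le> real (nat \<lfloor>2 ^ j * x $ e\<rfloor>)" by simp
    ultimately show ?thesis using fl[of j e] by linarith
  qed
  thus "x \<in> dyadic_cell j (cell_idx j x)" by (auto simp: dyadic_cell_def)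
  have "\<exists>b. b \<in> {0, 1} \<and> cell_idx (Suc j) x e = 2 * cell_idx j x e + b" for e
  proof -
    define y where "y = 2 ^ j * x $ e"
    define m where "m = nat \<lfloor>y\<rfloor>"
    have y0: "0 \<le> y" using x by (simp add: y_def)
    have "2 ^ Suc j * x $ e = 2 * y" by (simp add: y_def)
    hence c: "cell_idx (Suc j) x e = min (nat \<lfloor>2 * y\<rfloor>) (2 * 2 ^ j - 1)" "cell_idx j x e = min m (2 ^ j - 1)"
      by (auto simp: cell_idx_def y_def m_def mult.assoc)
    have m2: "nat \<lfloor>2 * y\<rfloor> = 2 * m \<or> nat \<lfloor>2 * y\<rfloor> = 2 * m + 1" unfolding m_def using y0 by linarith
    have "(1::nat) \<le> 2 ^ j" by simp
    show ?thesis
    proof (cases "m \<le> 2 ^ j - 1")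
      case True
      have le: "2 * m + 1 \<le> 2 * 2 ^ j - 1" using True \<open>1 \<le> 2 ^ j\<close> by linarith
      have "cell_idx j x e = m" using c(2) True by simp
      moreover have "cell_idx (Suc j) x e = 2 * m \<or> cell_idx (Suc j) x e = 2 * m + 1"
        using c(1) m2 le by (auto simp only: min_def split: if_split)
      ultimately show ?thesis by auto
    next
      case False
      hence "cell_idx (Suc j) x e = 2 * 2 ^ j - 1" "cell_idx j x e = 2 ^ j - 1" using c m2 by auto
      moreover have "2 * 2 ^ j - 1 = 2 * (2 ^ j - 1) + (1::nat)" using \<open>1 \<le> 2 ^ j\<close> by linarith
      ultimately show ?thesis by (intro exI[of _ 1]) auto
    qed
  qed
  hence "\<forall>e. \<exists>b. b \<in> {0::nat, 1} \<and> cell_idx (Suc j) x e = 2 * cell_idx j x e + b" by blast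
  from choice[OF this] obtain b where b: "\<forall>e. b e \<in> {0::nat, 1} \<and> cell_idx (Suc j) x e = 2 * cell_idx j x e + b e" by blast
  hence "b \<in> PiE UNIV (\<lambda>_. {0, 1})" by (intro PiE_I) (blast, simp)
  thus "\<exists>b\<in>PiE UNIV (\<lambda>_. {0, 1}). cell_idx (Suc j) x = (\<lambda>e. 2 * cell_idx j x e + b e)"
    using b by (intro bexI[of _ b]) auto
qed

text \<open>A stopping rule: x is assigned its cell at the first level from J on at which that cell
  is good. A selected cell is then of level J or a child of a bad cell, so there are at most 2^(J d)
  of them plus 2^d times a geometric series of numbers of bad cells.\<close>

lemma good_cover:
  fixes f :: "real^'d::finite \<Rightarrow> real"
  assumes r: "0 < r" and p: "0 < p" and bp: "real CARD('d) < \<beta> * p" and f: "continuous_on (cube 0 1) f"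
    and K: "0 \<le> K" "\<And>h e lam. 0 < h \<Longrightarrow> 0 < lam \<Longrightarrow>
       emeasure lborel (large_diff r h e f lam (cube 0 1)) \<le> ennreal (K * h powr (\<beta> * p) * lam powr (- p))"
  shows "\<exists>C (c::nat). \<forall>J\<ge>1. \<exists>Q :: (nat \<times> ('d \<Rightarrow> nat)) set. finite Q \<and> real (card Q) \<le> C * 2 ^ (J * CARD('d)) \<and>
     (\<forall>(j, k)\<in>Q. J \<le> j \<and> j \<le> c * (J + 1) \<and> k \<in> dyadic_idx j \<and> good_cell r f (2 powr (- \<beta> * real J)) j k) \<and>
     (\<forall>x\<in>cube 0 1. \<exists>(j, k)\<in>Q. x \<in> dyadic_cell j k)"
proof -
  let ?d = "CARD('d)"
  define \<sigma> where "\<sigma> = \<beta> * p - real ?d"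
  have \<sigma>: "0 < \<sigma>" using bp by (simp add: \<sigma>_def)
  define B where "B \<epsilon> j = {k\<in>dyadic_idx j. \<not> good_cell r f \<epsilon> j k}" for \<epsilon> j
  obtain C where C: "0 \<le> C" "\<And>j \<epsilon>. 1 \<le> j \<Longrightarrow> 0 < \<epsilon> \<Longrightarrow> real (card (B \<epsilon> j)) \<le> C * 2 powr (- \<sigma> * real j) * \<epsilon> powr (- p)"
    using count_bad_cells[OF r p bp f K] unfolding B_def \<sigma>_def by blast
  define g where "g = 2 powr (- \<sigma>)"
  have g: "0 < g" "g < 1" using \<sigma> by (auto simp: g_def powr_less_one)
  \<comment> \<open>Brings the bound on the number of bad cells at level \<open>Jm\<close> down to
    C/(C + 1) < 1, so that there are none. The summand 2 absorbs the shift in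
    \<open>Jm = c * (J + 1) - 1\<close> and ensures J \<le> Jm.\<close>
  define c where "c = nat \<lceil>(\<beta> * p + log 2 (C + 1)) / \<sigma>\<rceil> + 2"
  have fB: "finite (B \<epsilon> j)" for \<epsilon> j unfolding B_def by (rule finite_subset[OF _ finite_dyadic_idx]) auto
  show ?thesis
  proof (intro exI[of _ "1 + 2 ^ ?d * C / (1 - g)"] exI[of _ c] allI impI)
    fix J :: nat assume J: "1 \<le> J"
    define \<epsilon> where "\<epsilon> = 2 powr (- \<beta> * real J)"
    have \<epsilon>: "0 < \<epsilon>" by (simp add: \<epsilon>_def)
    have \<epsilon>p: "\<epsilon> powr (- p) = 2 powr (\<beta> * p * real J)" by (simp add: \<epsilon>_def powr_powr mult_ac)
    have cB: "real (card (B \<epsilon> j)) \<le> C * 2 ^ (J * ?d) * g ^ (j - J)" if "J \<le> j" for j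
    proof -
      have "2 powr (- \<sigma> * real j) * \<epsilon> powr (- p) = 2 powr (real (J * ?d)) * 2 powr (- \<sigma> * real (j - J))"
        unfolding \<epsilon>p powr_add[symmetric] using that by (simp add: of_nat_diff \<sigma>_def algebra_simps)
      also have "2 powr (- \<sigma> * real (j - J)) = g ^ (j - J)"
        unfolding g_def by (subst powr_realpow[symmetric]) (simp_all only: powr_powr, simp)
      also have "2 powr (real (J * ?d)) = (2::real) ^ (J * ?d)" by (rule powr_realpow) simp
      finally show ?thesis using C(2)[of j \<epsilon>] that J \<epsilon> by (simp add: mult.assoc)
    qed
    define Jm where "Jm = c * (J + 1) - 1"
    have c2: "2 \<le> c" by (simp add: c_def)
    have "2 * (J + 1) \<le> c * (J + 1)" using c2 by (intro mult_right_mono) auto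
    hence Jm: "J \<le> Jm" "Suc Jm = c * (J + 1)" by (auto simp: Jm_def)
    have empty: "B \<epsilon> Jm = {}"
    proof -
      have "(\<beta> * p + log 2 (C + 1)) / \<sigma> \<le> real (c - 2)" unfolding c_def by (simp add: real_nat_ceiling_ge)
      hence c3: "\<beta> * p + log 2 (C + 1) \<le> real (c - 2) * \<sigma>" using \<sigma> by (simp add: pos_divide_le_eq)
      have bp0: "0 \<le> \<beta> * p" using bp by linarith
      have lC: "0 \<le> log 2 (C + 1)" using C(1) by simp
      have "\<beta> * p * real J + log 2 (C + 1) \<le> (\<beta> * p + log 2 (C + 1)) * real (J + 1)"
        using bp0 lC by (simp add: algebra_simps)
      also have "\<dots> \<le> real (c - 2) * \<sigma> * real (J + 1)" using c3 by (intro mult_right_mono) auto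
      also have "\<dots> = \<sigma> * real ((c - 2) * (J + 1))" unfolding of_nat_mult by (simp only: mult_ac)
      also have "\<dots> \<le> \<sigma> * real Jm"
      proof -
        have "(c - 2) * (J + 1) \<le> Jm" using c2 unfolding Jm_def by (simp add: diff_mult_distrib)
        thus ?thesis using \<sigma> by (intro mult_left_mono) (auto simp only: of_nat_le_iff)
      qed
      finally have le: "- \<sigma> * real Jm + \<beta> * p * real J \<le> - log 2 (C + 1)" by simp
      have "real (card (B \<epsilon> Jm)) \<le> C * (2 powr (- \<sigma> * real Jm) * \<epsilon> powr (- p))"
        using C(2)[of Jm \<epsilon>] J Jm \<epsilon> by (simp add: mult.assoc)
      also have "2 powr (- \<sigma> * real Jm) * \<epsilon> powr (- p) = 2 powr (- \<sigma> * real Jm + \<beta> * p * real J)"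
        by (simp only: \<epsilon>p powr_add)
      also have "C * \<dots> \<le> C * 2 powr (- log 2 (C + 1))"
        using le C(1) by (intro mult_left_mono powr_mono) auto
      also have "\<dots> = C / (C + 1)" using C(1) by (simp add: powr_minus divide_inverse)
      also have "\<dots> < 1" using C(1) by simp
      finally have "card (B \<epsilon> Jm) = 0" by simp
      thus ?thesis using fB by simp
    qed
    define ch where "ch j = {(Suc j, k) |k k' b. k' \<in> B \<epsilon> j \<and> b \<in> PiE UNIV (\<lambda>_. {0, 1}) \<and> k = (\<lambda>e. 2 * k' e + b e)}" for j
    have chim: "ch j = (\<lambda>(k', b). (Suc j, \<lambda>e. 2 * k' e + b e)) ` (B \<epsilon> j \<times> PiE UNIV (\<lambda>_. {0, 1}))" for j
      unfolding ch_def by auto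
    have fP: "finite (PiE (UNIV :: 'd set) (\<lambda>_. {0, 1 :: nat}))" by (rule finite_PiE) auto
    have fch: "finite (ch j)" for j unfolding chim using fB fP by blast
    have cch: "card (ch j) \<le> card (B \<epsilon> j) * 2 ^ ?d" for j
    proof -
      have "card (ch j) \<le> card (B \<epsilon> j \<times> PiE (UNIV :: 'd set) (\<lambda>_. {0, 1 :: nat}))"
        unfolding chim by (rule card_image_le) (use fB fP in blast)
      thus ?thesis by (simp add: card_cartesian_product card_PiE numeral_2_eq_2)
    qed
    define Q0 where "Q0 = Pair J ` dyadic_idx J \<union> (\<Union>j\<in>{J..<Jm}. ch j)"
    define Q where "Q = {(j, k) \<in> Q0. k \<in> dyadic_idx j \<and> good_cell r f \<epsilon> j k}"
    have fQ0: "finite Q0" unfolding Q0_def using finite_dyadic_idx fch by blast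
    have fQ: "finite Q" unfolding Q_def by (rule finite_subset[OF _ fQ0]) auto
    have "card Q \<le> card Q0" unfolding Q_def by (rule card_mono[OF fQ0]) auto
    also have "\<dots> \<le> card (Pair J ` dyadic_idx J :: (nat \<times> ('d \<Rightarrow> nat)) set) + card (\<Union>j\<in>{J..<Jm}. ch j)"
      unfolding Q0_def by (rule card_Un_le)
    also have "\<dots> \<le> (2 ^ J) ^ ?d + (\<Sum>j\<in>{J..<Jm}. card (ch j))"
    proof (intro add_mono card_UN_le)
      show "card (Pair J ` dyadic_idx J :: (nat \<times> ('d \<Rightarrow> nat)) set) \<le> (2 ^ J) ^ ?d"
        using card_image_le[OF finite_dyadic_idx] card_dyadic_idx[of J, where 'd='d] by metis
    qed auto
    finally have "card Q \<le> (2 ^ J) ^ ?d + (\<Sum>j\<in>{J..<Jm}. card (ch j))" .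
    hence "real (card Q) \<le> real ((2 ^ J) ^ ?d + (\<Sum>j\<in>{J..<Jm}. card (ch j)))" by (simp only: of_nat_le_iff)
    also have "\<dots> = 2 ^ (J * ?d) + (\<Sum>j\<in>{J..<Jm}. real (card (ch j)))" by (simp add: power_mult)
    also have "(\<Sum>j\<in>{J..<Jm}. real (card (ch j))) \<le> (\<Sum>j\<in>{J..<Jm}. 2 ^ ?d * (C * 2 ^ (J * ?d) * g ^ (j - J)))"
    proof (rule sum_mono)
      fix j assume j: "j \<in> {J..<Jm}"
      have "real (card (ch j)) \<le> real (card (B \<epsilon> j) * 2 ^ ?d)" using cch by (simp only: of_nat_le_iff)
      also have "\<dots> = 2 ^ ?d * real (card (B \<epsilon> j))" by simp
      also have "\<dots> \<le> 2 ^ ?d * (C * 2 ^ (J * ?d) * g ^ (j - J))" using j by (intro mult_left_mono cB) auto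
      finally show "real (card (ch j)) \<le> 2 ^ ?d * (C * 2 ^ (J * ?d) * g ^ (j - J))" .
    qed
    also have "\<dots> = 2 ^ ?d * (C * 2 ^ (J * ?d)) * (\<Sum>j\<in>{J..<Jm}. g ^ (j - J))"
      by (simp add: sum_distrib_left mult.assoc)
    also have "(\<Sum>j\<in>{J..<Jm}. g ^ (j - J)) = (\<Sum>i<Jm - J. g ^ i)"
      using sum.shift_bounds_nat_ivl[of "\<lambda>j. g ^ (j - J)" 0 J "Jm - J"] Jm(1) by (simp add: atLeast0LessThan)
    finally have card0: "real (card Q) \<le> 2 ^ (J * ?d) + 2 ^ ?d * (C * 2 ^ (J * ?d)) * (\<Sum>i<Jm - J. g ^ i)" by simp
    have "(\<Sum>i<Jm - J. g ^ i) \<le> 1 / (1 - g)"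
    proof -
      have "(\<Sum>i<Jm - J. g ^ i) = (1 - g ^ (Jm - J)) / (1 - g)" using g by (subst sum_gp_strict) auto
      also have "\<dots> \<le> 1 / (1 - g)" using g by (intro divide_right_mono) auto
      finally show ?thesis .
    qed
    hence "2 ^ ?d * (C * 2 ^ (J * ?d)) * (\<Sum>i<Jm - J. g ^ i) \<le> 2 ^ ?d * (C * 2 ^ (J * ?d)) * (1 / (1 - g))"
      using C(1) by (intro mult_left_mono) auto
    hence "real (card Q) \<le> 2 ^ (J * ?d) + 2 ^ ?d * (C * 2 ^ (J * ?d)) * (1 / (1 - g))"
      using card0 by linarith
    hence card: "real (card Q) \<le> (1 + 2 ^ ?d * C / (1 - g)) * 2 ^ (J * ?d)"
      by (simp add: algebra_simps)
    have cov: "\<exists>(j, k)\<in>Q. x \<in> dyadic_cell j k" if x: "x \<in> cube 0 1" for x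
    proof -
      note ci = cell_idx_props[OF x]
      have "good_cell r f \<epsilon> Jm (cell_idx Jm x)" using empty ci(1)[of Jm] by (auto simp: B_def)
      hence ex: "\<exists>j. J \<le> j \<and> good_cell r f \<epsilon> j (cell_idx j x)" using Jm(1) by blast
      define j where "j = (LEAST j. J \<le> j \<and> good_cell r f \<epsilon> j (cell_idx j x))"
      have j: "J \<le> j" "good_cell r f \<epsilon> j (cell_idx j x)" using LeastI_ex[OF ex] by (auto simp: j_def)
      have jle: "j \<le> Jm" unfolding j_def by (rule Least_le) (use Jm(1) \<open>good_cell r f \<epsilon> Jm _\<close> in auto)
      have "(j, cell_idx j x) \<in> Q0"
      proof (cases "j = J")
        case True thus ?thesis using ci(1) by (auto simp: Q0_def)
      next
        case False
        then obtain i where i: "j = Suc i" "J \<le> i" using j(1) by (cases j) auto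
        have "\<not> good_cell r f \<epsilon> i (cell_idx i x)"
          using not_less_Least[of i "\<lambda>j. J \<le> j \<and> good_cell r f \<epsilon> j (cell_idx j x)"] i by (auto simp: j_def[symmetric])
        hence "cell_idx i x \<in> B \<epsilon> i" using ci(1) by (simp add: B_def)
        hence "(j, cell_idx j x) \<in> ch i" unfolding ch_def i(1) using ci(3)[of i] by blast
        thus ?thesis using i jle by (auto simp: Q0_def)
      qed
      hence "(j, cell_idx j x) \<in> Q" using j ci(1) by (simp add: Q_def)
      thus ?thesis using ci(2)[of j] by blast
    qed
    have lev: "\<forall>(j, k)\<in>Q. J \<le> j \<and> j \<le> c * (J + 1) \<and> k \<in> dyadic_idx j \<and> good_cell r f \<epsilon> j k"
    proof -
      have "J \<le> j \<and> j \<le> Suc Jm" if "(j, k) \<in> Q0" for j k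
        using that Jm(1) by (auto simp: Q0_def ch_def)
      thus ?thesis unfolding Jm(2)[symmetric] by (auto simp: Q_def)
    qed
    show "\<exists>Q :: (nat \<times> ('d \<Rightarrow> nat)) set. finite Q \<and> real (card Q) \<le> (1 + 2 ^ CARD('d) * C / (1 - g)) * 2 ^ (J * CARD('d)) \<and>
     (\<forall>(j, k)\<in>Q. J \<le> j \<and> j \<le> c * (J + 1) \<and> k \<in> dyadic_idx j \<and> good_cell r f (2 powr (- \<beta> * real J)) j k) \<and>
     (\<forall>x\<in>cube 0 1. \<exists>(j, k)\<in>Q. x \<in> dyadic_cell j k)"
      using fQ card lev cov unfolding \<epsilon>_def by blast
  qed
qed

section \<open>Layered computations\<close>

text \<open>\<open>k\<close> is a budget for the incoming weights together with the bias. Equality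
  is asked on the cube only, as in \<open>sparse_nets\<close>. Every unit ends in a ReLU, so a
  single unit can hand on a function unchanged only if it is non-negative.\<close>

definition neuron :: "real \<Rightarrow> (real^'d::finite \<Rightarrow> real) set \<Rightarrow> nat \<Rightarrow> (real^'d \<Rightarrow> real) \<Rightarrow> bool" where
  "neuron M F k g \<longleftrightarrow> (\<exists>T c b. T \<subseteq> F \<and> finite T \<and> card T + 1 \<le> k \<and> (\<forall>u\<in>T. \<bar>c u\<bar> \<le> M) \<and> \<bar>b\<bar> \<le> M \<and>
     (\<forall>x\<in>unit_cube. g x = max 0 ((\<Sum>u\<in>T. c u * u x) + b)))"

definition layer :: "real \<Rightarrow> nat \<Rightarrow> (real^'d::finite \<Rightarrow> real) set \<Rightarrow> (real^'d \<Rightarrow> real) set \<Rightarrow> bool" where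
  "layer M s F G \<longleftrightarrow> finite G \<and> (\<exists>k. (\<forall>g\<in>G. neuron M F (k g) g) \<and> (\<Sum>g\<in>G. k g) \<le> s)"

text \<open>Computation by \<open>l\<close> layers, from the functions in \<open>F\<close> to those in \<open>G\<close>. Sets of functions replace
  numbered units; \<open>M\<close> bounds the weights, and \<open>s\<close> the number of weights and biases.\<close>
primrec circ :: "real \<Rightarrow> nat \<Rightarrow> nat \<Rightarrow> (real^'d::finite \<Rightarrow> real) set \<Rightarrow> (real^'d \<Rightarrow> real) set \<Rightarrow> bool" where
  "circ M 0 s F G \<longleftrightarrow> G \<subseteq> F"
| "circ M (Suc l) s F G \<longleftrightarrow> (\<exists>H s1 s2. circ M l s1 F H \<and> layer M s2 H G \<and> s1 + s2 \<le> s)"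

lemma neuron_mono: "neuron M F k g \<Longrightarrow> M \<le> M' \<Longrightarrow> F \<subseteq> F' \<Longrightarrow> k \<le> k' \<Longrightarrow> neuron M' F' k' g"
  unfolding neuron_def by (meson order_trans)

lemma layer_mono: "layer M s F G \<Longrightarrow> M \<le> M' \<Longrightarrow> F \<subseteq> F' \<Longrightarrow> s \<le> s' \<Longrightarrow> layer M' s' F' G"
  unfolding layer_def by (meson order_refl order_trans neuron_mono)

lemma layer_Un:
  assumes "layer M s F G" "layer M s' F G'"
  shows "layer M (s + s') F (G \<union> G')"
proof -
  obtain k where k: "finite G" "\<forall>g\<in>G. neuron M F (k g) g" "(\<Sum>g\<in>G. k g) \<le> s" using assms(1) by (auto simp: layer_def)
  obtain k' where k': "finite G'" "\<forall>g\<in>G'. neuron M F (k' g) g" "(\<Sum>g\<in>G'. k' g) \<le> s'" using assms(2) by (auto simp: layer_def)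
  define kk where "kk g = (if g \<in> G then k g else k' g)" for g
  have "(\<Sum>g\<in>G \<union> G'. kk g) = (\<Sum>g\<in>G. kk g) + (\<Sum>g\<in>G' - G. kk g)"
    using k(1) k'(1) by (subst sum.union_disjoint[symmetric]) (auto intro: sum.cong)
  also have "(\<Sum>g\<in>G' - G. kk g) = (\<Sum>g\<in>G' - G. k' g)" by (intro sum.cong) (auto simp: kk_def)
  also have "\<dots> \<le> (\<Sum>g\<in>G'. k' g)" using k'(1) by (intro sum_mono2) auto
  also have "(\<Sum>g\<in>G. kk g) = (\<Sum>g\<in>G. k g)" by (intro sum.cong) (auto simp: kk_def)
  finally have "(\<Sum>g\<in>G \<union> G'. kk g) \<le> s + s'" using k(3) k'(3) by linarith
  moreover have "\<forall>g\<in>G \<union> G'. neuron M F (kk g) g" using k(2) k'(2) by (auto simp: kk_def)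
  ultimately show ?thesis using k(1) k'(1) unfolding layer_def by blast
qed

lemma layer_subset:
  assumes "layer M s F G" "G' \<subseteq> G"
  shows "layer M s F G'"
proof -
  obtain k where k: "finite G" "\<forall>g\<in>G. neuron M F (k g) g" "(\<Sum>g\<in>G. k g) \<le> s" using assms(1) by (auto simp: layer_def)
  have "(\<Sum>g\<in>G'. k g) \<le> (\<Sum>g\<in>G. k g)" using k(1) assms(2) by (intro sum_mono2) auto
  thus ?thesis using k assms(2) finite_subset unfolding layer_def by (metis order_trans subsetD)
qed

lemma layer_image:
  assumes "finite I" "\<And>i. i \<in> I \<Longrightarrow> neuron M F (k i) (g i)"
  shows "layer M (\<Sum>i\<in>I. k i) F (g ` I)"
  using assms
proof (induction I rule: finite_induct)
  case empty thus ?case by (simp add: layer_def)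
next
  case (insert i I)
  have "layer M (k i) F {g i}" using insert by (auto simp: layer_def intro!: exI[of _ "\<lambda>_. k i"])
  from layer_Un[OF this insert(3)] insert show ?case by simp
qed

lemma layer_image_const:
  assumes "finite I" "\<And>i. i \<in> I \<Longrightarrow> neuron M F k (g i)"
  shows "layer M (card I * k) F (g ` I)"
  using layer_image[of I M F "\<lambda>_. k" g] assms by simp

lemma layer_single: "neuron M F k g \<Longrightarrow> layer M k F {g}"
  by (auto simp: layer_def intro!: exI[of _ "\<lambda>_. k"])

lemma circ_mono: "circ M l s F G \<Longrightarrow> M \<le> M' \<Longrightarrow> s \<le> s' \<Longrightarrow> circ M' l s' F G"
proof (induction l arbitrary: s s' G)
  case (Suc l)
  then obtain H s1 s2 where "circ M l s1 F H" "layer M s2 H G" "s1 + s2 \<le> s" by auto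
  hence "circ M' l s1 F H" "layer M' s2 H G" "s1 + s2 \<le> s'"
    using Suc.IH[of s1 H s1] layer_mono[of M s2 H G M' H s2] Suc.prems by simp_all
  thus ?case by auto
qed auto

lemma circ_subset: "circ M l s F G \<Longrightarrow> G' \<subseteq> G \<Longrightarrow> circ M l s F G'"
  by (cases l) (auto intro: layer_subset)

lemma circ_comp: "circ M l s F G \<Longrightarrow> circ M l' s' G H \<Longrightarrow> circ M (l + l') (s + s') F H"
proof (induction l' arbitrary: s' H)
  case 0
  have "circ M l s F H" by (rule circ_subset[OF 0(1)]) (use 0(2) in simp)
  thus ?case using circ_mono[of M l s F H M "s + s'"] by simp
next
  case (Suc l')
  then obtain H' s1 s2 where H: "circ M l' s1 G H'" "layer M s2 H' H" "s1 + s2 \<le> s'" by auto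
  have "circ M (l + l') (s + s1) F H'" using Suc.IH[OF Suc.prems(1) H(1)] .
  moreover have "s + s1 + s2 \<le> s + s'" using H(3) by simp
  ultimately show ?case using H(2) unfolding add_Suc_right circ.simps by blast
qed

lemma circ_layer: "layer M s F G \<Longrightarrow> circ M 1 s F G"
  unfolding One_nat_def circ.simps by (intro exI[of _ F] exI[of _ "0::nat"] exI[of _ s]) simp

lemma circ_then_layer: "circ M l s F G \<Longrightarrow> layer M s' G H \<Longrightarrow> circ M (Suc l) (s + s') F H"
  by auto

text \<open>An indexed family may name the same function twice, while a neuron has one weight per
  function. Weights of equal functions are added, which is why the sum of the |c i| is bounded
  rather than each of them.\<close>

lemma neuron_sum:
  fixes g :: "real^'d::finite \<Rightarrow> real"
  assumes "finite I" "\<And>i. i \<in> I \<Longrightarrow> u i \<in> F" "(\<Sum>i\<in>I. \<bar>c i\<bar>) \<le> M" "\<bar>b\<bar> \<le> M"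
    and g: "\<And>x. x \<in> unit_cube \<Longrightarrow> g x = max 0 ((\<Sum>i\<in>I. c i * u i x) + b)"
  shows "neuron M F (card I + 1) g"
  unfolding neuron_def
proof (intro exI[of _ "u ` I"] exI[of _ "\<lambda>v. \<Sum>i\<in>{i\<in>I. u i = v}. c i"] exI[of _ b] conjI ballI)
  show "u ` I \<subseteq> F" "finite (u ` I)" "card (u ` I) + 1 \<le> card I + 1" "\<bar>b\<bar> \<le> M" using assms card_image_le by auto
  fix v assume "v \<in> u ` I"
  have "\<bar>\<Sum>i\<in>{i\<in>I. u i = v}. c i\<bar> \<le> (\<Sum>i\<in>{i\<in>I. u i = v}. \<bar>c i\<bar>)" by (rule sum_abs)
  also have "\<dots> \<le> (\<Sum>i\<in>I. \<bar>c i\<bar>)" using assms(1) by (intro sum_mono2) auto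
  finally show "\<bar>\<Sum>i\<in>{i\<in>I. u i = v}. c i\<bar> \<le> M" using assms(3) by simp
next
  fix x :: "real^'d" assume x: "x \<in> unit_cube"
  have "(\<Sum>i\<in>I. c i * u i x) = (\<Sum>v\<in>u ` I. \<Sum>i\<in>{i\<in>I. u i = v}. c i * u i x)"
    by (rule sum.image_gen[OF assms(1)])
  also have "\<dots> = (\<Sum>v\<in>u ` I. (\<Sum>i\<in>{i\<in>I. u i = v}. c i) * v x)"
    by (intro sum.cong refl) (auto simp: sum_distrib_right intro!: sum.cong)
  finally show "g x = max 0 ((\<Sum>v\<in>u ` I. (\<Sum>i\<in>{i\<in>I. u i = v}. c i) * v x) + b)"
    using g[OF x] by simp
qed

lemma neuron_pass:
  assumes "u \<in> F" "1 \<le> M" "\<And>x. x \<in> unit_cube \<Longrightarrow> 0 \<le> u x"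
  shows "neuron M F 2 u"
  using neuron_sum[of "{()}" "\<lambda>_. u" F "\<lambda>_. 1" M 0 u] assms by (simp add: max_def numeral_2_eq_2)

definition nonneg_units :: "(real^'d::finite \<Rightarrow> real) set \<Rightarrow> bool" where
  "nonneg_units F \<longleftrightarrow> (\<forall>u\<in>F. \<forall>x\<in>unit_cube. 0 \<le> u x)"

definition unit_units :: "(real^'d::finite \<Rightarrow> real) set \<Rightarrow> bool" where
  "unit_units F \<longleftrightarrow> (\<forall>u\<in>F. \<forall>x\<in>unit_cube. 0 \<le> u x \<and> u x \<le> 1)"

lemma unit_units_nonneg: "unit_units F \<Longrightarrow> nonneg_units F"
  by (auto simp: unit_units_def nonneg_units_def)

lemma layer_pass:
  assumes "finite F" "nonneg_units F" "1 \<le> M" "F \<subseteq> F'"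
  shows "layer M (2 * card F) F' F"
proof -
  have "layer M (card F * 2) F' ((\<lambda>u. u) ` F)"
    by (rule layer_image_const) (use assms in \<open>auto intro!: neuron_pass simp: nonneg_units_def\<close>)
  thus ?thesis by (simp add: mult.commute)
qed

section \<open>Approximate multiplication\<close>

text \<open>The jumps of slope at the points k/n of the zigzag that runs between 0 and 1 with slopes
  n and -n in turn.\<close>

definition zigzag_coef :: "nat \<Rightarrow> nat \<Rightarrow> real" where
  "zigzag_coef n k = (if k = 0 then real n else 2 * real n * (-1) ^ k)"

text \<open>The jumps of slope of the piecewise linear interpolant of z (1 - z) at the points k/n,
  whose slope on the piece starting at j/n is 1 - (2 j + 1)/n.\<close>

definition parabola_coef :: "nat \<Rightarrow> nat \<Rightarrow> real" where
  "parabola_coef n k = (if k = 0 then 1 - 1 / real n else - 2 / real n)"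

definition zigzag :: "nat \<Rightarrow> real \<Rightarrow> real" where
  "zigzag n z = (\<Sum>k<n. zigzag_coef n k * max 0 (z - real k / real n))"

definition parabola :: "nat \<Rightarrow> real \<Rightarrow> real" where
  "parabola n z = (\<Sum>k<n. parabola_coef n k * max 0 (z - real k / real n))"

lemma relu_sum_segment:
  fixes c :: "nat \<Rightarrow> real"
  assumes n: "0 < n" and z: "0 \<le> z" "z \<le> 1"
  obtains j where "j < n" "real j / real n \<le> z" "z \<le> (real j + 1) / real n"
    "\<And>c :: nat \<Rightarrow> real. (\<Sum>k<n. c k * max 0 (z - real k / real n)) = (\<Sum>k\<le>j. c k * (z - real k / real n))"
proof -
  define j where "j = min (nat \<lfloor>real n * z\<rfloor>) (n - 1)"
  have nz: "real n * z \<le> real n" "0 \<le> real n * z" using z n by (auto intro: mult_left_le)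
  have j: "j < n" "real j \<le> real n * z" "real n * z \<le> real j + 1"
  proof -
    show "j < n" using n by (auto simp: j_def)
    show "real j \<le> real n * z" using nz unfolding j_def by linarith
    show "real n * z \<le> real j + 1"
    proof (cases "nat \<lfloor>real n * z\<rfloor> \<le> n - 1")
      case True thus ?thesis using nz unfolding j_def by linarith
    next
      case False
      hence "j = n - 1" by (simp add: j_def)
      thus ?thesis using nz n by (simp add: of_nat_diff)
    qed
  qed
  have jz: "real j / real n \<le> z" "z \<le> (real j + 1) / real n"
    using j n by (auto simp: divide_le_eq le_divide_eq mult.commute)
  have "(\<Sum>k<n. c k * max 0 (z - real k / real n)) = (\<Sum>k\<le>j. c k * (z - real k / real n))" for c :: "nat \<Rightarrow> real"
  proof -
    have "(\<Sum>k<n. c k * max 0 (z - real k / real n)) = (\<Sum>k\<le>j. c k * max 0 (z - real k / real n))"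
    proof (rule sum.mono_neutral_right)
      show "\<forall>k\<in>{..<n} - {..j}. c k * max 0 (z - real k / real n) = 0"
      proof
        fix k assume "k \<in> {..<n} - {..j}"
        hence "real j + 1 \<le> real k" by auto
        hence "(real j + 1) / real n \<le> real k / real n" by (rule divide_right_mono) simp
        thus "c k * max 0 (z - real k / real n) = 0" using jz by simp
      qed
    qed (use j in auto)
    also have "\<dots> = (\<Sum>k\<le>j. c k * (z - real k / real n))"
    proof (rule sum.cong)
      fix k assume "k \<in> {..j}"
      hence "real k / real n \<le> real j / real n" by (intro divide_right_mono) auto
      thus "c k * max 0 (z - real k / real n) = c k * (z - real k / real n)" using jz by simp
    qed simp
    finally show ?thesis .
  qed
  thus ?thesis using that j(1) jz by blast
qed

lemma zigzag_sum: "0 < n \<Longrightarrow> (\<Sum>k\<le>j. zigzag_coef n k * (z - real k / real n)) = (if even j then real n * z - real j else real j + 1 - real n * z)"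
  by (induction j) (auto simp: zigzag_coef_def field_simps)

lemma parabola_sum: "0 < n \<Longrightarrow> (\<Sum>k\<le>j. parabola_coef n k * (z - real k / real n)) =
    z * (1 - (2 * real j + 1) / real n) + real j * (real j + 1) / (real n)\<^sup>2"
proof (induction j)
  case (Suc j)
  have "(\<Sum>k\<le>Suc j. parabola_coef n k * (z - real k / real n)) =
    z * (1 - (2 * real j + 1) / real n) + real j * (real j + 1) / (real n)\<^sup>2 + (- 2 / real n) * (z - (real j + 1) / real n)"
    using Suc by (simp add: parabola_coef_def add.commute)
  also have "\<dots> = z * (1 - (2 * real (Suc j) + 1) / real n) + real (Suc j) * (real (Suc j) + 1) / (real n)\<^sup>2"
    using Suc.prems by (simp add: field_simps power2_eq_square)
  finally show ?case .
qed (simp add: parabola_coef_def field_simps)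

text \<open>One step of the self-similarity of the parabola: on each of the \<open>n\<close> pieces \<open>z (1 - z)\<close> minus its
  chord is a scaled copy of the whole parabola.\<close>
lemma parabola_step:
  assumes n: "0 < n" and z: "0 \<le> z" "z \<le> 1"
  shows "0 \<le> zigzag n z" "zigzag n z \<le> 1" "0 \<le> parabola n z"
    "z * (1 - z) = parabola n z + zigzag n z * (1 - zigzag n z) / (real n)\<^sup>2"
proof -
  obtain j where j: "j < n" "real j / real n \<le> z" "z \<le> (real j + 1) / real n"
    and s: "\<And>c :: nat \<Rightarrow> real. (\<Sum>k<n. c k * max 0 (z - real k / real n)) = (\<Sum>k\<le>j. c k * (z - real k / real n))"
    using relu_sum_segment[OF n z] by blast
  have Z: "zigzag n z = (if even j then real n * z - real j else real j + 1 - real n * z)"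
    unfolding zigzag_def s zigzag_sum[OF n] ..
  have P: "parabola n z = z * (1 - (2 * real j + 1) / real n) + real j * (real j + 1) / (real n)\<^sup>2"
    unfolding parabola_def s parabola_sum[OF n] ..
  have nz: "real j \<le> real n * z" "real n * z \<le> real j + 1"
    using j n by (auto simp: divide_le_eq le_divide_eq mult.commute)
  show "0 \<le> zigzag n z" "zigzag n z \<le> 1" using nz by (auto simp: Z)
  have ZZ: "zigzag n z * (1 - zigzag n z) = (real n * z - real j) * (real j + 1 - real n * z)"
    by (auto simp: Z algebra_simps)
  have n2: "(real n)\<^sup>2 * z * (1 - z) = (real n)\<^sup>2 * parabola n z + zigzag n z * (1 - zigzag n z)"
    unfolding ZZ P using n by (simp add: field_simps power2_eq_square)
  thus "z * (1 - z) = parabola n z + zigzag n z * (1 - zigzag n z) / (real n)\<^sup>2"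
    using n by (simp add: field_simps)
  have "(real n)\<^sup>2 * parabola n z = (real n * z) * (real n - (2 * real j + 1)) + real j * (real j + 1)"
    unfolding P using n by (simp add: field_simps power2_eq_square)
  also have "0 \<le> \<dots>"
  proof -
    have jn: "real j + 1 \<le> real n" using j(1) by linarith
    define y where "y = real n * z - real j"
    have y: "0 \<le> y" "y \<le> 1" using nz by (auto simp: y_def)
    \<comment> \<open>The interpolant is affine on the piece, hence a convex combination, with
      parameter y, of its non-negative values at the two end points.\<close>
    have "(real n * z) * (real n - (2 * real j + 1)) + real j * (real j + 1) = real j * (real n - real j) * (1 - y) + y * ((real j + 1) * (real n - (real j + 1)))"
      by (simp add: y_def algebra_simps)
    also have "0 \<le> \<dots>" using y jn by (intro add_nonneg_nonneg mult_nonneg_nonneg) auto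
    finally show ?thesis .
  qed
  finally show "0 \<le> parabola n z" using n by (simp add: zero_le_mult_iff)
qed

lemma sum_abs_zigzag_coef: "(\<Sum>k<n. \<bar>zigzag_coef n k\<bar>) \<le> 2 * (real n)\<^sup>2"
proof -
  have "(\<Sum>k<n. \<bar>zigzag_coef n k\<bar>) \<le> (\<Sum>k<n. 2 * real n)"
    by (intro sum_mono) (auto simp: zigzag_coef_def abs_mult power_abs)
  thus ?thesis by (simp add: power2_eq_square mult_ac)
qed

lemma sum_abs_parabola_coef: assumes "0 < n" shows "(\<Sum>k<n. \<bar>parabola_coef n k\<bar>) \<le> 2 * real n"
proof -
  have "(\<Sum>k<n. \<bar>parabola_coef n k\<bar>) \<le> (\<Sum>k<n. 2)"
    using assms by (intro sum_mono) (auto simp: parabola_coef_def abs_if field_simps)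
  thus ?thesis by simp
qed

text \<open>Each step adds the scaled chords of the next self-similar copy, leaving a remainder of
  at most n^(-2 s)/4 after s steps. With n = 2^J a fixed number of steps thus reaches any fixed
  power of 2^(-J), at the price of about n units per step.\<close>

primrec parabola_acc :: "nat \<Rightarrow> nat \<Rightarrow> real \<Rightarrow> real" where
  "parabola_acc n 0 z = 0"
| "parabola_acc n (Suc s) z = parabola_acc n s z + parabola n ((zigzag n ^^ s) z) / (real n) ^ (2 * s)"

lemma parabola_acc_props:
  assumes n: "0 < n" and z: "0 \<le> z" "z \<le> 1"
  shows "0 \<le> (zigzag n ^^ s) z \<and> (zigzag n ^^ s) z \<le> 1 \<and> 0 \<le> parabola_acc n s z \<and>
     z * (1 - z) = parabola_acc n s z + (zigzag n ^^ s) z * (1 - (zigzag n ^^ s) z) / (real n) ^ (2 * s)"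
proof (induction s)
  case 0 thus ?case using z by simp
next
  case (Suc s)
  define y where "y = (zigzag n ^^ s) z"
  have y: "0 \<le> y" "y \<le> 1" using Suc by (auto simp: y_def)
  note st = parabola_step[OF n y]
  have "z * (1 - z) = parabola_acc n s z + (parabola n y + zigzag n y * (1 - zigzag n y) / (real n)\<^sup>2) / (real n) ^ (2 * s)"
    using Suc st(4) by (simp add: y_def[symmetric])
  thus ?case using Suc st n by (simp add: y_def[symmetric] add_divide_distrib power_add power2_eq_square mult_ac)
qed

lemma parabola_acc_error:
  assumes n: "0 < n" and z: "0 \<le> z" "z \<le> 1"
  shows "0 \<le> parabola_acc n s z" "parabola_acc n s z \<le> z * (1 - z)" "z * (1 - z) - parabola_acc n s z \<le> 1 / 4 / (real n) ^ (2 * s)"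
proof -
  define y where "y = (zigzag n ^^ s) z"
  note p = parabola_acc_props[OF n z, of s, folded y_def]
  have "(y - 1/2)\<^sup>2 \<ge> 0" by simp
  hence y4: "y * (1 - y) \<le> 1 / 4" by (simp add: power2_eq_square algebra_simps)
  have "0 \<le> y * (1 - y) / (real n) ^ (2 * s)" "y * (1 - y) / (real n) ^ (2 * s) \<le> 1 / 4 / (real n) ^ (2 * s)"
    using p divide_right_mono[OF y4, of "real n ^ (2 * s)"] by (auto intro!: divide_nonneg_nonneg mult_nonneg_nonneg)
  thus "0 \<le> parabola_acc n s z" "parabola_acc n s z \<le> z * (1 - z)" "z * (1 - z) - parabola_acc n s z \<le> 1 / 4 / (real n) ^ (2 * s)"
    using p by linarith+
qed

text \<open>Each step takes two layers: one for the ramps of the current iterate, one that sums them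
  both into the next iterate and into the accumulator. The initial layer supplies the accumulator 0.
  The bound on M covers \<open>sum_abs_zigzag_coef\<close> and, with the weight 1 of the old
  accumulator, \<open>sum_abs_parabola_coef\<close>.\<close>

lemma circ_parabola_acc_stage:
  fixes u :: "real^'d::finite \<Rightarrow> real"
  assumes F: "finite F" "unit_units F" "card F \<le> p" and n: "0 < n" and M: "2 * (real n)\<^sup>2 + 2 * real n + 2 \<le> M"
    and u: "u \<in> F"
  shows "circ M (1 + 2 * s) ((1 + 2 * s) * (4 * (p + n) + 10)) F
     (F \<union> {\<lambda>x. (zigzag n ^^ s) (u x), \<lambda>x. parabola_acc n s (u x)})"
proof (induction s)
  case 0
  have M1: "1 \<le> M" using M n by (smt (verit) of_nat_0_le_iff zero_le_power2)
  have "neuron M F (card ({} :: nat set) + 1) (\<lambda>x. 0)"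
    by (rule neuron_sum[where c="\<lambda>_. 0" and u="\<lambda>_. u" and b=0]) (use M1 in auto)
  hence "layer M 1 F {\<lambda>x. 0}" using layer_single[of M F 1] by simp
  moreover have "layer M (2 * card F) F F"
    by (rule layer_pass) (use F M1 unit_units_nonneg in auto)
  ultimately have "layer M (2 * card F + 1) F (F \<union> {\<lambda>x. 0})" by (intro layer_Un) auto
  from circ_layer[OF this] have "circ M 1 (4 * (p + n) + 10) F (F \<union> {\<lambda>x. 0})"
    by (rule circ_mono) (use F in auto)
  thus ?case using u by (simp add: insert_absorb)
next
  case (Suc s)
  have M1: "1 \<le> M" using M n by (smt (verit) of_nat_0_le_iff zero_le_power2)
  have kn: "real k / real n \<le> 1" if "k < n" for k using that by simp
  define z where "z = (\<lambda>x. (zigzag n ^^ s) (u x))"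
  define a where "a = (\<lambda>x. parabola_acc n s (u x))"
  define v where "v = (\<lambda>k x. max 0 (z x - real k / real n))"
  have ux: "0 \<le> u x \<and> u x \<le> 1" if "x \<in> unit_cube" for x using F u that by (auto simp: unit_units_def)
  have zx: "0 \<le> z x \<and> z x \<le> 1" "0 \<le> a x" if "x \<in> unit_cube" for x
    using parabola_acc_props[OF n, of "u x" s] ux[OF that] by (auto simp: z_def a_def)
  let ?H = "F \<union> {z, a}"
  let ?G = "F \<union> {a} \<union> v ` {..<n}"
  have pF: "layer M (2 * card F) F' F" if "F \<subseteq> F'" for F'
    by (rule layer_pass) (use F M1 unit_units_nonneg that in auto)
  have "layer M 2 ?H {a}" by (intro layer_single neuron_pass) (use M1 zx in auto)
  moreover have "layer M (card {..<n} * 2) ?H (v ` {..<n})"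
  proof (rule layer_image_const)
    fix k assume k: "k \<in> {..<n}"
    have "neuron M ?H (card {()} + 1) (v k)"
      by (rule neuron_sum[where c="\<lambda>_. 1" and u="\<lambda>_. z" and b="- (real k / real n)"])
         (use M1 k order_trans[OF kn M1] in \<open>auto simp: v_def\<close>)
    thus "neuron M ?H 2 (v k)" by (simp add: numeral_2_eq_2)
  qed simp
  ultimately have L1: "layer M (2 * card F + 2 + n * 2) ?H ?G"
    using pF[of ?H] by (intro layer_Un) auto
  have "neuron M ?G (card {..<n} + 1) (\<lambda>x. (zigzag n ^^ Suc s) (u x))"
  proof (rule neuron_sum[where c="zigzag_coef n" and u=v and b=0])
    show "(\<Sum>i<n. \<bar>zigzag_coef n i\<bar>) \<le> M" using sum_abs_zigzag_coef[of n] M by (smt (verit) of_nat_0_le_iff)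
    fix x :: "real^'d" assume x: "x \<in> unit_cube"
    have "(zigzag n ^^ Suc s) (u x) = zigzag n (z x)" by (simp add: z_def)
    moreover have "0 \<le> zigzag n (z x)" using parabola_step(1)[OF n] zx[OF x] by auto
    ultimately show "(zigzag n ^^ Suc s) (u x) = max 0 ((\<Sum>k<n. zigzag_coef n k * v k x) + 0)"
      by (simp add: zigzag_def v_def)
  qed (use M1 in auto)
  hence L2: "layer M (n + 1) ?G {\<lambda>x. (zigzag n ^^ Suc s) (u x)}" using layer_single by force
  have "neuron M ?G (card (insert n {..<n}) + 1) (\<lambda>x. parabola_acc n (Suc s) (u x))"
  proof (rule neuron_sum[where c="\<lambda>k. if k = n then 1 else parabola_coef n k / real n ^ (2 * s)" and u="\<lambda>k. if k = n then a else v k" and b=0])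
    have "1 \<le> real n ^ (2 * s)" using n by (intro one_le_power) simp
    have "(\<Sum>k<n. \<bar>parabola_coef n k / real n ^ (2 * s)\<bar>) \<le> (\<Sum>k<n. \<bar>parabola_coef n k\<bar>)"
    proof (rule sum_mono)
      fix k
      have "\<bar>parabola_coef n k\<bar> / real n ^ (2 * s) \<le> \<bar>parabola_coef n k\<bar> / 1"
        using \<open>1 \<le> real n ^ (2 * s)\<close> n by (intro divide_left_mono) auto
      thus "\<bar>parabola_coef n k / real n ^ (2 * s)\<bar> \<le> \<bar>parabola_coef n k\<bar>" by (simp add: abs_divide)
    qed
    also have "\<dots> \<le> 2 * real n" by (rule sum_abs_parabola_coef[OF n])
    finally have *: "(\<Sum>k<n. \<bar>parabola_coef n k / real n ^ (2 * s)\<bar>) \<le> 2 * real n" .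
    have "(\<Sum>k\<in>insert n {..<n}. \<bar>if k = n then 1 else parabola_coef n k / real n ^ (2 * s)\<bar>) =
      1 + (\<Sum>k<n. \<bar>if k = n then 1 else parabola_coef n k / real n ^ (2 * s)\<bar>)" by simp
    also have "(\<Sum>k<n. \<bar>if k = n then 1 else parabola_coef n k / real n ^ (2 * s)\<bar>) = (\<Sum>k<n. \<bar>parabola_coef n k / real n ^ (2 * s)\<bar>)"
      by (intro sum.cong) auto
    finally show "(\<Sum>k\<in>insert n {..<n}. \<bar>if k = n then 1 else parabola_coef n k / real n ^ (2 * s)\<bar>) \<le> M"
      using * M by (smt (verit) zero_le_power2)
    fix x :: "real^'d" assume x: "x \<in> unit_cube"
    have "(\<Sum>k\<in>insert n {..<n}. (if k = n then 1 else parabola_coef n k / real n ^ (2 * s)) * (if k = n then a else v k) x) =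
      a x + (\<Sum>k<n. (if k = n then 1 else parabola_coef n k / real n ^ (2 * s)) * (if k = n then a else v k) x)" by simp
    also have "(\<Sum>k<n. (if k = n then 1 else parabola_coef n k / real n ^ (2 * s)) * (if k = n then a else v k) x) = parabola n (z x) / real n ^ (2 * s)"
      unfolding parabola_def v_def sum_divide_distrib by (intro sum.cong) auto
    also have "a x + \<dots> = parabola_acc n (Suc s) (u x)" by (simp add: a_def z_def)
    finally have eq: "(\<Sum>k\<in>insert n {..<n}. (if k = n then 1 else parabola_coef n k / real n ^ (2 * s)) * (if k = n then a else v k) x) = parabola_acc n (Suc s) (u x)" .
    have "0 \<le> parabola_acc n (Suc s) (u x)" using parabola_acc_error(1)[OF n] ux[OF x] by blast
    thus "parabola_acc n (Suc s) (u x) = max 0 ((\<Sum>k\<in>insert n {..<n}. (if k = n then 1 else parabola_coef n k / real n ^ (2 * s)) * (if k = n then a else v k) x) + 0)"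
      unfolding eq by simp
  qed (use M1 in auto)
  hence L3: "layer M (n + 2) ?G {\<lambda>x. parabola_acc n (Suc s) (u x)}" using layer_single by force
  have L4: "layer M (2 * card F + (n + 1) + (n + 2)) ?G (F \<union> {\<lambda>x. (zigzag n ^^ Suc s) (u x)} \<union> {\<lambda>x. parabola_acc n (Suc s) (u x)})"
    using L2 L3 pF[of ?G] by (intro layer_Un) auto
  from circ_then_layer[OF circ_then_layer[OF Suc[folded z_def a_def] L1] L4]
  have "circ M (1 + 2 * Suc s) ((1 + 2 * s) * (4 * (p + n) + 10) + (2 * card F + 2 + n * 2) + (2 * card F + (n + 1) + (n + 2))) F
     (F \<union> {\<lambda>x. (zigzag n ^^ Suc s) (u x)} \<union> {\<lambda>x. parabola_acc n (Suc s) (u x)})"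
    by (simp only: add_Suc_right mult_Suc_right add_2_eq_Suc Suc_eq_plus1[symmetric] plus_1_eq_Suc mult_Suc add_Suc)
  moreover have "(1 + 2 * s) * (4 * (p + n) + 10) + (2 * card F + 2 + n * 2) + (2 * card F + (n + 1) + (n + 2)) \<le> (1 + 2 * Suc s) * (4 * (p + n) + 10)"
    using F(3) by (simp add: algebra_simps)
  ultimately have "circ M (1 + 2 * Suc s) ((1 + 2 * Suc s) * (4 * (p + n) + 10)) F
     (F \<union> {\<lambda>x. (zigzag n ^^ Suc s) (u x)} \<union> {\<lambda>x. parabola_acc n (Suc s) (u x)})"
    by (rule circ_mono[OF _ order_refl])
  thus ?case by (rule circ_subset) auto
qed

lemma circ_parabola_acc:
  fixes u :: "real^'d::finite \<Rightarrow> real"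
  assumes F: "finite F" "unit_units F" "card F \<le> p" and n: "0 < n" and M: "2 * (real n)\<^sup>2 + 2 * real n + 2 \<le> M"
    and u: "u \<in> F"
  shows "circ M (1 + 2 * s) ((1 + 2 * s) * (4 * (p + n) + 10)) F (insert (\<lambda>x. parabola_acc n s (u x)) F)"
  by (rule circ_subset[OF circ_parabola_acc_stage[OF assms]]) auto

lemma unit_units_parabola_acc:
  assumes "unit_units F" "u \<in> F" "0 < n"
  shows "unit_units (insert (\<lambda>x. parabola_acc n s (u x)) F)"
proof -
  have "0 \<le> parabola_acc n s (u x) \<and> parabola_acc n s (u x) \<le> 1" if "x \<in> unit_cube" for x
  proof -
    have ux: "0 \<le> u x" "u x \<le> 1" using assms that by (auto simp: unit_units_def)
    have "u x * (1 - u x) \<le> 1 * 1" using ux by (intro mult_mono) auto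
    thus ?thesis using parabola_acc_error(1,2)[OF assms(3) ux, of s] by linarith
  qed
  thus ?thesis using assms(1) by (auto simp: unit_units_def)
qed

text \<open>Polarisation with e(z) = z (1 - z) and a = (u + v)/2, namely u v = a - 2 e(a) + (e(u) +
  e(v))/2. The last two layers form this combination and clip it to [0, 1], so that the result can
  again serve as a factor.\<close>

lemma circ_mult:
  fixes u v :: "real^'d::finite \<Rightarrow> real"
  assumes F: "finite F" "unit_units F" "card F \<le> p" and n: "0 < n" and M: "2 * (real n)\<^sup>2 + 2 * real n + 4 \<le> M"
    and u: "u \<in> F" and v: "v \<in> F"
  shows "\<exists>w. circ M (6 + 6 * s) ((6 + 6 * s) * (4 * (p + n) + 30)) F (insert w F) \<and> unit_units {w} \<and>
     (\<forall>x\<in>unit_cube. \<bar>w x - u x * v x\<bar> \<le> 1 / real n ^ (2 * s))"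
proof -
  have M4: "4 \<le> M" using M by (smt (verit) of_nat_0_le_iff zero_le_power2)
  have M': "2 * (real n)\<^sup>2 + 2 * real n + 2 \<le> M" using M by linarith
  have pass: "layer M (2 * card G) G' G" if "finite G" "unit_units G" "G \<subseteq> G'" for G G'
    using that M4 unit_units_nonneg by (intro layer_pass) auto
  define a where "a = (\<lambda>x. (u x + v x) / 2)"
  define eu where "eu = (\<lambda>x. parabola_acc n s (u x))"
  define ev where "ev = (\<lambda>x. parabola_acc n s (v x))"
  define ea where "ea = (\<lambda>x. parabola_acc n s (a x))"
  have uv: "0 \<le> u x \<and> u x \<le> 1 \<and> 0 \<le> v x \<and> v x \<le> 1" if "x \<in> unit_cube" for x
    using F(2) u v that by (auto simp: unit_units_def)
  have ax: "0 \<le> a x \<and> a x \<le> 1" if "x \<in> unit_cube" for x using uv[OF that] by (auto simp: a_def)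
  let ?c = "\<lambda>m. (1 + 2 * s) * (4 * (p + m + n) + 10)"
  define F1 where "F1 = insert a F"
  define F2 where "F2 = insert eu F1"
  define F3 where "F3 = insert ev F2"
  define F4 where "F4 = insert ea F3"
  have fin: "finite F1" "finite F2" "finite F3" "finite F4" using F by (auto simp: F1_def F2_def F3_def F4_def)
  have un1: "unit_units F1" using F(2) ax by (auto simp: F1_def unit_units_def)
  have mem: "u \<in> F1" "v \<in> F2" "a \<in> F3" using u v by (auto simp: F1_def F2_def F3_def)
  have un2: "unit_units F2" unfolding F2_def eu_def by (rule unit_units_parabola_acc[OF un1 mem(1) n])
  have un3: "unit_units F3" unfolding F3_def ev_def by (rule unit_units_parabola_acc[OF un2 mem(2) n])
  have un4: "unit_units F4" unfolding F4_def ea_def by (rule unit_units_parabola_acc[OF un3 mem(3) n])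
  have c1: "card F1 \<le> p + 1" using F card_insert_le_m1[of "p + 1" F a] by (simp add: F1_def)
  have c2: "card F2 \<le> p + 2" using fin c1 by (simp add: F2_def card_insert_if)
  have c3: "card F3 \<le> p + 3" using fin c2 by (simp add: F3_def card_insert_if)
  have "neuron M F (card {True, False} + 1) a"
    by (rule neuron_sum[where c="\<lambda>_. 1/2" and u="\<lambda>b. if b then u else v" and b=0])
      (use M4 u v ax in \<open>auto simp: a_def add_divide_distrib\<close>)
  hence "layer M 3 F {a}" using layer_single[of M F 3 a] by (simp add: numeral_3_eq_3)
  hence "layer M (2 * card F + 3) F (F \<union> {a})" using F by (intro layer_Un pass) auto
  from circ_layer[OF this] have k1: "circ M 1 (2 * card F + 3) F F1" by (simp add: F1_def)
  have k2: "circ M (1 + 2 * s) (?c 1) F1 F2" unfolding F2_def eu_def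
    using circ_parabola_acc[OF fin(1) un1 c1 n M' mem(1), of s] by (simp only: add.assoc)
  have k3: "circ M (1 + 2 * s) (?c 2) F2 F3" unfolding F3_def ev_def
    using circ_parabola_acc[OF fin(2) un2 c2 n M' mem(2), of s] by (simp only: add.assoc)
  have k4: "circ M (1 + 2 * s) (?c 3) F3 F4" unfolding F4_def ea_def
    using circ_parabola_acc[OF fin(3) un3 c3 n M' mem(3), of s] by (simp only: add.assoc)
  define y where "y = (\<lambda>x. a x - 2 * ea x + (eu x + ev x) / 2)"
  define w1 where "w1 = (\<lambda>x. max 0 (y x))"
  define w2 where "w2 = (\<lambda>x. max 0 (y x - 1))"
  define w where "w = (\<lambda>x. max 0 (w1 x - w2 x))"
  have sums: "(\<Sum>i\<in>{0::nat,1,2,3}. (if i = 0 then 1 else if i = 1 then - 2 else 1/2) * (if i = 0 then a else if i = 1 then ea else if i = 2 then eu else ev) x) = y x" for x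
    by (simp add: y_def add_divide_distrib)
  have nw: "neuron M F4 (card {0::nat,1,2,3} + 1) (\<lambda>x. max 0 (y x + b))" if "\<bar>b\<bar> \<le> 1" for b
    by (rule neuron_sum[where c="\<lambda>i. if i = 0 then 1 else if i = 1 then - 2 else 1/2" and u="\<lambda>i. if i = 0 then a else if i = 1 then ea else if i = 2 then eu else ev" and b=b])
      (use M4 that sums in \<open>auto simp: F4_def F3_def F2_def F1_def\<close>)
  have "layer M 5 F4 {w1}" "layer M 5 F4 {w2}"
    using nw[of 0] nw[of "-1"] by (auto intro!: layer_single simp: w1_def w2_def eval_nat_numeral)
  moreover have "F \<subseteq> F4" by (auto simp: F4_def F3_def F2_def F1_def)
  ultimately have "layer M (2 * card F + 5 + 5) F4 (F \<union> {w1} \<union> {w2})" using F by (intro layer_Un pass) auto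
  hence k5: "circ M 1 (2 * card F + 10) F4 (F \<union> {w1} \<union> {w2})" using circ_layer by (simp add: add.assoc)
  have "neuron M (F \<union> {w1} \<union> {w2}) (card {True, False} + 1) w"
    by (rule neuron_sum[where c="\<lambda>b. if b then 1 else -1" and u="\<lambda>b. if b then w1 else w2" and b=0])
      (use M4 in \<open>auto simp: w_def\<close>)
  hence "layer M 3 (F \<union> {w1} \<union> {w2}) {w}" by (auto intro!: layer_single simp: numeral_3_eq_3)
  hence "layer M (2 * card F + 3) (F \<union> {w1} \<union> {w2}) (F \<union> {w})" using F by (intro layer_Un pass) auto
  hence k6: "circ M 1 (2 * card F + 3) (F \<union> {w1} \<union> {w2}) (F \<union> {w})" by (rule circ_layer)
  from circ_comp[OF circ_comp[OF circ_comp[OF circ_comp[OF circ_comp[OF k1 k2] k3] k4] k5] k6]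
  have "circ M (1 + (1 + 2 * s) + (1 + 2 * s) + (1 + 2 * s) + 1 + 1) (2 * card F + 3 + ?c 1 + ?c 2 + ?c 3 + (2 * card F + 10) + (2 * card F + 3)) F (insert w F)"
    by simp
  moreover have "2 * card F + 3 + ?c 1 + ?c 2 + ?c 3 + (2 * card F + 10) + (2 * card F + 3) \<le> (6 + 6 * s) * (4 * (p + n) + 30)"
    using F(3) by (simp add: algebra_simps)
  ultimately have "circ M (1 + (1 + 2 * s) + (1 + 2 * s) + (1 + 2 * s) + 1 + 1) ((6 + 6 * s) * (4 * (p + n) + 30)) F (insert w F)"
    by (rule circ_mono[OF _ order_refl])
  moreover have "1 + (1 + 2 * s) + (1 + 2 * s) + (1 + 2 * s) + 1 + 1 = 6 + 6 * s" by simp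
  ultimately have C: "circ M (6 + 6 * s) ((6 + 6 * s) * (4 * (p + n) + 30)) F (insert w F)"
    by (simp only:)
  have wx: "w x = min 1 (max 0 (y x))" for x by (auto simp: w_def w1_def w2_def max_def min_def)
  have W: "unit_units {w}" by (auto simp: unit_units_def wx)
  have "\<bar>w x - u x * v x\<bar> \<le> 1 / real n ^ (2 * s)" if x: "x \<in> unit_cube" for x
  proof -
    define \<delta> where "\<delta> = 1 / 4 / real n ^ (2 * s)"
    note uvx = uv[OF x] and axx = ax[OF x]
    note pu = parabola_acc_error[OF n, of "u x" s, folded \<delta>_def] and pv = parabola_acc_error[OF n, of "v x" s, folded \<delta>_def]
      and pa = parabola_acc_error[OF n, of "a x" s, folded \<delta>_def]
    define ru rv ra where "ru = u x * (1 - u x) - eu x" and "rv = v x * (1 - v x) - ev x" and "ra = a x * (1 - a x) - ea x"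
    have r: "0 \<le> ru" "ru \<le> \<delta>" "0 \<le> rv" "rv \<le> \<delta>" "0 \<le> ra" "ra \<le> \<delta>"
      using pu pv pa uvx axx by (auto simp: ru_def rv_def ra_def eu_def ev_def ea_def)
    define P where "P = u x * v x"
    have "y x = P + 2 * ra - (ru + rv) / 2"
      by (simp add: P_def y_def ra_def ru_def rv_def a_def field_simps)
    hence "y x - P \<le> 4 * \<delta>" "P - y x \<le> 4 * \<delta>" using r by argo+
    moreover have "0 \<le> P" "P \<le> 1" unfolding P_def using uvx by (auto simp: mult_le_one)
    ultimately have "w x - P \<le> 4 * \<delta>" "P - w x \<le> 4 * \<delta>" unfolding wx using r by (auto simp: min_def max_def)
    thus ?thesis by (simp add: \<delta>_def P_def abs_le_iff)
  qed
  with C W show ?thesis by blast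
qed

text \<open>All factors lie in [0, 1], so the errors of the successive multiplications only add
  up.\<close>

lemma circ_prod_list:
  fixes us :: "(real^'d::finite \<Rightarrow> real) list"
  assumes "us \<noteq> []" and F: "finite F" "unit_units F" "card F \<le> p" and n: "0 < n" and M: "2 * (real n)\<^sup>2 + 2 * real n + 4 \<le> M"
    and us: "set us \<subseteq> F"
  shows "\<exists>w. circ M (length us * (6 + 6 * s)) (length us * ((6 + 6 * s) * (4 * (p + 1 + n) + 30))) F (insert w F) \<and> unit_units {w} \<and>
     (\<forall>x\<in>unit_cube. \<bar>w x - prod_list (map (\<lambda>u. u x) us)\<bar> \<le> real (length us) / real n ^ (2 * s))"
  using assms(1) us
proof (induction us rule: list_nonempty_induct)
  case (single u)
  have M4: "1 \<le> M" using M by (smt (verit) of_nat_0_le_iff zero_le_power2)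
  \<comment> \<open>Idle layers. A list with one element is given the depth of one multiplication,
    which makes the depth proportional to the length.\<close>
  have "circ M l (2 * l * card F) F F" for l
  proof (induction l)
    case (Suc l)
    from circ_then_layer[OF this layer_pass[OF F(1) unit_units_nonneg[OF F(2)] M4 order_refl]]
    show ?case by (simp add: algebra_simps)
  qed simp
  moreover have "2 * (6 + 6 * s) * card F \<le> length [u] * ((6 + 6 * s) * (4 * (p + 1 + n) + 30))"
  proof -
    have "(6 + 6 * s) * (2 * card F) \<le> (6 + 6 * s) * (4 * (p + 1 + n) + 30)"
      using F(3) by (intro mult_left_mono) auto
    thus ?thesis by (simp add: mult_ac)
  qed
  ultimately have "circ M (6 + 6 * s) (length [u] * ((6 + 6 * s) * (4 * (p + 1 + n) + 30))) F F"
    by (rule circ_mono[OF _ order_refl])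
  thus ?case using single F(2) by (intro exI[of _ u]) (auto simp: insert_absorb unit_units_def)
next
  case (cons u us)
  obtain w where w: "circ M (length us * (6 + 6 * s)) (length us * ((6 + 6 * s) * (4 * (p + 1 + n) + 30))) F (insert w F)" "unit_units {w}"
     "\<forall>x\<in>unit_cube. \<bar>w x - prod_list (map (\<lambda>u. u x) us)\<bar> \<le> real (length us) / real n ^ (2 * s)"
    using cons by auto
  have "finite (insert w F)" "unit_units (insert w F)" "card (insert w F) \<le> p + 1"
    using F w(2) by (auto simp: unit_units_def card_insert_if)
  from circ_mult[OF this n M, of u w s] cons.prems
  obtain w' where w': "circ M (6 + 6 * s) ((6 + 6 * s) * (4 * (p + 1 + n) + 30)) (insert w F) (insert w' (insert w F))" "unit_units {w'}"
    "\<forall>x\<in>unit_cube. \<bar>w' x - u x * w x\<bar> \<le> 1 / real n ^ (2 * s)" by auto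
  have "circ M (length us * (6 + 6 * s) + (6 + 6 * s)) (length us * ((6 + 6 * s) * (4 * (p + 1 + n) + 30)) + (6 + 6 * s) * (4 * (p + 1 + n) + 30)) F (insert w' (insert w F))"
    by (rule circ_comp[OF w(1) w'(1)])
  moreover have len: "length (u # us) * A = length us * A + A" for A :: nat by simp
  ultimately have "circ M (length (u # us) * (6 + 6 * s)) (length (u # us) * ((6 + 6 * s) * (4 * (p + 1 + n) + 30))) F (insert w' (insert w F))"
    by (simp only: len)
  hence "circ M (length (u # us) * (6 + 6 * s)) (length (u # us) * ((6 + 6 * s) * (4 * (p + 1 + n) + 30))) F (insert w' F)"
    by (rule circ_subset) blast
  moreover have "\<bar>w' x - prod_list (map (\<lambda>u. u x) (u # us))\<bar> \<le> real (length (u # us)) / real n ^ (2 * s)" if x: "x \<in> unit_cube" for x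
  proof -
    have u: "\<bar>u x\<bar> \<le> 1" using cons.prems F(2) x by (auto simp: unit_units_def)
    have "\<bar>w' x - u x * prod_list (map (\<lambda>u. u x) us)\<bar> \<le> \<bar>w' x - u x * w x\<bar> + \<bar>u x * w x - u x * prod_list (map (\<lambda>u. u x) us)\<bar>" by linarith
    also have "\<bar>u x * w x - u x * prod_list (map (\<lambda>u. u x) us)\<bar> = \<bar>u x\<bar> * \<bar>w x - prod_list (map (\<lambda>u. u x) us)\<bar>"
      by (simp add: abs_mult right_diff_distrib[symmetric])
    also have "\<dots> \<le> 1 * (real (length us) / real n ^ (2 * s))" using u w(3) x by (intro mult_mono) auto
    finally show ?thesis using w'(3) x by (auto simp: add_divide_distrib)
  qed
  ultimately show ?case using w'(2) by blast
qed

text \<open>The products are computed one after another, with all earlier results carried along.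
  Depth therefore grows with \<open>card I\<close>, which will be a constant. It is stated as a
  bound because the lists differ in length.\<close>

lemma circ_prod_family:
  fixes us :: "'i \<Rightarrow> (real^'d::finite \<Rightarrow> real) list"
  assumes "finite I" "\<And>i. i \<in> I \<Longrightarrow> us i \<noteq> [] \<and> length (us i) \<le> m \<and> set (us i) \<subseteq> F"
    and F: "finite F" "unit_units F" "card F \<le> p" and n: "0 < n" and M: "2 * (real n)\<^sup>2 + 2 * real n + 4 \<le> M"
  shows "\<exists>w D. D \<le> card I * (m * (6 + 6 * s)) \<and>
     circ M D (card I * (m * ((6 + 6 * s) * (4 * (p + card I + 1 + n) + 30)))) F (F \<union> w ` I) \<and> unit_units (F \<union> w ` I) \<and>
     (\<forall>i\<in>I. \<forall>x\<in>unit_cube. \<bar>w i x - prod_list (map (\<lambda>u. u x) (us i))\<bar> \<le> real m / real n ^ (2 * s))"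
  using assms(1,2)
proof (induction I rule: finite_induct)
  case empty thus ?case using F by (auto intro!: exI[of _ "0::nat"])
next
  case (insert i I)
  from insert.IH insert.prems obtain w D where w: "D \<le> card I * (m * (6 + 6 * s))"
     "circ M D (card I * (m * ((6 + 6 * s) * (4 * (p + card I + 1 + n) + 30)))) F (F \<union> w ` I)" "unit_units (F \<union> w ` I)"
     "\<forall>i\<in>I. \<forall>x\<in>unit_cube. \<bar>w i x - prod_list (map (\<lambda>u. u x) (us i))\<bar> \<le> real m / real n ^ (2 * s)" by auto
  have ui: "us i \<noteq> []" "length (us i) \<le> m" "set (us i) \<subseteq> F" using insert.prems by auto
  have f: "finite (F \<union> w ` I)" using F insert by auto
  have c: "card (F \<union> w ` I) \<le> p + card I"
    using card_Un_le[of F "w ` I"] card_image_le[OF insert(1), of w] F(3) by linarith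
  from circ_prod_list[OF ui(1) f w(3) c n M, of s] ui(3)
  obtain v where v: "circ M (length (us i) * (6 + 6 * s)) (length (us i) * ((6 + 6 * s) * (4 * (p + card I + 1 + n) + 30))) (F \<union> w ` I) (insert v (F \<union> w ` I))"
     "unit_units {v}" "\<forall>x\<in>unit_cube. \<bar>v x - prod_list (map (\<lambda>u. u x) (us i))\<bar> \<le> real (length (us i)) / real n ^ (2 * s)" by blast
  define w' where "w' = w(i := v)"
  have im: "F \<union> w' ` (insert i I) = insert v (F \<union> w ` I)" using insert(2) by (auto simp: w'_def)
  define A where "A = (6 + 6 * s) * (4 * (p + card I + 1 + n) + 30)"
  define A' where "A' = (6 + 6 * s) * (4 * (p + card (insert i I) + 1 + n) + 30)"
  have AA: "A \<le> A'" unfolding A_def A'_def using insert by (intro mult_left_mono) auto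
  have "card I * (m * A) + length (us i) * A \<le> card I * (m * A') + m * A'"
    using ui(2) AA by (intro add_mono mult_mono) auto
  also have "\<dots> = card (insert i I) * (m * A')" using insert by simp
  finally have le: "card I * (m * A) + length (us i) * A \<le> card (insert i I) * (m * A')" .
  have "circ M (D + length (us i) * (6 + 6 * s)) (card (insert i I) * (m * A')) F (F \<union> w' ` (insert i I))"
    unfolding im by (rule circ_mono[OF circ_comp[OF w(2) v(1)] order_refl]) (use le in \<open>simp only: A_def\<close>)
  moreover have "D + length (us i) * (6 + 6 * s) \<le> card (insert i I) * (m * (6 + 6 * s))"
  proof -
    have "length (us i) * (6 + 6 * s) \<le> m * (6 + 6 * s)" using ui(2) by (intro mult_right_mono) auto
    thus ?thesis using w(1) unfolding card_insert_disjoint[OF insert(1,2)] mult_Suc by linarith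
  qed
  moreover have "unit_units (F \<union> w' ` (insert i I))" unfolding im using w(3) v(2) by (auto simp: unit_units_def)
  moreover have "\<forall>i'\<in>insert i I. \<forall>x\<in>unit_cube. \<bar>w' i' x - prod_list (map (\<lambda>u. u x) (us i'))\<bar> \<le> real m / real n ^ (2 * s)"
  proof (intro ballI)
    fix i' and x :: "real^'d" assume i': "i' \<in> insert i I" and x: "x \<in> unit_cube"
    have "real (length (us i)) / real n ^ (2 * s) \<le> real m / real n ^ (2 * s)" using ui(2) by (intro divide_right_mono) auto
    thus "\<bar>w' i' x - prod_list (map (\<lambda>u. u x) (us i'))\<bar> \<le> real m / real n ^ (2 * s)"
      using i' x w(4) v(3) insert(2) by (cases "i' = i") (force simp: w'_def)+
  qed
  ultimately show ?case unfolding A'_def by blast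
qed

section \<open>Expansion of the local polynomials in monomials\<close>

lemma linear_prod_expand:
  fixes \<beta> \<gamma> :: "'b \<Rightarrow> real"
  assumes "finite S" "1 \<le> G" "\<And>b. b \<in> S \<Longrightarrow> \<bar>\<beta> b\<bar> \<le> G \<and> \<bar>\<gamma> b\<bar> \<le> G"
  shows "\<exists>c. (\<forall>x. (\<Prod>b\<in>S. \<beta> b + \<gamma> b * x) = (\<Sum>m\<le>card S. c m * x ^ m)) \<and> (\<forall>m. \<bar>c m\<bar> \<le> (2 * G) ^ card S)"
  using assms(1,3)
proof (induction S rule: finite_induct)
  case empty
  show ?case by (intro exI[of _ "\<lambda>m. if m = 0 then 1 else 0"]) auto
next
  case (insert b S)
  then obtain c where c: "\<And>x. (\<Prod>b\<in>S. \<beta> b + \<gamma> b * x) = (\<Sum>m\<le>card S. c m * x ^ m)" "\<And>m. \<bar>c m\<bar> \<le> (2 * G) ^ card S"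
    by auto
  define n where "n = card S"
  define c' where "c' m = \<beta> b * (if m \<le> n then c m else 0) + \<gamma> b * (if m = 0 then 0 else c (m - 1))" for m
  have "(\<Prod>b\<in>insert b S. \<beta> b + \<gamma> b * x) = (\<Sum>m\<le>Suc n. c' m * x ^ m)" for x
  proof -
    have "(\<Sum>m\<le>Suc n. c' m * x ^ m) = (\<Sum>m\<le>Suc n. \<beta> b * (if m \<le> n then c m else 0) * x ^ m) + (\<Sum>m\<le>Suc n. \<gamma> b * (if m = 0 then 0 else c (m - 1)) * x ^ m)"
      by (simp only: c'_def distrib_right sum.distrib)
    also have "(\<Sum>m\<le>Suc n. \<beta> b * (if m \<le> n then c m else 0) * x ^ m) = \<beta> b * (\<Sum>m\<le>n. c m * x ^ m)"
      by (simp add: sum_distrib_left mult.assoc)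
    also have "(\<Sum>m\<le>Suc n. \<gamma> b * (if m = 0 then 0 else c (m - 1)) * x ^ m) = \<gamma> b * x * (\<Sum>m\<le>n. c m * x ^ m)"
      by (subst sum.atMost_Suc_shift) (simp add: sum_distrib_left mult_ac)
    finally show ?thesis using insert(1,2) c(1)[of x] by (simp add: n_def distrib_right)
  qed
  moreover have "\<bar>c' m\<bar> \<le> (2 * G) ^ Suc n" for m
  proof -
    have "\<bar>c' m\<bar> \<le> \<bar>\<beta> b\<bar> * \<bar>if m \<le> n then c m else 0\<bar> + \<bar>\<gamma> b\<bar> * \<bar>if m = 0 then 0 else c (m - 1)\<bar>"
      unfolding c'_def by (rule order_trans[OF abs_triangle_ineq]) (simp add: abs_mult)
    also have "\<dots> \<le> G * (2 * G) ^ n + G * (2 * G) ^ n"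
      using insert.prems[of b] c(2) assms(2) by (intro add_mono mult_mono) (auto simp: n_def)
    finally show ?thesis by (simp add: mult_ac)
  qed
  ultimately show ?case using insert(1,2) by (intro exI[of _ c']) (auto simp: n_def)
qed

text \<open>Each factor is (x - s - h b)/(h (a - b)). Its two coefficients are at most 1/h, because
  the nodes lie in [0, 1] and |a - b| \<ge> 1.\<close>

lemma lagrange_expand:
  assumes a: "a < r" and h: "0 < h" "0 \<le> s" "s + real r * h \<le> 1"
  shows "\<exists>c. (\<forall>x. lagrange r a ((x - s) / h) = (\<Sum>m<r. c m * x ^ m)) \<and> (\<forall>m. \<bar>c m\<bar> \<le> (2 / h) ^ r)"
proof -
  define \<gamma> where "\<gamma> b = 1 / (h * (real a - real b))" for b
  define \<beta> where "\<beta> b = - (s + h * real b) * \<gamma> b" for b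
  have "h \<le> real r * h" using a h by simp
  hence "h \<le> 1" using h by linarith
  hence h1: "1 \<le> 1 / h" using h by simp
  have bnd: "\<bar>\<beta> b\<bar> \<le> 1 / h \<and> \<bar>\<gamma> b\<bar> \<le> 1 / h" if b: "b \<in> {..<r} - {a}" for b
  proof
    have "1 \<le> \<bar>real a - real b\<bar>" using b by (cases a b rule: linorder_cases) auto
    hence "1 / (h * \<bar>real a - real b\<bar>) \<le> 1 / (h * 1)" using h by (intro divide_left_mono mult_left_mono) auto
    thus g: "\<bar>\<gamma> b\<bar> \<le> 1 / h" using h by (simp add: \<gamma>_def abs_mult)
    have "real b * h \<le> real r * h" using b h by (intro mult_right_mono) auto
    hence "h * real b \<le> real r * h" "0 \<le> h * real b" using h by (simp_all add: mult.commute)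
    hence "\<bar>s + h * real b\<bar> \<le> 1" using h by linarith
    hence "\<bar>s + h * real b\<bar> * \<bar>\<gamma> b\<bar> \<le> 1 * (1 / h)" using g by (intro mult_mono) auto
    thus "\<bar>\<beta> b\<bar> \<le> 1 / h" by (simp only: \<beta>_def abs_mult abs_minus_cancel mult_1)
  qed
  obtain c where c: "\<And>x. (\<Prod>b\<in>{..<r} - {a}. \<beta> b + \<gamma> b * x) = (\<Sum>m\<le>card ({..<r} - {a}). c m * x ^ m)"
      "\<And>m. \<bar>c m\<bar> \<le> (2 * (1 / h)) ^ card ({..<r} - {a})"
    using linear_prod_expand[of "{..<r} - {a}" "1 / h" \<beta> \<gamma>] h1 bnd by auto
  have cd: "card ({..<r} - {a}) = r - 1" using a by simp
  have "lagrange r a ((x - s) / h) = (\<Sum>m<r. c m * x ^ m)" for x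
  proof -
    have "lagrange r a ((x - s) / h) = (\<Prod>b\<in>{..<r} - {a}. \<beta> b + \<gamma> b * x)"
      unfolding lagrange_def
    proof (rule prod.cong)
      fix b assume "b \<in> {..<r} - {a}"
      hence "real a - real b \<noteq> 0" by simp
      moreover have "((x - s) / h - real b) / D = - (s + h * real b) * (1 / (h * D)) + 1 / (h * D) * x" if "D \<noteq> 0" for D
        using that h by (simp add: field_simps)
      ultimately show "((x - s) / h - real b) / (real a - real b) = \<beta> b + \<gamma> b * x"
        unfolding \<beta>_def \<gamma>_def by blast
    qed simp
    moreover have "{..r - 1} = {..<r}" using a by auto
    ultimately show ?thesis unfolding c cd by simp
  qed
  moreover have "\<bar>c m\<bar> \<le> (2 / h) ^ r" for m
  proof -
    have "\<bar>c m\<bar> \<le> (2 / h) ^ (r - 1)" using c(2)[of m] by (simp add: cd)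
    also have "\<dots> \<le> (2 / h) ^ r" using h1 by (intro power_increasing) auto
    finally show ?thesis .
  qed
  ultimately show ?thesis by blast
qed

text \<open>The monomials are centred at the origin and not at the cell, so that the coefficients of
  one monomial can be collected over all cells. This costs the factor of order h^(-r d) in the
  coefficients.\<close>

lemma grid_interp_expand:
  fixes f :: "real^'d::finite \<Rightarrow> real"
  assumes h: "0 < h" and s: "\<And>e. 0 \<le> s $ e \<and> s $ e + real r * h \<le> 1" and B: "\<And>z. z \<in> cube 0 1 \<Longrightarrow> \<bar>f z\<bar> \<le> B"
  shows "\<exists>a. (\<forall>x. grid_interp r s h f x = (\<Sum>\<mu>\<in>PiE UNIV (\<lambda>_. {..<r}). a \<mu> * (\<Prod>e\<in>UNIV. (x $ e) ^ \<mu> e))) \<and>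
     (\<forall>\<mu>. \<bar>a \<mu>\<bar> \<le> real r ^ CARD('d) * (B * ((2 / h) ^ r) ^ CARD('d)))"
proof -
  let ?P = "PiE (UNIV :: 'd set) (\<lambda>_. {..<r})"
  have "\<forall>e a. \<exists>c. a < r \<longrightarrow> ((\<forall>x. lagrange r a ((x - s $ e) / h) = (\<Sum>m<r. c m * x ^ m)) \<and> (\<forall>m. \<bar>c m\<bar> \<le> (2 / h) ^ r))"
    using lagrange_expand[OF _ h] s by blast
  then obtain c where c: "\<And>e a x. a < r \<Longrightarrow> lagrange r a ((x - s $ e) / h) = (\<Sum>m<r. c e a m * x ^ m)"
     "\<And>e a m. a < r \<Longrightarrow> \<bar>c e a m\<bar> \<le> (2 / h) ^ r" by metis
  define nd :: "('d \<Rightarrow> nat) \<Rightarrow> real^'d" where "nd \<alpha> = (\<chi> e. s $ e + h * real (\<alpha> e))" for \<alpha>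
  have nd: "\<bar>f (nd \<alpha>)\<bar> \<le> B" if \<alpha>: "\<alpha> \<in> ?P" for \<alpha>
  proof (rule B)
    have "h * real (\<alpha> e) \<le> real r * h" "0 \<le> h * real (\<alpha> e)" for e
    proof -
      have "\<alpha> e < r" using \<alpha> by auto
      thus "h * real (\<alpha> e) \<le> real r * h" "0 \<le> h * real (\<alpha> e)" using h by auto
    qed
    thus "nd \<alpha> \<in> cube 0 1" using s unfolding cube_def nd_def by (auto intro: order_trans[OF add_left_mono])
  qed
  define a where "a \<mu> = (\<Sum>\<alpha>\<in>?P. f (nd \<alpha>) * (\<Prod>e\<in>UNIV. c e (\<alpha> e) (\<mu> e)))" for \<mu>
  have "grid_interp r s h f x = (\<Sum>\<mu>\<in>?P. a \<mu> * (\<Prod>e\<in>UNIV. (x $ e) ^ \<mu> e))" for x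
  proof -
    have "grid_interp r s h f x = (\<Sum>\<alpha>\<in>?P. f (nd \<alpha>) * (\<Prod>e\<in>UNIV. \<Sum>m<r. c e (\<alpha> e) m * (x $ e) ^ m))"
      unfolding grid_interp_def prod_functional_def nd_def
      by (intro sum.cong refl arg_cong2[where f="(*)"] prod.cong c) auto
    also have "\<dots> = (\<Sum>\<alpha>\<in>?P. f (nd \<alpha>) * (\<Sum>\<mu>\<in>?P. \<Prod>e\<in>UNIV. c e (\<alpha> e) (\<mu> e) * (x $ e) ^ \<mu> e))"
      by (subst prod_sum_PiE) auto
    also have "\<dots> = (\<Sum>\<alpha>\<in>?P. \<Sum>\<mu>\<in>?P. f (nd \<alpha>) * (\<Prod>e\<in>UNIV. c e (\<alpha> e) (\<mu> e)) * (\<Prod>e\<in>UNIV. (x $ e) ^ \<mu> e))"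
      by (simp add: prod.distrib sum_distrib_left mult.assoc)
    also have "\<dots> = (\<Sum>\<mu>\<in>?P. \<Sum>\<alpha>\<in>?P. f (nd \<alpha>) * (\<Prod>e\<in>UNIV. c e (\<alpha> e) (\<mu> e)) * (\<Prod>e\<in>UNIV. (x $ e) ^ \<mu> e))"
      by (rule sum.swap)
    finally show ?thesis by (simp add: a_def sum_distrib_right)
  qed
  moreover have "\<bar>a \<mu>\<bar> \<le> real r ^ CARD('d) * (B * ((2 / h) ^ r) ^ CARD('d))" for \<mu>
  proof -
    have "\<bar>a \<mu>\<bar> \<le> (\<Sum>\<alpha>\<in>?P. B * ((2 / h) ^ r) ^ CARD('d))"
      unfolding a_def
    proof (rule order_trans[OF sum_abs], rule sum_mono)
      fix \<alpha> assume \<alpha>: "\<alpha> \<in> ?P"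
      have "(\<Prod>e\<in>UNIV. \<bar>c e (\<alpha> e) (\<mu> e)\<bar>) \<le> (\<Prod>e\<in>(UNIV::'d set). (2 / h) ^ r)"
        by (intro prod_mono) (use \<alpha> c(2) in auto)
      thus "\<bar>f (nd \<alpha>) * (\<Prod>e\<in>UNIV. c e (\<alpha> e) (\<mu> e))\<bar> \<le> B * ((2 / h) ^ r) ^ CARD('d)"
        unfolding abs_mult abs_prod using nd[OF \<alpha>] by (intro mult_mono) (auto intro: prod_nonneg order_trans[OF abs_ge_zero])
    qed
    thus ?thesis by (simp add: card_PiE)
  qed
  ultimately show ?thesis by blast
qed

section \<open>A sequential partition of unity\<close>

definition pou_sum :: "'q set \<Rightarrow> ('q \<Rightarrow> nat) \<Rightarrow> ('q \<Rightarrow> 'x \<Rightarrow> real) \<Rightarrow> nat \<Rightarrow> 'x \<Rightarrow> real" where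
  "pou_sum Q cl \<psi> c x = (\<Sum>q\<in>{q\<in>Q. cl q < c}. \<psi> q x)"

text \<open>Equal to \<open>min 1 (S + \<psi>) - min 1 S\<close>, where \<open>S\<close> sums the bumps of the preceding classes, so that the
  sum over the classes telescopes.\<close>
definition pou :: "'q set \<Rightarrow> ('q \<Rightarrow> nat) \<Rightarrow> ('q \<Rightarrow> 'x \<Rightarrow> real) \<Rightarrow> 'q \<Rightarrow> 'x \<Rightarrow> real" where
  "pou Q cl \<psi> q x = \<psi> q x - max 0 (pou_sum Q cl \<psi> (cl q) x + \<psi> q x - 1) + max 0 (pou_sum Q cl \<psi> (cl q) x - 1)"

lemma pou_nonneg: "0 \<le> \<psi> q x \<Longrightarrow> 0 \<le> pou Q cl \<psi> q x"
  by (auto simp: pou_def max_def)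

lemma pou_eq_0: "\<psi> q x = 0 \<Longrightarrow> pou Q cl \<psi> q x = 0"
  by (auto simp: pou_def)

text \<open>At a given point a class acts through at most one bump, so its total is min 1 of the
  partial sum after the class minus min 1 of the one before it. The telescoped value is 1 because a
  single bump already reaches 1.\<close>

lemma pou_sum_eq_1:
  assumes Q: "finite Q" "\<And>q. q \<in> Q \<Longrightarrow> 0 \<le> \<psi> q x" "\<And>q. q \<in> Q \<Longrightarrow> cl q < m"
    and disj: "\<And>q q'. q \<in> Q \<Longrightarrow> q' \<in> Q \<Longrightarrow> q \<noteq> q' \<Longrightarrow> cl q = cl q' \<Longrightarrow> \<psi> q x = 0 \<or> \<psi> q' x = 0"
    and one: "q0 \<in> Q" "1 \<le> \<psi> q0 x"
  shows "(\<Sum>q\<in>Q. pou Q cl \<psi> q x) = 1"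
proof -
  let ?S = "\<lambda>c. pou_sum Q cl \<psi> c x"
  have SS: "?S (Suc c) = ?S c + (\<Sum>q\<in>{q\<in>Q. cl q = c}. \<psi> q x)" for c
  proof -
    have "{q\<in>Q. cl q < Suc c} = {q\<in>Q. cl q < c} \<union> {q\<in>Q. cl q = c}" by auto
    thus ?thesis unfolding pou_sum_def using Q(1) by (simp only:) (rule sum.union_disjoint, auto)
  qed
  have S0: "0 \<le> ?S c" for c unfolding pou_sum_def using Q by (intro sum_nonneg) auto
  have cls: "(\<Sum>q\<in>{q\<in>Q. cl q = c}. pou Q cl \<psi> q x) = min 1 (?S (Suc c)) - min 1 (?S c)" for c
  proof (cases "\<exists>q\<in>{q\<in>Q. cl q = c}. \<psi> q x \<noteq> 0")
    case False
    hence "(\<Sum>q\<in>{q\<in>Q. cl q = c}. pou Q cl \<psi> q x) = 0" "(\<Sum>q\<in>{q\<in>Q. cl q = c}. \<psi> q x) = 0"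
      by (auto intro!: sum.neutral pou_eq_0)
    thus ?thesis unfolding SS by simp
  next
    case True
    then obtain q where q: "q \<in> {q\<in>Q. cl q = c}" "\<psi> q x \<noteq> 0" by blast
    have z: "\<psi> q' x = 0" if "q' \<in> {q\<in>Q. cl q = c} - {q}" for q' using disj[of q q'] q that by auto
    have "(\<Sum>q\<in>{q\<in>Q. cl q = c}. pou Q cl \<psi> q x) = pou Q cl \<psi> q x"
      using q Q(1) z by (subst sum.remove[of _ q]) (auto intro!: sum.neutral pou_eq_0)
    moreover have "(\<Sum>q\<in>{q\<in>Q. cl q = c}. \<psi> q x) = \<psi> q x"
      using q Q(1) z by (subst sum.remove[of _ q]) (auto intro!: sum.neutral)
    moreover have "cl q = c" using q by simp
    ultimately show ?thesis unfolding SS pou_def by (auto simp: max_def min_def)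
  qed
  have "(\<Sum>q\<in>Q. pou Q cl \<psi> q x) = (\<Sum>c<m. \<Sum>q\<in>{q\<in>Q. cl q = c}. pou Q cl \<psi> q x)"
    by (rule sum.group[symmetric]) (use Q in auto)
  also have "\<dots> = (\<Sum>c<m. min 1 (?S (Suc c)) - min 1 (?S c))" unfolding cls ..
  also have "\<dots> = min 1 (?S m) - min 1 (?S 0)" by (rule sum_lessThan_telescope)
  also have "?S 0 = 0" by (simp add: pou_sum_def)
  also have "1 \<le> ?S m"
  proof -
    have "\<psi> q0 x \<le> ?S m" unfolding pou_sum_def by (rule member_le_sum) (use Q one in auto)
    thus ?thesis using one by linarith
  qed
  hence "min 1 (?S m) - min 1 0 = 1" by simp
  finally show ?thesis .
qed

definition coords :: "(real^'d::finite \<Rightarrow> real) set" where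
  "coords = (\<lambda>e x. x $ e) ` UNIV"

lemma coords_props: "finite (coords :: (real^'d::finite \<Rightarrow> real) set)" "unit_units (coords :: (real^'d \<Rightarrow> real) set)"
  "card (coords :: (real^'d \<Rightarrow> real) set) \<le> CARD('d)"
  by (auto simp: coords_def unit_units_def mem_box_cart intro: card_image_le)

text \<open>A trapezoid that equals 1 on the box between \<open>lo\<close> and \<open>up\<close> and
  falls with slope \<kappa> in the l1 distance from it.\<close>

definition bump :: "real \<Rightarrow> ('d::finite \<Rightarrow> real) \<Rightarrow> ('d \<Rightarrow> real) \<Rightarrow> real^'d \<Rightarrow> real" where
  "bump \<kappa> lo up x = max 0 (1 - \<kappa> * (\<Sum>e\<in>UNIV. max 0 (lo e - x $ e) + max 0 (x $ e - up e)))"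

text \<open>The layers compute in turn the one-sided distances, the bumps, the class sums, their
  prefix sums, the two truncated terms of \<open>pou\<close>, and the linear combinations. Summing
  within classes before forming prefix sums keeps the cost linear in \<open>card Q\<close> up to
  \<open>m * m\<close>. Outputs are cut at 0 like every unit, so signed combinations have to be
  split into two parts by the choice of \<open>a\<close>.\<close>

lemma circ_pou:
  fixes lo up :: "'q \<Rightarrow> 'd::finite \<Rightarrow> real" and a :: "'i \<Rightarrow> 'q \<Rightarrow> real"
  assumes Q: "finite Q" and lu: "\<And>q e. q \<in> Q \<Longrightarrow> \<bar>lo q e\<bar> \<le> 1 \<and> \<bar>up q e\<bar> \<le> 1" and cl: "\<And>q. q \<in> Q \<Longrightarrow> cl q < m"
    and I: "finite I" and a: "\<And>i q. i \<in> I \<Longrightarrow> q \<in> Q \<Longrightarrow> \<bar>a i q\<bar> \<le> 1"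
    and M: "2 \<le> M" "\<And>q. q \<in> Q \<Longrightarrow> 0 \<le> \<kappa> q \<and> \<kappa> q * (2 * real CARD('d)) \<le> M" "3 * real (card Q) \<le> M" "real m \<le> M"
  defines "\<psi> \<equiv> \<lambda>q. bump (\<kappa> q) (lo q) (up q)"
  shows "circ M 6 (12 * CARD('d) + card Q * (6 * CARD('d) + 11 + 3 * card I) + m * m + 4 * m + card I) coords
    (coords \<union> (\<lambda>i x. max 0 (\<Sum>q\<in>Q. a i q * pou Q cl \<psi> q x)) ` I)"
proof -
  let ?d = "CARD('d)"
  let ?X = "coords :: (real^'d \<Rightarrow> real) set"
  have passX: "layer M (2 * ?d) F ?X" if "?X \<subseteq> F" for F
    by (rule layer_mono[OF layer_pass[OF coords_props(1) unit_units_nonneg[OF coords_props(2)] _ that, of M]])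
      (use coords_props(3)[where 'd='d] M(1) in auto)
  have \<psi>0: "0 \<le> \<psi> q x" for q x by (simp add: \<psi>_def bump_def)
  have pass\<psi>: "layer M (card Q * 2) F (\<psi> ` Q)" if "\<psi> ` Q \<subseteq> F" for F
    by (rule layer_image_const[OF Q]) (use that M(1) \<psi>0 in \<open>auto intro!: neuron_pass\<close>)
  define T where "T = (\<lambda>c x. \<Sum>q\<in>{q\<in>Q. cl q = c}. \<psi> q x)"
  define S where "S = (\<lambda>c x. pou_sum Q cl \<psi> c x)"
  have S0: "0 \<le> S c x" for c x unfolding S_def pou_sum_def by (intro sum_nonneg) (use \<psi>0 in auto)
  have T0: "0 \<le> T c x" for c x unfolding T_def by (intro sum_nonneg) (use \<psi>0 in auto)
  have ST: "S c x = (\<Sum>c'<c. T c' x)" for c x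
    unfolding S_def T_def pou_sum_def
  proof -
    have "(\<Sum>c'<c. \<Sum>q\<in>{q\<in>Q. cl q = c'}. \<psi> q x) = (\<Sum>c'<c. \<Sum>q\<in>{q\<in>{q\<in>Q. cl q < c}. cl q = c'}. \<psi> q x)"
      by (intro sum.cong refl) auto
    also have "\<dots> = (\<Sum>q\<in>{q\<in>Q. cl q < c}. \<psi> q x)" by (rule sum.group) (use Q in auto)
    finally show "(\<Sum>q\<in>{q\<in>Q. cl q < c}. \<psi> q x) = (\<Sum>c'<c. \<Sum>q\<in>{q\<in>Q. cl q = c'}. \<psi> q x)" ..
  qed
  define hl where "hl = (\<lambda>(q, e, b) x. if b then max 0 (lo q e - x $ e) else max 0 (x $ e - up q e))"
  let ?I1 = "Q \<times> (UNIV :: 'd set) \<times> (UNIV :: bool set)"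
  let ?H1 = "?X \<union> hl ` ?I1"
  let ?H2 = "?X \<union> \<psi> ` Q"
  let ?H3 = "?X \<union> \<psi> ` Q \<union> T ` {..<m}"
  let ?H4 = "?X \<union> \<psi> ` Q \<union> S ` {..<m}"
  define A where "A = (\<lambda>q x. max 0 (S (cl q) x + \<psi> q x - 1))"
  define Bc where "Bc = (\<lambda>c x. max 0 (S c x - 1))"
  let ?H5 = "?X \<union> \<psi> ` Q \<union> A ` Q \<union> Bc ` {..<m}"
  have "layer M (card ?I1 * 2) ?X (hl ` ?I1)"
  proof (rule layer_image_const)
    fix i assume i: "i \<in> ?I1"
    obtain q e b where ieq: "i = (q, e, b)" by (cases i) auto
    have q: "q \<in> Q" using i ieq by auto
    have "neuron M ?X (card {()} + 1) (hl i)"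
      by (rule neuron_sum[where c="\<lambda>_. if b then - 1 else 1" and u="\<lambda>_ x. x $ e" and b="if b then lo q e else - up q e"])
        (use lu[OF q, of e] M(1) in \<open>auto simp: hl_def ieq coords_def\<close>)
    thus "neuron M ?X 2 (hl i)" by (simp add: eval_nat_numeral)
  qed (use Q in auto)
  from circ_layer[OF layer_Un[OF passX[OF order_refl] this]]
  have c1: "circ M 1 (2 * ?d + card ?I1 * 2) ?X ?H1" .
  have "layer M (card Q * (2 * ?d + 1)) ?H1 (\<psi> ` Q)"
  proof (rule layer_image_const[OF Q])
    fix q assume q: "q \<in> Q"
    have "neuron M ?H1 (card ((UNIV :: 'd set) \<times> (UNIV :: bool set)) + 1) (\<psi> q)"
    proof (rule neuron_sum[where c="\<lambda>_. - \<kappa> q" and u="\<lambda>(e, b). hl (q, e, b)" and b=1])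
      fix x :: "real^'d"
      have "(\<Sum>(e, b)\<in>(UNIV :: 'd set) \<times> (UNIV :: bool set). - \<kappa> q * hl (q, e, b) x) = - \<kappa> q * (\<Sum>e\<in>UNIV. \<Sum>b\<in>UNIV. hl (q, e, b) x)"
        by (simp only: sum.cartesian_product[symmetric] sum_distrib_left)
      also have "\<dots> = - \<kappa> q * (\<Sum>e\<in>UNIV. max 0 (lo q e - x $ e) + max 0 (x $ e - up q e))"
        by (simp add: UNIV_bool hl_def add.commute)
      finally show "\<psi> q x = max 0 ((\<Sum>i\<in>UNIV \<times> UNIV. - \<kappa> q * (case i of (e, b) \<Rightarrow> hl (q, e, b)) x) + 1)"
        by (simp add: \<psi>_def bump_def case_prod_unfold)
    qed (use q M(1) M(2)[OF q] in \<open>auto simp: mult_ac\<close>)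
    thus "neuron M ?H1 (2 * ?d + 1) (\<psi> q)" by (simp add: card_cartesian_product mult.commute)
  qed
  from circ_then_layer[OF c1 layer_Un[OF passX this]]
  have c2: "circ M 2 (2 * ?d + card ?I1 * 2 + (2 * ?d + card Q * (2 * ?d + 1))) ?X ?H2" by (simp add: eval_nat_numeral)
  have sub3: "?X \<subseteq> ?H2" "\<psi> ` Q \<subseteq> ?H2" by auto
  have "layer M (\<Sum>c<m. card {q\<in>Q. cl q = c} + 1) ?H2 (T ` {..<m})"
  proof (rule layer_image)
    fix c assume "c \<in> {..<m}"
    have "card {q\<in>Q. cl q = c} \<le> card Q" using Q by (intro card_mono) auto
    hence "real (card {q\<in>Q. cl q = c}) \<le> M" using M(3) by linarith
    thus "neuron M ?H2 (card {q\<in>Q. cl q = c} + 1) (T c)"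
      by (intro neuron_sum[where c="\<lambda>_. 1" and u=\<psi> and b=0]) (use Q M(1) T0[of c] in \<open>auto simp: T_def\<close>)
  qed simp
  moreover have "(\<Sum>c<m. card {q\<in>Q. cl q = c} + 1) = card Q + m"
  proof -
    have "(\<Sum>c<m. card {q\<in>Q. cl q = c}) = (\<Sum>c<m. \<Sum>q\<in>{q\<in>Q. cl q = c}. 1)" by simp
    also have "\<dots> = (\<Sum>q\<in>Q. 1)" by (rule sum.group) (use Q cl in auto)
    finally show ?thesis by (simp only: sum.distrib) simp
  qed
  ultimately have "layer M (card Q + m) ?H2 (T ` {..<m})" by simp
  from circ_then_layer[OF c2 layer_Un[OF layer_Un[OF passX[OF sub3(1)] pass\<psi>[OF sub3(2)]] this]]
  have c3: "circ M 3 (2 * ?d + card ?I1 * 2 + (2 * ?d + card Q * (2 * ?d + 1)) + (2 * ?d + card Q * 2 + (card Q + m))) ?X ?H3"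
    by (simp add: eval_nat_numeral)
  have sub4: "?X \<subseteq> ?H3" "\<psi> ` Q \<subseteq> ?H3" by auto
  have "layer M (card {..<m} * (m + 1)) ?H3 (S ` {..<m})"
  proof (rule layer_image_const)
    fix c assume c: "c \<in> {..<m}"
    have "neuron M ?H3 (card {..<c} + 1) (S c)"
      by (intro neuron_sum[where c="\<lambda>_. 1" and u=T and b=0]) (use c M(1,4) S0[of c] in \<open>auto simp: ST\<close>)
    thus "neuron M ?H3 (m + 1) (S c)" by (rule neuron_mono) (use c in auto)
  qed simp
  from circ_then_layer[OF c3 layer_Un[OF layer_Un[OF passX[OF sub4(1)] pass\<psi>[OF sub4(2)]] this]]
  have c4: "circ M 4 (2 * ?d + card ?I1 * 2 + (2 * ?d + card Q * (2 * ?d + 1)) + (2 * ?d + card Q * 2 + (card Q + m))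
      + (2 * ?d + card Q * 2 + m * (m + 1))) ?X ?H4"
    by (simp add: eval_nat_numeral)
  have sub5: "?X \<subseteq> ?H4" "\<psi> ` Q \<subseteq> ?H4" by auto
  have L5a: "layer M (card Q * 3) ?H4 (A ` Q)"
  proof (rule layer_image_const[OF Q])
    fix q assume q: "q \<in> Q"
    have "neuron M ?H4 (card (UNIV :: bool set) + 1) (A q)"
      by (rule neuron_sum[where c="\<lambda>_. 1" and u="\<lambda>b. if b then S (cl q) else \<psi> q" and b="- 1"])
        (use q cl M(1) in \<open>auto simp: A_def UNIV_bool\<close>)
    thus "neuron M ?H4 3 (A q)" by (simp add: eval_nat_numeral)
  qed
  have L5b: "layer M (card {..<m} * 2) ?H4 (Bc ` {..<m})"
  proof (rule layer_image_const)
    fix c assume c: "c \<in> {..<m}"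
    have "neuron M ?H4 (card {()} + 1) (Bc c)"
      by (rule neuron_sum[where c="\<lambda>_. 1" and u="\<lambda>_. S c" and b="- 1"]) (use c M(1) in \<open>auto simp: Bc_def\<close>)
    thus "neuron M ?H4 2 (Bc c)" by (simp add: eval_nat_numeral)
  qed simp
  from circ_then_layer[OF c4 layer_Un[OF layer_Un[OF layer_Un[OF passX[OF sub5(1)] pass\<psi>[OF sub5(2)]] L5a] L5b]]
  have c5: "circ M 5 (2 * ?d + card ?I1 * 2 + (2 * ?d + card Q * (2 * ?d + 1)) + (2 * ?d + card Q * 2 + (card Q + m))
      + (2 * ?d + card Q * 2 + m * (m + 1)) + (2 * ?d + card Q * 2 + card Q * 3 + m * 2)) ?X ?H5"
    by (simp add: eval_nat_numeral)
  have L6: "layer M (card I * (3 * card Q + 1)) ?H5 ((\<lambda>i x. max 0 (\<Sum>q\<in>Q. a i q * pou Q cl \<psi> q x)) ` I)"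
  proof (rule layer_image_const[OF I])
    fix i assume i: "i \<in> I"
    let ?K = "Q \<times> {0::nat, 1, 2}"
    let ?co = "\<lambda>(q, t). if t = (1::nat) then - a i q else a i q"
    let ?un = "\<lambda>(q, t). if t = (0::nat) then \<psi> q else if t = 1 then A q else Bc (cl q)"
    have "neuron M ?H5 (card ?K + 1) (\<lambda>x. max 0 (\<Sum>q\<in>Q. a i q * pou Q cl \<psi> q x))"
    proof (rule neuron_sum[where c="?co" and u="?un" and b=0])
      have "(\<Sum>k\<in>?K. \<bar>?co k\<bar>) \<le> (\<Sum>k\<in>?K. 1)" by (intro sum_mono) (use a[OF i] in auto)
      also have "\<dots> = 3 * real (card Q)" by (simp add: card_cartesian_product)
      finally show "(\<Sum>k\<in>?K. \<bar>?co k\<bar>) \<le> M" using M(3) by linarith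
      fix x :: "real^'d"
      have "(\<Sum>k\<in>?K. ?co k * ?un k x) = (\<Sum>q\<in>Q. \<Sum>t\<in>{0::nat, 1, 2}. ?co (q, t) * ?un (q, t) x)"
        unfolding sum.cartesian_product by (intro sum.cong) auto
      also have "\<dots> = (\<Sum>q\<in>Q. a i q * pou Q cl \<psi> q x)"
        by (intro sum.cong refl) (simp add: pou_def A_def Bc_def S_def algebra_simps)
      finally show "max 0 (\<Sum>q\<in>Q. a i q * pou Q cl \<psi> q x) = max 0 ((\<Sum>k\<in>?K. ?co k * ?un k x) + 0)" by simp
    qed (use Q cl M(1) in auto)
    moreover have "card ?K + 1 = 3 * card Q + 1" by (simp add: card_cartesian_product)
    ultimately show "neuron M ?H5 (3 * card Q + 1) (\<lambda>x. max 0 (\<Sum>q\<in>Q. a i q * pou Q cl \<psi> q x))"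
      by (simp only:)
  qed
  have "?X \<subseteq> ?H5" by auto
  from circ_then_layer[OF c5 layer_Un[OF passX[OF this] L6]]
  have "circ M 6 (2 * ?d + card ?I1 * 2 + (2 * ?d + card Q * (2 * ?d + 1)) + (2 * ?d + card Q * 2 + (card Q + m))
      + (2 * ?d + card Q * 2 + m * (m + 1)) + (2 * ?d + card Q * 2 + card Q * 3 + m * 2) + (2 * ?d + card I * (3 * card Q + 1))) ?X
     (coords \<union> (\<lambda>i x. max 0 (\<Sum>q\<in>Q. a i q * pou Q cl \<psi> q x)) ` I)"
    by (simp add: eval_nat_numeral)
  thus ?thesis
    by (rule circ_mono[OF _ order_refl]) (simp add: card_cartesian_product algebra_simps)
qed

text \<open>The slope 4 * 2^j makes the bump vanish at a quarter of a side from its cell. This keeps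
  its support within the big cube and separates cells of one level whose indices differ by at least
  two in some coordinate.\<close>

lemma bump_dyadic:
  fixes x :: "real^'d::finite"
  assumes "1 \<le> j"
  defines "\<psi> \<equiv> \<lambda>k. bump (4 * 2 ^ j) (\<lambda>e. real (k e) / 2 ^ j) (\<lambda>e. (real (k e) + 1) / 2 ^ j)"
  shows "x \<in> dyadic_cell j k \<Longrightarrow> \<psi> k x = 1"
    and "\<psi> k x \<noteq> 0 \<Longrightarrow> real (k e) - 1/4 < 2 ^ j * x $ e \<and> 2 ^ j * x $ e < real (k e) + 5/4"
proof -
  have sc: "max 0 (real (k e) / 2 ^ j - x $ e) + max 0 (x $ e - (real (k e) + 1) / 2 ^ j) =
     (max 0 (real (k e) - 2 ^ j * x $ e) + max 0 (2 ^ j * x $ e - (real (k e) + 1))) / 2 ^ j" for e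
    by (auto simp: max_def field_simps)
  have \<psi>: "\<psi> k x = max 0 (1 - 4 * (\<Sum>e\<in>UNIV. max 0 (real (k e) - 2 ^ j * x $ e) + max 0 (2 ^ j * x $ e - (real (k e) + 1))))"
    unfolding \<psi>_def bump_def sc sum_divide_distrib[symmetric] by simp
  show "\<psi> k x = 1" if "x \<in> dyadic_cell j k"
  proof -
    have "max 0 (real (k e) - 2 ^ j * x $ e) + max 0 (2 ^ j * x $ e - (real (k e) + 1)) = 0" for e
      using that by (auto simp: dyadic_cell_def max_def dest!: spec[of _ e])
    thus ?thesis unfolding \<psi> by simp
  qed
  show "real (k e) - 1/4 < 2 ^ j * x $ e \<and> 2 ^ j * x $ e < real (k e) + 5/4" if "\<psi> k x \<noteq> 0"
  proof -
    define g where "g e = max 0 (real (k e) - 2 ^ j * x $ e) + max 0 (2 ^ j * x $ e - (real (k e) + 1))" for e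
    have "4 * (\<Sum>e\<in>UNIV. g e) < 1" using that unfolding \<psi> g_def[symmetric] by (auto simp: max_def split: if_splits)
    moreover have "g e \<le> (\<Sum>e\<in>UNIV. g e)" by (rule member_le_sum) (auto simp: g_def)
    ultimately have "4 * g e < 1" by linarith
    moreover have "real (k e) - 2 ^ j * x $ e \<le> g e" "2 ^ j * x $ e - (real (k e) + 1) \<le> g e" by (auto simp: g_def)
    ultimately show ?thesis by linarith
  qed
qed

section \<open>The blended local polynomials as a circuit\<close>

lemma absorb_power2:
  assumes "1 \<le> J" "Z \<le> 2 ^ z" shows "Z * 2 ^ (k * J) \<le> (2::real) ^ ((k + z) * J)"
proof -
  have "Z * 2 ^ (k * J) \<le> 2 ^ z * 2 ^ (k * J)" using assms(2) by (intro mult_right_mono) auto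
  also have "\<dots> = 2 ^ (z + k * J)" by (simp add: power_add)
  also have "\<dots> \<le> 2 ^ ((k + z) * J)" using assms(1) by (intro power_increasing) (auto simp: add_mult_distrib)
  finally show ?thesis .
qed

text \<open>The number of classes is of order J + 1, and their prefix sums cost its square; this
  comparison charges that cost to 2^J.\<close>

lemma Suc_power2_le: "(J + 1)\<^sup>2 \<le> 4 * 2 ^ (J::nat)"
proof (induction J rule: less_induct)
  case (less J)
  show ?case
  proof (cases "J < 3")
    case True
    hence "J \<in> {0,1,2}" by auto
    thus ?thesis by (auto simp: power2_eq_square)
  next
    case False
    then obtain i where i: "J = Suc i" "2 \<le> i" by (cases J) auto
    have "2 * i + 3 \<le> (i + 1)\<^sup>2" using i(2) by (cases i) (auto simp: power2_eq_square)
    hence "(J + 1)\<^sup>2 \<le> 2 * (i + 1)\<^sup>2" by (simp add: i power2_eq_square algebra_simps)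
    also have "\<dots> \<le> 2 * (4 * 2 ^ i)" using less[of i] i by simp
    finally show ?thesis by (simp add: i)
  qed
qed

lemma unit_cube_eq_cube: "(unit_cube :: (real^'d::finite) set) = cube 0 1"
  unfolding cube_eq_cbox by (intro arg_cong[where f="cbox 0"]) (simp add: vec_eq_iff)

text \<open>The sum over cells and the sum over monomials are interchanged: for each \<mu> the
  combination of the a \<mu> q with the partition of unity is one function, and only its product
  with the monomial is approximated. This makes N products, two per monomial for the two signs, and
  their errors are magnified by the normalisation A.\<close>

lemma circ_polynomial_pou:
  fixes lo up :: "'q \<Rightarrow> 'd::finite \<Rightarrow> real" and a :: "('d \<Rightarrow> nat) \<Rightarrow> 'q \<Rightarrow> real"
  assumes Q: "finite Q" and lu: "\<And>q e. q \<in> Q \<Longrightarrow> \<bar>lo q e\<bar> \<le> 1 \<and> \<bar>up q e\<bar> \<le> 1" and cl: "\<And>q. q \<in> Q \<Longrightarrow> cl q < m"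
    and a: "\<And>\<mu> q. q \<in> Q \<Longrightarrow> \<bar>a \<mu> q\<bar> \<le> A" and A: "0 < A" and B: "0 \<le> B" and n: "0 < n"
    and M: "\<And>q. q \<in> Q \<Longrightarrow> 0 \<le> \<kappa> q \<and> \<kappa> q * (2 * real CARD('d)) \<le> M" "3 * real (card Q) \<le> M" "real m \<le> M"
      "2 * (real n)\<^sup>2 + 2 * real n + 4 \<le> M" "A * (2 * real r ^ CARD('d)) \<le> M" "B \<le> M"
  defines "\<psi> \<equiv> \<lambda>q. bump (\<kappa> q) (lo q) (up q)"
  assumes pou1: "\<And>x. x \<in> unit_cube \<Longrightarrow> (\<Sum>q\<in>Q. pou Q cl \<psi> q x) = 1"
  defines "N \<equiv> 2 * r ^ CARD('d)" and "l \<equiv> 1 + CARD('d) * r"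
  shows "\<exists>w D. D \<le> 8 + N * (l * (6 + 6 * s)) \<and>
    circ M D (12 * CARD('d) + card Q * (6 * CARD('d) + 11 + 3 * N) + m * m + 4 * m + N +
       N * (l * ((6 + 6 * s) * (4 * (CARD('d) + 2 * N + 1 + n) + 30))) + 2 * (N + 1) + 3) coords {w} \<and>
    (\<forall>x\<in>unit_cube. 0 \<le> w x \<and> w x \<le> 2 * B \<and>
      (\<forall>y. \<bar>y\<bar> \<le> B \<longrightarrow> \<bar>w x - B - y\<bar> \<le> \<bar>(\<Sum>q\<in>Q. pou Q cl \<psi> q x * (\<Sum>\<mu>\<in>PiE UNIV (\<lambda>_. {..<r}). a \<mu> q * (\<Prod>e\<in>UNIV. (x $ e) ^ \<mu> e))) - y\<bar>
          + A * (real N * (real l / real n ^ (2 * s)))))"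
proof -
  let ?P = "PiE (UNIV :: 'd set) (\<lambda>_. {..<r})"
  let ?I = "?P \<times> {1, - 1 :: real}"
  have M4: "4 \<le> M" using M(4) by (smt (verit) of_nat_0_le_iff zero_le_power2)
  have fP: "finite ?P" by (rule finite_PiE) auto
  have fI: "finite ?I" using fP by simp
  have cI: "card ?I = N" by (simp add: card_cartesian_product card_PiE N_def)
  define \<phi> where "\<phi> = pou Q cl \<psi>"
  have \<phi>0: "0 \<le> \<phi> q x" for q x unfolding \<phi>_def by (rule pou_nonneg) (simp add: \<psi>_def bump_def)
  \<comment> \<open>Positive and negative part of the blended coefficient of the monomial \<mu>,
    divided by A. As the partition of unity sums to 1, both lie in [0, 1] and qualify as
    factors.\<close>
  define U where "U = (\<lambda>(\<mu>, t) x. max 0 (\<Sum>q\<in>Q. t * (a \<mu> q / A) * \<phi> q x))"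
  have aA: "\<bar>t * (a \<mu> q / A)\<bar> \<le> 1" if "t \<in> {1, - 1}" "q \<in> Q" for t \<mu> q
    using that a[of q \<mu>] A by (auto simp: abs_mult abs_divide divide_le_eq)
  have C1: "circ M 6 (12 * CARD('d) + card Q * (6 * CARD('d) + 11 + 3 * N) + m * m + 4 * m + N) coords (coords \<union> U ` ?I)"
  proof -
    have "circ M 6 (12 * CARD('d) + card Q * (6 * CARD('d) + 11 + 3 * card ?I) + m * m + 4 * m + card ?I) coords
      (coords \<union> (\<lambda>i x. max 0 (\<Sum>q\<in>Q. (\<lambda>(\<mu>, t) q. t * (a \<mu> q / A)) i q * pou Q cl (\<lambda>q. bump (\<kappa> q) (lo q) (up q)) q x)) ` ?I)"
      by (rule circ_pou[OF Q lu cl fI _ _ M(1-3)]) (use a A M4 in \<open>auto simp: abs_mult divide_le_eq\<close>)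
    moreover have "(\<lambda>i x. max 0 (\<Sum>q\<in>Q. (\<lambda>(\<mu>, t) q. t * (a \<mu> q / A)) i q * pou Q cl (\<lambda>q. bump (\<kappa> q) (lo q) (up q)) q x)) = U"
      by (auto simp: U_def \<phi>_def \<psi>_def fun_eq_iff)
    ultimately show ?thesis by (simp only: cI)
  qed
  let ?F = "coords \<union> U ` ?I"
  have Ux: "0 \<le> U i x \<and> U i x \<le> 1" if i: "i \<in> ?I" and x: "x \<in> unit_cube" for i x
  proof -
    obtain \<mu> t where mt: "i = (\<mu>, t)" "t \<in> {1, - 1}" using i by auto
    have "(\<Sum>q\<in>Q. t * (a \<mu> q / A) * \<phi> q x) \<le> (\<Sum>q\<in>Q. 1 * \<phi> q x)"
      by (intro sum_mono mult_right_mono \<phi>0 order_trans[OF abs_ge_self aA[OF mt(2)]])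
    also have "\<dots> = 1" using pou1[OF x] by (simp add: \<phi>_def)
    finally show ?thesis by (simp add: U_def mt)
  qed
  have F: "finite ?F" "unit_units ?F" "card ?F \<le> CARD('d) + N"
  proof -
    show "finite ?F" using fI coords_props(1) by blast
    show "unit_units ?F" using Ux coords_props(2)[where 'd='d] by (auto simp: unit_units_def)
    show "card ?F \<le> CARD('d) + N"
      using card_Un_le[of coords "U ` ?I"] card_image_le[OF fI, of U] coords_props(3)[where 'd='d] by (simp add: cI)
  qed
  obtain es :: "'d list" where es: "set es = UNIV" "distinct es" using finite_distinct_list[OF finite[of "UNIV :: 'd set"]] by blast
  \<comment> \<open>The factors of one product: the blended coefficient, and each coordinate as
    often as its exponent says.\<close>
  define us where "us = (\<lambda>i. U i # concat (map (\<lambda>e. replicate (fst i e) (\<lambda>x::real^'d. x $ e)) es))"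
  have us_prod: "prod_list (map (\<lambda>u. u x) (us i)) = U i x * (\<Prod>e\<in>UNIV. (x $ e) ^ fst i e)" for i x
  proof -
    have "prod_list (map (\<lambda>u. u x) (concat (map (\<lambda>e. replicate (fst i e) (\<lambda>x::real^'d. x $ e)) es'))) = prod_list (map (\<lambda>e. (x $ e) ^ fst i e) es')" for es'
      by (induction es') (auto simp: prod_list_replicate)
    thus ?thesis using prod.distinct_set_conv_list[OF es(2), of "\<lambda>e. (x $ e) ^ fst i e"] es(1) by (simp add: us_def)
  qed
  have us_ok: "us i \<noteq> [] \<and> length (us i) \<le> l \<and> set (us i) \<subseteq> ?F" if i: "i \<in> ?I" for i
  proof -
    have "fst i e \<le> r" for e using i by (auto simp: PiE_def Pi_def less_imp_le)
    hence "length (concat (map (\<lambda>e. replicate (fst i e) (\<lambda>x::real^'d. x $ e)) es')) \<le> length es' * r" for es'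
      by (induction es') (auto intro: add_mono)
    moreover have "length es = CARD('d)" using distinct_card[OF es(2)] es(1) by simp
    ultimately have "length (us i) \<le> l" by (simp add: us_def l_def) (metis)
    moreover have "set (us i) \<subseteq> ?F" using i by (auto simp: us_def coords_def)
    ultimately show ?thesis by (simp add: us_def)
  qed
  have "\<exists>w D. D \<le> card ?I * (l * (6 + 6 * s)) \<and>
     circ M D (card ?I * (l * ((6 + 6 * s) * (4 * (CARD('d) + N + card ?I + 1 + n) + 30)))) ?F (?F \<union> w ` ?I) \<and> unit_units (?F \<union> w ` ?I) \<and>
     (\<forall>i\<in>?I. \<forall>x\<in>unit_cube. \<bar>w i x - prod_list (map (\<lambda>u. u x) (us i))\<bar> \<le> real l / real n ^ (2 * s))"
    by (rule circ_prod_family[OF fI _ F n M(4)]) (rule us_ok)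
  note ex = this[unfolded cI us_prod]
  obtain w D where D: "D \<le> N * (l * (6 + 6 * s))"
    and C2: "circ M D (N * (l * ((6 + 6 * s) * (4 * (CARD('d) + N + N + 1 + n) + 30)))) ?F (?F \<union> w ` ?I)"
    and "unit_units (?F \<union> w ` ?I)"
    and werr: "\<forall>i\<in>?I. \<forall>x\<in>unit_cube. \<bar>w i x - U i x * (\<Prod>e\<in>UNIV. (x $ e) ^ fst i e)\<bar> \<le> real l / real n ^ (2 * s)"
    using ex by (elim exE conjE) (rule that, assumption+)
  define g where "g = (\<lambda>x. A * (\<Sum>i\<in>?I. snd i * w i x))"
  \<comment> \<open>\<open>v 1 - v (- 1)\<close> is g clipped to [-B, B] and raised by B. The offset
    makes the output non-negative, and clipping cannot increase the distance to a value y with |y|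
    \<le> B.\<close>
  define v where "v = (\<lambda>t x. max 0 (g x + t * B))"
  define z where "z = (\<lambda>x. max 0 (v 1 x - v (- 1) x))"
  have L1: "layer M (card {1, - 1 :: real} * (N + 1)) (?F \<union> w ` ?I) (v ` {1, - 1})"
  proof (rule layer_image_const)
    fix t :: real assume t: "t \<in> {1, - 1}"
    have "neuron M (?F \<union> w ` ?I) (card ?I + 1) (v t)"
    proof (rule neuron_sum[where c="\<lambda>i. A * snd i" and u=w and b="t * B"])
      have "(\<Sum>i\<in>?I. \<bar>A * snd i\<bar>) = (\<Sum>i\<in>?I. A)" using A by (intro sum.cong) (auto simp: abs_mult)
      also have "\<dots> = A * (2 * real r ^ CARD('d))" unfolding sum_constant cI by (simp add: N_def)
      finally show "(\<Sum>i\<in>?I. \<bar>A * snd i\<bar>) \<le> M" using M(5) by simp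
      show "\<bar>t * B\<bar> \<le> M" using t M(6) B by (auto simp: abs_mult)
      fix x show "v t x = max 0 ((\<Sum>i\<in>?I. A * snd i * w i x) + t * B)"
        by (simp only: v_def g_def sum_distrib_left mult.assoc)
    qed (use fI in auto)
    thus "neuron M (?F \<union> w ` ?I) (N + 1) (v t)" by (simp only: cI)
  qed simp
  have "neuron M (v ` {1, - 1}) (card {1, - 1 :: real} + 1) z"
    by (rule neuron_sum[where c="\<lambda>t. t" and u=v and b=0]) (use M4 in \<open>auto simp: z_def\<close>)
  hence L2: "layer M 3 (v ` {1, - 1}) {z}" by (auto intro!: layer_single simp: eval_nat_numeral)
  have e: "card {1, - 1 :: real} = 2" "CARD('d) + N + N + 1 + n = CARD('d) + 2 * N + 1 + n" "Suc (Suc (6 + D)) = 8 + D"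
    by auto
  note C = circ_then_layer[OF circ_then_layer[OF circ_comp[OF C1 C2] L1] L2, unfolded e]
  have zx: "z x = max (- B) (min B (g x)) + B" for x using B by (auto simp: z_def v_def max_def min_def)
  have "\<bar>z x - B - y\<bar> \<le> \<bar>(\<Sum>q\<in>Q. pou Q cl \<psi> q x * (\<Sum>\<mu>\<in>?P. a \<mu> q * (\<Prod>e\<in>UNIV. (x $ e) ^ \<mu> e))) - y\<bar>
          + A * (real N * (real l / real n ^ (2 * s)))" if x: "x \<in> unit_cube" and y: "\<bar>y\<bar> \<le> B" for x y
  proof -
    define mo where "mo \<mu> = (\<Prod>e\<in>UNIV. (x $ e) ^ \<mu> e)" for \<mu>
    have "(\<Sum>i\<in>?I. snd i * (U i x * mo (fst i))) = (\<Sum>\<mu>\<in>?P. mo \<mu> * (U (\<mu>, 1) x - U (\<mu>, - 1) x))"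
      by (simp add: sum.cartesian_product[symmetric, where g="\<lambda>\<mu> t. t * (U (\<mu>, t) x * mo \<mu>)", unfolded case_prod_unfold, simplified] algebra_simps case_prod_unfold)
    also have "\<dots> = (\<Sum>\<mu>\<in>?P. mo \<mu> * (\<Sum>q\<in>Q. (a \<mu> q / A) * \<phi> q x))"
    proof (intro sum.cong refl arg_cong2[where f="(*)"])
      fix \<mu>
      have "(\<Sum>q\<in>Q. - 1 * (a \<mu> q / A) * \<phi> q x) = - (\<Sum>q\<in>Q. (a \<mu> q / A) * \<phi> q x)"
        by (simp add: sum_negf)
      thus "U (\<mu>, 1) x - U (\<mu>, - 1) x = (\<Sum>q\<in>Q. (a \<mu> q / A) * \<phi> q x)"
        by (simp add: U_def max_def)
    qed
    also have "A * \<dots> = (\<Sum>q\<in>Q. \<phi> q x * (\<Sum>\<mu>\<in>?P. a \<mu> q * mo \<mu>))"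
      using A by (simp add: sum_distrib_left mult_ac) (rule sum.swap)
    finally have tgt: "A * (\<Sum>i\<in>?I. snd i * (U i x * mo (fst i))) = (\<Sum>q\<in>Q. \<phi> q x * (\<Sum>\<mu>\<in>?P. a \<mu> q * mo \<mu>))" .
    have "\<bar>g x - A * (\<Sum>i\<in>?I. snd i * (U i x * mo (fst i)))\<bar> = A * \<bar>\<Sum>i\<in>?I. snd i * (w i x - U i x * mo (fst i))\<bar>"
      unfolding g_def right_diff_distrib[symmetric] abs_mult sum_subtractf[symmetric] using A by simp
    also have "\<bar>\<Sum>i\<in>?I. snd i * (w i x - U i x * mo (fst i))\<bar> \<le> (\<Sum>i\<in>?I. real l / real n ^ (2 * s))"
    proof (rule order_trans[OF sum_abs], rule sum_mono)
      fix i assume i: "i \<in> ?I"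
      have "\<bar>snd i\<bar> = 1" using i by auto
      thus "\<bar>snd i * (w i x - U i x * mo (fst i))\<bar> \<le> real l / real n ^ (2 * s)"
        using werr[rule_format, OF i x] by (simp add: abs_mult mo_def)
    qed
    also have "\<dots> = real N * (real l / real n ^ (2 * s))" unfolding sum_constant cI ..
    finally have "\<bar>g x - (\<Sum>q\<in>Q. \<phi> q x * (\<Sum>\<mu>\<in>?P. a \<mu> q * mo \<mu>))\<bar> \<le> A * (real N * (real l / real n ^ (2 * s)))"
      unfolding tgt using A by simp
    moreover have "\<bar>z x - B - y\<bar> \<le> \<bar>g x - y\<bar>" unfolding zx using y B by (auto simp: max_def min_def)
    ultimately show ?thesis unfolding \<phi>_def mo_def by linarith
  qed
  moreover have "0 \<le> z x \<and> z x \<le> 2 * B" for x unfolding zx using B by auto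
  moreover have "8 + D \<le> 8 + N * (l * (6 + 6 * s))" using D by simp
  ultimately show ?thesis using C by blast
qed

lemma ex_power2_ge: "\<exists>z. (x::real) \<le> 2 ^ z"
  using real_arch_pow[of 2 x] less_imp_le by fastforce

text \<open>The cells of the cover are coloured by their level and the parities of their indices.
  Cells of one colour have disjoint bumps, and the number of colours is linear in J. With
  \<open>n = 2 ^ J\<close> the multiplications cost of the order of 2^J \<le> 2^(J d), so the total
  is of the order of the number of cells.\<close>

theorem approx_circ:
  fixes f :: "real^'d::finite \<Rightarrow> real"
  assumes r: "0 < r" and p: "0 < p" and \<beta>: "0 < \<beta>" and bp: "real CARD('d) < \<beta> * p" and f: "continuous_on (cube 0 1) f"
    and K: "0 \<le> K" "\<And>h e lam. 0 < h \<Longrightarrow> 0 < lam \<Longrightarrow>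
       emeasure lborel (large_diff r h e f lam (cube 0 1)) \<le> ennreal (K * h powr (\<beta> * p) * lam powr (- p))"
    and B: "1 \<le> B" "\<And>x. x \<in> cube 0 1 \<Longrightarrow> \<bar>f x\<bar> \<le> B"
  shows "\<exists>(Dm::nat) (c::nat) C K. 0 \<le> C \<and> 0 \<le> K \<and> (\<forall>J\<ge>1. \<exists>D s w. D \<le> Dm \<and> real s \<le> C * 2 ^ (J * CARD('d)) \<and>
     circ (2 ^ (c * J)) D s coords {w} \<and>
     (\<forall>x\<in>unit_cube. 0 \<le> w x \<and> w x \<le> 2 * B \<and> \<bar>w x - B - f x\<bar> \<le> K * 2 powr (- \<beta> * real J)))"
proof -
  let ?d = "CARD('d)"
  obtain C1 :: real and c1 :: nat where cover: "\<forall>J\<ge>1. \<exists>Q :: (nat \<times> ('d \<Rightarrow> nat)) set. finite Q \<and> real (card Q) \<le> C1 * 2 ^ (J * ?d) \<and>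
     (\<forall>(j, k)\<in>Q. J \<le> j \<and> j \<le> c1 * (J + 1) \<and> k \<in> dyadic_idx j \<and> good_cell r f (2 powr (- \<beta> * real J)) j k) \<and>
     (\<forall>x\<in>cube 0 1. \<exists>(j, k)\<in>Q. x \<in> dyadic_cell j k)"
    using good_cover[OF r p bp f K] by blast
  define Z where "Z = real r ^ ?d * (B * (real (r + 1) ^ r) ^ ?d)"
  obtain z1 where z1: "Z \<le> 2 ^ z1" using ex_power2_ge by blast
  \<comment> \<open>The coefficients in global monomials are at most Z * 2^(j r d) with j \<le> 2 c1
    J, and z1 absorbs Z.\<close>
  define cA where "cA = 2 * c1 * r * ?d + z1"
  obtain zd where zd: "8 * real ?d \<le> 2 ^ zd" using ex_power2_ge by blast
  obtain zc where zc: "3 * C1 \<le> 2 ^ zc" using ex_power2_ge by blast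
  define E where "E = real (c1 + 1) * 2 ^ ?d"
  obtain zm where zm: "E \<le> 2 ^ zm" using ex_power2_ge by blast
  obtain zr where zr: "2 * real r ^ ?d \<le> 2 ^ zr" using ex_power2_ge by blast
  obtain zB where zB: "B \<le> 2 ^ zB" using ex_power2_ge by blast
  \<comment> \<open>One summand for each of the six requirements on the weight bound in
    \<open>circ_polynomial_pou\<close>; constant factors move into the exponent by
    \<open>absorb_power2\<close>, as J \<ge> 1.\<close>
  define c where "c = (2 * c1 + zd) + (?d + zc) + (1 + zm) + (2 + 3) + (cA + zr) + zB"
  \<comment> \<open>Large enough that the multiplication error n^(-2 s), magnified by A = 2^(cA J),
    stays below 2^(-\<beta> J).\<close>
  define s where "s = nat \<lceil>real cA + \<beta>\<rceil>"
  define N where "N = 2 * r ^ ?d"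
  define l where "l = 1 + ?d * r"
  define Cc where "Cc = 12 * real ?d + C1 * real (6 * ?d + 11 + 3 * N) + 4 * E\<^sup>2 + 4 * E + real N +
      real (N * (l * (6 + 6 * s))) * real (4 * (?d + 2 * N + 2) + 30) + real (2 * (N + 1) + 3)"
  have E0: "0 \<le> E" by (simp add: E_def)
  \<comment> \<open>\<open>s'\<close> is a copy of the constant \<open>s\<close>, whose name is
    rebound to the size of the circuit under the existential quantifier.\<close>
  have main: "\<exists>D s w. D \<le> 8 + N * (l * (6 + 6 * s')) \<and> real s \<le> Cc * 2 ^ (J * ?d) \<and>
     circ (2 ^ (c * J)) D s coords {w} \<and>
     (\<forall>x\<in>unit_cube. 0 \<le> w x \<and> w x \<le> 2 * B \<and> \<bar>w x - B - f x\<bar> \<le> (1 + real (N * l)) * 2 powr (- \<beta> * real J))"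
    if J: "1 \<le> J" and s': "s' = s" for J s'
  proof -
    define \<epsilon> where "\<epsilon> = 2 powr (- \<beta> * real J)"
    define T where "T = (2::real) ^ (J * ?d)"
    have T1: "1 \<le> T" by (simp add: T_def)
    have JT: "(2::real) ^ J \<le> T" unfolding T_def by (intro power_increasing) auto
    have J1: "real (J + 1) \<le> 2 ^ J"
    proof -
      have "J + 1 \<le> 2 ^ J" using less_exp[of J] by linarith
      hence "real (J + 1) \<le> real (2 ^ J)" by (simp only: of_nat_le_iff)
      thus ?thesis by simp
    qed
    define n :: nat where "n = 2 ^ J"
    have n: "0 < n" "real n = 2 ^ J" by (auto simp: n_def)
    obtain Q :: "(nat \<times> ('d \<Rightarrow> nat)) set" where Q: "finite Q" "real (card Q) \<le> C1 * 2 ^ (J * ?d)"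
      "\<And>j k. (j, k) \<in> Q \<Longrightarrow> J \<le> j \<and> j \<le> c1 * (J + 1) \<and> k \<in> dyadic_idx j \<and> good_cell r f \<epsilon> j k"
      "\<And>x. x \<in> cube 0 1 \<Longrightarrow> \<exists>(j, k)\<in>Q. x \<in> dyadic_cell j k"
      using cover[rule_format, OF J] unfolding \<epsilon>_def by blast
    have C1T: "C1 * T \<ge> 0" using Q(2) unfolding T_def by (meson of_nat_0_le_iff order_trans)
    hence C10: "0 \<le> C1" using T1 by (simp add: zero_le_mult_iff)
    have jle: "j \<le> 2 * c1 * J" if "(j, k) \<in> Q" for j k
    proof -
      have "j \<le> c1 * (J + 1)" using Q(3)[OF that] by simp
      also have "\<dots> \<le> c1 * (2 * J)" using J by (intro mult_left_mono) auto
      finally show ?thesis by (simp add: mult_ac)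
    qed
    define A where "A = (2::real) ^ (cA * J)"
    have A: "0 < A" by (simp add: A_def)
    have "\<exists>a. (\<forall>x\<in>big_cube j k. \<bar>f x - (\<Sum>\<mu>\<in>PiE UNIV (\<lambda>_. {..<r}). a \<mu> * (\<Prod>e\<in>UNIV. (x $ e) ^ \<mu> e))\<bar> \<le> \<epsilon>) \<and> (\<forall>\<mu>. \<bar>a \<mu>\<bar> \<le> A)"
      if q: "(j, k) \<in> Q" for j and k :: "'d \<Rightarrow> nat"
    proof -
      define h where "h = 2 / 2 ^ j / real (r + 1)"
      have h: "0 < h" by (simp add: h_def)
      obtain t where t: "\<And>e. 0 \<le> t $ e \<and> t $ e + real r * h \<le> 1" "\<forall>x\<in>big_cube j k. \<bar>f x - grid_interp r t h f x\<bar> \<le> \<epsilon>"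
        using Q(3)[OF q] unfolding good_cell_def h_def by blast
      obtain a where a: "\<And>x. grid_interp r t h f x = (\<Sum>\<mu>\<in>PiE UNIV (\<lambda>_. {..<r}). a \<mu> * (\<Prod>e\<in>UNIV. (x $ e) ^ \<mu> e))"
        "\<And>\<mu>. \<bar>a \<mu>\<bar> \<le> real r ^ ?d * (B * ((2 / h) ^ r) ^ ?d)"
        using grid_interp_expand[where f=f and s=t and B=B, OF h t(1) B(2)] by blast
      have "2 / h = 2 ^ j * real (r + 1)" by (simp add: h_def)
      hence "real r ^ ?d * (B * ((2 / h) ^ r) ^ ?d) = Z * 2 ^ (j * (r * ?d))"
        by (simp add: Z_def power_mult_distrib power_mult[symmetric] mult_ac)
      also have "\<dots> \<le> Z * 2 ^ (2 * c1 * J * (r * ?d))"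
        using jle[OF q] B(1) by (intro mult_left_mono power_increasing mult_right_mono) (auto simp: Z_def)
      also have "2 * c1 * J * (r * ?d) = (2 * c1 * r * ?d) * J" by (simp add: mult_ac)
      also have "Z * 2 ^ ((2 * c1 * r * ?d) * J) \<le> A" unfolding A_def cA_def by (rule absorb_power2[OF J z1])
      finally have le: "real r ^ ?d * (B * ((2 / h) ^ r) ^ ?d) \<le> A" .
      show ?thesis
      proof (intro exI[of _ a] conjI allI)
        show "\<forall>x\<in>big_cube j k. \<bar>f x - (\<Sum>\<mu>\<in>PiE UNIV (\<lambda>_. {..<r}). a \<mu> * (\<Prod>e\<in>UNIV. (x $ e) ^ \<mu> e))\<bar> \<le> \<epsilon>"
          using t(2) unfolding a(1) .
        show "\<bar>a \<mu>\<bar> \<le> A" for \<mu> using a(2)[of \<mu>] le by linarith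
      qed
    qed
    hence "\<forall>q. \<exists>a. q \<in> Q \<longrightarrow> (\<forall>x\<in>big_cube (fst q) (snd q). \<bar>f x - (\<Sum>\<mu>\<in>PiE UNIV (\<lambda>_. {..<r}). a \<mu> * (\<Prod>e\<in>UNIV. (x $ e) ^ \<mu> e))\<bar> \<le> \<epsilon>) \<and> (\<forall>\<mu>. \<bar>a \<mu>\<bar> \<le> A)"
      by (intro allI) (case_tac q, simp)
    from choice[OF this] obtain a' where a': "\<And>q. q \<in> Q \<Longrightarrow> (\<forall>x\<in>big_cube (fst q) (snd q). \<bar>f x - (\<Sum>\<mu>\<in>PiE UNIV (\<lambda>_. {..<r}). a' q \<mu> * (\<Prod>e\<in>UNIV. (x $ e) ^ \<mu> e))\<bar> \<le> \<epsilon>) \<and> (\<forall>\<mu>. \<bar>a' q \<mu>\<bar> \<le> A)"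
      by blast
    define CS where "CS = {J..c1 * (J + 1)} \<times> PiE (UNIV :: 'd set) (\<lambda>_. {0, 1::nat})"
    have fP: "finite (PiE (UNIV :: 'd set) (\<lambda>_. {0, 1::nat}))" by (rule finite_PiE) auto
    have fCS: "finite CS" unfolding CS_def using fP by simp
    define m where "m = card CS"
    define cl where "cl q = to_nat_on CS (fst q, \<lambda>e. snd q e mod 2)" for q :: "nat \<times> ('d \<Rightarrow> nat)"
    have inCS: "(fst q, \<lambda>e. snd q e mod 2) \<in> CS" if "q \<in> Q" for q
      using Q(3)[of "fst q" "snd q"] that by (auto simp: CS_def)
    have bij: "bij_betw (to_nat_on CS) CS {..<m}" unfolding m_def by (rule to_nat_on_finite[OF fCS])
    have cl: "cl q < m" if "q \<in> Q" for q using bij_betwE[OF bij] inCS[OF that] by (auto simp: cl_def)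
    have mE: "real m \<le> E * real (J + 1)"
    proof -
      have "card {J..c1 * (J + 1)} \<le> (c1 + 1) * (J + 1)" by simp
      moreover have "card (PiE (UNIV :: 'd set) (\<lambda>_. {0, 1::nat})) = 2 ^ ?d" by (simp add: card_PiE numeral_2_eq_2)
      ultimately have "m \<le> (c1 + 1) * (J + 1) * 2 ^ ?d"
        unfolding m_def CS_def card_cartesian_product by (simp only: mult_le_mono1)
      hence "real m \<le> real ((c1 + 1) * (J + 1) * 2 ^ ?d)" by (simp only: of_nat_le_iff)
      also have "\<dots> = E * real (J + 1)" unfolding E_def of_nat_mult by simp
      finally show ?thesis .
    qed
    have mEJ: "real m \<le> E * 2 ^ J" using mE mult_left_mono[OF J1 E0] by linarith
    define \<kappa> lo up where "\<kappa> = (\<lambda>q :: nat \<times> ('d \<Rightarrow> nat). 4 * 2 ^ fst q :: real)" and "lo = (\<lambda>(q :: nat \<times> ('d \<Rightarrow> nat)) e. real (snd q e) / 2 ^ fst q)"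
      and "up = (\<lambda>(q :: nat \<times> ('d \<Rightarrow> nat)) e. (real (snd q e) + 1) / 2 ^ fst q)"
    define \<psi> where "\<psi> = (\<lambda>q. bump (\<kappa> q) (lo q) (up q))"
    have j1: "1 \<le> j" if "(j, k) \<in> Q" for j k using Q(3)[OF that] J by auto
    have \<psi>1: "\<psi> (j, k) x = 1" if "(j, k) \<in> Q" "x \<in> dyadic_cell j k" for j k x
      using bump_dyadic(1)[OF j1[OF that(1)] that(2)] by (simp add: \<psi>_def \<kappa>_def lo_def up_def)
    have \<psi>n: "real (k e) - 1/4 < 2 ^ j * x $ e \<and> 2 ^ j * x $ e < real (k e) + 5/4" if "(j, k) \<in> Q" "\<psi> (j, k) x \<noteq> 0" for j k x e
      using bump_dyadic(2)[OF j1[OF that(1)], of k x e] that(2) by (simp add: \<psi>_def \<kappa>_def lo_def up_def)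
    have \<psi>0: "0 \<le> \<psi> q x" for q x by (simp add: \<psi>_def bump_def)
    have pou1: "(\<Sum>q\<in>Q. pou Q cl \<psi> q x) = 1" if x: "x \<in> unit_cube" for x
    proof -
      obtain j0 k0 where q0: "(j0, k0) \<in> Q" "x \<in> dyadic_cell j0 k0" using Q(4) x unfolding unit_cube_eq_cube by blast
      show ?thesis
      proof (rule pou_sum_eq_1[where ?q0.0="(j0, k0)" and m=m])
        fix q q' assume q: "q \<in> Q" "q' \<in> Q" "q \<noteq> q'" "cl q = cl q'"
        obtain j k j' k' where jk: "q = (j, k)" "q' = (j', k')" by (cases q, cases q') auto
        have "(fst q, \<lambda>e. snd q e mod 2) = (fst q', \<lambda>e. snd q' e mod 2)"
          using bij_betw_imp_inj_on[OF bij] q(4) inCS[OF q(1)] inCS[OF q(2)] unfolding cl_def inj_on_def by blast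
        hence eq: "j = j'" "\<And>e. k e mod 2 = k' e mod 2" by (auto simp: jk fun_eq_iff)
        then obtain e where e: "k e \<noteq> k' e" using q(3) by (auto simp: jk fun_eq_iff)
        \<comment> \<open>Different indices of equal parity are at least 2 apart, and each bump
          reaches only a quarter of a side beyond its cell.\<close>
        have "k e + 2 \<le> k' e \<or> k' e + 2 \<le> k e" using e eq(2)[of e] by presburger
        hence far: "real (k e) + 2 \<le> real (k' e) \<or> real (k' e) + 2 \<le> real (k e)" by linarith
        show "\<psi> q x = 0 \<or> \<psi> q' x = 0"
        proof (rule ccontr)
          assume "\<not> ?thesis"
          hence "\<psi> (j, k) x \<noteq> 0" "\<psi> (j', k') x \<noteq> 0" by (auto simp: jk)
          from \<psi>n[OF _ this(1), of e] \<psi>n[OF _ this(2), of e] show False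
            using q(1,2) far by (simp add: jk eq(1))
        qed
      qed (use q0 \<psi>1[OF q0] Q(1) \<psi>0 cl in auto)
    qed
    have cle: "2 ^ (i * J) \<le> (2::real) ^ (c * J)" if "i \<le> c" for i using that by (intro power_increasing mult_right_mono) auto
    have lu: "\<bar>lo q e\<bar> \<le> 1 \<and> \<bar>up q e\<bar> \<le> 1" if "q \<in> Q" for q e
    proof -
      obtain j k where q: "q = (j, k)" by (cases q)
      have "k e < 2 ^ j" using Q(3)[of j k] that q by (auto simp: dyadic_idx_def)
      hence "real (k e + 1) \<le> real (2 ^ j)" by (subst of_nat_le_iff) auto
      hence "real (k e) + 1 \<le> 2 ^ j" by simp
      hence "real (k e) / 2 ^ j \<le> 1" "(real (k e) + 1) / 2 ^ j \<le> 1" by (subst pos_divide_le_eq, simp, linarith)+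
      moreover have "0 \<le> real (k e) / 2 ^ j" "0 \<le> (real (k e) + 1) / 2 ^ j" by auto
      ultimately have "0 \<le> real (k e) / 2 ^ j \<and> real (k e) / 2 ^ j \<le> 1 \<and> 0 \<le> (real (k e) + 1) / 2 ^ j \<and> (real (k e) + 1) / 2 ^ j \<le> 1"
        by blast
      thus ?thesis unfolding lo_def up_def q fst_conv snd_conv by linarith
    qed
    have M1: "0 \<le> \<kappa> q \<and> \<kappa> q * (2 * real ?d) \<le> 2 ^ (c * J)" if "q \<in> Q" for q
    proof
      have "fst q \<le> 2 * c1 * J" using jle[of "fst q" "snd q"] that by simp
      hence "\<kappa> q * (2 * real ?d) \<le> 8 * real ?d * 2 ^ (2 * c1 * J)"
        by (simp add: \<kappa>_def power_increasing)
      also have "\<dots> \<le> 2 ^ ((2 * c1 + zd) * J)" by (rule absorb_power2[OF J zd])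
      also have "\<dots> \<le> 2 ^ (c * J)" by (rule cle) (simp add: c_def)
      finally show "\<kappa> q * (2 * real ?d) \<le> 2 ^ (c * J)" .
    qed (simp add: \<kappa>_def)
    have M2: "3 * real (card Q) \<le> 2 ^ (c * J)"
    proof -
      have "3 * real (card Q) \<le> 3 * C1 * 2 ^ (?d * J)" using Q(2) by (simp add: mult.commute)
      also have "\<dots> \<le> 2 ^ ((?d + zc) * J)" by (rule absorb_power2[OF J zc])
      also have "\<dots> \<le> 2 ^ (c * J)" by (rule cle) (simp add: c_def)
      finally show ?thesis .
    qed
    have M3: "real m \<le> 2 ^ (c * J)"
    proof -
      have "real m \<le> E * 2 ^ (1 * J)" using mEJ by simp
      also have "\<dots> \<le> 2 ^ ((1 + zm) * J)" by (rule absorb_power2[OF J zm])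
      also have "\<dots> \<le> 2 ^ (c * J)" by (rule cle) (simp add: c_def)
      finally show ?thesis .
    qed
    have M4: "2 * (real n)\<^sup>2 + 2 * real n + 4 \<le> 2 ^ (c * J)"
    proof -
      have "1 \<le> real n" by (simp add: n_def)
      moreover from this have "real n * 1 \<le> real n * real n" by (intro mult_left_mono) auto
      ultimately have "real n \<le> (real n)\<^sup>2" "1 \<le> (real n)\<^sup>2" unfolding power2_eq_square by linarith+
      hence "2 * (real n)\<^sup>2 + 2 * real n + 4 \<le> 8 * (real n)\<^sup>2" by linarith
      also have "\<dots> = 8 * 2 ^ (2 * J)" by (simp add: n power_mult[symmetric] mult.commute)
      also have "\<dots> \<le> 2 ^ ((2 + 3) * J)" by (rule absorb_power2[OF J]) simp
      also have "\<dots> \<le> 2 ^ (c * J)" by (rule cle) (simp add: c_def)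
      finally show ?thesis .
    qed
    have M5: "A * (2 * real r ^ ?d) \<le> 2 ^ (c * J)"
    proof -
      have "A * (2 * real r ^ ?d) = 2 * real r ^ ?d * 2 ^ (cA * J)" by (simp add: A_def)
      also have "\<dots> \<le> 2 ^ ((cA + zr) * J)" by (rule absorb_power2[OF J zr])
      also have "\<dots> \<le> 2 ^ (c * J)" by (rule cle) (simp add: c_def)
      finally show ?thesis .
    qed
    have M6: "B \<le> 2 ^ (c * J)"
    proof -
      have "B \<le> 2 ^ ((0 + zB) * J)" using absorb_power2[OF J zB, of 0] by simp
      also have "\<dots> \<le> 2 ^ (c * J)" by (rule cle) (simp add: c_def)
      finally show ?thesis .
    qed
    have aA: "\<bar>a' q \<mu>\<bar> \<le> A" if "q \<in> Q" for \<mu> q using a'[OF that] by blast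
    have B0: "0 \<le> B" using B(1) by simp
    define cost where "cost = 12 * ?d + card Q * (6 * ?d + 11 + 3 * N) + m * m + 4 * m + N +
       N * (l * ((6 + 6 * s) * (4 * (?d + 2 * N + 1 + n) + 30))) + 2 * (N + 1) + 3"
    have "\<exists>w D. D \<le> 8 + N * (l * (6 + 6 * s)) \<and> circ (2 ^ (c * J)) D cost coords {w} \<and>
    (\<forall>x\<in>unit_cube. 0 \<le> w x \<and> w x \<le> 2 * B \<and>
      (\<forall>y. \<bar>y\<bar> \<le> B \<longrightarrow> \<bar>w x - B - y\<bar> \<le> \<bar>(\<Sum>q\<in>Q. pou Q cl (\<lambda>q. bump (\<kappa> q) (lo q) (up q)) q x * (\<Sum>\<mu>\<in>PiE UNIV (\<lambda>_. {..<r}). a' q \<mu> * (\<Prod>e\<in>UNIV. (x $ e) ^ \<mu> e))) - y\<bar>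
          + A * (real N * (real l / real n ^ (2 * s)))))"
      unfolding cost_def N_def l_def
      by (rule circ_polynomial_pou[OF Q(1) lu cl _ A B0 n(1) M1 M2 M3 M4 M5 M6]) (use aA pou1[unfolded \<psi>_def] in auto)
    then obtain w D where w: "D \<le> 8 + N * (l * (6 + 6 * s))" "circ (2 ^ (c * J)) D cost coords {w}"
      "\<forall>x\<in>unit_cube. 0 \<le> w x \<and> w x \<le> 2 * B \<and>
      (\<forall>y. \<bar>y\<bar> \<le> B \<longrightarrow> \<bar>w x - B - y\<bar> \<le> \<bar>(\<Sum>q\<in>Q. pou Q cl \<psi> q x * (\<Sum>\<mu>\<in>PiE UNIV (\<lambda>_. {..<r}). a' q \<mu> * (\<Prod>e\<in>UNIV. (x $ e) ^ \<mu> e))) - y\<bar>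
          + A * (real N * (real l / real n ^ (2 * s))))"
      unfolding \<psi>_def[symmetric] by (elim exE conjE) (rule that, assumption+)
    have An: "A / real n ^ (2 * s) \<le> \<epsilon>"
    proof -
      have "A = 2 powr (real cA * real J)" by (simp add: A_def powr_realpow[symmetric])
      moreover have "real n ^ (2 * s) = 2 powr (2 * real s * real J)"
      proof -
        have "real n ^ (2 * s) = 2 ^ (J * (2 * s))" unfolding n(2) power_mult ..
        also have "\<dots> = 2 powr real (J * (2 * s))" by (rule powr_realpow[symmetric]) simp
        also have "real (J * (2 * s)) = 2 * real s * real J" by simp
        finally show ?thesis .
      qed
      ultimately have "A / real n ^ (2 * s) = 2 powr ((real cA - 2 * real s) * real J)" by (simp add: powr_diff left_diff_distrib)
      also have "\<dots> \<le> \<epsilon>" unfolding \<epsilon>_def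
      proof (intro powr_mono mult_right_mono)
        have "real cA + \<beta> \<le> real s" unfolding s_def by (rule real_nat_ceiling_ge)
        thus "real cA - 2 * real s \<le> - \<beta>" using \<beta> by linarith
      qed auto
      finally show ?thesis .
    qed
    have err: "\<bar>w x - B - f x\<bar> \<le> (1 + real (N * l)) * \<epsilon>" if x: "x \<in> unit_cube" for x
    proof -
      define P where "P q = (\<Sum>\<mu>\<in>PiE UNIV (\<lambda>_. {..<r}). a' q \<mu> * (\<Prod>e\<in>UNIV. (x $ e) ^ \<mu> e))" for q
      have xc: "x \<in> cube 0 1" using x unfolding unit_cube_eq_cube .
      have "\<bar>w x - B - f x\<bar> \<le> \<bar>(\<Sum>q\<in>Q. pou Q cl \<psi> q x * P q) - f x\<bar> + A * (real N * (real l / real n ^ (2 * s)))"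
        using w(3) x B(2)[OF xc] unfolding P_def by blast
      also have "(\<Sum>q\<in>Q. pou Q cl \<psi> q x * P q) - f x = (\<Sum>q\<in>Q. pou Q cl \<psi> q x * (P q - f x))"
        using pou1[OF x] by (simp add: right_diff_distrib sum_subtractf sum_distrib_right[symmetric])
      also have "\<bar>\<dots>\<bar> \<le> (\<Sum>q\<in>Q. pou Q cl \<psi> q x * \<epsilon>)"
      proof (rule order_trans[OF sum_abs], rule sum_mono)
        fix q assume q: "q \<in> Q"
        obtain j k where jk: "q = (j, k)" by (cases q)
        have p0: "0 \<le> pou Q cl \<psi> q x" by (rule pou_nonneg) (rule \<psi>0)
        show "\<bar>pou Q cl \<psi> q x * (P q - f x)\<bar> \<le> pou Q cl \<psi> q x * \<epsilon>"
        proof (cases "\<psi> q x = 0")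
          case True thus ?thesis by (simp add: pou_eq_0)
        next
          case False
          have "x \<in> big_cube j k"
            by (rule big_cube_contains[OF _ xc]) (use Q(3)[of j k] \<psi>n[of j k x] q jk False less_imp_le in auto)
          hence "\<bar>P q - f x\<bar> \<le> \<epsilon>" using a'[OF q] unfolding P_def jk by (simp add: abs_minus_commute)
          thus ?thesis using p0 by (simp add: abs_mult mult_left_mono)
        qed
      qed
      also have "\<dots> = \<epsilon>" using pou1[OF x] by (simp add: sum_distrib_right[symmetric])
      also have "A * (real N * (real l / real n ^ (2 * s))) = real (N * l) * (A / real n ^ (2 * s))" by simp
      also have "\<dots> \<le> real (N * l) * \<epsilon>" using An by (intro mult_left_mono) auto
      finally show ?thesis by (simp add: distrib_right)
    qed
    have cost: "real cost \<le> Cc * T"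
    proof -
      have m2: "real m * real m \<le> 4 * E\<^sup>2 * T"
      proof -
        have "real m * real m \<le> (E * real (J + 1)) * (E * real (J + 1))" using mE by (intro mult_mono) (auto simp: E0)
        also have "\<dots> = E\<^sup>2 * real ((J + 1)\<^sup>2)" unfolding power2_eq_square of_nat_mult by (simp only: mult_ac)
        also have "real ((J + 1)\<^sup>2) \<le> real (4 * 2 ^ J)" unfolding of_nat_le_iff by (rule Suc_power2_le)
        hence "E\<^sup>2 * real ((J + 1)\<^sup>2) \<le> E\<^sup>2 * real (4 * 2 ^ J)" by (intro mult_left_mono) auto
        also have "\<dots> = 4 * E\<^sup>2 * 2 ^ J" by simp
        also have "\<dots> \<le> 4 * E\<^sup>2 * T" using JT by (intro mult_left_mono) auto
        finally show ?thesis .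
      qed
      have m1: "real m \<le> E * T" using mEJ mult_left_mono[OF JT E0] by linarith
      have cT: "x \<le> x * T" if "0 \<le> x" for x using T1 that by (simp add: mult_le_cancel_left1)
      have nT: "real (4 * (?d + 2 * N + 1 + n) + 30) \<le> real (4 * (?d + 2 * N + 2) + 30) * T"
      proof -
        have "real (4 * (?d + 2 * N + 1 + n) + 30) = real (4 * (?d + 2 * N + 1) + 30) + 4 * real n" by simp
        also have "\<dots> \<le> real (4 * (?d + 2 * N + 1) + 30) * T + 4 * T" using cT[OF of_nat_0_le_iff] JT n(2) T1 by (intro add_mono mult_left_mono) simp_all
        finally show ?thesis by (simp add: algebra_simps)
      qed
      have "real cost = 12 * real ?d + real (card Q) * real (6 * ?d + 11 + 3 * N) + real m * real m + 4 * real m + real N +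
        real (N * (l * (6 + 6 * s))) * real (4 * (?d + 2 * N + 1 + n) + 30) + real (2 * (N + 1) + 3)"
        unfolding cost_def by (simp add: algebra_simps)
      also have "\<dots> \<le> 12 * real ?d * T + C1 * T * real (6 * ?d + 11 + 3 * N) + 4 * E\<^sup>2 * T + 4 * (E * T) + real N * T +
        real (N * (l * (6 + 6 * s))) * (real (4 * (?d + 2 * N + 2) + 30) * T) + real (2 * (N + 1) + 3) * T"
        using Q(2)[folded T_def] m2 m1 cT nT
        by (intro add_mono mult_right_mono mult_left_mono) auto
      also have "\<dots> = Cc * T" by (simp add: Cc_def algebra_simps)
      finally show ?thesis .
    qed
    show ?thesis unfolding s' using w err cost unfolding \<epsilon>_def T_def by blast
  qed
  have Cc0: "0 \<le> Cc"
  proof -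
    from main[of 1, OF order_refl refl] obtain s0 :: nat where "real s0 \<le> Cc * 2 ^ (1 * ?d)" by blast
    hence "0 \<le> Cc * 2 ^ (1 * ?d)" by (meson of_nat_0_le_iff order_trans)
    moreover have "0 < (2::real) ^ (1 * ?d)" by (rule zero_less_power) simp
    ultimately show ?thesis unfolding zero_le_mult_iff by linarith
  qed
  show ?thesis
  proof (rule exI[of _ "8 + N * (l * (6 + 6 * s))"], rule exI[of _ c], rule exI[of _ Cc], rule exI[of _ "1 + real (N * l)"],
      rule conjI[OF Cc0], rule conjI, simp, rule allI, rule impI)
    fix J :: nat assume "1 \<le> J"
    thus "\<exists>D sa w. D \<le> 8 + N * (l * (6 + 6 * s)) \<and> real sa \<le> Cc * 2 ^ (J * ?d) \<and>
     circ (2 ^ (c * J)) D sa coords {w} \<and>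
     (\<forall>x\<in>unit_cube. 0 \<le> w x \<and> w x \<le> 2 * B \<and> \<bar>w x - B - f x\<bar> \<le> (1 + real (N * l)) * 2 powr (- \<beta> * real J))"
      by (rule main[OF _ refl])
  qed
qed

section \<open>From circuits to weight matrices\<close>

text \<open>Positive homogeneity of the ReLU. With inputs divided by M^l and the output by M^(l +
  1), the weights shrink by M and the bias by M^(l + 1), so all of them end up at most 1.\<close>

lemma neuron_scale:
  fixes g :: "real^'d::finite \<Rightarrow> real"
  assumes "neuron M F k g" "1 \<le> M"
  shows "neuron 1 ((\<lambda>u x. u x / M ^ l) ` F) k (\<lambda>x. g x / M ^ Suc l)"
proof -
  obtain T c b where T: "T \<subseteq> F" "finite T" "card T + 1 \<le> k" "\<forall>u\<in>T. \<bar>c u\<bar> \<le> M" "\<bar>b\<bar> \<le> M"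
    "\<forall>x\<in>unit_cube. g x = max 0 ((\<Sum>u\<in>T. c u * u x) + b)" using assms(1) unfolding neuron_def by blast
  define sc where "sc u = (\<lambda>x::real^'d. u x / M ^ l)" for u :: "real^'d \<Rightarrow> real"
  define un where "un u = (\<lambda>x::real^'d. u x * M ^ l)" for u :: "real^'d \<Rightarrow> real"
  have us: "un (sc u) = u" for u using assms(2) by (auto simp: un_def sc_def)
  have inj: "inj_on sc T" by (rule inj_on_inverseI[of T un]) (rule us)
  have Ml: "1 \<le> M ^ l" using assms(2) by (rule one_le_power)
  show ?thesis unfolding neuron_def
  proof (intro exI[of _ "sc ` T"] exI[of _ "\<lambda>u. c (un u) / M"] exI[of _ "b / M ^ Suc l"] conjI ballI)
    show "sc ` T \<subseteq> (\<lambda>u x. u x / M ^ l) ` F" using T(1) by (auto simp: sc_def)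
    show "finite (sc ` T)" "card (sc ` T) + 1 \<le> k" using T(2,3) card_image[OF inj] by auto
    show "\<bar>c (un u) / M\<bar> \<le> 1" if "u \<in> sc ` T" for u using that T(4) assms(2) by (auto simp: us divide_le_eq)
    have "\<bar>b\<bar> \<le> M * M ^ l" using T(5) mult_left_mono[OF Ml, of M] assms(2) by linarith
    thus "\<bar>b / M ^ Suc l\<bar> \<le> 1" using assms(2) by (simp add: divide_le_eq abs_mult)
    fix x :: "real^'d" assume x: "x \<in> unit_cube"
    have "(\<Sum>u\<in>sc ` T. c (un u) / M * u x) = (\<Sum>u\<in>T. c u / M * (u x / M ^ l))"
      unfolding sum.reindex[OF inj] comp_def us by (simp only: sc_def)
    also have "\<dots> = (\<Sum>u\<in>T. c u * u x) / M ^ Suc l" unfolding sum_divide_distrib by (intro sum.cong refl) simp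
    finally have "(\<Sum>u\<in>sc ` T. c (un u) / M * u x) + b / M ^ Suc l = ((\<Sum>u\<in>T. c u * u x) + b) / M ^ Suc l"
      by (simp add: add_divide_distrib)
    moreover have "max 0 (y / m) = max 0 y / m" if "0 < m" for y m :: real
      using that by (auto simp: max_def zero_le_divide_iff)
    moreover have "0 < M ^ Suc l" using assms(2) by simp
    ultimately show "g x / M ^ Suc l = max 0 ((\<Sum>u\<in>sc ` T. c (un u) / M * u x) + b / M ^ Suc l)"
      using T(6) x by simp
  qed
qed

lemma circ_scale:
  assumes "1 \<le> M"
  shows "circ M l s F G \<Longrightarrow> circ 1 l s F ((\<lambda>u x. u x / M ^ l) ` G)"
proof (induction l arbitrary: s G)
  case 0 thus ?case by simp
next
  case (Suc l)
  then obtain H s1 s2 where H: "circ M l s1 F H" "layer M s2 H G" "s1 + s2 \<le> s" by auto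
  obtain k where k: "finite G" "\<forall>g\<in>G. neuron M H (k g) g" "(\<Sum>g\<in>G. k g) \<le> s2" using H(2) by (auto simp: layer_def)
  have "layer 1 (\<Sum>g\<in>G. k g) ((\<lambda>u x. u x / M ^ l) ` H) ((\<lambda>u x. u x / M ^ Suc l) ` G)"
    by (rule layer_image[OF k(1)]) (use k(2) neuron_scale[OF _ assms] in blast)
  hence "layer 1 s2 ((\<lambda>u x. u x / M ^ l) ` H) ((\<lambda>u x. u x / M ^ Suc l) ` G)"
    by (rule layer_mono) (use k(3) in auto)
  thus ?case using Suc.IH[OF H(1)] H(3) by auto
qed

lemma hidden_layers_cong:
  assumes "\<And>i. i \<le> l \<Longrightarrow> w i = w' i" "\<And>i. i \<le> l \<Longrightarrow> A i = A' i \<and> b i = b' i"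
  shows "hidden_layers w A b l z = hidden_layers w' A' b' l z"
  using assms
proof (induction l)
  case (Suc l)
  have "hidden_layers w A b l z = hidden_layers w' A' b' l z" by (rule Suc.IH) (use Suc.prems in auto)
  thus ?case using Suc.prems(1)[of "Suc l"] Suc.prems(2)[of "Suc l"] by simp
qed simp

definition layer_nnz :: "nat \<Rightarrow> nat \<Rightarrow> (nat \<Rightarrow> nat \<Rightarrow> real) \<Rightarrow> (nat \<Rightarrow> real) \<Rightarrow> nat" where
  "layer_nnz m' m A b = card {(i, j). i < m' \<and> j < m \<and> A i j \<noteq> 0} + card {i. i < m' \<and> b i \<noteq> 0}"

text \<open>A network without its affine output layer; \<open>g i\<close> is its i-th unit after l
  hidden layers. The parameter count is exact, as \<open>sparse_nets\<close> demands. The bound 1 on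
  the parameters is imposed at all indices, so that appending a layer needs no check of
  ranges.\<close>

definition hidden_net :: "nat \<Rightarrow> nat \<Rightarrow> nat \<Rightarrow> nat \<Rightarrow> (nat \<Rightarrow> real^'d::finite \<Rightarrow> real) \<Rightarrow> bool" where
  "hidden_net W l m s g \<longleftrightarrow> (\<exists>w A b. w 1 = CARD('d) \<and> w (Suc l) = m \<and> (\<forall>i\<in>{1..Suc l}. 1 \<le> w i \<and> w i \<le> W) \<and>
     num_nonzero l w A b = s \<and> (\<forall>k i j. \<bar>A k i j\<bar> \<le> 1) \<and> (\<forall>k i. \<bar>b k i\<bar> \<le> (1::real)) \<and>
     (\<forall>x\<in>unit_cube. \<forall>i<m. hidden_layers w A b l (\<lambda>i. x $ from_nat_into UNIV i) i = g i x))"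

lemma finite_layer_idx: "finite {(i, j). i < (m'::nat) \<and> j < (m::nat) \<and> P i j}"
  by (rule finite_subset[of _ "{..<m'} \<times> {..<m}"]) auto

lemma finite_weight_idx: "finite {(k, i, j) \<in> weight_idx l w. P k i j}"
proof (rule finite_subset)
  show "{(k, i, j) \<in> weight_idx l w. P k i j} \<subseteq> (\<Union>k\<in>{..l}. {k} \<times> ({..<w (Suc k)} \<times> {..<w k}))"
    by (auto simp: weight_idx_def)
qed auto

lemma finite_bias_idx: "finite {(k, i) \<in> bias_idx l w. P k i}"
proof (rule finite_subset)
  show "{(k, i) \<in> bias_idx l w. P k i} \<subseteq> (\<Union>k\<in>{..l}. {k} \<times> {..<w (Suc k)})"
    by (auto simp: bias_idx_def)
qed auto

lemma num_nonzero_Suc: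
  assumes "\<And>i. i \<le> Suc l \<Longrightarrow> w i = w' i" "\<And>i. i \<le> l \<Longrightarrow> A i = A' i \<and> b i = b' i"
  shows "num_nonzero (Suc l) w A b = num_nonzero l w' A' b' + layer_nnz (w (Suc (Suc l))) (w (Suc l)) (A (Suc l)) (b (Suc l))"
proof -
  have ws: "w (Suc i) = w' (Suc i)" if "i \<le> l" for i using assms(1) that by auto
  have "{(k, i, j) \<in> weight_idx (Suc l) w. A k i j \<noteq> 0} = {(k, i, j) \<in> weight_idx l w'. A' k i j \<noteq> 0} \<union>
     Pair (Suc l) ` {(i, j). i < w (Suc (Suc l)) \<and> j < w (Suc l) \<and> A (Suc l) i j \<noteq> 0}" (is "?L = ?R1 \<union> ?R2")
    using assms ws by (auto simp: weight_idx_def le_Suc_eq)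
  moreover have "card (?R1 \<union> ?R2) = card ?R1 + card ?R2"
    by (rule card_Un_disjoint[OF finite_weight_idx finite_imageI[OF finite_layer_idx]]) (auto simp: weight_idx_def)
  moreover have "card ?R2 = card {(i, j). i < w (Suc (Suc l)) \<and> j < w (Suc l) \<and> A (Suc l) i j \<noteq> 0}"
    by (rule card_image) (auto simp: inj_on_def)
  moreover have "{(k, i) \<in> bias_idx (Suc l) w. b k i \<noteq> 0} = {(k, i) \<in> bias_idx l w'. b' k i \<noteq> 0} \<union>
     Pair (Suc l) ` {i. i < w (Suc (Suc l)) \<and> b (Suc l) i \<noteq> 0}" (is "?L' = ?R1' \<union> ?R2'")
    using assms ws by (auto simp: bias_idx_def le_Suc_eq)
  moreover have "card (?R1' \<union> ?R2') = card ?R1' + card ?R2'"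
    by (rule card_Un_disjoint[OF finite_bias_idx]) (auto simp: bias_idx_def)
  moreover have "card ?R2' = card {i. i < w (Suc (Suc l)) \<and> b (Suc l) i \<noteq> 0}"
    by (rule card_image) (auto simp: inj_on_def)
  ultimately show ?thesis unfolding num_nonzero_def layer_nnz_def by simp
qed

lemma hidden_net_0:
  assumes "CARD('d) \<le> W"
  shows "hidden_net W 0 CARD('d) 0 (\<lambda>i (x::real^'d::finite). x $ from_nat_into UNIV i)"
  unfolding hidden_net_def
proof (rule exI[of _ "\<lambda>_. CARD('d)"], rule exI[of _ "\<lambda>_ _ _. 0"], rule exI[of _ "\<lambda>_ _. 0"], intro conjI)
  have "{(k, i, j) \<in> weight_idx 0 (\<lambda>_. CARD('d)). (0::real) \<noteq> 0} = {}" "{(k, i) \<in> bias_idx 0 (\<lambda>_. CARD('d)). (0::real) \<noteq> 0} = {}"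
    by auto
  thus "num_nonzero 0 (\<lambda>_. CARD('d)) (\<lambda>_ _ _. 0) (\<lambda>_ _. 0) = 0" unfolding num_nonzero_def by (simp only: card.empty)
qed (use assms in \<open>auto simp: Suc_le_eq\<close>)

lemma hidden_net_step:
  fixes g :: "nat \<Rightarrow> real^'d::finite \<Rightarrow> real"
  assumes "hidden_net W l m s g" "1 \<le> m'" "m' \<le> W" and A': "\<And>i j. \<bar>A' i j\<bar> \<le> 1" "\<And>i. \<bar>b' i\<bar> \<le> (1::real)"
    and g': "\<And>i x. i < m' \<Longrightarrow> x \<in> unit_cube \<Longrightarrow> g' i x = max 0 ((\<Sum>j<m. A' i j * g j x) + b' i)"
  shows "hidden_net W (Suc l) m' (s + layer_nnz m' m A' b') g'"
proof -
  obtain w A b where w: "w 1 = CARD('d)" "w (Suc l) = m" "\<forall>i\<in>{1..Suc l}. 1 \<le> w i \<and> w i \<le> W"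
     "num_nonzero l w A b = s" "\<forall>k i j. \<bar>A k i j\<bar> \<le> 1" "\<forall>k i. \<bar>b k i\<bar> \<le> (1::real)"
     "\<forall>x\<in>unit_cube. \<forall>i<m. hidden_layers w A b l (\<lambda>i. x $ from_nat_into UNIV i) i = g i (x :: real^'d)"
    using assms(1) unfolding hidden_net_def by blast
  define w2 A2 b2 where "w2 = w(Suc (Suc l) := m')" and "A2 = A(Suc l := A')" and "b2 = b(Suc l := b')"
  have hl: "hidden_layers w2 A2 b2 l z = hidden_layers w A b l z" for z
    by (rule hidden_layers_cong) (auto simp: w2_def A2_def b2_def)
  have "num_nonzero (Suc l) w2 A2 b2 = num_nonzero l w A b + layer_nnz (w2 (Suc (Suc l))) (w2 (Suc l)) (A2 (Suc l)) (b2 (Suc l))"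
    by (rule num_nonzero_Suc) (auto simp: w2_def A2_def b2_def)
  hence nn: "num_nonzero (Suc l) w2 A2 b2 = s + layer_nnz m' m A' b'"
    using w by (simp add: w2_def A2_def b2_def)
  have "hidden_layers w2 A2 b2 (Suc l) (\<lambda>i. x $ from_nat_into UNIV i) i = g' i x" if "x \<in> unit_cube" "i < m'" for x i
  proof -
    have "hidden_layers w2 A2 b2 (Suc l) (\<lambda>i. x $ from_nat_into UNIV i) i =
       max ((\<Sum>j<m. A' i j * hidden_layers w A b l (\<lambda>i. x $ from_nat_into UNIV i) j) + b' i) 0"
      using w(2) by (simp add: affine_map_def hl) (simp add: w2_def A2_def b2_def)
    also have "(\<Sum>j<m. A' i j * hidden_layers w A b l (\<lambda>i. x $ from_nat_into UNIV i) j) = (\<Sum>j<m. A' i j * g j x)"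
      using w(7) that by (intro sum.cong) auto
    finally show ?thesis using g'[OF that(2,1)] by (simp add: max.commute)
  qed
  moreover have "\<forall>i\<in>{1..Suc (Suc l)}. 1 \<le> w2 i \<and> w2 i \<le> W" using w(3) assms(2,3) by (auto simp: w2_def)
  moreover have "w2 1 = CARD('d)" "w2 (Suc (Suc l)) = m'" using w(1) by (auto simp: w2_def)
  moreover have "\<forall>k i j. \<bar>A2 k i j\<bar> \<le> 1" "\<forall>k i. \<bar>b2 k i\<bar> \<le> 1" using w(5,6) A' by (auto simp: A2_def b2_def)
  ultimately show ?thesis unfolding hidden_net_def using nn by blast
qed

lemma hidden_net_cong:
  assumes "hidden_net W l m s g" "\<And>i x. i < m \<Longrightarrow> x \<in> unit_cube \<Longrightarrow> g i x = g' i x"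
  shows "hidden_net W l m s g'"
  using assms unfolding hidden_net_def by metis

text \<open>The functions of each layer are enumerated, with one extra unit that is constantly 0 so
  that no layer is empty. The width is controlled by the budget, since every neuron is charged at
  least for its bias.\<close>

lemma circ_imp_hidden_net:
  fixes G :: "(real^'d::finite \<Rightarrow> real) set"
  assumes "circ 1 l s coords G" "s + 1 \<le> W" "CARD('d) \<le> W"
  shows "\<exists>m s' g. s' \<le> s \<and> hidden_net W l m s' g \<and> G \<subseteq> g ` {..<m}"
  using assms(1,2)
proof (induction l arbitrary: s G)
  case 0
  have "(\<lambda>x::real^'d. x $ e) \<in> (\<lambda>i x. x $ from_nat_into UNIV i) ` {..<CARD('d)}" for e :: 'd
  proof -
    have "bij_betw (from_nat_into (UNIV :: 'd set)) {..<CARD('d)} UNIV" by (rule bij_betw_from_nat_into_finite) simp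
    hence "e \<in> from_nat_into UNIV ` {..<CARD('d)}" by (simp add: bij_betw_imp_surj_on)
    thus ?thesis by auto
  qed
  hence "G \<subseteq> (\<lambda>i x. x $ from_nat_into UNIV i) ` {..<CARD('d)}" using 0 by (auto simp: coords_def)
  thus ?case using hidden_net_0[OF assms(3)] by blast
next
  case (Suc l)
  then obtain H s1 s2 where H: "circ 1 l s1 coords H" "layer 1 s2 H G" "s1 + s2 \<le> s" by auto
  obtain m s' g where IH: "s' \<le> s1" "hidden_net W l m s' g" "H \<subseteq> g ` {..<m}"
    using Suc.IH[OF H(1)] H(3) Suc.prems(2) by auto
  obtain k where k: "finite G" "\<forall>g\<in>G. neuron 1 H (k g) g" "(\<Sum>g\<in>G. k g) \<le> s2" using H(2) by (auto simp: layer_def)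
  define Pr where "Pr h z \<longleftrightarrow> (case z of (T, c, b) \<Rightarrow> T \<subseteq> H \<and> finite T \<and> card T + 1 \<le> k h \<and> (\<forall>u\<in>T. \<bar>c u\<bar> \<le> 1) \<and> \<bar>b\<bar> \<le> (1::real) \<and>
     (\<forall>x\<in>unit_cube. h x = max 0 ((\<Sum>u\<in>T. c u * u x) + b)))" for h :: "real^'d \<Rightarrow> real" and z :: "(real^'d \<Rightarrow> real) set \<times> ((real^'d \<Rightarrow> real) \<Rightarrow> real) \<times> real"
  have "\<forall>h\<in>G. \<exists>z. Pr h z" using k(2) unfolding neuron_def Pr_def by fast
  from bchoice[OF this] obtain z where z: "\<forall>h\<in>G. Pr h (z h)" by blast
  define T c b where "T h = fst (z h)" and "c h = fst (snd (z h))" and "b h = snd (snd (z h))" for h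
  have T: "\<And>h. h \<in> G \<Longrightarrow> T h \<subseteq> H \<and> finite (T h) \<and> card (T h) + 1 \<le> k h \<and> (\<forall>u\<in>T h. \<bar>c h u\<bar> \<le> 1) \<and> \<bar>b h\<bar> \<le> (1::real) \<and>
     (\<forall>x\<in>unit_cube. h x = max 0 ((\<Sum>u\<in>T h. c h u * u x) + b h))"
    using z by (simp add: Pr_def case_prod_unfold T_def c_def b_def)
  obtain e where e: "bij_betw e {..<card G} G" using ex_bij_betw_nat_finite[OF k(1)] by (auto simp: atLeast0LessThan)
  have eG: "e i \<in> G" if "i < card G" for i using e that by (auto simp: bij_betw_def)
  \<comment> \<open>The enumeration g may repeat a function; the weight of u is attached only to the
    representative index \<iota> u.\<close>
  define \<iota> where "\<iota> u = (SOME j. j < m \<and> g j = u)" for u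
  have \<iota>: "\<iota> u < m \<and> g (\<iota> u) = u" if "u \<in> H" for u
  proof -
    have "\<exists>j. j < m \<and> g j = u" using IH(3) that by auto
    thus ?thesis unfolding \<iota>_def by (rule someI_ex)
  qed
  define A' where "A' i j = (if i < card G \<and> g j \<in> T (e i) \<and> \<iota> (g j) = j then c (e i) (g j) else 0)" for i j
  have A'nz: "i < card G \<and> j \<in> \<iota> ` T (e i)" if "A' i j \<noteq> 0" for i j
  proof -
    have "i < card G" "g j \<in> T (e i)" "\<iota> (g j) = j" using that by (auto simp: A'_def split: if_splits)
    thus ?thesis by (metis image_eqI)
  qed
  define b' where "b' i = (if i < card G then b (e i) else 0)" for i
  define g' where "g' i = (if i < card G then e i else (\<lambda>_. 0))" for i
  have cG: "card G \<le> (\<Sum>g\<in>G. k g)"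
  proof -
    have "(\<Sum>g\<in>G. 1) \<le> (\<Sum>g\<in>G. k g)" by (intro sum_mono) (use T in fastforce)
    thus ?thesis by simp
  qed
  have st: "hidden_net W (Suc l) (card G + 1) (s' + layer_nnz (card G + 1) m A' b') g'"
  proof (rule hidden_net_step[OF IH(2)])
    show "card G + 1 \<le> W" using cG k(3) H(3) Suc.prems(2) by linarith
    show "\<bar>A' i j\<bar> \<le> 1" for i j using T[OF eG[of i]] by (auto simp: A'_def)
    show "\<bar>b' i\<bar> \<le> 1" for i using T[OF eG[of i]] by (auto simp: b'_def)
    fix i x assume i: "i < card G + 1" and x: "(x :: real^'d) \<in> unit_cube"
    show "g' i x = max 0 ((\<Sum>j<m. A' i j * g j x) + b' i)"
    proof (cases "i < card G")
      case True
      note Ti = T[OF eG[OF True]]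
      have inj: "inj_on \<iota> (T (e i))"
        by (rule inj_on_inverseI[of _ g]) (use \<iota> Ti in blast)
      have "(\<Sum>j<m. A' i j * g j x) = (\<Sum>j\<in>\<iota> ` T (e i). A' i j * g j x)"
      proof (rule sum.mono_neutral_right)
        show "\<iota> ` T (e i) \<subseteq> {..<m}" using \<iota> Ti by auto
        show "\<forall>j\<in>{..<m} - \<iota> ` T (e i). A' i j * g j x = 0" using A'nz by auto
      qed simp
      also have "\<dots> = (\<Sum>u\<in>T (e i). c (e i) u * u x)"
        by (subst sum.reindex[OF inj]) (intro sum.cong refl, use True \<iota> Ti in \<open>auto simp: A'_def subset_iff\<close>)
      finally show ?thesis using True Ti x by (simp add: g'_def b'_def)
    next
      case False
      thus ?thesis by (simp add: g'_def A'_def b'_def)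
    qed
  qed simp
  have nnz: "layer_nnz (card G + 1) m A' b' \<le> s2"
  proof -
    have "{(i, j). i < card G + 1 \<and> j < m \<and> A' i j \<noteq> 0} \<subseteq> (SIGMA i:{..<card G}. \<iota> ` T (e i))"
      using A'nz by auto
    moreover have "finite (SIGMA i:{..<card G}. \<iota> ` T (e i))" using T eG by (intro finite_SigmaI) auto
    ultimately have "card {(i, j). i < card G + 1 \<and> j < m \<and> A' i j \<noteq> 0} \<le> card (SIGMA i:{..<card G}. \<iota> ` T (e i))"
      by (intro card_mono)
    also have "\<dots> = (\<Sum>i<card G. card (\<iota> ` T (e i)))" by (rule card_SigmaI) (use T eG in auto)
    also have "\<dots> \<le> (\<Sum>i<card G. card (T (e i)))" by (intro sum_mono card_image_le) (use T eG in auto)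
    finally have 1: "card {(i, j). i < card G + 1 \<and> j < m \<and> A' i j \<noteq> 0} \<le> (\<Sum>i<card G. card (T (e i)))" .
    have "card {i. i < card G + 1 \<and> b' i \<noteq> 0} \<le> card {..<card G}"
      by (rule card_mono) (auto simp: b'_def split: if_splits)
    hence 2: "card {i. i < card G + 1 \<and> b' i \<noteq> 0} \<le> (\<Sum>i<card G. 1)" by simp
    have "layer_nnz (card G + 1) m A' b' \<le> (\<Sum>i<card G. card (T (e i)) + 1)"
      unfolding layer_nnz_def sum.distrib using 1 2 by linarith
    also have "\<dots> \<le> (\<Sum>i<card G. k (e i))" by (intro sum_mono) (use T eG in auto)
    also have "\<dots> = (\<Sum>g\<in>G. k g)" by (rule sum.reindex_bij_betw[OF e])
    finally show ?thesis using k(3) by linarith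
  qed
  have "G \<subseteq> g' ` {..<card G + 1}"
  proof
    fix h assume "h \<in> G"
    hence "h \<in> e ` {..<card G}" using e by (simp add: bij_betw_imp_surj_on)
    then obtain i where "i < card G" "e i = h" by auto
    thus "h \<in> g' ` {..<card G + 1}" by (intro image_eqI[of _ _ i]) (auto simp: g'_def)
  qed
  moreover have "s' + layer_nnz (card G + 1) m A' b' \<le> s" using nnz IH(1) H(3) by linarith
  ultimately show ?case using st by blast
qed

section \<open>Scaling back, padding and the output layer\<close>

lemma hidden_net_select:
  fixes g :: "nat \<Rightarrow> real^'d::finite \<Rightarrow> real"
  assumes "hidden_net W l m s g" "i0 < m" "1 \<le> W" "\<And>x. x \<in> unit_cube \<Longrightarrow> 0 \<le> g i0 x"
  shows "hidden_net W (Suc l) 1 (s + 1) (\<lambda>_. g i0)"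
proof -
  define A' where "A' = (\<lambda>i j. if i = (0::nat) \<and> j = i0 then 1 else (0::real))"
  have "{(i, j). i < 1 \<and> j < m \<and> A' i j \<noteq> 0} = {(0, i0)}" using assms(2) by (auto simp: A'_def)
  hence "layer_nnz 1 m A' (\<lambda>_. 0) = 1" by (simp add: layer_nnz_def)
  moreover have "hidden_net W (Suc l) 1 (s + layer_nnz 1 m A' (\<lambda>_. 0)) (\<lambda>_. g i0)"
  proof (rule hidden_net_step[OF assms(1)])
    fix i x assume "i < (1::nat)" "(x :: real^'d) \<in> unit_cube"
    thus "g i0 x = max 0 ((\<Sum>j<m. A' i j * g j x) + 0)"
      using assms(2,4) by (simp add: A'_def if_distrib[of "\<lambda>y. y * _"] sum.delta cong: if_cong)
  qed (use assms(3) in \<open>auto simp: A'_def\<close>)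
  ultimately show ?thesis by simp
qed

lemma hidden_net_pass:
  assumes "hidden_net W l 1 s (\<lambda>_. u)" "1 \<le> W" "\<And>x. x \<in> unit_cube \<Longrightarrow> 0 \<le> u x"
  shows "hidden_net W (l + t) 1 (s + t) (\<lambda>_. u)"
proof (induction t)
  case (Suc t)
  from hidden_net_select[OF this, of 0] show ?case using assms by simp
qed (use assms in simp)

text \<open>Multiplication by n with all weights equal to 1: one layer makes n copies of the unit,
  the next adds them up. A round costs exactly 2 n parameters.\<close>

lemma hidden_net_amplify:
  fixes u :: "real^'d::finite \<Rightarrow> real"
  assumes "hidden_net W l 1 s (\<lambda>_. u)" "1 \<le> n" "n \<le> W" and u: "\<And>x. x \<in> unit_cube \<Longrightarrow> 0 \<le> u x"
  shows "hidden_net W (l + 2 * t) 1 (s + 2 * n * t) (\<lambda>_ x. real n ^ t * u x)"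
proof (induction t)
  case 0 thus ?case using assms(1) by simp
next
  case (Suc t)
  define v where "v = (\<lambda>x. real n ^ t * u x)"
  have v0: "0 \<le> v x" if "x \<in> unit_cube" for x using u[OF that] by (simp add: v_def)
  have "{(i, j). i < n \<and> j < (1::nat) \<and> (1::real) \<noteq> 0} = {..<n} \<times> {0}" by auto
  hence n1: "layer_nnz n 1 (\<lambda>_ _. 1) (\<lambda>_. 0) = n" by (simp add: layer_nnz_def card_cartesian_product)
  have "hidden_net W (Suc (l + 2 * t)) n (s + 2 * n * t + layer_nnz n 1 (\<lambda>_ _. 1) (\<lambda>_. 0)) (\<lambda>_. v)"
    by (rule hidden_net_step[OF Suc[folded v_def]]) (use assms v0 in auto)
  note h1 = this[unfolded n1]
  have "{(i, j). i < (1::nat) \<and> j < n \<and> (1::real) \<noteq> 0} = {0} \<times> {..<n}" by auto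
  hence n2: "layer_nnz 1 n (\<lambda>_ _. 1) (\<lambda>_. 0) = n" by (simp add: layer_nnz_def card_cartesian_product)
  have "hidden_net W (Suc (Suc (l + 2 * t))) 1 (s + 2 * n * t + n + layer_nnz 1 n (\<lambda>_ _. 1) (\<lambda>_. 0)) (\<lambda>_ x. real n * v x)"
    by (rule hidden_net_step[OF h1]) (use assms v0 in auto)
  thus ?case unfolding n2 by (simp add: v_def algebra_simps)
qed

text \<open>The network classes fix the exact number of non-zero parameters. Superfluous weights between units that
  are identically zero make up the difference.\<close>
lemma hidden_net_pad:
  fixes u :: "real^'d::finite \<Rightarrow> real"
  assumes "hidden_net W l 1 s (\<lambda>_. u)" "q + 1 \<le> W" "E \<le> q * q" and u: "\<And>x. x \<in> unit_cube \<Longrightarrow> 0 \<le> u x"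
  shows "hidden_net W (l + 3) 1 (s + 3 + E) (\<lambda>_. u)"
proof -
  obtain P where P: "P \<subseteq> {1..q} \<times> {1..q}" "card P = E"
    using obtain_subset_with_card_n[of E "{1..q} \<times> {1..q}"] assms(3) by (auto simp: card_cartesian_product)
  define g where "g = (\<lambda>i x. if i = (0::nat) then u x else 0)"
  define A1 where "A1 = (\<lambda>i j. if i = (0::nat) \<and> j = (0::nat) then 1 else (0::real))"
  define A2 where "A2 = (\<lambda>i j. if (i, j) \<in> insert (0, 0) P then 1 else (0::real))"
  have "{(i, j). i < q + 1 \<and> j < (1::nat) \<and> A1 i j \<noteq> 0} = {(0, 0)}" by (auto simp: A1_def)
  hence n1: "layer_nnz (q + 1) 1 A1 (\<lambda>_. 0) = 1" by (simp add: layer_nnz_def)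
  have "hidden_net W (Suc l) (q + 1) (s + layer_nnz (q + 1) 1 A1 (\<lambda>_. 0)) g"
    by (rule hidden_net_step[OF assms(1)]) (use assms(2) u in \<open>auto simp: A1_def g_def\<close>)
  note h1 = this[unfolded n1]
  have "{(i, j). i < q + 1 \<and> j < q + 1 \<and> A2 i j \<noteq> 0} = insert (0, 0) P" using P(1) by (auto simp: A2_def)
  moreover have "card (insert (0, 0) P) = E + 1"
    using P finite_subset[OF P(1)] by (subst card_insert_disjoint) auto
  ultimately have n2: "layer_nnz (q + 1) (q + 1) A2 (\<lambda>_. 0) = E + 1" by (simp add: layer_nnz_def)
  have "hidden_net W (Suc (Suc l)) (q + 1) (s + 1 + layer_nnz (q + 1) (q + 1) A2 (\<lambda>_. 0)) g"
  proof (rule hidden_net_step[OF h1])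
    fix i x assume i: "i < q + 1" and x: "(x::real^'d) \<in> unit_cube"
    have "(\<Sum>j<q + 1. A2 i j * g j x) = A2 i 0 * u x"
      by (simp add: g_def lessThan_Suc_eq_insert_0 sum.reindex)
    moreover have "A2 i 0 = (if i = 0 then 1 else 0)" using P(1) by (auto simp: A2_def)
    ultimately show "g i x = max 0 ((\<Sum>j<q + 1. A2 i j * g j x) + 0)" using u[OF x] by (simp add: g_def)
  qed (use assms(2) in \<open>auto simp: A2_def\<close>)
  note h2 = this[unfolded n2]
  have "hidden_net W (Suc (Suc (Suc l))) 1 (s + 1 + (E + 1) + 1) (\<lambda>_. g 0)"
    by (rule hidden_net_select[OF h2]) (use assms(2) u in \<open>auto simp: g_def\<close>)
  thus ?thesis by (simp add: g_def numeral_3_eq_3)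
qed

text \<open>The constant B may exceed the parameter bound and cannot be an output bias. It is
  assembled from k units that are constantly 1, each with output weight -B/k. The function is
  likewise spread over k units u/k with output weight 1. Both layers have exactly 2 k non-zero
  parameters.\<close>

lemma hidden_net_output:
  fixes u :: "real^'d::finite \<Rightarrow> real"
  assumes h: "hidden_net W l 1 s (\<lambda>_. u)" and k: "1 \<le> k" "2 * k \<le> W" and B: "0 < B" "B \<le> real k"
    and u: "\<And>x. x \<in> unit_cube \<Longrightarrow> 0 \<le> u x \<and> u x \<le> 2 * B" and Bp: "1 \<le> Bp"
  shows "(\<lambda>x. u x - B) \<in> sparse_nets (l + 2) W (s + 4 * k) Bp B"
proof -
  define A1 where "A1 = (\<lambda>i j. if i < k \<and> j = (0::nat) then 1 / real k else (0::real))"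
  define b1 where "b1 = (\<lambda>i. if k \<le> i then 1 else (0::real))"
  define g where "g = (\<lambda>i x. if i < k then u x / real k else 1)"
  have "{(i, j). i < 2 * k \<and> j < (1::nat) \<and> A1 i j \<noteq> 0} = {..<k} \<times> {0}" using k by (auto simp: A1_def)
  moreover have "{i. i < 2 * k \<and> b1 i \<noteq> 0} = {k..<2 * k}" by (auto simp: b1_def)
  ultimately have n1: "layer_nnz (2 * k) 1 A1 b1 = 2 * k" by (simp add: layer_nnz_def card_cartesian_product)
  have "hidden_net W (Suc l) (2 * k) (s + layer_nnz (2 * k) 1 A1 b1) g"
    by (rule hidden_net_step[OF h]) (use k u in \<open>auto simp: A1_def b1_def g_def\<close>)
  then obtain w A b where w: "w 1 = CARD('d)" "w (Suc (Suc l)) = 2 * k" "\<forall>i\<in>{1..Suc (Suc l)}. 1 \<le> w i \<and> w i \<le> W"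
     "num_nonzero (Suc l) w A b = s + 2 * k" "\<forall>k i j. \<bar>A k i j\<bar> \<le> 1" "\<forall>k i. \<bar>b k i\<bar> \<le> (1::real)"
     "\<forall>x\<in>unit_cube. \<forall>i<2 * k. hidden_layers w A b (Suc l) (\<lambda>i. x $ from_nat_into UNIV i) i = g i (x :: real^'d)"
    unfolding hidden_net_def n1 by blast
  define A' where "A' = (\<lambda>(i::nat) j. if j < k then 1 else - (B / real k))"
  define w2 A2 b2 where "w2 = w(Suc (Suc (Suc l)) := 1)" and "A2 = A(Suc (Suc l) := A')" and "b2 = b(Suc (Suc l) := (\<lambda>_. 0))"
  have A'n: "A' i j \<noteq> 0" for i j using k B by (auto simp: A'_def)
  have "num_nonzero (Suc (Suc l)) w2 A2 b2 = num_nonzero (Suc l) w A b + layer_nnz (w2 (Suc (Suc (Suc l)))) (w2 (Suc (Suc l))) (A2 (Suc (Suc l))) (b2 (Suc (Suc l)))"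
    by (rule num_nonzero_Suc) (auto simp: w2_def A2_def b2_def)
  also have "\<dots> = s + 2 * k + layer_nnz 1 (2 * k) A' (\<lambda>_. 0)" using w(2,4) by (simp add: w2_def A2_def b2_def)
  also have "layer_nnz 1 (2 * k) A' (\<lambda>_. 0) = 2 * k"
  proof -
    have "{(i, j). i < (1::nat) \<and> j < 2 * k \<and> A' i j \<noteq> 0} = {0} \<times> {..<2 * k}" using A'n by auto
    thus ?thesis by (simp add: layer_nnz_def card_cartesian_product)
  qed
  finally have nn: "num_nonzero (l + 2) w2 A2 b2 = s + 4 * k" by simp
  have hl: "hidden_layers w2 A2 b2 (Suc l) z = hidden_layers w A b (Suc l) z" for z
    by (rule hidden_layers_cong) (auto simp: w2_def A2_def b2_def)
  have rn: "u x - B = relu_net (l + 2) w2 A2 b2 x" if x: "x \<in> unit_cube" for x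
  proof -
    have "relu_net (l + 2) w2 A2 b2 x = (\<Sum>j<2 * k. A' 0 j * hidden_layers w A b (Suc l) (\<lambda>i. x $ from_nat_into UNIV i) j)"
      unfolding relu_net_def affine_map_def using w(2) hl by (simp add: w2_def[symmetric] del: hidden_layers.simps) (simp add: w2_def A2_def b2_def del: hidden_layers.simps)
    also have "\<dots> = (\<Sum>j<2 * k. A' 0 j * g j x)" using w(7) x by (intro sum.cong) auto
    also have "\<dots> = (\<Sum>j<k. A' 0 j * g j x) + (\<Sum>j=k..<2 * k. A' 0 j * g j x)"
      using sum.atLeastLessThan_concat[of 0 k "2 * k" "\<lambda>j. A' 0 j * g j x"] by (simp add: atLeast0LessThan)
    also have "(\<Sum>j<k. A' 0 j * g j x) = (\<Sum>j<k. u x / real k)" by (intro sum.cong) (auto simp: A'_def g_def)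
    also have "(\<Sum>j=k..<2 * k. A' 0 j * g j x) = (\<Sum>j=k..<2 * k. - (B / real k))" by (intro sum.cong) (auto simp: A'_def g_def)
    finally show ?thesis using k by simp
  qed
  have "sup_norm (\<lambda>x. u x - B) \<le> ennreal B" unfolding sup_norm_def
    by (rule SUP_least) (use u in \<open>auto intro!: ennreal_leI simp: abs_le_iff\<close>)
  moreover have "w2 1 = CARD('d)" "w2 (Suc (l + 2)) = 1" using w(1) by (auto simp: w2_def)
  moreover have "\<forall>i\<in>{1..Suc (l + 2)}. 1 \<le> w2 i \<and> w2 i \<le> W" using w(3) k by (auto simp: w2_def)
  moreover have "\<bar>A' i j\<bar> \<le> 1" for i j using k B by (auto simp: A'_def)
  hence "\<bar>A2 k i j\<bar> \<le> 1" "\<bar>b2 k i\<bar> \<le> 1" for k i j using w(5,6) by (auto simp: A2_def b2_def)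
  hence "\<bar>A2 k i j\<bar> \<le> Bp" "\<bar>b2 k i\<bar> \<le> Bp" for k i j using Bp by (meson order_trans)+
  hence "\<forall>(k, i, j)\<in>weight_idx (l + 2) w2. \<bar>A2 k i j\<bar> \<le> Bp" "\<forall>(k, i)\<in>bias_idx (l + 2) w2. \<bar>b2 k i\<bar> \<le> Bp" by auto
  ultimately show ?thesis unfolding sparse_nets_def mem_Collect_eq using nn rn by blast
qed

lemma circ_imp_sparse_nets:
  fixes w :: "real^'d::finite \<Rightarrow> real"
  assumes c: "circ (2 ^ (c * J)) D s coords {w}" and w: "\<And>x. x \<in> unit_cube \<Longrightarrow> 0 \<le> w x \<and> w x \<le> 2 * B"
    and B: "1 \<le> B" "B \<le> real k" and Bp: "1 \<le> Bp"
    and W: "s + 1 \<le> W" "CARD('d) \<le> W" "2 ^ J \<le> W" "2 * k \<le> W" "q + 1 \<le> W" "S \<le> q * q"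
    and L: "D + 2 * (c * D) + 6 \<le> L" and S: "s + 2 * 2 ^ J * (c * D) + 4 + 4 * k + L \<le> S"
  shows "(\<lambda>x. w x - B) \<in> sparse_nets L W S Bp B"
proof -
  define M :: real where "M = 2 ^ (c * J)"
  have M1: "1 \<le> M" unfolding M_def by (rule one_le_power) simp
  define t where "t = c * D"
  define v where "v = (\<lambda>x. w x / M ^ D)"
  have MD: "M ^ D = real (2 ^ J) ^ t" unfolding M_def t_def by (simp add: power_mult[symmetric] mult_ac)
  have v0: "0 \<le> v x" if "x \<in> unit_cube" for x using w[OF that] M1 by (simp add: v_def)
  have "circ 1 D s coords {v}" using circ_scale[OF M1 c[folded M_def]] by (simp add: v_def)
  from circ_imp_hidden_net[OF this W(1,2)]
  obtain m s' g where h: "s' \<le> s" "hidden_net W D m s' g" "v \<in> g ` {..<m}" by auto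
  then obtain i0 where i0: "i0 < m" "g i0 = v" by auto
  have W1: "1 \<le> W" using W(1) by simp
  have h1: "hidden_net W (Suc D) 1 (s' + 1) (\<lambda>_. v)"
    using hidden_net_select[OF h(2) i0(1) W1] v0 i0(2) by simp
  have "hidden_net W (Suc D + 2 * t) 1 (s' + 1 + 2 * 2 ^ J * t) (\<lambda>_ x. real (2 ^ J) ^ t * v x)"
    by (rule hidden_net_amplify[OF h1]) (use W(3) v0 in auto)
  hence h2: "hidden_net W (Suc D + 2 * t) 1 (s' + 1 + 2 * 2 ^ J * t) (\<lambda>_. w)"
    by (rule hidden_net_cong) (use M1 in \<open>simp add: v_def MD[symmetric] del: of_nat_power\<close>)
  have w0: "0 \<le> w x" if "x \<in> unit_cube" for x using w[OF that] by simp
  \<comment> \<open>Besides these idle layers there are D of the circuit, 2 t of the amplification,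
    and 6 for selection (1), padding (3) and output (2).\<close>
  define T where "T = L - (D + 2 * t + 6)"
  have h3: "hidden_net W (Suc D + 2 * t + T) 1 (s' + 1 + 2 * 2 ^ J * t + T) (\<lambda>_. w)"
    by (rule hidden_net_pass[OF h2 W1 w0])
  define E where "E = S - (s' + 1 + 2 * 2 ^ J * t + T + 3 + 4 * k)"
  have TL: "T + (D + 2 * t + 6) = L" using L by (simp add: T_def t_def)
  have le: "s' + 1 + 2 * 2 ^ J * t + T + 3 + 4 * k \<le> S" using S h(1) TL unfolding t_def by linarith
  have "E \<le> q * q" using W(6) by (simp add: E_def)
  from hidden_net_pad[OF h3 W(5) this w0]
  have h4: "hidden_net W (Suc D + 2 * t + T + 3) 1 (s' + 1 + 2 * 2 ^ J * t + T + 3 + E) (\<lambda>_. w)" .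
  have k1: "1 \<le> k" using B by linarith
  have "(\<lambda>x. w x - B) \<in> sparse_nets (Suc D + 2 * t + T + 3 + 2) W (s' + 1 + 2 * 2 ^ J * t + T + 3 + E + 4 * k) Bp B"
    by (rule hidden_net_output[OF h4 k1 W(4) _ B(2) w Bp]) (use B in auto)
  moreover have "Suc D + 2 * t + T + 3 + 2 = L" using TL by simp
  moreover have "s' + 1 + 2 * 2 ^ J * t + T + 3 + E + 4 * k = S" using le unfolding E_def by linarith
  ultimately show ?thesis by simp
qed

section \<open>The Besov modulus\<close>

lemma epowr_leD:
  assumes "epowr x a \<le> ennreal b" "0 < a" "0 \<le> b"
  shows "x \<le> ennreal (b powr (1 / a))"
proof -
  have x: "x \<noteq> \<infinity>" using assms(1) by (auto simp: epowr_def top_unique)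
  hence "enn2real x powr a \<le> b" using assms(1,3) by (simp add: epowr_def)
  hence "(enn2real x powr a) powr (1 / a) \<le> b powr (1 / a)" using assms(2) by (intro powr_mono2) auto
  hence "enn2real x \<le> b powr (1 / a)" using assms(2) by (simp add: powr_powr)
  hence "ennreal (enn2real x) \<le> ennreal (b powr (1 / a))" by (rule ennreal_leI)
  thus ?thesis using x by (simp add: ennreal_enn2real_if)
qed

lemma epowr_mono: "x \<le> y \<Longrightarrow> 0 < a \<Longrightarrow> epowr x a \<le> epowr y a"
  by (auto simp: epowr_def top_unique intro!: ennreal_leI powr_mono2 enn2real_mono simp: less_top)

lemma modulus_mono: "u \<le> v \<Longrightarrow> modulus r p f u \<le> modulus r p f v"
  unfolding modulus_def by (intro SUP_subset_mono) auto

text \<open>The embedding of the space with index q into the one with index \<infinity>. For q <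
  \<infinity> the integral is restricted to [u, 2 u]: there the modulus is at least its value at u,
  t^(-\<beta>) is at least (2 u)^(-\<beta>), and the integral of 1/t is at least 1/2.\<close>

lemma besov_modulus_bound:
  fixes f :: "real^'d::finite \<Rightarrow> real"
  assumes semi: "besov_seminorm r p q \<beta> f \<le> ennreal B" and q: "0 < q" and \<beta>: "0 < \<beta>" and B: "0 \<le> B"
  shows "\<exists>K\<ge>0. \<forall>u>0. modulus r p f u \<le> ennreal (K * u powr \<beta>)"
proof (cases "q = \<infinity>")
  case True
  show ?thesis
  proof (intro exI[of _ B] conjI B allI impI)
    fix u :: real assume u: "0 < u"
    have "ennreal (u powr (- \<beta>)) * modulus r p f u \<le> besov_seminorm r p q \<beta> f"
      unfolding besov_seminorm_def using True u by (auto intro: SUP_upper)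
    hence "ennreal (u powr (- \<beta>)) * modulus r p f u \<le> ennreal B" using semi by (rule order_trans)
    hence "ennreal (u powr \<beta>) * (ennreal (u powr (- \<beta>)) * modulus r p f u) \<le> ennreal (u powr \<beta>) * ennreal B"
      by (rule mult_left_mono) simp
    also have "ennreal (u powr \<beta>) * (ennreal (u powr (- \<beta>)) * modulus r p f u) = ennreal (u powr \<beta> * u powr (- \<beta>)) * modulus r p f u"
      by (simp add: ennreal_mult mult.assoc)
    also have "u powr \<beta> * u powr (- \<beta>) = 1" using u by (simp add: powr_add[symmetric])
    finally show "modulus r p f u \<le> ennreal (B * u powr \<beta>)" using B by (simp add: ennreal_mult mult.commute)
  qed
next
  case False
  define q' where "q' = enn2real q"
  have q': "0 < q'" using q False by (simp add: q'_def enn2real_positive_iff less_top)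
  define I where "I = (\<integral>\<^sup>+ u\<in>{0<..}. epowr (ennreal (u powr (- \<beta>)) * modulus r p f u) q' * ennreal (1 / u) \<partial>lborel)"
  have "epowr I (1 / q') \<le> ennreal B"
    using semi False by (simp add: besov_seminorm_def I_def q'_def)
  from epowr_leD[OF this _ B] have I: "I \<le> ennreal (B powr q')" using q' by simp
  define K where "K = 2 powr \<beta> * (2 * B powr q') powr (1 / q')"
  show ?thesis
  proof (intro exI[of _ K] conjI allI impI)
    show "0 \<le> K" by (simp add: K_def)
    fix u :: real assume u: "0 < u"
    define y where "y = ennreal ((2 * u) powr (- \<beta>)) * modulus r p f u"
    have "epowr y q' * ennreal (1 / (2 * u)) * ennreal u = (\<integral>\<^sup>+t. epowr y q' * ennreal (1 / (2 * u)) * indicator {u..2 * u} t \<partial>lborel)"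
      using u by (subst nn_integral_cmult_indicator) auto
    also have "\<dots> \<le> I" unfolding I_def
    proof (rule nn_integral_mono)
      fix t :: real
      show "epowr y q' * ennreal (1 / (2 * u)) * indicator {u..2 * u} t \<le>
         epowr (ennreal (t powr (- \<beta>)) * modulus r p f t) q' * ennreal (1 / t) * indicator {0<..} t"
      proof (cases "t \<in> {u..2 * u}")
        case True
        have "y \<le> ennreal (t powr (- \<beta>)) * modulus r p f t" unfolding y_def
          using True u \<beta> by (intro mult_mono ennreal_leI modulus_mono powr_mono2') auto
        hence "epowr y q' * ennreal (1 / (2 * u)) \<le> epowr (ennreal (t powr (- \<beta>)) * modulus r p f t) q' * ennreal (1 / t)"
          using True u q' by (intro mult_mono epowr_mono ennreal_leI divide_left_mono) auto
        thus ?thesis using True u by simp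
      qed simp
    qed
    also have "epowr y q' * ennreal (1 / (2 * u)) * ennreal u = epowr y q' * ennreal (1 / 2)"
      using u by (simp add: mult.assoc ennreal_mult[symmetric])
    finally have "epowr y q' * ennreal (1 / 2) \<le> ennreal (B powr q')" using I by (rule order_trans)
    hence "epowr y q' * ennreal (1 / 2) * ennreal 2 \<le> ennreal (B powr q') * ennreal 2" by (rule mult_right_mono) simp
    moreover have "ennreal (1 / 2) * ennreal 2 = 1" by (subst ennreal_mult[symmetric]) auto
    moreover have "ennreal (B powr q') * ennreal 2 = ennreal (2 * B powr q')" by (subst ennreal_mult[symmetric]) (auto simp: mult.commute)
    ultimately have "epowr y q' \<le> ennreal (2 * B powr q')" by (simp only: mult.assoc mult_1_right)
    from epowr_leD[OF this q'] have y: "y \<le> ennreal ((2 * B powr q') powr (1 / q'))" by simp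
    have "ennreal ((2 * u) powr \<beta>) * y = ennreal ((2 * u) powr \<beta> * (2 * u) powr (- \<beta>)) * modulus r p f u"
      by (simp add: y_def ennreal_mult mult.assoc)
    also have "(2 * u) powr \<beta> * (2 * u) powr (- \<beta>) = 1" using u by (simp add: powr_add[symmetric])
    finally have "modulus r p f u = ennreal ((2 * u) powr \<beta>) * y" by simp
    also have "\<dots> \<le> ennreal ((2 * u) powr \<beta>) * ennreal ((2 * B powr q') powr (1 / q'))"
      by (rule mult_left_mono[OF y]) simp
    also have "\<dots> = ennreal (K * u powr \<beta>)"
      using u by (simp add: K_def ennreal_mult[symmetric] powr_mult mult_ac)
    finally show "modulus r p f u \<le> ennreal (K * u powr \<beta>)" .
  qed
qed

lemma emeasure_lebesgue_on_cube:
  assumes "A \<in> sets borel" "A \<subseteq> unit_cube"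
  shows "A \<in> sets (lebesgue_on unit_cube)" "emeasure (lebesgue_on unit_cube) A = emeasure lborel A"
proof -
  have A: "A \<in> sets lebesgue" using assms(1) by auto
  show "A \<in> sets (lebesgue_on unit_cube)" using A assms(2) by (auto simp: sets_restrict_space)
  have "emeasure (lebesgue_on unit_cube) A = emeasure lebesgue A"
    using assms(2) by (intro emeasure_restrict_space) auto
  thus "emeasure (lebesgue_on unit_cube) A = emeasure lborel A"
    using assms(1) by simp
qed

lemma large_diff_fin_diff:
  fixes f :: "real^'d::finite \<Rightarrow> real"
  assumes "x \<in> large_diff r h e f lam (cube 0 1)"
  shows "x \<in> unit_cube" "lam < \<bar>fin_diff r (h *\<^sub>R axis e 1) f x\<bar>"
proof -
  show "x \<in> unit_cube" using assms by (simp add: large_diff_def unit_cube_eq_cube)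
  have "x + real r *\<^sub>R (h *\<^sub>R axis e 1) \<in> unit_cube" using assms by (simp add: large_diff_def unit_cube_eq_cube)
  hence "fin_diff r (h *\<^sub>R axis e 1) f x = axis_diff r h e f x"
    unfolding fin_diff_def axis_diff_def by simp
  thus "lam < \<bar>fin_diff r (h *\<^sub>R axis e 1) f x\<bar>" using assms by (simp add: large_diff_def)
qed

text \<open>Markov's inequality for the p-th power of the difference. On the set in question
  \<open>fin_diff\<close> agrees with \<open>axis_diff\<close>, as both end points lie in the
  cube.\<close>

lemma large_diff_measure_Lp:
  fixes f :: "real^'d::finite \<Rightarrow> real"
  assumes p: "0 < p" "p \<noteq> \<infinity>" and f: "continuous_on (cube 0 1) f" and lam: "0 < lam" and k: "0 \<le> k"
    and L: "Lp_norm p (fin_diff r (h *\<^sub>R axis e 1) f) \<le> ennreal k"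
  shows "emeasure lborel (large_diff r h e f lam (cube 0 1)) \<le> ennreal (k powr enn2real p * lam powr (- enn2real p))"
proof -
  define p' where "p' = enn2real p"
  have p': "0 < p'" using p by (simp add: p'_def enn2real_positive_iff less_top)
  define g where "g = fin_diff r (h *\<^sub>R axis e 1) f"
  define A where "A = large_diff r h e f lam (cube 0 1)"
  have Ab: "A \<in> sets borel" unfolding A_def by (rule large_diff_borel[OF f])
  have Au: "A \<subseteq> unit_cube" using large_diff_fin_diff(1) by (auto simp: A_def)
  note Am = emeasure_lebesgue_on_cube[OF Ab Au]
  have "epowr (\<integral>\<^sup>+ x. ennreal (\<bar>g x\<bar> powr p') \<partial>lebesgue_on unit_cube) (1 / p') \<le> ennreal k"
    using L p(2) by (simp add: Lp_norm_def g_def p'_def)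
  from epowr_leD[OF this _ k] have "(\<integral>\<^sup>+ x. ennreal (\<bar>g x\<bar> powr p') \<partial>lebesgue_on unit_cube) \<le> ennreal (k powr p')"
    using p' by simp
  moreover have "ennreal (lam powr p') * emeasure lborel A \<le> (\<integral>\<^sup>+ x. ennreal (\<bar>g x\<bar> powr p') \<partial>lebesgue_on unit_cube)"
  proof -
    have "ennreal (lam powr p') * emeasure lborel A = (\<integral>\<^sup>+ x. ennreal (lam powr p') * indicator A x \<partial>lebesgue_on unit_cube)"
      using Am by (subst nn_integral_cmult_indicator) auto
    also have "\<dots> \<le> (\<integral>\<^sup>+ x. ennreal (\<bar>g x\<bar> powr p') \<partial>lebesgue_on unit_cube)"
    proof (rule nn_integral_mono)
      fix x
      show "ennreal (lam powr p') * indicator A x \<le> ennreal (\<bar>g x\<bar> powr p')"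
      proof (cases "x \<in> A")
        case True
        hence "lam < \<bar>g x\<bar>" using large_diff_fin_diff(2) by (auto simp: A_def g_def)
        hence "lam powr p' \<le> \<bar>g x\<bar> powr p'" using lam p' by (intro powr_mono2) auto
        thus ?thesis using True by (simp add: ennreal_leI)
      qed simp
    qed
    finally show ?thesis .
  qed
  ultimately have *: "ennreal (lam powr p') * emeasure lborel A \<le> ennreal (k powr p')" by (rule order_trans[rotated])
  have "ennreal (lam powr (- p')) * (ennreal (lam powr p') * emeasure lborel A) \<le> ennreal (lam powr (- p')) * ennreal (k powr p')"
    by (rule mult_left_mono[OF *]) simp
  also have "ennreal (lam powr (- p')) * (ennreal (lam powr p') * emeasure lborel A) = ennreal (lam powr (- p') * lam powr p') * emeasure lborel A"
    by (simp add: ennreal_mult mult.assoc)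
  also have "lam powr (- p') * lam powr p' = 1" using lam by (simp add: powr_add[symmetric])
  finally show ?thesis by (simp add: A_def p'_def ennreal_mult mult.commute)
qed

text \<open>If lam is at least the essential bound k, the set is null; otherwise its measure is at
  most 1, which is below (k/lam)^p'. Hence every positive exponent p' works.\<close>

lemma large_diff_measure_Linfty:
  fixes f :: "real^'d::finite \<Rightarrow> real"
  assumes f: "continuous_on (cube 0 1) f" and lam: "0 < lam" and k: "0 \<le> k" and p': "0 < p'"
    and L: "Lp_norm \<infinity> (fin_diff r (h *\<^sub>R axis e 1) f) \<le> ennreal k"
  shows "emeasure lborel (large_diff r h e f lam (cube 0 1)) \<le> ennreal (k powr p' * lam powr (- p'))"
proof -
  define g where "g = fin_diff r (h *\<^sub>R axis e 1) f"
  define A where "A = large_diff r h e f lam (cube 0 1)"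
  have Ab: "A \<in> sets borel" unfolding A_def by (rule large_diff_borel[OF f])
  have Au: "A \<subseteq> unit_cube" using large_diff_fin_diff(1) by (auto simp: A_def)
  note Am = emeasure_lebesgue_on_cube[OF Ab Au]
  show ?thesis
  proof (cases "k \<le> lam")
    case True
    have "AE x in lebesgue_on unit_cube. ennreal \<bar>g x\<bar> \<le> esssup (lebesgue_on unit_cube) (\<lambda>x. ennreal \<bar>g x\<bar>)"
      by (rule esssup_AE)
    hence "AE x in lebesgue_on unit_cube. x \<notin> A"
    proof (rule AE_mp, intro AE_I2 impI)
      fix x assume "ennreal \<bar>g x\<bar> \<le> esssup (lebesgue_on unit_cube) (\<lambda>x. ennreal \<bar>g x\<bar>)"
      also have "\<dots> \<le> ennreal k" using L by (simp add: Lp_norm_def g_def)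
      finally have "\<bar>g x\<bar> \<le> lam" using k True by simp
      thus "x \<notin> A" using large_diff_fin_diff(2)[of x r h e f lam] by (auto simp: A_def g_def)
    qed
    hence "emeasure (lebesgue_on unit_cube) A = 0"
      using AE_iff_null_sets[OF Am(1)] by auto
    thus ?thesis using Am(2) by (simp add: A_def)
  next
    case False
    have "emeasure lborel A \<le> emeasure lborel (unit_cube :: (real^'d) set)" by (rule emeasure_mono[OF Au]) simp
    also have "\<dots> = ennreal (measure lborel (cbox 0 1 :: (real^'d) set))"
      by (rule emeasure_eq_ennreal_measure) (use emeasure_bounded_finite[OF bounded_cbox, of "0 :: real^'d" 1] in simp)
    also have "measure lborel (cbox 0 1 :: (real^'d) set) = 1"
      by (subst content_cbox_cart) (auto simp: interval_ne_empty_cart)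
    also have "ennreal 1 \<le> ennreal (k powr p' * lam powr (- p'))"
    proof (rule ennreal_leI)
      have "lam powr p' \<le> k powr p'" using False lam p' by (intro powr_mono2) auto
      thus "1 \<le> k powr p' * lam powr (- p')" using lam by (simp add: powr_minus divide_inverse[symmetric] le_divide_eq)
    qed
    finally show ?thesis by (simp add: A_def)
  qed
qed

text \<open>Both cases of p lead to one weak-type estimate with a finite exponent p' satisfying
  \<beta> p' > d, which is the form in which smoothness enters the counting of bad cells.\<close>

lemma besov_large_diff:
  fixes f :: "real^'d::finite \<Rightarrow> real"
  assumes fb: "f \<in> besov_ball r p q \<beta> B" and p: "0 < p" "of_nat CARD('d) / p < ennreal \<beta>" and q: "0 < q" and B: "0 \<le> B"
    and f: "continuous_on (cube 0 1) f"
  shows "\<exists>p' K. 0 < p' \<and> 0 \<le> K \<and> real CARD('d) < \<beta> * p' \<and> (\<forall>h e lam. 0 < h \<longrightarrow> 0 < lam \<longrightarrow>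
     emeasure lborel (large_diff r h e f lam (cube 0 1)) \<le> ennreal (K * h powr (\<beta> * p') * lam powr (- p')))"
proof -
  have \<beta>: "0 < \<beta>" using p(2) by (cases "0 < \<beta>") (auto simp: ennreal_neg not_less)
  have "besov_seminorm r p q \<beta> f \<le> Lp_norm p f + besov_seminorm r p q \<beta> f" by simp
  also have "\<dots> \<le> ennreal B" using fb by (simp add: besov_ball_def)
  finally have semi: "besov_seminorm r p q \<beta> f \<le> ennreal B" .
  obtain K0 where K0: "0 \<le> K0" "\<And>u. 0 < u \<Longrightarrow> modulus r p f u \<le> ennreal (K0 * u powr \<beta>)"
    using besov_modulus_bound[OF semi q \<beta> B] by blast
  have L: "Lp_norm p (fin_diff r (h *\<^sub>R axis e 1) f) \<le> ennreal (K0 * h powr \<beta>)" if h: "0 < h" for h e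
  proof -
    have "Lp_norm p (fin_diff r (h *\<^sub>R axis e 1) f) \<le> modulus r p f h"
      unfolding modulus_def by (rule SUP_upper) (use h in simp)
    thus ?thesis using K0(2)[OF h] by (rule order_trans)
  qed
  have fin: "ennreal ((K0 * h powr \<beta>) powr p' * lam powr (- p')) = ennreal (K0 powr p' * h powr (\<beta> * p') * lam powr (- p'))"
    if "0 < h" for h p' lam :: real
    using that K0(1) by (simp add: powr_mult powr_powr)
  show ?thesis
  proof (cases "p = \<infinity>")
    case True
    \<comment> \<open>Any exponent with \<beta> p' > d would do; this one gives \<beta> p' = d +
      1.\<close>
    define p' where "p' = (real CARD('d) + 1) / \<beta>"
    have p': "0 < p'" "real CARD('d) < \<beta> * p'" using \<beta> by (auto simp: p'_def)
    show ?thesis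
    proof (rule exI[of _ p'], rule exI[of _ "K0 powr p'"], intro conjI allI impI p')
      fix h :: real and e :: 'd and lam :: real assume h: "0 < h" and lam: "0 < lam"
      have "emeasure lborel (large_diff r h e f lam (cube 0 1)) \<le> ennreal ((K0 * h powr \<beta>) powr p' * lam powr (- p'))"
        by (rule large_diff_measure_Linfty[OF f lam _ p'(1)]) (use K0 L[OF h] True in auto)
      thus "emeasure lborel (large_diff r h e f lam (cube 0 1)) \<le> ennreal (K0 powr p' * h powr (\<beta> * p') * lam powr (- p'))"
        unfolding fin[OF h] .
    qed simp
  next
    case False
    define p' where "p' = enn2real p"
    have p': "0 < p'" using p(1) False by (simp add: p'_def enn2real_positive_iff less_top)
    have pe: "p = ennreal p'" using False by (simp add: p'_def ennreal_enn2real_if)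
    have "ennreal (real CARD('d) / p') < ennreal \<beta>" using p(2) p' unfolding pe by (simp add: divide_ennreal ennreal_of_nat_eq_real_of_nat)
    hence "real CARD('d) / p' < \<beta>" by (subst (asm) ennreal_less_iff) (use p' in auto)
    hence bp: "real CARD('d) < \<beta> * p'" using p' by (simp add: divide_less_eq)
    show ?thesis
    proof (rule exI[of _ p'], rule exI[of _ "K0 powr p'"], intro conjI allI impI p' bp)
      fix h :: real and e :: 'd and lam :: real assume h: "0 < h" and lam: "0 < lam"
      have "emeasure lborel (large_diff r h e f lam (cube 0 1)) \<le> ennreal ((K0 * h powr \<beta>) powr p' * lam powr (- p'))"
        unfolding p'_def by (rule large_diff_measure_Lp[OF p(1) False f lam _ L[OF h]]) (use K0 in auto)
      thus "emeasure lborel (large_diff r h e f lam (cube 0 1)) \<le> ennreal (K0 powr p' * h powr (\<beta> * p') * lam powr (- p'))"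
        unfolding fin[OF h] .
    qed simp
  qed
qed

section \<open>Approximation by sparse networks of prescribed size\<close>

lemma ex_level:
  assumes "0 < d" "2 ^ d \<le> (y::real)"
  shows "\<exists>J\<ge>1. 2 ^ (J * d) \<le> y \<and> y < 2 ^ ((J + 1) * d)"
proof -
  define J where "J = nat \<lfloor>log 2 y / real d\<rfloor>"
  have y: "0 < y" using assms(2) zero_less_power[of "2::real" d] by linarith
  have l: "real d \<le> log 2 y" using assms(2) y by (subst le_log_iff) (auto simp: powr_realpow)
  hence 1: "1 \<le> log 2 y / real d" using assms(1) by (simp add: le_divide_eq)
  hence J: "1 \<le> J" "real J \<le> log 2 y / real d" "log 2 y / real d < real J + 1" unfolding J_def by linarith+
  have "real (J * d) \<le> log 2 y" using J(2) assms(1) by (simp add: le_divide_eq)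
  hence "2 powr real (J * d) \<le> y" using y by (subst (asm) le_log_iff) auto
  moreover have "log 2 y < real ((J + 1) * d)" using J(3) assms(1) by (simp add: divide_less_eq algebra_simps)
  hence "y < 2 powr real ((J + 1) * d)" using y by (subst (asm) log_less_iff) auto
  moreover have p: "2 powr real i = (2::real) ^ i" for i by (rule powr_realpow) simp
  ultimately show ?thesis using J(1) unfolding p by blast
qed

text \<open>J is the largest level for which the total cost C' 2^(J d) stays within \<eta>
  n^\<gamma>. By maximality 2^((J + 1) d) exceeds \<eta> n^\<gamma>/C', so the error 2^(-\<beta> J)
  is of order n^(-\<beta> \<gamma>/d) = n^(-\<beta>/(2 \<beta> + d)).\<close>

theorem approx_sparse_nets:
  fixes f :: "real^'d::finite \<Rightarrow> real"
  assumes r: "0 < r" and p: "0 < p" and \<beta>: "0 < \<beta>" and bp: "real CARD('d) < \<beta> * p" and f: "continuous_on (cube 0 1) f"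
    and K: "0 \<le> K" "\<And>h e lam. 0 < h \<Longrightarrow> 0 < lam \<Longrightarrow>
       emeasure lborel (large_diff r h e f lam (cube 0 1)) \<le> ennreal (K * h powr (\<beta> * p) * lam powr (- p))"
    and B: "1 \<le> B" "\<And>x. x \<in> cube 0 1 \<Longrightarrow> \<bar>f x\<bar> \<le> B"
    and L: "\<forall>n. ln (real n) \<le> real (L n)" and \<kappa>: "\<kappa> < 1" "\<forall>\<^sub>F n in sequentially. real (L n) \<le> \<kappa> * real (S n)"
    and S: "same_order (\<lambda>n. real (S n)) (\<lambda>n. real (W n))"
    and W: "same_order (\<lambda>n. real (W n)) (\<lambda>n. real n powr (real CARD('d) / (2 * \<beta> + real CARD('d))))"
    and Bp: "\<forall>n. 1 \<le> Bpar n"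
  shows "\<exists>K\<ge>0. \<forall>\<^sub>F n in sequentially. \<exists>g\<in>sparse_nets (L n) (W n) (S n) (Bpar n) B.
     \<forall>x\<in>unit_cube. \<bar>g x - f x\<bar> \<le> K * real n powr (- \<beta> / (2 * \<beta> + real CARD('d)))"
proof -
  let ?d = "CARD('d)"
  obtain Dm c :: nat and C K1 :: real where CK: "0 \<le> C" "0 \<le> K1" and A: "\<And>J. 1 \<le> J \<Longrightarrow> \<exists>D s w. D \<le> Dm \<and> real s \<le> C * 2 ^ (J * ?d) \<and>
     circ (2 ^ (c * J)) D s coords {w} \<and>
     (\<forall>x\<in>unit_cube. 0 \<le> w x \<and> w x \<le> 2 * B \<and> \<bar>w x - B - f x\<bar> \<le> K1 * 2 powr (- \<beta> * real J))"
    using approx_circ[OF r p \<beta> bp f K B] by blast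
  obtain k :: nat where k: "B \<le> real k" using real_arch_simple by blast
  define \<gamma> where "\<gamma> = real ?d / (2 * \<beta> + real ?d)"
  have d0: "0 < real ?d" by simp
  have \<gamma>: "0 < \<gamma>" using \<beta> d0 by (simp add: \<gamma>_def divide_pos_pos add_pos_pos)
  obtain c1 where c1: "0 < c1" "(\<lambda>n. real (S n) / real (W n)) \<longlonglongrightarrow> c1" using S unfolding same_order_def by blast
  obtain c2 where c2: "0 < c2" "(\<lambda>n. real (W n) / real n powr \<gamma>) \<longlonglongrightarrow> c2" using W unfolding same_order_def \<gamma>_def by blast
  \<comment> \<open>Collects every summand of the later width and parameter requirements, each
    charged to 2^(J d).\<close>
  define C' where "C' = C + 5 + 4 * real k + 2 * real (c * Dm) + 1 + 2 * real k + real ?d"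
  have C': "1 \<le> C'" using CK by (simp add: C'_def)
  \<comment> \<open>The first term keeps the cost below W. The second keeps it below (1 - \<kappa>)
    S, which is what remains of S after L \<le> \<kappa> S has been set aside; S is eventually at
    least c1 c2/4 times n^\<gamma>.\<close>
  define \<eta> where "\<eta> = min (c2 / 2) ((1 - \<kappa>) * (c1 * c2 / 4))"
  have \<eta>: "0 < \<eta>" using c1 c2 \<kappa> by (simp add: \<eta>_def)
  define K2 where "K2 = K1 * (2 powr \<beta> * (\<eta> / C') powr (- \<beta> / real ?d))"
  have ninf: "filterlim (\<lambda>n. real n powr \<gamma>) at_top sequentially"
    using \<gamma> by real_asymp
  have e1: "\<forall>\<^sub>F n in sequentially. c1 / 2 < real (S n) / real (W n)" by (rule order_tendstoD(1)[OF c1(2)]) (use c1 in simp)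
  have e2: "\<forall>\<^sub>F n in sequentially. real (S n) / real (W n) < 2 * c1" by (rule order_tendstoD(2)[OF c1(2)]) (use c1 in simp)
  have e3: "\<forall>\<^sub>F n in sequentially. c2 / 2 < real (W n) / real n powr \<gamma>" by (rule order_tendstoD(1)[OF c2(2)]) (use c2 in simp)
  \<comment> \<open>The first summand yields y \<ge> 2^d and hence a level J \<ge> 1. The second
    yields W \<ge> 2 c1 + 2, so that S \<le> (W - 1)^2 and padding finds enough idle weights. The
    last one is for N \<ge> 1.\<close>
  have e4: "\<forall>\<^sub>F n in sequentially. 2 ^ ?d * C' / \<eta> + 2 * (2 * c1 + 2) / c2 + 1 \<le> real n powr \<gamma>"
    using ninf unfolding filterlim_at_top by blast
  \<comment> \<open>The depth of the scaled and amplified circuit is bounded independently of n, and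
    L grows at least like ln n.\<close>
  have e5: "\<forall>\<^sub>F n in sequentially. real (Dm + 2 * (c * Dm) + 6) \<le> ln (real n)"
    using filterlim_compose[OF ln_at_top filterlim_real_sequentially] unfolding filterlim_at_top by blast
  have e6: "\<forall>\<^sub>F n in sequentially. 1 \<le> n" by (rule eventually_ge_at_top)
  have "\<forall>\<^sub>F n in sequentially. \<exists>g\<in>sparse_nets (L n) (W n) (S n) (Bpar n) B.
     \<forall>x\<in>unit_cube. \<bar>g x - f x\<bar> \<le> K2 * real n powr (- \<beta> / (2 * \<beta> + real CARD('d)))"
    using e1 e2 e3 e4 e5 e6 \<kappa>(2)
  proof eventually_elim
    case (elim n)
    define N where "N = real n powr \<gamma>"
    have N1: "1 \<le> N"
    proof -
      have "0 \<le> 2 ^ ?d * C' / \<eta> + 2 * (2 * c1 + 2) / c2" using C' \<eta> c1 c2 by (intro add_nonneg_nonneg divide_nonneg_nonneg) auto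
      thus ?thesis using elim(4) unfolding N_def by linarith
    qed
    have WN: "c2 / 2 * N \<le> real (W n)" using elim(3) N1 unfolding N_def[symmetric] by (simp add: less_divide_eq)
    have W0: "0 < real (W n)" using WN c2 N1 by (smt (verit) divide_pos_pos mult_pos_pos)
    have SW: "c1 / 2 * real (W n) \<le> real (S n)" "real (S n) \<le> 2 * c1 * real (W n)"
      using elim(1,2) W0 by (auto simp: less_divide_eq divide_less_eq)
    define y where "y = \<eta> * N / C'"
    have y: "2 ^ ?d \<le> y"
    proof -
      have "2 ^ ?d * C' / \<eta> \<le> N" using elim(4) c1 c2 unfolding N_def[symmetric] by (smt (verit) divide_nonneg_pos mult_nonneg_nonneg)
      hence "2 ^ ?d * C' \<le> \<eta> * N" using \<eta> by (simp add: divide_le_eq mult.commute)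
      thus ?thesis using C' by (simp add: y_def le_divide_eq)
    qed
    obtain J where J: "1 \<le> J" "2 ^ (J * ?d) \<le> y" "y < 2 ^ ((J + 1) * ?d)" using ex_level[OF _ y] by auto
    obtain D s w where w: "D \<le> Dm" "real s \<le> C * 2 ^ (J * ?d)" "circ (2 ^ (c * J)) D s coords {w}"
      "\<forall>x\<in>unit_cube. 0 \<le> w x \<and> w x \<le> 2 * B \<and> \<bar>w x - B - f x\<bar> \<le> K1 * 2 powr (- \<beta> * real J)"
      using A[OF J(1)] by blast
    define T where "T = (2::real) ^ (J * ?d)"
    have T1: "1 \<le> T" by (simp add: T_def)
    have JT: "(2::real) ^ J \<le> T" unfolding T_def by (intro power_increasing) auto
    have CT: "C' * T \<le> \<eta> * N" using J(2) C' by (simp add: y_def T_def le_divide_eq mult.commute)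
    have cT: "x \<le> x * T" if "0 \<le> x" for x using T1 that by (simp add: mult_le_cancel_left1)
    have bud: "real s + 5 + 4 * real k + 2 * 2 ^ J * real (c * D) + 2 ^ J + 2 * real k + real ?d \<le> C' * T"
    proof -
      have "2 * 2 ^ J * real (c * D) \<le> 2 * T * real (c * Dm)"
        using JT w(1) T1 by (intro mult_mono mult_left_mono) (simp_all add: mult_left_mono)
      moreover have "C' * T = C * T + 5 * T + (4 * real k) * T + 2 * T * real (c * Dm) + T + (2 * real k) * T + real ?d * T"
        by (simp add: C'_def algebra_simps)
      moreover have "4 * real k \<le> 4 * real k * T" "2 * real k \<le> 2 * real k * T" "real ?d \<le> real ?d * T" "5 \<le> 5 * T"
        by (rule cT; simp)+
      moreover note w(2)[folded T_def] JT
      ultimately show ?thesis by linarith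
    qed
    have \<eta>W: "\<eta> * N \<le> real (W n)"
    proof -
      have "\<eta> * N \<le> c2 / 2 * N" using N1 by (intro mult_right_mono) (auto simp: \<eta>_def)
      thus ?thesis using WN by linarith
    qed
    have \<eta>S: "\<eta> * N \<le> (1 - \<kappa>) * real (S n)"
    proof -
      have "\<eta> * N \<le> (1 - \<kappa>) * (c1 * c2 / 4) * N" using N1 by (intro mult_right_mono) (auto simp: \<eta>_def)
      also have "\<dots> = (1 - \<kappa>) * (c1 / 2 * (c2 / 2 * N))" by simp
      also have "\<dots> \<le> (1 - \<kappa>) * real (S n)"
      proof (rule mult_left_mono)
        have "c1 / 2 * (c2 / 2 * N) \<le> c1 / 2 * real (W n)" using WN c1 by (intro mult_left_mono) auto
        thus "c1 / 2 * (c2 / 2 * N) \<le> real (S n)" using SW(1) by linarith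
      qed (use \<kappa> in simp)
      finally show ?thesis .
    qed
    have nn: "0 \<le> real s" "0 \<le> real k" "0 \<le> 2 * 2 ^ J * real (c * D)" "0 \<le> real ?d" "0 \<le> (2::real) ^ J" by auto
    have W1: "s + 1 \<le> W n" "?d \<le> W n" "2 * k \<le> W n" "2 ^ J \<le> W n"
    proof -
      have "real s + 1 \<le> real (W n)" "real ?d \<le> real (W n)" "2 * real k \<le> real (W n)" "2 ^ J \<le> real (W n)"
        using bud CT \<eta>W nn by linarith+
      hence "real (s + 1) \<le> real (W n)" "real ?d \<le> real (W n)" "real (2 * k) \<le> real (W n)" "real (2 ^ J) \<le> real (W n)" by simp_all
      thus "s + 1 \<le> W n" "?d \<le> W n" "2 * k \<le> W n" "2 ^ J \<le> W n" by (simp_all only: of_nat_le_iff)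
    qed
    have Wb: "S n \<le> (W n - 1) * (W n - 1)" "W n - 1 + 1 \<le> W n"
    proof -
      have W2: "2 * c1 + 2 \<le> real (W n)"
      proof -
        have "2 * (2 * c1 + 2) / c2 \<le> N"
        proof -
          have "0 \<le> 2 ^ ?d * C' / \<eta>" using C' \<eta> by (intro divide_nonneg_nonneg mult_nonneg_nonneg) auto
          thus ?thesis using elim(4) unfolding N_def[symmetric] by linarith
        qed
        hence "2 * c1 + 2 \<le> c2 / 2 * N" using c2 by (simp add: divide_le_eq mult.commute)
        thus ?thesis using WN by linarith
      qed
      have "2 * c1 * real (W n) \<le> (real (W n) - 2) * real (W n)" using W2 by (intro mult_right_mono) auto
      also have "\<dots> \<le> (real (W n) - 1) * (real (W n) - 1)" by (simp add: algebra_simps)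
      also have "\<dots> = real ((W n - 1) * (W n - 1))" using W0 by (simp add: of_nat_diff)
      finally have "real (S n) \<le> real ((W n - 1) * (W n - 1))" using SW(2) by linarith
      thus "S n \<le> (W n - 1) * (W n - 1)" by (simp only: of_nat_le_iff)
      show "W n - 1 + 1 \<le> W n" using W0 by simp
    qed
    have L1: "D + 2 * (c * D) + 6 \<le> L n"
    proof -
      have "real (Dm + 2 * (c * Dm) + 6) \<le> real (L n)" using elim(5) L by (meson order_trans)
      hence "Dm + 2 * (c * Dm) + 6 \<le> L n" by (simp only: of_nat_le_iff)
      moreover have "c * D \<le> c * Dm" using w(1) by simp
      ultimately show ?thesis using w(1) by linarith
    qed
    have S1: "s + 2 * 2 ^ J * (c * D) + 4 + 4 * k + L n \<le> S n"
    proof -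
      have "real s + 2 * 2 ^ J * real (c * D) + 4 + 4 * real k \<le> (1 - \<kappa>) * real (S n)" using bud CT \<eta>S nn by linarith
      hence "real s + 2 * 2 ^ J * real (c * D) + 4 + 4 * real k + real (L n) \<le> real (S n)" using elim(7) by (simp add: algebra_simps)
      hence "real (s + 2 * 2 ^ J * (c * D) + 4 + 4 * k + L n) \<le> real (S n)" by simp
      thus ?thesis by (simp only: of_nat_le_iff)
    qed
    have mem: "(\<lambda>x. w x - B) \<in> sparse_nets (L n) (W n) (S n) (Bpar n) B"
      by (rule circ_imp_sparse_nets[OF w(3) _ B(1) k _ W1(1,2,4,3) Wb(2,1) L1 S1]) (use w(4) Bp in auto)
    have "K1 * 2 powr (- \<beta> * real J) \<le> K2 * real n powr (- \<beta> / (2 * \<beta> + real ?d))"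
    proof -
      have y0: "0 < y" using \<eta> N1 C' by (simp add: y_def)
      have "2 powr (- \<beta> * real J) = 2 powr \<beta> * (2 ^ ((J + 1) * ?d)) powr (- \<beta> / real ?d)"
        by (simp add: powr_realpow[symmetric] powr_powr powr_add[symmetric] algebra_simps)
      also have "\<dots> \<le> 2 powr \<beta> * y powr (- \<beta> / real ?d)"
        using J(3) y0 \<beta> by (intro mult_left_mono powr_mono2') auto
      also have "y powr (- \<beta> / real ?d) = (\<eta> / C') powr (- \<beta> / real ?d) * N powr (- \<beta> / real ?d)"
      proof -
        have "y = (\<eta> / C') * N" by (simp add: y_def)
        thus ?thesis using \<eta> C' N1 by (simp only:) (subst powr_mult, auto)
      qed
      also have "N powr (- \<beta> / real ?d) = real n powr (- \<beta> / (2 * \<beta> + real ?d))"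
        unfolding N_def powr_powr \<gamma>_def by simp
      finally have "2 powr (- \<beta> * real J) \<le> 2 powr \<beta> * ((\<eta> / C') powr (- \<beta> / real ?d) * real n powr (- \<beta> / (2 * \<beta> + real ?d)))" .
      from mult_left_mono[OF this CK(2)] show ?thesis by (simp add: K2_def mult.assoc)
    qed
    thus ?case using mem w(4) by (intro bexI[OF _ mem]) force
  qed
  moreover have "0 \<le> K2" using CK by (simp add: K2_def)
  ultimately show ?thesis by blast
qed

section \<open>Empirical risk and sample coverage\<close>

text \<open>For finite s \<ge> 1 the factor d^(1/s) is at most d, so that one cell size serves all
  orders s.\<close>

lemma lnorm_le:
  fixes z :: "real^'d::finite"
  assumes s: "1 \<le> s" and z: "\<And>e. \<bar>z $ e\<bar> \<le> \<delta>"
  shows "lnorm s z \<le> real CARD('d) * \<delta>"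
proof (cases "s = \<infinity>")
  case True
  thus ?thesis using infnorm_le_norm[of z] norm_le_CARD[OF z] by (simp add: lnorm_def)
next
  case False
  define t where "t = enn2real s"
  have t: "1 \<le> t" using s False unfolding t_def by (metis enn2real_1 enn2real_mono less_top infinity_ennreal_def)
  have \<delta>: "0 \<le> \<delta>" using z[of undefined] by linarith
  have "(\<Sum>i\<in>UNIV. \<bar>z $ i\<bar> powr t) \<le> (\<Sum>i\<in>(UNIV::'d set). \<delta> powr t)"
    using t z by (intro sum_mono powr_mono2) auto
  hence "(\<Sum>i\<in>UNIV. \<bar>z $ i\<bar> powr t) powr (1 / t) \<le> (real CARD('d) * \<delta> powr t) powr (1 / t)"
    using t by (intro powr_mono2) (auto intro: sum_nonneg)
  also have "\<dots> = real CARD('d) powr (1 / t) * \<delta>"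
    using t \<delta> by (subst powr_mult) (auto simp: powr_powr)
  also have "\<dots> \<le> real CARD('d) powr 1 * \<delta>"
    using t \<delta> by (intro mult_right_mono powr_mono) (auto simp: Suc_le_eq)
  finally show ?thesis using False by (simp add: lnorm_def t_def)
qed

lemma continuous_hidden_layers:
  assumes "\<And>i. continuous_on X (\<lambda>x. z x i)"
  shows "continuous_on X (\<lambda>x. hidden_layers w A b l (z x) i)"
proof (induction l arbitrary: i)
  case (Suc l)
  show ?case unfolding hidden_layers.simps affine_map_def by (intro continuous_intros Suc)
qed (simp add: assms)

lemma sparse_nets_continuous:
  fixes f :: "real^'d::finite \<Rightarrow> real"
  assumes "f \<in> sparse_nets L W S Bp B"
  shows "continuous_on unit_cube f"
proof -
  obtain w A b where eq: "\<forall>x\<in>unit_cube. f x = relu_net L w A b x" using assms unfolding sparse_nets_def by blast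
  have "continuous_on unit_cube (relu_net L w A b :: real^'d \<Rightarrow> real)"
    unfolding relu_net_def affine_map_def by (intro continuous_intros continuous_hidden_layers)
  thus ?thesis by (rule continuous_on_eq) (use eq in auto)
qed

lemma sup_norm_leD: "sup_norm g \<le> ennreal B \<Longrightarrow> x \<in> unit_cube \<Longrightarrow> 0 \<le> B \<Longrightarrow> \<bar>g x\<bar> \<le> B"
  unfolding sup_norm_def SUP_le_iff by (metis ennreal_le_iff)

lemma sup_norm_leI: "(\<And>x. x \<in> unit_cube \<Longrightarrow> \<bar>g x\<bar> \<le> B) \<Longrightarrow> sup_norm g \<le> ennreal B"
  unfolding sup_norm_def by (intro SUP_least ennreal_leI)

lemma neighbourhood_bdd:
  fixes g :: "real^'d::finite \<Rightarrow> real"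
  assumes "continuous_on unit_cube g"
  shows "bdd_above ((\<lambda>x'. (g x')\<^sup>2) ` neighbourhood s h x)"
proof -
  have "compact ((\<lambda>x'. (g x')\<^sup>2) ` unit_cube)"
    by (intro compact_continuous_image continuous_intros assms compact_cbox)
  hence "bdd_above ((\<lambda>x'. (g x')\<^sup>2) ` unit_cube)" by (simp add: compact_imp_bounded bounded_imp_bdd_above)
  thus ?thesis by (rule bdd_above_mono) (auto simp: neighbourhood_def)
qed

text \<open>Every sample point whose neighbourhood contains \<open>x0\<close> contributes at least \<open>(y x0 - f x0)\<^sup>2\<close> to the empirical risk.\<close>
lemma adv_risk_minimiser:
  fixes X :: "nat \<Rightarrow> real^'d::finite"
  assumes n: "0 < n" and X: "\<And>i. i < n \<Longrightarrow> X i \<in> unit_cube \<and> X i \<in> neighbourhood s h (X i)"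
    and y: "continuous_on unit_cube y" and f: "continuous_on unit_cube f"
    and min: "adv_risk s h n X y f \<le> adv_risk s h n X y g" and g: "\<And>x. x \<in> unit_cube \<Longrightarrow> \<bar>y x - g x\<bar> \<le> \<rho>"
    and c: "0 < c" and x0: "x0 \<in> unit_cube" and cnt: "c * real n \<le> real (card {i. i < n \<and> x0 \<in> neighbourhood s h (X i)})"
  shows "\<bar>y x0 - f x0\<bar> \<le> \<rho> / sqrt c"
proof -
  let ?F = "\<lambda>i. SUP x'\<in>neighbourhood s h (X i). (y x' - f x')\<^sup>2"
  have \<rho>: "0 \<le> \<rho>" using g[OF x0] by linarith
  have bdd: "bdd_above ((\<lambda>x'. (y x' - f x')\<^sup>2) ` neighbourhood s h (X i))" for i
    by (rule neighbourhood_bdd) (intro continuous_intros y f)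
  have F0: "0 \<le> ?F i" if "i < n" for i
  proof -
    have "(y (X i) - f (X i))\<^sup>2 \<le> ?F i" by (rule cSUP_upper[OF _ bdd]) (use X[OF that] in simp)
    thus ?thesis using zero_le_power2 order_trans by blast
  qed
  have "c * real n * (y x0 - f x0)\<^sup>2 \<le> real (card {i. i < n \<and> x0 \<in> neighbourhood s h (X i)}) * (y x0 - f x0)\<^sup>2"
    using cnt by (rule mult_right_mono) simp
  also have "\<dots> = (\<Sum>i\<in>{i. i < n \<and> x0 \<in> neighbourhood s h (X i)}. (y x0 - f x0)\<^sup>2)" by simp
  also have "\<dots> \<le> (\<Sum>i\<in>{i. i < n \<and> x0 \<in> neighbourhood s h (X i)}. ?F i)"
    by (intro sum_mono cSUP_upper bdd) auto
  also have "\<dots> \<le> (\<Sum>i<n. ?F i)" by (rule sum_mono2) (use F0 in auto)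
  finally have 1: "c * real n * (y x0 - f x0)\<^sup>2 \<le> (\<Sum>i<n. ?F i)" .
  have "(\<Sum>i<n. SUP x'\<in>neighbourhood s h (X i). (y x' - g x')\<^sup>2) \<le> (\<Sum>i<n. \<rho>\<^sup>2)"
  proof (intro sum_mono cSUP_least)
    fix i assume "i \<in> {..<n}"
    thus "neighbourhood s h (X i) \<noteq> {}" using X by auto
    fix x' assume "x' \<in> neighbourhood s h (X i)"
    hence "\<bar>y x' - g x'\<bar> \<le> \<bar>\<rho>\<bar>" using g \<rho> by (simp add: neighbourhood_def)
    thus "(y x' - g x')\<^sup>2 \<le> \<rho>\<^sup>2" by (simp only: abs_le_square_iff)
  qed
  hence 2: "(\<Sum>i<n. SUP x'\<in>neighbourhood s h (X i). (y x' - g x')\<^sup>2) \<le> real n * \<rho>\<^sup>2" by simp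
  have "(\<Sum>i<n. ?F i) \<le> (\<Sum>i<n. SUP x'\<in>neighbourhood s h (X i). (y x' - g x')\<^sup>2)"
    using min n by (simp add: adv_risk_def divide_le_cancel)
  hence "c * real n * (y x0 - f x0)\<^sup>2 \<le> real n * \<rho>\<^sup>2" using 1 2 by linarith
  hence "c * (y x0 - f x0)\<^sup>2 \<le> \<rho>\<^sup>2" using n by (simp add: mult.assoc mult.left_commute[of c])
  hence "(y x0 - f x0)\<^sup>2 \<le> (\<rho> / sqrt c)\<^sup>2" using c by (simp add: power_divide le_divide_eq mult.commute)
  thus ?thesis using \<rho> c by (metis abs_le_square_iff abs_of_nonneg divide_nonneg_nonneg real_sqrt_ge_zero less_imp_le)
qed

section \<open>Sampling frequencies of dyadic cells\<close>

lemma emeasure_dyadic_cell: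
  fixes k :: "'d::finite \<Rightarrow> nat"
  shows "dyadic_cell j k \<in> sets borel" "emeasure lborel (dyadic_cell j k) = ennreal ((1 / 2 ^ j) ^ CARD('d))"
proof -
  have eq: "dyadic_cell j k = cbox (\<chi> e. real (k e) / 2 ^ j) (\<chi> e. (real (k e) + 1) / 2 ^ j)"
    by (auto simp: dyadic_cell_def mem_box_cart divide_le_eq le_divide_eq mult.commute)
  show "dyadic_cell j k \<in> sets borel" unfolding eq by (rule borel_closed) (rule closed_cbox)
  have "emeasure lborel (dyadic_cell j k) = ennreal (measure lborel (dyadic_cell j k))"
    unfolding eq by (rule emeasure_eq_ennreal_measure) (use emeasure_bounded_finite[OF bounded_cbox, of "\<chi> e. real (k e) / 2 ^ j" "\<chi> e. (real (k e) + 1) / 2 ^ j"] in simp)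
  also have "measure lborel (dyadic_cell j k) = (1 / 2 ^ j) ^ CARD('d)"
    unfolding eq by (subst content_cbox_cart) (auto simp: interval_ne_empty_cart divide_right_mono diff_divide_distrib[symmetric])
  finally show "emeasure lborel (dyadic_cell j k) = ennreal ((1 / 2 ^ j) ^ CARD('d))" .
qed

lemma dyadic_cell_subset:
  assumes "k \<in> dyadic_idx j" shows "dyadic_cell j k \<subseteq> unit_cube"
proof
  fix x assume x: "x \<in> dyadic_cell j k"
  have "0 \<le> x $ e \<and> x $ e \<le> 1" for e
  proof -
    have "k e < 2 ^ j" using assms by (auto simp: dyadic_idx_def)
    hence "real (k e + 1) \<le> real (2 ^ j)" by (subst of_nat_le_iff) auto
    hence "real (k e) + 1 \<le> 2 ^ j" by simp
    moreover have "real (k e) \<le> 2 ^ j * x $ e" "2 ^ j * x $ e \<le> real (k e) + 1" using x by (auto simp: dyadic_cell_def)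
    moreover have "0 \<le> real (k e)" by simp
    ultimately have "2 ^ j * 0 \<le> 2 ^ j * x $ e" "2 ^ j * x $ e \<le> 2 ^ j * 1" by linarith+
    thus ?thesis by (simp only: mult_le_cancel_left_pos zero_less_power zero_less_numeral)
  qed
  thus "x \<in> unit_cube" by (simp add: mem_box_cart)
qed

lemma dyadic_cell_neighbourhood:
  fixes x x0 :: "real^'d::finite"
  assumes "x \<in> dyadic_cell j k" "x0 \<in> dyadic_cell j k" "x0 \<in> unit_cube" "1 \<le> s" "real CARD('d) / 2 ^ j \<le> h"
  shows "x0 \<in> neighbourhood s h x"
proof -
  have "\<bar>(x - x0) $ e\<bar> \<le> 1 / 2 ^ j" for e
  proof -
    have "\<bar>2 ^ j * x $ e - 2 ^ j * x0 $ e\<bar> \<le> 1"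
      using assms(1,2) unfolding dyadic_cell_def mem_Collect_eq by (smt (verit))
    hence "2 ^ j * \<bar>x $ e - x0 $ e\<bar> \<le> 1" by (simp add: right_diff_distrib[symmetric] abs_mult)
    thus ?thesis by (simp add: le_divide_eq mult.commute)
  qed
  from lnorm_le[OF assms(4) this] show ?thesis using assms(3,5) by (simp add: neighbourhood_def)
qed

text \<open>Hoeffding's inequality: the expected number of hits is at least 2 c n, so falling to c n
  is a deviation of c n and has probability at most exp(-2 c^2 n). Relaxing this by t \<le> exp t
  gives an order 1/n, which is small enough beside the rate.\<close>

lemma (in prob_space) sample_coverage:
  fixes X :: "nat \<Rightarrow> 'a \<Rightarrow> real^'d::finite" and Y :: "nat \<Rightarrow> 'a \<Rightarrow> real"
  assumes ind: "indep_vars (\<lambda>_. borel) (\<lambda>i \<omega>. (X i \<omega>, Y i \<omega>)) UNIV"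
    and ident: "\<And>i. distr M borel (\<lambda>\<omega>. (X i \<omega>, Y i \<omega>)) = distr M borel (\<lambda>\<omega>. (X 0 \<omega>, Y 0 \<omega>))"
    and A: "A \<in> sets borel" and c: "0 < c" "2 * c \<le> prob (X 0 -` A \<inter> space M)" and n: "0 < n"
  shows "{\<omega>\<in>space M. real (card {i. i < n \<and> X i \<omega> \<in> A}) \<le> c * real n} \<in> events"
    and "prob {\<omega>\<in>space M. real (card {i. i < n \<and> X i \<omega> \<in> A}) \<le> c * real n} \<le> 1 / (2 * c\<^sup>2 * real n)"
proof -
  define Z where "Z = (\<lambda>i \<omega>. indicator A (X i \<omega>) :: real)"
  have rv: "(\<lambda>\<omega>. (X i \<omega>, Y i \<omega>)) \<in> borel_measurable M" for i
    using ind by (simp add: indep_vars_def)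
  have mf: "(fst :: (real^'d) \<times> real \<Rightarrow> real^'d) \<in> borel_measurable borel"
    by (intro borel_measurable_continuous_onI continuous_intros)
  have X: "X i \<in> borel_measurable M" for i
    using measurable_compose[OF rv[of i] mf] by simp
  have mg: "(\<lambda>xy :: (real^'d) \<times> real. indicator A (fst xy) :: real) \<in> borel_measurable borel"
    by (rule measurable_compose[OF mf]) (use A in simp)
  have indZ: "indep_vars (\<lambda>_. borel) Z UNIV"
    using indep_vars_compose2[OF ind, of "\<lambda>_ xy. indicator A (fst xy) :: real" "\<lambda>_. borel"] mg by (simp add: Z_def)
  interpret Hoeffding_ineq M "{..<n}" Z "\<lambda>_. 0" "\<lambda>_. 1" "\<Sum>i<n. expectation (Z i)"
  proof unfold_locales
    show "indep_vars (\<lambda>_. borel) Z {..<n}" by (rule indep_vars_subset[OF indZ]) simp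
  qed (auto simp: Z_def indicator_def)
  have EZ: "expectation (Z i) = prob (X 0 -` A \<inter> space M)" for i
  proof -
    have "expectation (Z i) = (\<integral>xy. indicator A (fst xy) \<partial>distr M borel (\<lambda>\<omega>. (X i \<omega>, Y i \<omega>)))"
      unfolding Z_def using rv[of i] mg by (subst integral_distr) auto
    also have "\<dots> = (\<integral>xy. indicator A (fst xy) \<partial>distr M borel (\<lambda>\<omega>. (X 0 \<omega>, Y 0 \<omega>)))" by (simp only: ident[of i])
    also have "\<dots> = expectation (\<lambda>\<omega>. indicator A (X 0 \<omega>))"
      using rv[of 0] mg by (subst integral_distr) auto
    also have "\<dots> = expectation (indicator (X 0 -` A \<inter> space M))"
      by (intro Bochner_Integration.integral_cong) (auto simp: indicator_def)
    also have "\<dots> = prob (X 0 -` A \<inter> space M)"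
      using measurable_sets[OF X A] by simp
    finally show ?thesis .
  qed
  have cnt: "real (card {i. i < n \<and> X i \<omega> \<in> A}) = (\<Sum>i<n. Z i \<omega>)" for \<omega>
  proof -
    have "(\<Sum>i<n. Z i \<omega>) = (\<Sum>i<n. if X i \<omega> \<in> A then 1 else 0)" by (intro sum.cong refl) (simp add: Z_def indicator_def)
    also have "\<dots> = (\<Sum>i\<in>{..<n} \<inter> {i. X i \<omega> \<in> A}. 1)" by (subst sum.inter_restrict) simp_all
    also have "\<dots> = real (card ({..<n} \<inter> {i. X i \<omega> \<in> A}))" by (rule sum_constant[of 1, unfolded mult_1_right])
    also have "{..<n} \<inter> {i. X i \<omega> \<in> A} = {i. i < n \<and> X i \<omega> \<in> A}" by auto
    finally show ?thesis ..
  qed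
  have Zm: "Z i \<in> borel_measurable M" for i unfolding Z_def using measurable_compose[OF X, of "indicator A" borel i] A by simp
  show ev: "{\<omega>\<in>space M. real (card {i. i < n \<and> X i \<omega> \<in> A}) \<le> c * real n} \<in> events"
    unfolding cnt using Zm by measurable
  have "{\<omega>\<in>space M. real (card {i. i < n \<and> X i \<omega> \<in> A}) \<le> c * real n} \<subseteq> {x\<in>space M. (\<Sum>i<n. Z i x) \<le> (\<Sum>i<n. expectation (Z i)) - c * real n}"
  proof -
    have "2 * c * real n \<le> (\<Sum>i<n. expectation (Z i))" unfolding EZ using c(2) by (simp add: mult.commute mult_left_mono)
    thus ?thesis unfolding cnt by auto
  qed
  moreover have "{x\<in>space M. (\<Sum>i<n. Z i x) \<le> (\<Sum>i<n. expectation (Z i)) - c * real n} \<in> events"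
    using Zm by measurable
  ultimately have "prob {\<omega>\<in>space M. real (card {i. i < n \<and> X i \<omega> \<in> A}) \<le> c * real n} \<le>
     prob {x\<in>space M. (\<Sum>i<n. Z i x) \<le> (\<Sum>i<n. expectation (Z i)) - c * real n}"
    by (intro finite_measure_mono)
  also have "\<dots> \<le> exp (- 2 * (c * real n)\<^sup>2 / (\<Sum>i<n. (1 - 0)\<^sup>2))"
    by (rule Hoeffding_ineq_le) (use c n in auto)
  also have "- 2 * (c * real n)\<^sup>2 / (\<Sum>i<n. (1 - 0)\<^sup>2) = - (2 * c\<^sup>2 * real n)"
    using n by (simp add: power2_eq_square)
  also have "exp (- (2 * c\<^sup>2 * real n)) \<le> 1 / (2 * c\<^sup>2 * real n)"
  proof -
    define t where "t = 2 * c\<^sup>2 * real n"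
    have t: "0 < t" using c n by (simp add: t_def)
    have "t \<le> exp t" using exp_ge_add_one_self[of t] by linarith
    hence "1 / exp t \<le> 1 / t" using t by (intro divide_left_mono) auto
    thus ?thesis unfolding t_def[symmetric] exp_minus inverse_eq_divide .
  qed
  finally show "prob {\<omega>\<in>space M. real (card {i. i < n \<and> X i \<omega> \<in> A}) \<le> c * real n} \<le> 1 / (2 * c\<^sup>2 * real n)" .
qed

section \<open>The convergence rate\<close>

lemma (in prob_space) ex_sup_norm_small:
  fixes Z :: "'a \<Rightarrow> ennreal"
  assumes "(\<integral>\<^sup>+ \<omega>. Z \<omega> \<partial>M) \<le> ennreal a" "a < b" "0 \<le> a"
  shows "\<exists>\<omega>\<in>space M. Z \<omega> \<le> ennreal b"
proof (rule ccontr)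
  assume "\<not> ?thesis"
  hence "(\<integral>\<^sup>+ \<omega>. ennreal b \<partial>M) \<le> (\<integral>\<^sup>+ \<omega>. Z \<omega> \<partial>M)" by (intro nn_integral_mono) auto
  hence "ennreal b \<le> ennreal a" using assms(1) by (simp add: emeasure_space_1)
  thus False using assms(2,3) by (simp add: ennreal_le_iff)
qed

lemma (in prob_space) continuous_of_mean_limit:
  fixes f :: "real^'d::finite \<Rightarrow> real" and Yh :: "nat \<Rightarrow> 'a \<Rightarrow> real^'d \<Rightarrow> real"
  assumes cont: "\<And>n \<omega>. \<omega> \<in> space M \<Longrightarrow> continuous_on unit_cube (Yh n \<omega>)"
    and mean: "\<And>n. (\<integral>\<^sup>+ \<omega>. (sup_norm (\<lambda>x. Yh n \<omega> x - f x))\<^sup>2 \<partial>M) \<le> ennreal ((\<zeta> n)\<^sup>2)" and \<zeta>: "\<zeta> \<longlonglongrightarrow> 0"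
  shows "continuous_on unit_cube f"
proof -
  \<comment> \<open>The summand 1/(n + 1) provides the strict inequality by which
    \<open>ex_sup_norm_small\<close> finds a realisation.\<close>
  have "\<forall>n. \<exists>\<omega>. \<omega> \<in> space M \<and> (sup_norm (\<lambda>x. Yh n \<omega> x - f x))\<^sup>2 \<le> ennreal ((\<zeta> n)\<^sup>2 + 1 / real (Suc n))"
  proof
    fix n
    have "\<exists>\<omega>\<in>space M. (sup_norm (\<lambda>x. Yh n \<omega> x - f x))\<^sup>2 \<le> ennreal ((\<zeta> n)\<^sup>2 + 1 / real (Suc n))"
      by (rule ex_sup_norm_small[OF mean[of n]]) auto
    thus "\<exists>\<omega>. \<omega> \<in> space M \<and> (sup_norm (\<lambda>x. Yh n \<omega> x - f x))\<^sup>2 \<le> ennreal ((\<zeta> n)\<^sup>2 + 1 / real (Suc n))" by blast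
  qed
  from choice[OF this] obtain w where w: "\<And>n. w n \<in> space M" "\<And>n. (sup_norm (\<lambda>x. Yh n (w n) x - f x))\<^sup>2 \<le> ennreal ((\<zeta> n)\<^sup>2 + 1 / real (Suc n))"
    by blast
  have sq: "\<bar>Yh n (w n) x - f x\<bar> \<le> sqrt ((\<zeta> n)\<^sup>2 + 1 / real (Suc n))" if "x \<in> unit_cube" for n x
  proof -
    have "ennreal \<bar>Yh n (w n) x - f x\<bar> \<le> sup_norm (\<lambda>x. Yh n (w n) x - f x)"
      unfolding sup_norm_def using that by (rule SUP_upper)
    hence "(ennreal \<bar>Yh n (w n) x - f x\<bar>)\<^sup>2 \<le> ennreal ((\<zeta> n)\<^sup>2 + 1 / real (Suc n))"
      using w(2)[of n] by (meson order_trans power_mono zero_le)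
    hence "(Yh n (w n) x - f x)\<^sup>2 \<le> (\<zeta> n)\<^sup>2 + 1 / real (Suc n)"
      by (subst (asm) ennreal_power, simp, subst (asm) ennreal_le_iff) (auto simp: add_nonneg_nonneg)
    thus ?thesis by (rule real_le_rsqrt[of "\<bar>Yh n (w n) x - f x\<bar>", unfolded power2_abs])
  qed
  have lim: "(\<lambda>n. sqrt ((\<zeta> n)\<^sup>2 + 1 / real (Suc n))) \<longlonglongrightarrow> 0"
  proof -
    have "(\<lambda>n. sqrt ((\<zeta> n)\<^sup>2 + 1 / real (Suc n))) \<longlonglongrightarrow> sqrt (0\<^sup>2 + 0)"
      by (intro tendsto_intros \<zeta>) (rule LIMSEQ_Suc[OF lim_1_over_n])
    thus ?thesis by simp
  qed
  have "uniform_limit unit_cube (\<lambda>n x. Yh n (w n) x) f sequentially"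
  proof (rule uniform_limitI)
    fix e :: real assume "0 < e"
    from order_tendstoD(2)[OF lim this]
    show "\<forall>\<^sub>F n in sequentially. \<forall>x\<in>unit_cube. dist (Yh n (w n) x) (f x) < e"
      by eventually_elim (simp only: dist_real_def, blast intro: le_less_trans sq)
  qed
  thus ?thesis by (rule uniform_limit_theorem[rotated]) (use cont w(1) in auto)
qed

text \<open>By continuity the supremum may be taken over a countable dense subset of the cube, which
  reduces measurability to that of the point evaluations. It is needed to split the integral of the
  error bound.\<close>

lemma (in prob_space) sup_norm_measurable:
  fixes f :: "real^'d::finite \<Rightarrow> real" and Yh :: "'a \<Rightarrow> real^'d \<Rightarrow> real"
  assumes cont: "\<And>\<omega>. \<omega> \<in> space M \<Longrightarrow> continuous_on unit_cube (Yh \<omega>)" and f: "continuous_on unit_cube f"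
    and meas: "\<And>x. x \<in> unit_cube \<Longrightarrow> (\<lambda>\<omega>. Yh \<omega> x) \<in> borel_measurable M"
  shows "(\<lambda>\<omega>. sup_norm (\<lambda>x. Yh \<omega> x - f x)) \<in> borel_measurable M"
proof -
  obtain T :: "(real^'d) set" where T: "countable T" "T \<subseteq> unit_cube" "unit_cube \<subseteq> closure T"
    using separable[of "unit_cube :: (real^'d) set"] by blast
  have eq: "sup_norm (\<lambda>x. Yh \<omega> x - f x) = (SUP x\<in>T. ennreal \<bar>Yh \<omega> x - f x\<bar>)" if \<omega>: "\<omega> \<in> space M" for \<omega>
  proof (rule antisym)
    show "(SUP x\<in>T. ennreal \<bar>Yh \<omega> x - f x\<bar>) \<le> sup_norm (\<lambda>x. Yh \<omega> x - f x)"
      unfolding sup_norm_def by (rule SUP_subset_mono[OF T(2)]) simp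
    show "sup_norm (\<lambda>x. Yh \<omega> x - f x) \<le> (SUP x\<in>T. ennreal \<bar>Yh \<omega> x - f x\<bar>)"
      unfolding sup_norm_def
    proof (rule SUP_least)
      fix x :: "real^'d" assume x: "x \<in> unit_cube"
      then obtain s where s: "\<And>n. s n \<in> T" "s \<longlonglongrightarrow> x" using T(3) closure_sequential by blast
      have "continuous_on unit_cube (\<lambda>x. \<bar>Yh \<omega> x - f x\<bar>)" by (intro continuous_intros cont f \<omega>)
      hence "(\<lambda>n. \<bar>Yh \<omega> (s n) - f (s n)\<bar>) \<longlonglongrightarrow> \<bar>Yh \<omega> x - f x\<bar>"
        using s T(2) x unfolding continuous_on_sequentially comp_def by blast
      hence "(\<lambda>n. ennreal \<bar>Yh \<omega> (s n) - f (s n)\<bar>) \<longlonglongrightarrow> ennreal \<bar>Yh \<omega> x - f x\<bar>"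
        by (rule tendsto_ennrealI)
      thus "ennreal \<bar>Yh \<omega> x - f x\<bar> \<le> (SUP x\<in>T. ennreal \<bar>Yh \<omega> x - f x\<bar>)"
        by (rule Lim_bounded) (use s(1) in \<open>auto intro: SUP_upper\<close>)
    qed
  qed
  have "(\<lambda>\<omega>. SUP x\<in>T. ennreal \<bar>Yh \<omega> x - f x\<bar>) \<in> borel_measurable M"
    using meas T(2) by (intro borel_measurable_SUP[OF T(1)]) auto
  thus ?thesis by (subst measurable_cong[OF eq])
qed

text \<open>Let Z be the realised distance of Yh from f and a = 1/sqrt c. Outside E the comparison
  with g gives |Yh - fh| \<le> a (Z + \<epsilon>) on the cube, hence |fh - f| \<le> (1 + a) Z + a
  \<epsilon>, and squaring costs a factor 2. On E only the bound 2 B is available, weighted with the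
  small probability of E.\<close>

lemma (in prob_space) adv_training_bound:
  fixes f :: "real^'d::finite \<Rightarrow> real" and Yh fh :: "'a \<Rightarrow> real^'d \<Rightarrow> real"
  assumes n: "0 < n" and s: "1 \<le> s" and h: "real CARD('d) / 2 ^ j \<le> h" and B: "1 \<le> B"
    and X: "\<And>i \<omega>. \<omega> \<in> space M \<Longrightarrow> X i \<omega> \<in> unit_cube"
    and f: "continuous_on unit_cube f" "sup_norm f \<le> ennreal B"
    and cont: "\<And>\<omega>. \<omega> \<in> space M \<Longrightarrow> continuous_on unit_cube (Yh \<omega>)"
    and meas: "\<And>x. x \<in> unit_cube \<Longrightarrow> (\<lambda>\<omega>. Yh \<omega> x) \<in> borel_measurable M"
    and g: "g \<in> sparse_nets L W S Bp B" "\<And>x. x \<in> unit_cube \<Longrightarrow> \<bar>g x - f x\<bar> \<le> \<epsilon>" "0 \<le> \<epsilon>"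
    and fh: "\<And>\<omega>. \<omega> \<in> space M \<Longrightarrow> is_arg_min (adv_risk s h n (\<lambda>i. X i \<omega>) (Yh \<omega>)) (\<lambda>f. f \<in> sparse_nets L W S Bp B) (fh \<omega>)"
    and mean: "(\<integral>\<^sup>+ \<omega>. (sup_norm (\<lambda>x. Yh \<omega> x - f x))\<^sup>2 \<partial>M) \<le> ennreal z"  "0 \<le> z"
    and c: "0 < c" and E: "E \<in> events" "prob E \<le> \<delta>"
    and cov: "\<And>\<omega> k. \<omega> \<in> space M - E \<Longrightarrow> k \<in> dyadic_idx j \<Longrightarrow> c * real n \<le> real (card {i. i < n \<and> X i \<omega> \<in> dyadic_cell j k})"
  shows "(\<integral>\<^sup>+ \<omega>. (sup_norm (\<lambda>x. fh \<omega> x - f x))\<^sup>2 \<partial>M) \<le>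
     ennreal (2 * (1 + 1 / sqrt c)\<^sup>2 * z + 2 * (1 / sqrt c)\<^sup>2 * \<epsilon>\<^sup>2 + (2 * B)\<^sup>2 * \<delta>)"
proof -
  define a where "a = 1 / sqrt c"
  have a: "0 < a" using c by (simp add: a_def)
  define Z where "Z \<omega> = sup_norm (\<lambda>x. Yh \<omega> x - f x)" for \<omega>
  have Zm: "Z \<in> borel_measurable M" unfolding Z_def by (rule sup_norm_measurable[OF cont f(1) meas])
  have fhn: "fh \<omega> \<in> sparse_nets L W S Bp B" if "\<omega> \<in> space M" for \<omega> using fh[OF that] by (simp add: is_arg_min_def)
  have good: "(sup_norm (\<lambda>x. fh \<omega> x - f x))\<^sup>2 \<le> ennreal (2 * (1 + a)\<^sup>2) * (Z \<omega>)\<^sup>2 + ennreal (2 * a\<^sup>2 * \<epsilon>\<^sup>2)"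
    if \<omega>: "\<omega> \<in> space M - E" for \<omega>
  proof -
    have \<omega>M: "\<omega> \<in> space M" using \<omega> by simp
    have "continuous_on unit_cube (\<lambda>x. \<bar>Yh \<omega> x - f x\<bar>)" by (intro continuous_intros cont f(1) \<omega>M)
    hence "compact ((\<lambda>x. \<bar>Yh \<omega> x - f x\<bar>) ` unit_cube)" by (intro compact_continuous_image compact_cbox)
    then obtain b where b: "\<And>x. x \<in> unit_cube \<Longrightarrow> \<bar>Yh \<omega> x - f x\<bar> \<le> b"
      using compact_imp_bounded bounded_imp_bdd_above unfolding bdd_above_def by (metis (no_types, lifting) imageI)
    have Zfin: "Z \<omega> < \<infinity>"
    proof -
      have "Z \<omega> \<le> ennreal b" unfolding Z_def by (rule sup_norm_leI) (rule b)
      thus ?thesis by (simp add: order_le_less_trans)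
    qed
    define \<zeta> where "\<zeta> = enn2real (Z \<omega>)"
    have \<zeta>: "Z \<omega> = ennreal \<zeta>" "0 \<le> \<zeta>" using Zfin by (auto simp: \<zeta>_def)
    have Yf: "\<bar>Yh \<omega> x - f x\<bar> \<le> \<zeta>" if "x \<in> unit_cube" for x
      by (rule sup_norm_leD[OF _ that \<zeta>(2)]) (simp add: \<zeta>(1)[symmetric] Z_def)
    have Yg: "\<bar>Yh \<omega> x - g x\<bar> \<le> \<zeta> + \<epsilon>" if "x \<in> unit_cube" for x using Yf[OF that] g(2)[OF that] by linarith
    have min: "adv_risk s h n (\<lambda>i. X i \<omega>) (Yh \<omega>) (fh \<omega>) \<le> adv_risk s h n (\<lambda>i. X i \<omega>) (Yh \<omega>) g"
      using fh[OF \<omega>M] g(1) by (auto simp: is_arg_min_def not_less)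
    have h0: "lnorm s (0 :: real^'d) \<le> h"
      using lnorm_le[OF s, of "0 :: real^'d" "1 / 2 ^ j"] h by simp
    have "\<bar>fh \<omega> x - f x\<bar> \<le> (1 + a) * \<zeta> + a * \<epsilon>" if x: "x \<in> unit_cube" for x
    proof -
      have xc: "x \<in> cube 0 1" using x unfolding unit_cube_eq_cube .
      define k where "k = cell_idx j x"
      have k: "k \<in> dyadic_idx j" "x \<in> dyadic_cell j k" using cell_idx_props(1,2)[OF xc] by (auto simp: k_def)
      have "card {i. i < n \<and> X i \<omega> \<in> dyadic_cell j k} \<le> card {i. i < n \<and> x \<in> neighbourhood s h (X i \<omega>)}"
        using dyadic_cell_neighbourhood[OF _ k(2) x s h] by (intro card_mono) auto
      hence "real (card {i. i < n \<and> X i \<omega> \<in> dyadic_cell j k}) \<le> real (card {i. i < n \<and> x \<in> neighbourhood s h (X i \<omega>)})"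
        by (simp only: of_nat_le_iff)
      hence cnt: "c * real n \<le> real (card {i. i < n \<and> x \<in> neighbourhood s h (X i \<omega>)})"
        using cov[OF \<omega> k(1)] by linarith
      have "\<bar>Yh \<omega> x - fh \<omega> x\<bar> \<le> (\<zeta> + \<epsilon>) / sqrt c"
        by (rule adv_risk_minimiser[OF n _ cont[OF \<omega>M] sparse_nets_continuous[OF fhn[OF \<omega>M]] min Yg c x cnt])
          (use X[OF \<omega>M] h0 in \<open>auto simp: neighbourhood_def\<close>)
      also have "\<dots> = a * \<zeta> + a * \<epsilon>" by (simp add: a_def add_divide_distrib)
      finally show ?thesis using Yf[OF x] by (simp add: distrib_right)
    qed
    hence "sup_norm (\<lambda>x. fh \<omega> x - f x) \<le> ennreal ((1 + a) * \<zeta> + a * \<epsilon>)" by (rule sup_norm_leI)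
    hence "(sup_norm (\<lambda>x. fh \<omega> x - f x))\<^sup>2 \<le> (ennreal ((1 + a) * \<zeta> + a * \<epsilon>))\<^sup>2" by (rule power_mono) simp
    also have "\<dots> = ennreal (((1 + a) * \<zeta> + a * \<epsilon>)\<^sup>2)" by (rule ennreal_power) (use a \<zeta>(2) g(3) in simp)
    also have "((1 + a) * \<zeta> + a * \<epsilon>)\<^sup>2 \<le> 2 * (1 + a)\<^sup>2 * \<zeta>\<^sup>2 + 2 * a\<^sup>2 * \<epsilon>\<^sup>2"
    proof -
      have "0 \<le> ((1 + a) * \<zeta> - a * \<epsilon>)\<^sup>2" by simp
      thus ?thesis by (simp add: power2_eq_square algebra_simps)
    qed
    also have "ennreal (2 * (1 + a)\<^sup>2 * \<zeta>\<^sup>2 + 2 * a\<^sup>2 * \<epsilon>\<^sup>2) = ennreal (2 * (1 + a)\<^sup>2) * (Z \<omega>)\<^sup>2 + ennreal (2 * a\<^sup>2 * \<epsilon>\<^sup>2)"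
      unfolding \<zeta>(1) using \<zeta>(2) by (simp add: ennreal_plus ennreal_mult ennreal_power del: ennreal_plus[symmetric])
    finally show ?thesis by (simp add: ennreal_leI)
  qed
  have bad: "(sup_norm (\<lambda>x. fh \<omega> x - f x))\<^sup>2 \<le> ennreal ((2 * B)\<^sup>2)" if \<omega>: "\<omega> \<in> space M" for \<omega>
  proof -
    have "sup_norm (fh \<omega>) \<le> ennreal B" using fhn[OF \<omega>] by (simp add: sparse_nets_def)
    hence "\<bar>fh \<omega> x - f x\<bar> \<le> 2 * B" if "x \<in> unit_cube" for x
      using sup_norm_leD[OF _ that, of "fh \<omega>" B] sup_norm_leD[OF f(2) that] B by force
    hence "sup_norm (\<lambda>x. fh \<omega> x - f x) \<le> ennreal (2 * B)" by (rule sup_norm_leI)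
    hence "(sup_norm (\<lambda>x. fh \<omega> x - f x))\<^sup>2 \<le> (ennreal (2 * B))\<^sup>2" by (rule power_mono) simp
    thus ?thesis using B by (simp only: ennreal_power)
  qed
  have "(\<integral>\<^sup>+ \<omega>. (sup_norm (\<lambda>x. fh \<omega> x - f x))\<^sup>2 \<partial>M) \<le>
     (\<integral>\<^sup>+ \<omega>. (ennreal (2 * (1 + a)\<^sup>2) * (Z \<omega>)\<^sup>2 + ennreal (2 * a\<^sup>2 * \<epsilon>\<^sup>2)) + ennreal ((2 * B)\<^sup>2) * indicator E \<omega> \<partial>M)"
  proof (rule nn_integral_mono)
    fix \<omega> assume \<omega>: "\<omega> \<in> space M"
    show "(sup_norm (\<lambda>x. fh \<omega> x - f x))\<^sup>2 \<le> (ennreal (2 * (1 + a)\<^sup>2) * (Z \<omega>)\<^sup>2 + ennreal (2 * a\<^sup>2 * \<epsilon>\<^sup>2)) + ennreal ((2 * B)\<^sup>2) * indicator E \<omega>"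
    proof (cases "\<omega> \<in> E")
      case True thus ?thesis using bad[OF \<omega>] by (simp add: add_increasing)
    next
      case False thus ?thesis using good[of \<omega>] \<omega> by simp
    qed
  qed
  also have "\<dots> = (\<integral>\<^sup>+ \<omega>. ennreal (2 * (1 + a)\<^sup>2) * (Z \<omega>)\<^sup>2 \<partial>M) + (\<integral>\<^sup>+ \<omega>. ennreal (2 * a\<^sup>2 * \<epsilon>\<^sup>2) \<partial>M) + (\<integral>\<^sup>+ \<omega>. ennreal ((2 * B)\<^sup>2) * indicator E \<omega> \<partial>M)"
    using Zm E(1) by (subst nn_integral_add, measurable)+
  also have "(\<integral>\<^sup>+ \<omega>. ennreal (2 * (1 + a)\<^sup>2) * (Z \<omega>)\<^sup>2 \<partial>M) = ennreal (2 * (1 + a)\<^sup>2) * (\<integral>\<^sup>+ \<omega>. (Z \<omega>)\<^sup>2 \<partial>M)"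
    by (rule nn_integral_cmult) (use Zm in measurable)
  also have "(\<integral>\<^sup>+ \<omega>. ennreal (2 * a\<^sup>2 * \<epsilon>\<^sup>2) \<partial>M) = ennreal (2 * a\<^sup>2 * \<epsilon>\<^sup>2)" by (simp add: emeasure_space_1)
  also have "(\<integral>\<^sup>+ \<omega>. ennreal ((2 * B)\<^sup>2) * indicator E \<omega> \<partial>M) = ennreal ((2 * B)\<^sup>2) * ennreal (prob E)"
    using E(1) by (subst nn_integral_cmult_indicator) (auto simp: emeasure_eq_measure)
  also have "ennreal (2 * (1 + a)\<^sup>2) * (\<integral>\<^sup>+ \<omega>. (Z \<omega>)\<^sup>2 \<partial>M) + ennreal (2 * a\<^sup>2 * \<epsilon>\<^sup>2) + ennreal ((2 * B)\<^sup>2) * ennreal (prob E)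
     \<le> ennreal (2 * (1 + a)\<^sup>2) * ennreal z + ennreal (2 * a\<^sup>2 * \<epsilon>\<^sup>2) + ennreal ((2 * B)\<^sup>2) * ennreal \<delta>"
    using mean(1) E(2) unfolding Z_def by (intro add_mono mult_left_mono ennreal_leI) auto
  also have "\<dots> = ennreal (2 * (1 + a)\<^sup>2 * z + 2 * a\<^sup>2 * \<epsilon>\<^sup>2 + (2 * B)\<^sup>2 * \<delta>)"
  proof -
    have "0 \<le> \<delta>" using E(2) measure_nonneg[of M E] by linarith
    thus ?thesis using mean(2) by (simp add: ennreal_mult[symmetric] ennreal_plus[symmetric] del: ennreal_plus)
  qed
  finally show ?thesis by (simp add: a_def)
qed

theorem proposition7:
  fixes p :: ennreal and \<beta> B :: real
  assumes "0 < p" and "of_nat CARD('d) / p < ennreal \<beta>" and "1 \<le> B"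
  shows "\<exists>C>0. \<forall>(q :: ennreal) (r :: real \<Rightarrow> nat) (s :: ennreal) (hlow :: real) (h :: real)
      (M :: 'a measure) (fstar :: real^'d::finite \<Rightarrow> real)
      (X :: nat \<Rightarrow> 'a \<Rightarrow> real^'d) (\<xi> :: nat \<Rightarrow> 'a \<Rightarrow> real) (Y :: nat \<Rightarrow> 'a \<Rightarrow> real)
      (dens :: real^'d \<Rightarrow> ennreal) (CX :: real)
      (Yhat :: nat \<Rightarrow> 'a \<Rightarrow> real^'d \<Rightarrow> real) (V :: real) (\<zeta> :: nat \<Rightarrow> real) (\<beta>star :: real)
      (L :: nat \<Rightarrow> nat) (W :: nat \<Rightarrow> nat) (S :: nat \<Rightarrow> nat) (Bpar :: nat \<Rightarrow> real)
      (a :: real) (\<kappa> :: real) (fhat :: nat \<Rightarrow> 'a \<Rightarrow> real^'d \<Rightarrow> real).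
    0 < q \<longrightarrow> 1 \<le> s \<longrightarrow> 0 < hlow \<longrightarrow> hlow < h \<longrightarrow> h < 1 \<longrightarrow>
    prob_space M \<longrightarrow> prob_space.iid_regression M fstar X \<xi> Y \<longrightarrow>
    distributed M lborel (X 0) dens \<longrightarrow> 0 < CX \<longrightarrow> (\<forall>x\<in>unit_cube. ennreal CX \<le> dens x) \<longrightarrow>
    (\<forall>\<beta>'\<in>{0<..\<beta>}. \<beta>' < real (r \<beta>') \<and> fstar \<in> besov_ball (r \<beta>') p q \<beta>' B) \<longrightarrow>
    sup_norm fstar \<le> ennreal B \<longrightarrow>
    (\<forall>n. \<forall>x\<in>unit_cube. (\<lambda>\<omega>. Yhat n \<omega> x) \<in> borel_measurable M) \<longrightarrow>
    (\<forall>n. \<forall>\<omega>\<in>space M. continuous_on unit_cube (Yhat n \<omega>)) \<longrightarrow>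
    0 < V \<longrightarrow> (\<forall>n. (\<integral>\<^sup>+ \<omega>. (sup_norm (Yhat n \<omega>))\<^sup>2 \<partial>M) \<le> ennreal (V\<^sup>2)) \<longrightarrow>
    (\<forall>n. 0 \<le> \<zeta> n) \<longrightarrow> \<zeta> \<longlonglongrightarrow> 0 \<longrightarrow> 0 < \<beta>star \<longrightarrow>
    (\<lambda>n. (\<zeta> n)\<^sup>2) \<in> O(\<lambda>n. real n powr (- 2 * \<beta> / (2 * \<beta> + real CARD('d))) * ln (real n) powr \<beta>star) \<longrightarrow>
    (\<forall>n. (\<integral>\<^sup>+ \<omega>. (sup_norm (\<lambda>x. Yhat n \<omega> x - fstar x))\<^sup>2 \<partial>M) \<le> ennreal ((\<zeta> n)\<^sup>2)) \<longrightarrow>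
    (\<forall>n. 1 \<le> L n \<and> C * ln (real n) \<le> real (L n)) \<longrightarrow>
    \<kappa> < 1 \<longrightarrow> (\<forall>\<^sub>F n in sequentially. real (L n) \<le> \<kappa> * real (S n)) \<longrightarrow>
    same_order (\<lambda>n. real (S n)) (\<lambda>n. real (W n)) \<longrightarrow>
    same_order (\<lambda>n. real (W n)) (\<lambda>n. real n powr (real CARD('d) / (2 * \<beta> + real CARD('d)))) \<longrightarrow>
    (\<forall>n. 1 \<le> Bpar n) \<longrightarrow> 0 < a \<longrightarrow> Bpar \<in> O(\<lambda>n. real n powr a) \<longrightarrow>
    (\<forall>n. \<forall>x\<in>unit_cube. (\<lambda>\<omega>. fhat n \<omega> x) \<in> borel_measurable M) \<longrightarrow>
    (\<forall>\<^sub>F n in sequentially. \<forall>\<omega>\<in>space M.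
       is_arg_min (adv_risk s h n (\<lambda>i. X i \<omega>) (Yhat n \<omega>))
         (\<lambda>f. f \<in> sparse_nets (L n) (W n) (S n) (Bpar n) B) (fhat n \<omega>)) \<longrightarrow>
    (\<exists>K. \<forall>\<^sub>F n in sequentially.
       (\<integral>\<^sup>+ \<omega>. (sup_norm (\<lambda>x. fhat n \<omega> x - fstar x))\<^sup>2 \<partial>M)
         \<le> ennreal (K * (real n powr (- 2 * \<beta> / (2 * \<beta> + real CARD('d)))
                        * ln (real n) powr max 3 \<beta>star)))"
proof (rule exI[of _ 1], rule conjI[OF zero_less_one], intro allI impI)
  fix q :: ennreal and r :: "real \<Rightarrow> nat" and s :: ennreal and hlow h :: real
    and M :: "'a measure" and f :: "real^'d \<Rightarrow> real"
    and X :: "nat \<Rightarrow> 'a \<Rightarrow> real^'d" and \<xi> Y :: "nat \<Rightarrow> 'a \<Rightarrow> real"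
    and dens :: "real^'d \<Rightarrow> ennreal" and CX :: real
    and Yh :: "nat \<Rightarrow> 'a \<Rightarrow> real^'d \<Rightarrow> real" and V :: real and \<zeta> :: "nat \<Rightarrow> real" and \<beta>star :: real
    and L W S :: "nat \<Rightarrow> nat" and Bpar :: "nat \<Rightarrow> real" and a \<kappa> :: real and fh :: "nat \<Rightarrow> 'a \<Rightarrow> real^'d \<Rightarrow> real"
  assume q: "0 < q" and s: "1 \<le> s" and hl: "0 < hlow" "hlow < h" and "h < 1"
    and PM: "prob_space M" and iid: "prob_space.iid_regression M f X \<xi> Y"
    and dens: "distributed M lborel (X 0) dens" and CX: "0 < CX" "\<forall>x\<in>unit_cube. ennreal CX \<le> dens x"
    and besov: "\<forall>\<beta>'\<in>{0<..\<beta>}. \<beta>' < real (r \<beta>') \<and> f \<in> besov_ball (r \<beta>') p q \<beta>' B"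
    and fB: "sup_norm f \<le> ennreal B"
    and Ym: "\<forall>n. \<forall>x\<in>unit_cube. (\<lambda>\<omega>. Yh n \<omega> x) \<in> borel_measurable M"
    and Yc: "\<forall>n. \<forall>\<omega>\<in>space M. continuous_on unit_cube (Yh n \<omega>)"
    and \<zeta>: "\<forall>n. 0 \<le> \<zeta> n" "\<zeta> \<longlonglongrightarrow> 0" and "0 < \<beta>star"
    and \<zeta>O: "(\<lambda>n. (\<zeta> n)\<^sup>2) \<in> O(\<lambda>n. real n powr (- 2 * \<beta> / (2 * \<beta> + real CARD('d))) * ln (real n) powr \<beta>star)"
    and mean: "\<forall>n. (\<integral>\<^sup>+ \<omega>. (sup_norm (\<lambda>x. Yh n \<omega> x - f x))\<^sup>2 \<partial>M) \<le> ennreal ((\<zeta> n)\<^sup>2)"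
    and L: "\<forall>n. 1 \<le> L n \<and> 1 * ln (real n) \<le> real (L n)"
    and \<kappa>: "\<kappa> < 1" "\<forall>\<^sub>F n in sequentially. real (L n) \<le> \<kappa> * real (S n)"
    and S: "same_order (\<lambda>n. real (S n)) (\<lambda>n. real (W n))"
    and W: "same_order (\<lambda>n. real (W n)) (\<lambda>n. real n powr (real CARD('d) / (2 * \<beta> + real CARD('d))))"
    and Bp: "\<forall>n. 1 \<le> Bpar n"
    and fh: "\<forall>\<^sub>F n in sequentially. \<forall>\<omega>\<in>space M.
       is_arg_min (adv_risk s h n (\<lambda>i. X i \<omega>) (Yh n \<omega>))
         (\<lambda>f. f \<in> sparse_nets (L n) (W n) (S n) (Bpar n) B) (fh n \<omega>)"
  interpret prob_space M by (rule PM)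
  have \<beta>: "0 < \<beta>" using assms(2) by (cases "0 < \<beta>") (auto simp: ennreal_neg not_less)
  have fc: "continuous_on unit_cube f" by (rule continuous_of_mean_limit[of Yh f \<zeta>]) (use Yc mean \<zeta> in auto)
  hence fc': "continuous_on (cube 0 1) f" unfolding unit_cube_eq_cube .
  have fb: "\<bar>f x\<bar> \<le> B" if "x \<in> cube 0 1" for x
    by (rule sup_norm_leD[OF fB]) (use that assms(3) in \<open>auto simp: unit_cube_eq_cube\<close>)
  have r: "0 < r \<beta>" and fbes: "f \<in> besov_ball (r \<beta>) p q \<beta> B" using besov \<beta> by force+
  have B0: "0 \<le> B" using assms(3) by simp
  obtain p' K0 where p': "0 < p'" "0 \<le> K0" "real CARD('d) < \<beta> * p'" and K0: "\<And>h e lam. 0 < h \<Longrightarrow> 0 < lam \<Longrightarrow>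
     emeasure lborel (large_diff (r \<beta>) h e f lam (cube 0 1)) \<le> ennreal (K0 * h powr (\<beta> * p') * lam powr (- p'))"
    using besov_large_diff[OF fbes assms(1,2) q B0 fc'] by blast
  \<comment> \<open>The witness 1 serves as the constant in the depth condition: the approximating
    networks have bounded depth before idle layers are added, so they eventually fit below ln
    n.\<close>
  have L': "\<forall>n. ln (real n) \<le> real (L n)" using L by simp
  obtain K1 where K1: "0 \<le> K1" "\<forall>\<^sub>F n in sequentially. \<exists>g\<in>sparse_nets (L n) (W n) (S n) (Bpar n) B.
     \<forall>x\<in>unit_cube. \<bar>g x - f x\<bar> \<le> K1 * real n powr (- \<beta> / (2 * \<beta> + real CARD('d)))"
    using approx_sparse_nets[OF r p'(1) \<beta> p'(3) fc' p'(2) K0 assms(3) fb L' \<kappa> S W Bp] by blast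
  have ind: "indep_vars (\<lambda>_. borel) (\<lambda>i \<omega>. (X i \<omega>, Y i \<omega>)) UNIV"
    and ident: "\<And>i. distr M borel (\<lambda>\<omega>. (X i \<omega>, Y i \<omega>)) = distr M borel (\<lambda>\<omega>. (X 0 \<omega>, Y 0 \<omega>))"
    and Xc: "\<And>i \<omega>. \<omega> \<in> space M \<Longrightarrow> X i \<omega> \<in> unit_cube"
    using iid unfolding iid_regression_def by blast+

  have h0: "0 < h" using hl by simp
  \<comment> \<open>A mesh fine enough that any two points of a cell are within distance h in every
    norm of order s \<ge> 1.\<close>
  obtain j :: nat where j: "real CARD('d) / h < 2 ^ j" using real_arch_pow[of 2 "real CARD('d) / h"] by auto
  hence jh: "real CARD('d) / 2 ^ j \<le> h" using h0 by (simp add: divide_less_eq divide_le_eq mult.commute)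
  \<comment> \<open>Half of the least probability CX 2^(-j d) that a cell can have; the other half
    is the room for deviations.\<close>
  define c where "c = CX * (1 / 2 ^ j) ^ CARD('d) / 2"
  have c: "0 < c" using CX by (simp add: c_def)
  have pc: "2 * c \<le> prob (X 0 -` dyadic_cell j k \<inter> space M)" if k: "k \<in> dyadic_idx j" for k
  proof -
    note cell = emeasure_dyadic_cell[of j k]
    have "ennreal (2 * c) = (\<integral>\<^sup>+x. ennreal CX * indicator (dyadic_cell j k) x \<partial>lborel)"
      using cell CX(1) by (subst nn_integral_cmult_indicator) (auto simp: c_def ennreal_mult[symmetric])
    also have "\<dots> \<le> (\<integral>\<^sup>+x. dens x * indicator (dyadic_cell j k) x \<partial>lborel)"
      using CX(2) dyadic_cell_subset[OF k] by (intro nn_integral_mono) (auto simp: indicator_def)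
    also have "\<dots> = emeasure M (X 0 -` dyadic_cell j k \<inter> space M)"
      by (rule distributed_emeasure[OF dens, symmetric]) (use cell(1) in simp)
    finally show ?thesis by (simp add: emeasure_eq_measure)
  qed
  define E where "E n = (\<Union>k\<in>dyadic_idx j. {\<omega>\<in>space M. real (card {i. i < n \<and> X i \<omega> \<in> dyadic_cell j k}) \<le> c * real n})" for n
  define m where "m = real (card (dyadic_idx j :: ('d \<Rightarrow> nat) set))"
  have E: "E n \<in> events \<and> prob (E n) \<le> m * (1 / (2 * c\<^sup>2)) * (1 / real n)" if n: "0 < n" for n
  proof -
    note sc = sample_coverage[OF ind ident emeasure_dyadic_cell(1) c pc n]
    have ev: "{\<omega>\<in>space M. real (card {i. i < n \<and> X i \<omega> \<in> dyadic_cell j k}) \<le> c * real n} \<in> events"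
      if "k \<in> dyadic_idx j" for k by (rule sc(1)[OF that])
    have "E n \<in> events" unfolding E_def by (intro sets.finite_UN finite_dyadic_idx ev)
    moreover have "prob (E n) \<le> (\<Sum>k\<in>dyadic_idx j. prob {\<omega>\<in>space M. real (card {i. i < n \<and> X i \<omega> \<in> dyadic_cell j k}) \<le> c * real n})"
      unfolding E_def by (rule finite_measure_subadditive_finite[OF finite_dyadic_idx]) (use ev in blast)
    moreover have "\<dots> \<le> (\<Sum>k\<in>(dyadic_idx j :: ('d \<Rightarrow> nat) set). 1 / (2 * c\<^sup>2 * real n))"
      by (intro sum_mono sc(2))
    ultimately show ?thesis by (simp add: m_def)
  qed
  define \<rho> where "\<rho> = - 2 * \<beta> / (2 * \<beta> + real CARD('d))"
  have dpos: "0 < 2 * \<beta> + real CARD('d)" using \<beta> by (simp add: add_pos_pos)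
  \<comment> \<open>The rate decays no faster than 1/n, so the failure probability of the coverage
    event is absorbed into it.\<close>
  have \<rho>1: "- 1 \<le> \<rho>" unfolding \<rho>_def using dpos by (simp add: le_divide_eq)
  obtain K2 where K2: "0 < K2" "\<forall>\<^sub>F n in sequentially. norm ((\<zeta> n)\<^sup>2) \<le> K2 * norm (real n powr \<rho> * ln (real n) powr \<beta>star)"
    using \<zeta>O unfolding \<rho>_def by (elim landau_o.bigE) blast
  define b1 where "b1 = 2 * (1 + 1 / sqrt c)\<^sup>2"
  define b2 where "b2 = 2 * (1 / sqrt c)\<^sup>2"
  define b3 where "b3 = (2 * B)\<^sup>2 * (m * (1 / (2 * c\<^sup>2)))"
  have b: "0 \<le> b1" "0 \<le> b2" "0 \<le> b3" by (auto simp: b1_def b2_def b3_def m_def)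
  have "\<forall>\<^sub>F n in sequentially. 1 \<le> ln (real n)" by real_asymp
  hence "\<forall>\<^sub>F n in sequentially.
       (\<integral>\<^sup>+ \<omega>. (sup_norm (\<lambda>x. fh n \<omega> x - f x))\<^sup>2 \<partial>M)
         \<le> ennreal ((b1 * K2 + b2 * K1\<^sup>2 + b3) * (real n powr \<rho> * ln (real n) powr max 3 \<beta>star))"
    using eventually_ge_at_top[of 1] K1(2) K2(2) fh
  proof eventually_elim
    case (elim n)
    obtain g where g: "g \<in> sparse_nets (L n) (W n) (S n) (Bpar n) B"
      "\<And>x. x \<in> unit_cube \<Longrightarrow> \<bar>g x - f x\<bar> \<le> K1 * real n powr (- \<beta> / (2 * \<beta> + real CARD('d)))"
      using elim(3) by blast
    have n: "0 < n" using elim(2) by simp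
    define T where "T = real n powr \<rho> * ln (real n) powr max 3 \<beta>star"
    define e where "e = K1 * real n powr (- \<beta> / (2 * \<beta> + real CARD('d)))"
    have "(\<integral>\<^sup>+ \<omega>. (sup_norm (\<lambda>x. fh n \<omega> x - f x))\<^sup>2 \<partial>M) \<le>
      ennreal (2 * (1 + 1 / sqrt c)\<^sup>2 * (\<zeta> n)\<^sup>2 + 2 * (1 / sqrt c)\<^sup>2 * e\<^sup>2 + (2 * B)\<^sup>2 * (m * (1 / (2 * c\<^sup>2)) * (1 / real n)))"
    proof (rule adv_training_bound[where Yh = "Yh n" and E = "E n", OF n s jh assms(3) Xc fc fB _ _ g(1) _ _ _ _ _ c])
      show "c * real n \<le> real (card {i. i < n \<and> X i \<omega> \<in> dyadic_cell j k})" if "\<omega> \<in> space M - E n" "k \<in> dyadic_idx j" for \<omega> k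
        using that by (auto simp: E_def)
    qed (use Yc Ym g(2) K1(1) elim(5) mean E[OF n] in \<open>auto simp: e_def\<close>)
    also have "2 * (1 + 1 / sqrt c)\<^sup>2 * (\<zeta> n)\<^sup>2 + 2 * (1 / sqrt c)\<^sup>2 * e\<^sup>2 + (2 * B)\<^sup>2 * (m * (1 / (2 * c\<^sup>2)) * (1 / real n))
       = b1 * (\<zeta> n)\<^sup>2 + b2 * e\<^sup>2 + b3 * (1 / real n)" by (simp add: b1_def b2_def b3_def)
    also have "\<dots> \<le> b1 * (K2 * T) + b2 * (K1\<^sup>2 * T) + b3 * T"
    proof (intro add_mono mult_left_mono b)
      have ln1: "ln (real n) powr \<beta>star \<le> ln (real n) powr max 3 \<beta>star" using elim(1) by (intro powr_mono) auto
      have "(\<zeta> n)\<^sup>2 \<le> K2 * (real n powr \<rho> * ln (real n) powr \<beta>star)" using elim(4) by (simp add: abs_mult)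
      also have "\<dots> \<le> K2 * T" unfolding T_def using K2(1) ln1 by (intro mult_left_mono) auto
      finally show "(\<zeta> n)\<^sup>2 \<le> K2 * T" .
      have nT: "real n powr \<rho> \<le> T"
      proof -
        have "1 powr max 3 \<beta>star \<le> ln (real n) powr max 3 \<beta>star" using elim(1) by (intro powr_mono2) auto
        from mult_left_mono[OF this, of "real n powr \<rho>"] show ?thesis by (simp add: T_def)
      qed
      have "e\<^sup>2 = K1\<^sup>2 * real n powr \<rho>"
        using n by (simp add: e_def \<rho>_def power_mult_distrib powr_power)
      also have "\<dots> \<le> K1\<^sup>2 * T" using nT by (intro mult_left_mono) auto
      finally show "e\<^sup>2 \<le> K1\<^sup>2 * T" .
      have "1 / real n = real n powr (- 1)" using n by (simp add: powr_minus divide_inverse)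
      also have "\<dots> \<le> real n powr \<rho>" using n \<rho>1 by (intro powr_mono) auto
      finally show "1 / real n \<le> T" using nT by linarith
    qed
    also have "\<dots> = (b1 * K2 + b2 * K1\<^sup>2 + b3) * T" by (simp add: algebra_simps)
    finally show ?case by (simp add: T_def ennreal_leI)
  qed
  thus "\<exists>K. \<forall>\<^sub>F n in sequentially.
       (\<integral>\<^sup>+ \<omega>. (sup_norm (\<lambda>x. fh n \<omega> x - f x))\<^sup>2 \<partial>M)
         \<le> ennreal (K * (real n powr (- 2 * \<beta> / (2 * \<beta> + real CARD('d)))
                        * ln (real n) powr max 3 \<beta>star))"
    unfolding \<rho>_def by blast
qed

end
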